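(* Let $(\mathcal P,\sqsubset)$ be a dual CL-shellable pair with $\mathcal P$ pure and finite and $\mathrm d(\mathcal P)\ge 3$, and let $F\colon\mathcal P^{\mathrm{op}}\to R\text{-mod}$ be a functor with $F(\hat 0)=0$. Assume that there is a subset $\mathcal A$ of the set of atoms of $\mathcal P$ such that for every unrefinable $\hat 1$-chain $c$ of length $\mathrm d(\mathcal P)-2$ the natural map \[ F(c_0)\to\bigoplus_{a\in C(c)\setminus\mathcal A}F(a) \] is an epimorphism. Then there is an exact sequence whose central arrow is the connecting homomorphism (associated with the short exact sequence of functors $0\to E\to F\to G\to 0$, where $E$ is the subfunctor of $F$ with $E(a)=F(a)$ for $a\in\mathcal A$ and $E(p)=0$ for $p\notin\mathcal A$, and $G=F/E$): \[ 0\to H^{\mathrm d(\mathcal P)-3}(\mathcal P\setminus\{\hat 1\};F)\to H^{\mathrm d(\mathcal P)-3}(\overline{\mathcal P}\setminus\mathcal A;F)\to\bigoplus_{a\in\mathcal A}F(a)^{|\mu(a,\hat 1)|}\to H^{\mathrm d(\mathcal P)-2}(\mathcal P\setminus\{\hat 1\};F)\to 0 . \]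
   Context: $R$ is a commutative ring with unit. For a poset $\mathcal P$, $p\prec q$ means $p<q$ with no element strictly between. An unrefinable $\hat 1$-chain of length $n$ is a sequence $c=(c_0\prec c_1\prec\dots\prec c_n=\hat 1)$ (length $0$: $c=(\hat 1)$). $\mathcal P$ is filtered if $\mathrm d(p)=\max\{n\mid \exists\, c_0\prec\dots\prec c_n=p\}$ is a well-defined natural number for each $p$ and $\mathrm d$ is strictly order preserving; $\mathrm d(\mathcal P)=\max_p \mathrm d(p)$. A bounded poset is a filtered poset with a maximum $\hat 1$ and a minimum $\hat 0$; then $\overline{\mathcal P}=\mathcal P\setminus\{\hat 0,\hat 1\}$. Atoms are the elements covering $\hat 0$. $\mathcal P$ is pure if all maximal chains have the same length. Write $\mathcal P_{\prec p}=\{q\mid q\prec p\}$, $\mathcal P_{<p}=\{q\mid q<p\}$. A coatom ordering on a bounded poset $\mathcal P$ is a family $\sqsubset=\{\sqsubset_c\}_c$, indexed by all unrefinable $\hat 1$-chains $c$, where $\sqsubset_c$ is a well-order on $\mathcal P_{\prec c_0}$. For $c=(c_0\prec c_1\prec\dots\prec\hat 1)$ of positive length put $c'=(c_1\prec\dots\prec\hat 1)$ and $C(c)=\{x\prec c_0\mid x<h\text{ for some } h\prec c_1\text{ strictly preceding }c_0\text{ in }\sqsubset_{c'}\}$; put $C(\hat 1)=\emptyset$. The pair $(\mathcal P,\sqsubset)$ is dual CL-shellable if for every unrefinable $\hat 1$-chain $c$: (CL0) every initial segment (downward closed subset) of $\sqsubset_c$ is finite or isomorphic to $(\mathbb N,\le)$;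 (CL1) $C(c)$ is an initial segment of $\sqsubset_c$; (CL2) for $h',h\in\mathcal P_{\prec c_0}$ with $h'$ strictly preceding $h$ in $\sqsubset_c$ and $p\in\mathcal P_{<h}\cap\mathcal P_{<h'}$, there exist $h''\in\mathcal P_{\prec c_0}$ strictly preceding $h$ in $\sqsubset_c$ and $q\in\mathcal P_{\prec h}$ with $p\le q<h''$. For a finite poset and $p\le q$, $\mu(p,q)=1$ if $p=q$ and $\mu(p,q)=-\sum_{p<r\le q}\mu(r,q)$ otherwise. For a poset $\mathcal Q$ and $F\colon\mathcal Q^{\mathrm{op}}\to R\text{-mod}$, $H^*(\mathcal Q;F)$ denotes the right derived functors of $\lim\colon \mathrm{Fun}(\mathcal Q^{\mathrm{op}},R\text{-mod})\to R\text{-mod}$ evaluated at $F$ (restricted if defined on a larger poset). *)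

theory Defs
  imports "HOL-Algebra.Module" "HOL-Algebra.AbelCoset" "HOL-Library.FuncSet"
begin

section \<open>Posets\<close>

text \<open>A poset is a subset \<open>P\<close> of an ordered type, with the induced order.  All notions
  (covers, chains, top, bottom) are relative to \<open>P\<close>.\<close>

definition covers :: "'p::order set \<Rightarrow> 'p \<Rightarrow> 'p \<Rightarrow> bool" where
  "covers P p q \<longleftrightarrow> p \<in> P \<and> q \<in> P \<and> p < q \<and> \<not> (\<exists>r\<in>P. p < r \<and> r < q)"

definition lower_covers :: "'p::order set \<Rightarrow> 'p \<Rightarrow> 'p set" where
  "lower_covers P q = {p. covers P p q}"

text \<open>The unrefinable chain \<open>c\<^sub>0 \<prec> \<dots> \<prec> c\<^sub>n = p\<close> is the list \<open>[c\<^sub>0, \<dots>, c\<^sub>n]\<close>; its length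
  is \<open>n\<close>, one less than the length of the list.\<close>

definition unref_chains_to :: "'p::order set \<Rightarrow> 'p \<Rightarrow> 'p list set" where
  "unref_chains_to P p =
     {c. c \<noteq> [] \<and> set c \<subseteq> P \<and> successively (covers P) c \<and> last c = p}"

definition chain_length :: "'p list \<Rightarrow> nat" where
  "chain_length c = length c - 1"

definition elem_rank :: "'p::order set \<Rightarrow> 'p \<Rightarrow> nat" where
  "elem_rank P p = Max (chain_length ` unref_chains_to P p)"

definition poset_rank :: "'p::order set \<Rightarrow> nat" where
  "poset_rank P = Max (elem_rank P ` P)"

definition filtered_poset :: "'p::order set \<Rightarrow> bool" where
  "filtered_poset P \<longleftrightarrow>
     (\<forall>p\<in>P. finite (chain_length ` unref_chains_to P p)) \<and> strict_mono_on P (elem_rank P)"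

definition top_of :: "'p::order set \<Rightarrow> 'p" where
  "top_of P = (GREATEST p. p \<in> P)"

definition bot_of :: "'p::order set \<Rightarrow> 'p" where
  "bot_of P = (LEAST p. p \<in> P)"

definition bounded_poset :: "'p::order set \<Rightarrow> bool" where
  "bounded_poset P \<longleftrightarrow>
     filtered_poset P \<and> (\<exists>t\<in>P. \<forall>p\<in>P. p \<le> t) \<and> (\<exists>b\<in>P. \<forall>p\<in>P. b \<le> p)"

definition proper_part :: "'p::order set \<Rightarrow> 'p set" where
  "proper_part P = P - {bot_of P, top_of P}"

definition atoms_of :: "'p::order set \<Rightarrow> 'p set" where
  "atoms_of P = {a. covers P (bot_of P) a}"

text \<open>Lengths of maximal chains are compared through \<open>card\<close>, hence meaningful when all
  chains of \<open>P\<close> are finite.\<close>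

definition pure_poset :: "'p::order set \<Rightarrow> bool" where
  "pure_poset P \<longleftrightarrow>
     (\<forall>C D. pred_on.maxchain P (<) C \<and> pred_on.maxchain P (<) D \<longrightarrow> card C = card D)"

function mobius :: "'p::order set \<Rightarrow> 'p \<Rightarrow> 'p \<Rightarrow> int" where
  "mobius P p q =
     (if p = q then 1
      else if finite P then - (\<Sum>r\<in>{r\<in>P. p < r \<and> r \<le> q}. mobius P r q)
      else 0)"
  by pat_completeness auto
termination
proof (relation "measure (\<lambda>(P, p, q). card {r\<in>P. p < r \<and> r \<le> q})", goal_cases)
  case (2 P p q r)
  then have "{s\<in>P. r < s \<and> s \<le> q} \<subset> {s\<in>P. p < s \<and> s \<le> q}" by auto
  with 2 show ?case by (simp add: psubset_card_mono)
qed simp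

declare mobius.simps [simp del]

section \<open>Dual CL-shellability\<close>

text \<open>A coatom ordering assigns to each unrefinable chain \<open>c\<close> ending at the top a
  (reflexive) well-order \<open>L c\<close>; the values of \<open>L\<close> at other lists are irrelevant.\<close>

definition coatom_ordering :: "'p::order set \<Rightarrow> ('p list \<Rightarrow> 'p rel) \<Rightarrow> bool" where
  "coatom_ordering P L \<longleftrightarrow>
     (\<forall>c\<in>unref_chains_to P (top_of P). well_order_on (lower_covers P (hd c)) (L c))"

definition strictly_precedes :: "'p rel \<Rightarrow> 'p \<Rightarrow> 'p \<Rightarrow> bool" where
  "strictly_precedes r x y \<longleftrightarrow> (x, y) \<in> r \<and> x \<noteq> y"

definition C_set :: "'p::order set \<Rightarrow> ('p list \<Rightarrow> 'p rel) \<Rightarrow> 'p list \<Rightarrow> 'p set" where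
  "C_set P L c =
     (if chain_length c = 0 then {}
      else {x \<in> lower_covers P (hd c).
              \<exists>h\<in>lower_covers P (hd (tl c)). strictly_precedes (L (tl c)) h (hd c) \<and> x < h})"

definition dual_CL_shellable :: "'p::order set \<Rightarrow> ('p list \<Rightarrow> 'p rel) \<Rightarrow> bool" where
  "dual_CL_shellable P L \<longleftrightarrow>
     bounded_poset P \<and> coatom_ordering P L \<and>
     (\<forall>c\<in>unref_chains_to P (top_of P).
        (\<forall>S. ofilter (L c) S \<longrightarrow> finite S \<or> (Restr (L c) S, natLeq) \<in> ordIso) \<and>
        ofilter (L c) (C_set P L c) \<and>
        (\<forall>h\<in>lower_covers P (hd c). \<forall>h'\<in>lower_covers P (hd c). \<forall>p\<in>P.
           strictly_precedes (L c) h' h \<and> p < h \<and> p < h' \<longrightarrow>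
           (\<exists>h''\<in>lower_covers P (hd c). \<exists>q\<in>lower_covers P h.
              strictly_precedes (L c) h'' h \<and> p \<le> q \<and> q < h'')))"

section \<open>Modules\<close>

definition mod_hom :: "'r ring \<Rightarrow> ('r, 'a) module \<Rightarrow> ('r, 'b) module \<Rightarrow> ('a \<Rightarrow> 'b) set" where
  "mod_hom R M N =
     {h \<in> carrier M \<rightarrow> carrier N.
        (\<forall>x\<in>carrier M. \<forall>y\<in>carrier M. h (x \<oplus>\<^bsub>M\<^esub> y) = h x \<oplus>\<^bsub>N\<^esub> h y) \<and>
        (\<forall>a\<in>carrier R. \<forall>x\<in>carrier M. h (a \<odot>\<^bsub>M\<^esub> x) = a \<odot>\<^bsub>N\<^esub> h x)}"

definition mod_iso :: "'r ring \<Rightarrow> ('r, 'a) module \<Rightarrow> ('r, 'b) module \<Rightarrow> ('a \<Rightarrow> 'b) set" where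
  "mod_iso R M N = {h \<in> mod_hom R M N. bij_betw h (carrier M) (carrier N)}"

text \<open>The multiplicative fields that a module record inherits from \<open>ring\<close> carry no
  information and are left undefined.\<close>

definition quot_module :: "('r, 'm) module \<Rightarrow> 'm set \<Rightarrow> ('r, 'm set) module" where
  "quot_module M N =
     \<lparr>carrier = A_RCOSETS M N, mult = undefined, one = undefined,
      zero = N, add = set_add M,
      smult = (\<lambda>a X. \<Union>x\<in>X. a_r_coset M N (a \<odot>\<^bsub>M\<^esub> x))\<rparr>"

definition dsum_module :: "'i set \<Rightarrow> ('i \<Rightarrow> ('r, 'm) module) \<Rightarrow> ('r, 'i \<Rightarrow> 'm) module" where
  "dsum_module I M =
     \<lparr>carrier = {x \<in> \<Pi>\<^sub>E i\<in>I. carrier (M i). finite {i\<in>I. x i \<noteq> \<zero>\<^bsub>M i\<^esub>}},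
      mult = undefined, one = undefined,
      zero = (\<lambda>i\<in>I. \<zero>\<^bsub>M i\<^esub>), add = (\<lambda>x y. \<lambda>i\<in>I. x i \<oplus>\<^bsub>M i\<^esub> y i),
      smult = (\<lambda>a x. \<lambda>i\<in>I. a \<odot>\<^bsub>M i\<^esub> x i)\<rparr>"

text \<open>Exactness of \<open>0 \<rightarrow> M\<^sub>1 \<rightarrow> M\<^sub>2 \<rightarrow> M\<^sub>3 \<rightarrow> 0\<close> and of
  \<open>0 \<rightarrow> M\<^sub>1 \<rightarrow> M\<^sub>2 \<rightarrow> M\<^sub>3 \<rightarrow> M\<^sub>4 \<rightarrow> 0\<close>.\<close>

definition short_exact ::
  "'r ring \<Rightarrow> ('r, 'a) module \<Rightarrow> ('a \<Rightarrow> 'b) \<Rightarrow> ('r, 'b) module \<Rightarrow> ('b \<Rightarrow> 'c) \<Rightarrow> ('r, 'c) module \<Rightarrow> bool"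
where
  "short_exact R M1 f M2 g M3 \<longleftrightarrow>
     f \<in> mod_hom R M1 M2 \<and> g \<in> mod_hom R M2 M3 \<and>
     inj_on f (carrier M1) \<and> f ` carrier M1 = a_kernel M2 M3 g \<and> g ` carrier M2 = carrier M3"

definition exact_four ::
  "'r ring \<Rightarrow> ('r, 'a) module \<Rightarrow> ('a \<Rightarrow> 'b) \<Rightarrow> ('r, 'b) module \<Rightarrow> ('b \<Rightarrow> 'c) \<Rightarrow>
   ('r, 'c) module \<Rightarrow> ('c \<Rightarrow> 'd) \<Rightarrow> ('r, 'd) module \<Rightarrow> bool"
where
  "exact_four R M1 f M2 g M3 h M4 \<longleftrightarrow>
     f \<in> mod_hom R M1 M2 \<and> g \<in> mod_hom R M2 M3 \<and> h \<in> mod_hom R M3 M4 \<and>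
     inj_on f (carrier M1) \<and> f ` carrier M1 = a_kernel M2 M3 g \<and>
     g ` carrier M2 = a_kernel M3 M4 h \<and> h ` carrier M3 = carrier M4"

section \<open>Functors \<open>Q\<^sup>o\<^sup>p \<rightarrow> R-mod\<close> and their limits\<close>

record ('p, 'r, 'm) presheaf =
  ob :: "'p \<Rightarrow> ('r, 'm) module"
  ar :: "'p \<Rightarrow> 'p \<Rightarrow> 'm \<Rightarrow> 'm" \<comment> \<open>\<open>ar F p q\<close> is the map \<open>F p \<rightarrow> F q\<close> for \<open>q \<le> p\<close>\<close>

definition presheaf_on :: "'r ring \<Rightarrow> 'p::order set \<Rightarrow> ('p, 'r, 'm) presheaf \<Rightarrow> bool" where
  "presheaf_on R Q F \<longleftrightarrow>
     (\<forall>p\<in>Q. module R (ob F p)) \<and>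
     (\<forall>p\<in>Q. \<forall>q\<in>Q. q \<le> p \<longrightarrow> ar F p q \<in> mod_hom R (ob F p) (ob F q)) \<and>
     (\<forall>p\<in>Q. \<forall>x\<in>carrier (ob F p). ar F p p x = x) \<and>
     (\<forall>p\<in>Q. \<forall>q\<in>Q. \<forall>r\<in>Q. r \<le> q \<and> q \<le> p \<longrightarrow>
        (\<forall>x\<in>carrier (ob F p). ar F q r (ar F p q x) = ar F p r x))"

definition nat_trans ::
  "'r ring \<Rightarrow> 'p::order set \<Rightarrow> ('p, 'r, 'a) presheaf \<Rightarrow> ('p, 'r, 'b) presheaf \<Rightarrow> ('p \<Rightarrow> 'a \<Rightarrow> 'b) \<Rightarrow> bool"
where
  "nat_trans R Q F G t \<longleftrightarrow>
     (\<forall>p\<in>Q. t p \<in> mod_hom R (ob F p) (ob G p)) \<and>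
     (\<forall>p\<in>Q. \<forall>q\<in>Q. q \<le> p \<longrightarrow>
        (\<forall>x\<in>carrier (ob F p). t q (ar F p q x) = ar G p q (t p x)))"

definition lim_module :: "'p::order set \<Rightarrow> ('p, 'r, 'm) presheaf \<Rightarrow> ('r, 'p \<Rightarrow> 'm) module" where
  "lim_module Q F =
     \<lparr>carrier = {x \<in> \<Pi>\<^sub>E q\<in>Q. carrier (ob F q). \<forall>p\<in>Q. \<forall>q\<in>Q. q \<le> p \<longrightarrow> ar F p q (x p) = x q},
      mult = undefined, one = undefined,
      zero = (\<lambda>q\<in>Q. \<zero>\<^bsub>ob F q\<^esub>), add = (\<lambda>x y. \<lambda>q\<in>Q. x q \<oplus>\<^bsub>ob F q\<^esub> y q),
      smult = (\<lambda>a x. \<lambda>q\<in>Q. a \<odot>\<^bsub>ob F q\<^esub> x q)\<rparr>"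

definition lim_map :: "'p set \<Rightarrow> ('p \<Rightarrow> 'a \<Rightarrow> 'b) \<Rightarrow> ('p \<Rightarrow> 'a) \<Rightarrow> ('p \<Rightarrow> 'b)" where
  "lim_map Q t x = (\<lambda>q\<in>Q. t q (x q))"

section \<open>Right derived functors of the limit\<close>

text \<open>
  Injectivity in \<open>Fun(Q\<^sup>o\<^sup>p, R-mod)\<close> is tested on functors with values in modules whose carrier
  lies in \<open>'r + 'i\<close>, as a definition cannot quantify over types.  By Baer's criterion (the
  projective generators have values \<open>0\<close> and \<open>R\<close>) any test type that contains a copy of
  \<open>'r\<close> yields injectivity with respect to modules of arbitrary size; a test type without room
  for \<open>R\<close> would give a weaker notion.  Monomorphisms, kernels and images of functors are
  computed objectwise.
\<close>

definition injective_presheaf :: "'r ring \<Rightarrow> 'p::order set \<Rightarrow> ('p, 'r, 'i) presheaf \<Rightarrow> bool" where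
  "injective_presheaf R Q I \<longleftrightarrow>
     presheaf_on R Q I \<and>
     (\<forall>(X :: ('p, 'r, 'r + 'i) presheaf) (Y :: ('p, 'r, 'r + 'i) presheaf) m f.
        presheaf_on R Q X \<and> presheaf_on R Q Y \<and>
        nat_trans R Q X Y m \<and> (\<forall>p\<in>Q. inj_on (m p) (carrier (ob X p))) \<and>
        nat_trans R Q X I f \<longrightarrow>
        (\<exists>g. nat_trans R Q Y I g \<and> (\<forall>p\<in>Q. \<forall>x\<in>carrier (ob X p). g p (m p x) = f p x)))"

text \<open>A coaugmented complex \<open>F \<rightarrow> I\<^sup>0 \<rightarrow> I\<^sup>1 \<rightarrow> \<dots>\<close>.\<close>

record ('p, 'r, 'm, 'i) coresolution =
  aug :: "'p \<Rightarrow> 'm \<Rightarrow> 'i"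
  cx :: "nat \<Rightarrow> ('p, 'r, 'i) presheaf"
  dif :: "nat \<Rightarrow> 'p \<Rightarrow> 'i \<Rightarrow> 'i"

definition injective_resolution ::
  "'r ring \<Rightarrow> 'p::order set \<Rightarrow> ('p, 'r, 'm) presheaf \<Rightarrow> ('p, 'r, 'm, 'i) coresolution \<Rightarrow> bool"
where
  "injective_resolution R Q F I \<longleftrightarrow>
     (\<forall>n. injective_presheaf R Q (cx I n)) \<and>
     nat_trans R Q F (cx I 0) (aug I) \<and>
     (\<forall>n. nat_trans R Q (cx I n) (cx I (Suc n)) (dif I n)) \<and>
     (\<forall>q\<in>Q. inj_on (aug I q) (carrier (ob F q)) \<and>
        aug I q ` carrier (ob F q) = a_kernel (ob (cx I 0) q) (ob (cx I 1) q) (dif I 0 q) \<and>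
        (\<forall>n. dif I n q ` carrier (ob (cx I n) q) =
             a_kernel (ob (cx I (Suc n)) q) (ob (cx I (Suc (Suc n))) q) (dif I (Suc n) q)))"

definition lim_cocycles :: "'p::order set \<Rightarrow> ('p, 'r, 'm, 'i) coresolution \<Rightarrow> nat \<Rightarrow> ('p \<Rightarrow> 'i) set" where
  "lim_cocycles Q I n =
     a_kernel (lim_module Q (cx I n)) (lim_module Q (cx I (Suc n))) (lim_map Q (dif I n))"

definition lim_coboundaries :: "'p::order set \<Rightarrow> ('p, 'r, 'm, 'i) coresolution \<Rightarrow> nat \<Rightarrow> ('p \<Rightarrow> 'i) set" where
  "lim_coboundaries Q I n =
     (case n of
        0 \<Rightarrow> {\<zero>\<^bsub>lim_module Q (cx I 0)\<^esub>}
      | Suc k \<Rightarrow> lim_map Q (dif I k) ` carrier (lim_module Q (cx I k)))"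

text \<open>For an injective resolution \<open>I\<close> of \<open>F\<close> this is \<open>H\<^sup>n(Q; F)\<close>: the \<open>n\<close>-th cohomology of
  the complex \<open>lim I\<^sup>0 \<rightarrow> lim I\<^sup>1 \<rightarrow> \<dots>\<close>.\<close>

definition derived_lim :: "'p::order set \<Rightarrow> ('p, 'r, 'm, 'i) coresolution \<Rightarrow> nat \<Rightarrow> ('r, ('p \<Rightarrow> 'i) set) module" where
  "derived_lim Q I n =
     quot_module ((lim_module Q (cx I n))\<lparr>carrier := lim_cocycles Q I n\<rparr>) (lim_coboundaries Q I n)"

text \<open>Maps of coresolutions on \<open>U\<close> of two functors \<open>F\<close> and \<open>G\<close>, covering a natural
  transformation \<open>e : F \<rightarrow> G\<close>.\<close>

definition resolution_map ::
  "'r ring \<Rightarrow> 'p::order set \<Rightarrow> ('p, 'r, 'm) presheaf \<Rightarrow> ('p \<Rightarrow> 'm \<Rightarrow> 'n) \<Rightarrow>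
   ('p, 'r, 'm, 'i) coresolution \<Rightarrow> ('p, 'r, 'n, 'j) coresolution \<Rightarrow> (nat \<Rightarrow> 'p \<Rightarrow> 'i \<Rightarrow> 'j) \<Rightarrow> bool"
where
  "resolution_map R U F e I J t \<longleftrightarrow>
     (\<forall>n. nat_trans R U (cx I n) (cx J n) (t n)) \<and>
     (\<forall>q\<in>U. \<forall>x\<in>carrier (ob F q). t 0 q (aug I q x) = aug J q (e q x)) \<and>
     (\<forall>n. \<forall>q\<in>U. \<forall>x\<in>carrier (ob (cx I n) q). t (Suc n) q (dif I n q x) = dif J n q (t n q x))"

text \<open>For \<open>U \<subseteq> Q\<close> and a map \<open>t\<close> on \<open>U\<close> from the restriction to \<open>U\<close> of a complex \<open>I\<close> on \<open>Q\<close> to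
  a complex \<open>J\<close> on \<open>U\<close>: the map induced in cohomology, restriction to \<open>U\<close> followed by \<open>t\<close>.\<close>

definition derived_map ::
  "'p::order set \<Rightarrow> ('p, 'r, 'n, 'j) coresolution \<Rightarrow> nat \<Rightarrow> (nat \<Rightarrow> 'p \<Rightarrow> 'i \<Rightarrow> 'j) \<Rightarrow>
   ('p \<Rightarrow> 'i) set \<Rightarrow> ('p \<Rightarrow> 'j) set"
where
  "derived_map U J n t X =
     (\<Union>x\<in>X. a_r_coset (lim_module U (cx J n)) (lim_coboundaries U J n) (lim_map U (t n) x))"

text \<open>A short exact sequence \<open>0 \<rightarrow> I\<^sub>E \<rightarrow> I\<^sub>F \<rightarrow> I\<^sub>G \<rightarrow> 0\<close> of injective resolutions over the
  sequence \<open>E \<rightarrow> F \<rightarrow> G\<close> with maps \<open>i\<close>, \<open>p\<close>, as provided by the horseshoe lemma.\<close>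

definition short_exact_resolutions ::
  "'r ring \<Rightarrow> 'p::order set \<Rightarrow>
   ('p, 'r, 'a) presheaf \<Rightarrow> ('p \<Rightarrow> 'a \<Rightarrow> 'b) \<Rightarrow> ('p, 'r, 'b) presheaf \<Rightarrow> ('p \<Rightarrow> 'b \<Rightarrow> 'c) \<Rightarrow> ('p, 'r, 'c) presheaf \<Rightarrow>
   ('p, 'r, 'a, 'i) coresolution \<Rightarrow> (nat \<Rightarrow> 'p \<Rightarrow> 'i \<Rightarrow> 'i) \<Rightarrow> ('p, 'r, 'b, 'i) coresolution \<Rightarrow>
   (nat \<Rightarrow> 'p \<Rightarrow> 'i \<Rightarrow> 'i) \<Rightarrow> ('p, 'r, 'c, 'i) coresolution \<Rightarrow> bool"
where
  "short_exact_resolutions R Q E i F p G IE \<alpha> IF \<beta> IG \<longleftrightarrow>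
     injective_resolution R Q E IE \<and> injective_resolution R Q F IF \<and> injective_resolution R Q G IG \<and>
     resolution_map R Q E i IE IF \<alpha> \<and> resolution_map R Q F p IF IG \<beta> \<and>
     (\<forall>n. \<forall>q\<in>Q. short_exact R (ob (cx IE n) q) (\<alpha> n q) (ob (cx IF n) q) (\<beta> n q) (ob (cx IG n) q))"

text \<open>The connecting homomorphism \<open>H\<^sup>n(Q; G) \<rightarrow> H\<^sup>n\<^sup>+\<^sup>1(Q; E)\<close> of the snake lemma.  The class \<open>Z\<close>
  is sent to the set of all \<open>w\<close> with \<open>\<alpha> w = d y\<close> for some lift \<open>y\<close> of an element of \<open>Z\<close>; this set
  is a full coset of the coboundaries.\<close>

definition connecting_hom ::
  "'p::order set \<Rightarrow> ('p, 'r, 'a, 'i) coresolution \<Rightarrow> (nat \<Rightarrow> 'p \<Rightarrow> 'i \<Rightarrow> 'j) \<Rightarrow> ('p, 'r, 'b, 'j) coresolution \<Rightarrow>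
   (nat \<Rightarrow> 'p \<Rightarrow> 'j \<Rightarrow> 'k) \<Rightarrow> nat \<Rightarrow> ('p \<Rightarrow> 'k) set \<Rightarrow> ('p \<Rightarrow> 'i) set"
where
  "connecting_hom Q IE \<alpha> IF \<beta> n Z =
     {w \<in> carrier (lim_module Q (cx IE (Suc n))).
        \<exists>y\<in>carrier (lim_module Q (cx IF n)).
          lim_map Q (\<beta> n) y \<in> Z \<and> lim_map Q (\<alpha> (Suc n)) w = lim_map Q (dif IF n) y}"

section \<open>The subfunctor concentrated on \<open>A\<close> and its quotient\<close>

definition sub_presheaf :: "'p set \<Rightarrow> ('p, 'r, 'm) presheaf \<Rightarrow> ('p, 'r, 'm) presheaf" where
  "sub_presheaf A F =
     \<lparr>ob = (\<lambda>p. (ob F p)\<lparr>carrier := (if p \<in> A then carrier (ob F p) else {\<zero>\<^bsub>ob F p\<^esub>})\<rparr>),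
      ar = ar F\<rparr>"

definition quot_proj ::
  "('p, 'r, 'm) presheaf \<Rightarrow> ('p, 'r, 'm) presheaf \<Rightarrow> 'p \<Rightarrow> 'm \<Rightarrow> 'm set" where
  "quot_proj F E p x = a_r_coset (ob F p) (carrier (ob E p)) x"

definition quot_presheaf ::
  "('p, 'r, 'm) presheaf \<Rightarrow> ('p, 'r, 'm) presheaf \<Rightarrow> ('p, 'r, 'm set) presheaf" where
  "quot_presheaf F E =
     \<lparr>ob = (\<lambda>p. quot_module (ob F p) (carrier (ob E p))),
      ar = (\<lambda>p q X. \<Union>x\<in>X. quot_proj F E q (ar F p q x))\<rparr>"

text \<open>Where \<open>E\<close> vanishes, the cosets in \<open>F/E\<close> are singletons, and \<open>\<lambda>_. the_elem\<close> is the
  canonical isomorphism \<open>F/E \<rightarrow> F\<close>.\<close>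

end

theory Submission
  imports Defs
begin

text \<open>
  Injective functors are flasque: sections over a down-set extend. So the sections of an injective
  resolution satisfy Mayer--Vietoris for down-sets, and a principal down-set has cohomology in degree
  \<open>0\<close> only. Attach the principal down-sets of the coatoms of an interval one by one in the given order.
  By (CL1) and (CL2) the next one meets the union of the earlier ones in the down-set of an initial segment of
  the coatoms of a smaller interval, so induction on the length of the interval applies. For \<open>G\<close> it
  gives vanishing of the top cohomology, where the surjectivity assumption starts the induction. For \<open>E\<close> it
  gives vanishing below the top degree and, in the top degree, a copy of \<open>F a\<close> for every falling chain
  from the top to \<open>a \<in> A\<close>, built by iterated connecting homomorphisms; inclusion--exclusion shows that there
  are \<open>\<bar>\<mu> a\<bar>\<close> of them. The theorem then is the long exact sequence of \<open>E \<rightarrow> F \<rightarrow> G\<close>.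
  Since \<open>G\<close> vanishes on the down-set outside \<open>U\<close>, its cohomology on the whole poset is that of its
  restriction to \<open>U\<close>; this and the independence of the resolution hold because the mapping cone of the
  comparison map is exact on principal down-sets, hence on all of them.
\<close>

subsection \<open>Modules and cochain complexes\<close>

text \<open>The degrees explain the shape of the inductions. The open interval below the head of a
  chain of length \<open>l\<close> has its top cohomology in degree \<open>rk - l - 2\<close>, and
  passing from \<open>c\<close> to \<open>h # c\<close> lowers the degree by one, just as a
  Mayer--Vietoris step does. Purity makes this bookkeeping depend on \<open>l\<close> alone: the
  coatoms of the current interval are atoms exactly when degree \<open>0\<close> is reached. Degree
  \<open>0\<close> is the obstacle, since a principal down-set has the cohomology \<open>F h\<close>
  there. For \<open>E\<close> this is zero as long as \<open>h\<close> is not an atom. For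
  \<open>G\<close> a class of degree \<open>0\<close> on the attaching set is a family of elements
  at the members of a set \<open>C\<close>, and it has to come from an element at \<open>h\<close>;
  this is what the epimorphism provides. The two vanishing statements sit in neighbouring degrees,
  \<open>rk - 3\<close> for \<open>E\<close> and \<open>rk - 2\<close> for \<open>G\<close>, and cut
  the long exact sequence down to four terms. The resolutions \<open>K\<close>, \<open>J\<close> and
  the triple \<open>IE\<close>, \<open>IF\<close>, \<open>IG\<close> are unrelated, so that
  \<open>K\<close> has to be compared with \<open>IF\<close>, and \<open>IG\<close> over
  \<open>U\<close> with \<open>J\<close>.\<close>

lemma (in abelian_group) a_inv_zero: "\<ominus> \<zero> = \<zero>"
  by (rule minus_equality) auto

text \<open>Registers a normalising set of equations for the \<open>algebra\<close> method in
  abelian groups. Identities between sums and differences of sections or cochains are then settled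
  without rearranging by hand.\<close>

lemmas (in abelian_group) [algebra abelian_group "zero G" "add G" "a_inv G" "a_minus G"] =
  a_closed zero_closed a_inv_closed minus_closed a_assoc l_zero r_zero l_neg r_neg a_comm minus_eq
  r_neg1 r_neg2 minus_add minus_minus a_inv_zero a_lcomm

lemma (in abelian_group) a_minus_zero [simp]: "x \<in> carrier G \<Longrightarrow> x \<ominus> \<zero> = x"
  by algebra

lemma (in abelian_group) a_minus_self [simp]: "x \<in> carrier G \<Longrightarrow> x \<ominus> x = \<zero>"
  by algebra

lemma (in abelian_group) a_zero_minus: "x \<in> carrier G \<Longrightarrow> \<zero> \<ominus> x = \<ominus> x"
  by algebra

lemma (in abelian_group) minus_eq_zero_iff:
  assumes "x \<in> carrier G" "y \<in> carrier G"
  shows "x \<ominus> y = \<zero> \<longleftrightarrow> x = y"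
proof
  assume "x \<ominus> y = \<zero>"
  moreover have "x = (x \<ominus> y) \<oplus> y" using assms by algebra
  ultimately show "x = y" using assms by simp
qed (use assms in simp)

lemma mod_homI:
  assumes "\<And>x. x \<in> carrier M \<Longrightarrow> h x \<in> carrier N"
    and "\<And>x y. x \<in> carrier M \<Longrightarrow> y \<in> carrier M \<Longrightarrow> h (x \<oplus>\<^bsub>M\<^esub> y) = h x \<oplus>\<^bsub>N\<^esub> h y"
    and "\<And>a x. a \<in> carrier R \<Longrightarrow> x \<in> carrier M \<Longrightarrow> h (a \<odot>\<^bsub>M\<^esub> x) = a \<odot>\<^bsub>N\<^esub> h x"
  shows "h \<in> mod_hom R M N"
  using assms by (auto simp: mod_hom_def)

lemma
  assumes "h \<in> mod_hom R M N"
  shows mod_hom_closed: "\<And>x. x \<in> carrier M \<Longrightarrow> h x \<in> carrier N"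
    and mod_hom_add: "\<And>x y. x \<in> carrier M \<Longrightarrow> y \<in> carrier M \<Longrightarrow> h (x \<oplus>\<^bsub>M\<^esub> y) = h x \<oplus>\<^bsub>N\<^esub> h y"
    and mod_hom_smult: "\<And>a x. a \<in> carrier R \<Longrightarrow> x \<in> carrier M \<Longrightarrow> h (a \<odot>\<^bsub>M\<^esub> x) = a \<odot>\<^bsub>N\<^esub> h x"
  using assms by (auto simp: mod_hom_def)

lemma mod_hom_zero:
  assumes "module R M" "module R N" "h \<in> mod_hom R M N"
  shows "h \<zero>\<^bsub>M\<^esub> = \<zero>\<^bsub>N\<^esub>"
proof -
  interpret M: module R M by fact
  interpret N: module R N by fact
  have "h \<zero>\<^bsub>M\<^esub> \<oplus>\<^bsub>N\<^esub> h \<zero>\<^bsub>M\<^esub> = h \<zero>\<^bsub>M\<^esub>"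
    using mod_hom_add[OF assms(3), of "\<zero>\<^bsub>M\<^esub>" "\<zero>\<^bsub>M\<^esub>"] by simp
  then show ?thesis
    using mod_hom_closed[OF assms(3)] by (metis M.M.zero_closed N.add.r_cancel_one')
qed

lemma mod_hom_neg:
  assumes "module R M" "module R N" "h \<in> mod_hom R M N" "x \<in> carrier M"
  shows "h (\<ominus>\<^bsub>M\<^esub> x) = \<ominus>\<^bsub>N\<^esub> h x"
proof -
  interpret M: module R M by fact
  interpret N: module R N by fact
  have "h (\<ominus>\<^bsub>M\<^esub> x) \<oplus>\<^bsub>N\<^esub> h x = \<zero>\<^bsub>N\<^esub>"
    using mod_hom_add[OF assms(3), of "\<ominus>\<^bsub>M\<^esub> x" x] mod_hom_zero[OF assms(1-3)] assms(4)
    by (simp add: M.M.l_neg)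
  then show ?thesis
    using mod_hom_closed[OF assms(3)] assms(4) N.M.minus_equality M.M.a_inv_closed by metis
qed

lemma mod_hom_minus:
  assumes "module R M" "module R N" "h \<in> mod_hom R M N" "x \<in> carrier M" "y \<in> carrier M"
  shows "h (x \<ominus>\<^bsub>M\<^esub> y) = h x \<ominus>\<^bsub>N\<^esub> h y"
proof -
  interpret M: module R M by fact
  show ?thesis
    using assms mod_hom_add[OF assms(3), of x "\<ominus>\<^bsub>M\<^esub> y"] mod_hom_neg[OF assms(1-3,5)]
    by (simp add: a_minus_def)
qed

lemma mod_hom_comp:
  assumes "f \<in> mod_hom R M N" "g \<in> mod_hom R N K"
  shows "(\<lambda>x. g (f x)) \<in> mod_hom R M K"
  using assms by (auto simp: mod_hom_def Pi_iff)

lemma mem_a_kernel: "x \<in> a_kernel M N h \<longleftrightarrow> x \<in> carrier M \<and> h x = \<zero>\<^bsub>N\<^esub>"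
  by (simp add: a_kernel_def kernel_def)

lemma mod_iso_inv:
  assumes "module R M" "h \<in> mod_iso R M N"
  shows "inv_into (carrier M) h \<in> mod_iso R N M"
proof -
  interpret M: module R M by fact
  let ?g = "inv_into (carrier M) h"
  have h: "h \<in> mod_hom R M N" and b: "bij_betw h (carrier M) (carrier N)"
    using assms by (auto simp: mod_iso_def)
  have g: "?g y \<in> carrier M" "h (?g y) = y" if "y \<in> carrier N" for y
    using that b by (auto simp: bij_betw_def inv_into_into f_inv_into_f)
  have i: "inj_on h (carrier M)" using b by (simp add: bij_betw_def)
  have "?g \<in> mod_hom R N M"
  proof (rule mod_homI)
    fix x y assume xy: "x \<in> carrier N" "y \<in> carrier N"
    have "h (?g x \<oplus>\<^bsub>M\<^esub> ?g y) = x \<oplus>\<^bsub>N\<^esub> y" using xy g mod_hom_add[OF h] by simp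
    then show "?g (x \<oplus>\<^bsub>N\<^esub> y) = ?g x \<oplus>\<^bsub>M\<^esub> ?g y"
      using inv_into_f_f[OF i, of "?g x \<oplus>\<^bsub>M\<^esub> ?g y"] xy g by simp
  next
    fix a x assume xy: "a \<in> carrier R" "x \<in> carrier N"
    have "h (a \<odot>\<^bsub>M\<^esub> ?g x) = a \<odot>\<^bsub>N\<^esub> x" using xy g mod_hom_smult[OF h] by simp
    then show "?g (a \<odot>\<^bsub>N\<^esub> x) = a \<odot>\<^bsub>M\<^esub> ?g x"
      using inv_into_f_f[OF i, of "a \<odot>\<^bsub>M\<^esub> ?g x"] xy g by simp
  qed (use g in auto)
  then show ?thesis using b by (auto simp: mod_iso_def bij_betw_inv_into)
qed

text \<open>The isomorphisms point the way they arise later: the first one into the given sequence,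
  the other three out of it. Only the two inner inverses enter the transported maps.\<close>

lemma exact_four_transport:
  assumes ex: "exact_four R M1 f M2 g M3 h M4"
    and m: "module R M1" "module R M2" "module R M3" "module R M4" "module R N3" "module R N4"
    and i: "i1 \<in> mod_iso R N1 M1" "i2 \<in> mod_iso R M2 N2" "i3 \<in> mod_iso R M3 N3" "i4 \<in> mod_iso R M4 N4"
  shows "exact_four R N1 (\<lambda>x. i2 (f (i1 x))) N2 (\<lambda>x. i3 (g (inv_into (carrier M2) i2 x)))
     N3 (\<lambda>x. i4 (h (inv_into (carrier M3) i3 x))) N4"
proof -
  let ?j2 = "inv_into (carrier M2) i2" and ?j3 = "inv_into (carrier M3) i3"
  have j: "?j2 \<in> mod_iso R N2 M2" "?j3 \<in> mod_iso R N3 M3"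
    using mod_iso_inv m i by blast+
  have H: "i1 \<in> mod_hom R N1 M1" "i2 \<in> mod_hom R M2 N2" "i3 \<in> mod_hom R M3 N3" "i4 \<in> mod_hom R M4 N4"
    "?j2 \<in> mod_hom R N2 M2" "?j3 \<in> mod_hom R N3 M3"
    using i j by (auto simp: mod_iso_def)
  have b: "bij_betw i1 (carrier N1) (carrier M1)" "bij_betw i2 (carrier M2) (carrier N2)"
    "bij_betw i3 (carrier M3) (carrier N3)" "bij_betw i4 (carrier M4) (carrier N4)"
    using i by (auto simp: mod_iso_def)
  have c: "i1 ` carrier N1 = carrier M1" "i2 ` carrier M2 = carrier N2"
    "i3 ` carrier M3 = carrier N3" "i4 ` carrier M4 = carrier N4"
    using b by (auto simp: bij_betw_def)
  have e: "f \<in> mod_hom R M1 M2" "g \<in> mod_hom R M2 M3" "h \<in> mod_hom R M3 M4" "inj_on f (carrier M1)"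
    "f ` carrier M1 = a_kernel M2 M3 g" "g ` carrier M2 = a_kernel M3 M4 h" "h ` carrier M3 = carrier M4"
    using ex by (auto simp: exact_four_def)
  have inj: "inj_on i1 (carrier N1)" "inj_on i2 (carrier M2)" "inj_on i3 (carrier M3)" "inj_on i4 (carrier M4)"
    using b by (auto simp: bij_betw_def)
  have j2: "?j2 (i2 x) = x" if "x \<in> carrier M2" for x using that inj by simp
  have j3: "?j3 (i3 x) = x" if "x \<in> carrier M3" for x using that inj by simp
  have z3: "i3 x = \<zero>\<^bsub>N3\<^esub> \<longleftrightarrow> x = \<zero>\<^bsub>M3\<^esub>" if "x \<in> carrier M3" for x
  proof -
    interpret M3: module R M3 by fact
    show ?thesis using that inj(3) mod_hom_zero[OF m(3,5) H(3)] M3.M.zero_closed by (metis inj_onD)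
  qed
  have z4: "i4 x = \<zero>\<^bsub>N4\<^esub> \<longleftrightarrow> x = \<zero>\<^bsub>M4\<^esub>" if "x \<in> carrier M4" for x
  proof -
    interpret M4: module R M4 by fact
    show ?thesis using that inj(4) mod_hom_zero[OF m(4,6) H(4)] M4.M.zero_closed by (metis inj_onD)
  qed
  have hs: "(\<lambda>x. i2 (f (i1 x))) \<in> mod_hom R N1 N2" "(\<lambda>x. i3 (g (?j2 x))) \<in> mod_hom R N2 N3"
    "(\<lambda>x. i4 (h (?j3 x))) \<in> mod_hom R N3 N4"
    by (rule mod_hom_comp[OF mod_hom_comp[OF H(1) e(1)] H(2)] mod_hom_comp[OF mod_hom_comp[OF H(5) e(2)] H(3)]
      mod_hom_comp[OF mod_hom_comp[OF H(6) e(3)] H(4)])+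
  have 1: "inj_on (\<lambda>x. i2 (f (i1 x))) (carrier N1)"
    using inj(1,2) e(4) mod_hom_closed[OF H(1)] mod_hom_closed[OF e(1)]
    unfolding inj_on_def by metis
  have img1: "(\<lambda>x. i2 (f (i1 x))) ` carrier N1 = i2 ` a_kernel M2 M3 g"
    by (simp add: e(5)[symmetric] c(1)[symmetric] image_image)
  have ker2: "a_kernel N2 N3 (\<lambda>x. i3 (g (?j2 x))) = i2 ` a_kernel M2 M3 g"
    unfolding c(2)[symmetric] set_eq_iff mem_a_kernel image_iff Bex_def
    by (metis j2 z3 mod_hom_closed[OF e(2)])
  have img2: "(\<lambda>x. i3 (g (?j2 x))) ` carrier N2 = i3 ` a_kernel M3 M4 h"
    unfolding e(6)[symmetric] c(2)[symmetric] image_image by (auto simp: j2 image_iff)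
  have ker3: "a_kernel N3 N4 (\<lambda>x. i4 (h (?j3 x))) = i3 ` a_kernel M3 M4 h"
    unfolding c(3)[symmetric] set_eq_iff mem_a_kernel image_iff Bex_def
    by (metis j3 z4 mod_hom_closed[OF e(3)])
  have img3: "(\<lambda>x. i4 (h (?j3 x))) ` carrier N3 = carrier N4"
    unfolding c(3,4)[symmetric] e(7)[symmetric] image_image by (auto simp: j3 image_iff)
  show ?thesis
    unfolding exact_four_def using hs 1 img1 ker2 img2 ker3 img3 by auto
qed

lemma mem_a_r_coset: "y \<in> a_r_coset M N x \<longleftrightarrow> (\<exists>b\<in>N. y = b \<oplus>\<^bsub>M\<^esub> x)"
  by (auto simp: a_r_coset_def')

lemma (in module) submoduleD:
  assumes "submodule N R M"
  shows "\<And>x. x \<in> N \<Longrightarrow> x \<in> carrier M" "\<zero>\<^bsub>M\<^esub> \<in> N" "\<And>x. x \<in> N \<Longrightarrow> \<ominus>\<^bsub>M\<^esub> x \<in> N"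
    "\<And>x y. x \<in> N \<Longrightarrow> y \<in> N \<Longrightarrow> x \<oplus>\<^bsub>M\<^esub> y \<in> N" "\<And>x y. x \<in> N \<Longrightarrow> y \<in> N \<Longrightarrow> x \<ominus>\<^bsub>M\<^esub> y \<in> N"
    "\<And>a x. a \<in> carrier R \<Longrightarrow> x \<in> N \<Longrightarrow> a \<odot>\<^bsub>M\<^esub> x \<in> N"
proof -
  show "\<zero>\<^bsub>M\<^esub> \<in> N" using subgroup.one_closed[OF submodule.axioms(1)[OF assms]] by simp
  show "x \<ominus>\<^bsub>M\<^esub> y \<in> N" if "x \<in> N" "y \<in> N" for x y
    using that submoduleE[OF assms] by (simp add: a_minus_def)
qed (use submoduleE[OF assms] in auto)

lemma mem_a_r_coset_minus:
  assumes "module R M" "submodule N R M" "x \<in> carrier M"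
  shows "y \<in> a_r_coset M N x \<longleftrightarrow> y \<in> carrier M \<and> y \<ominus>\<^bsub>M\<^esub> x \<in> N"
proof -
  interpret module R M by fact
  note N = submoduleD[OF assms(2)]
  show ?thesis
  proof
    assume "y \<in> a_r_coset M N x"
    then obtain b where b: "b \<in> N" "y = b \<oplus>\<^bsub>M\<^esub> x" by (auto simp: mem_a_r_coset)
    then have "y \<ominus>\<^bsub>M\<^esub> x = b" using N(1)[of b] assms(3) by simp algebra
    then show "y \<in> carrier M \<and> y \<ominus>\<^bsub>M\<^esub> x \<in> N" using b N(1) assms(3) by simp
  next
    assume y: "y \<in> carrier M \<and> y \<ominus>\<^bsub>M\<^esub> x \<in> N"
    then have "y = (y \<ominus>\<^bsub>M\<^esub> x) \<oplus>\<^bsub>M\<^esub> x" using assms(3) by algebra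
    then show "y \<in> a_r_coset M N x" using y unfolding mem_a_r_coset by blast
  qed
qed

lemma coset_eq_iff:
  assumes "module R M" "submodule N R M" "x \<in> carrier M" "y \<in> carrier M"
  shows "a_r_coset M N x = a_r_coset M N y \<longleftrightarrow> x \<ominus>\<^bsub>M\<^esub> y \<in> N"
proof -
  interpret module R M by fact
  note N = submoduleD[OF assms(2)]
  note mem = mem_a_r_coset_minus[OF assms(1,2)]
  show ?thesis
  proof
    assume "a_r_coset M N x = a_r_coset M N y"
    moreover have "x \<in> a_r_coset M N x"
      using mem[OF assms(3)] assms(3) N(2) by simp
    ultimately show "x \<ominus>\<^bsub>M\<^esub> y \<in> N" using mem[OF assms(4)] by simp
  next
    assume xy: "x \<ominus>\<^bsub>M\<^esub> y \<in> N"
    have "z \<ominus>\<^bsub>M\<^esub> x \<in> N \<longleftrightarrow> z \<ominus>\<^bsub>M\<^esub> y \<in> N" if z: "z \<in> carrier M" for z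
    proof -
      have "z \<ominus>\<^bsub>M\<^esub> y = (z \<ominus>\<^bsub>M\<^esub> x) \<oplus>\<^bsub>M\<^esub> (x \<ominus>\<^bsub>M\<^esub> y)" "z \<ominus>\<^bsub>M\<^esub> x = (z \<ominus>\<^bsub>M\<^esub> y) \<ominus>\<^bsub>M\<^esub> (x \<ominus>\<^bsub>M\<^esub> y)"
        using assms z by algebra+
      then show ?thesis using N(4,5) xy by metis
    qed
    then show "a_r_coset M N x = a_r_coset M N y"
      using mem[OF assms(3)] mem[OF assms(4)] by auto
  qed
qed

text \<open>The operations of \<open>quot_module\<close> are unions over, or sums of, whole cosets.
  Evaluated on representatives they collapse to a single coset, and all later work with quotients
  uses this form only.\<close>

lemma
  assumes "module R M" "submodule N R M"
  shows carrier_quot_module: "carrier (quot_module M N) = a_r_coset M N ` carrier M"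
    and zero_quot_module: "\<zero>\<^bsub>quot_module M N\<^esub> = a_r_coset M N \<zero>\<^bsub>M\<^esub>"
    and add_quot_module: "\<And>x y. x \<in> carrier M \<Longrightarrow> y \<in> carrier M \<Longrightarrow>
      a_r_coset M N x \<oplus>\<^bsub>quot_module M N\<^esub> a_r_coset M N y = a_r_coset M N (x \<oplus>\<^bsub>M\<^esub> y)"
    and smult_quot_module: "\<And>a x. a \<in> carrier R \<Longrightarrow> x \<in> carrier M \<Longrightarrow>
      a \<odot>\<^bsub>quot_module M N\<^esub> a_r_coset M N x = a_r_coset M N (a \<odot>\<^bsub>M\<^esub> x)"
    and module_quot_module: "module R (quot_module M N)"
proof -
  interpret module R M by fact
  note N = submoduleD[OF assms(2)]
  note mem = mem_a_r_coset_minus[OF assms(1,2)]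
  let ?Q = "quot_module M N" and ?c = "a_r_coset M N"
  show c: "carrier ?Q = ?c ` carrier M"
    by (auto simp: quot_module_def A_RCOSETS_def')
  show z: "\<zero>\<^bsub>?Q\<^esub> = ?c \<zero>\<^bsub>M\<^esub>"
    using N(1) by (auto simp: quot_module_def mem_a_r_coset)
  show a: "?c x \<oplus>\<^bsub>?Q\<^esub> ?c y = ?c (x \<oplus>\<^bsub>M\<^esub> y)" if xy: "x \<in> carrier M" "y \<in> carrier M" for x y
  proof -
    have "z \<in> ?c x \<oplus>\<^bsub>?Q\<^esub> ?c y \<longleftrightarrow> z \<in> ?c (x \<oplus>\<^bsub>M\<^esub> y)" for z
    proof
      assume "z \<in> ?c x \<oplus>\<^bsub>?Q\<^esub> ?c y"
      then obtain b1 b2 where b: "b1 \<in> N" "b2 \<in> N" "z = b1 \<oplus>\<^bsub>M\<^esub> x \<oplus>\<^bsub>M\<^esub> (b2 \<oplus>\<^bsub>M\<^esub> y)"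
        by (auto simp: quot_module_def set_add_def' mem_a_r_coset)
      then have "z = (b1 \<oplus>\<^bsub>M\<^esub> b2) \<oplus>\<^bsub>M\<^esub> (x \<oplus>\<^bsub>M\<^esub> y)"
        using xy N(1) by (simp add: M.a_ac)
      then show "z \<in> ?c (x \<oplus>\<^bsub>M\<^esub> y)" using N(4)[OF b(1,2)] unfolding mem_a_r_coset by blast
    next
      assume "z \<in> ?c (x \<oplus>\<^bsub>M\<^esub> y)"
      then obtain b where b: "b \<in> N" "z = b \<oplus>\<^bsub>M\<^esub> (x \<oplus>\<^bsub>M\<^esub> y)" by (auto simp: mem_a_r_coset)
      then have "z = b \<oplus>\<^bsub>M\<^esub> x \<oplus>\<^bsub>M\<^esub> (\<zero>\<^bsub>M\<^esub> \<oplus>\<^bsub>M\<^esub> y)" using xy N(1) by (simp add: M.a_ac)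
      moreover have "b \<oplus>\<^bsub>M\<^esub> x \<in> ?c x" "\<zero>\<^bsub>M\<^esub> \<oplus>\<^bsub>M\<^esub> y \<in> ?c y"
        using b(1) N(2) unfolding mem_a_r_coset by blast+
      ultimately show "z \<in> ?c x \<oplus>\<^bsub>?Q\<^esub> ?c y" by (auto simp: quot_module_def set_add_def')
    qed
    then show ?thesis by blast
  qed
  show s: "r \<odot>\<^bsub>?Q\<^esub> ?c x = ?c (r \<odot>\<^bsub>M\<^esub> x)" if xy: "r \<in> carrier R" "x \<in> carrier M" for r x
  proof -
    \<comment> \<open>All cosets in the union that defines the scalar multiple coincide, so the
      union is one of them.\<close>
    have "?c (r \<odot>\<^bsub>M\<^esub> y) = ?c (r \<odot>\<^bsub>M\<^esub> x)" if "y \<in> ?c x" for y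
    proof -
      have y: "y \<in> carrier M" "y \<ominus>\<^bsub>M\<^esub> x \<in> N" using that mem xy by auto
      have "r \<odot>\<^bsub>M\<^esub> y \<ominus>\<^bsub>M\<^esub> r \<odot>\<^bsub>M\<^esub> x = r \<odot>\<^bsub>M\<^esub> (y \<ominus>\<^bsub>M\<^esub> x)"
        using y xy by (simp add: a_minus_def smult_r_distr smult_r_minus)
      then have "r \<odot>\<^bsub>M\<^esub> y \<ominus>\<^bsub>M\<^esub> r \<odot>\<^bsub>M\<^esub> x \<in> N" using N(6)[OF xy(1) y(2)] by simp
      then show ?thesis using coset_eq_iff[OF assms] y xy by simp
    qed
    moreover have "x \<in> ?c x" using mem[OF xy(2)] xy N(2) by simp
    ultimately have "(\<Union>y\<in>?c x. ?c (r \<odot>\<^bsub>M\<^esub> y)) = ?c (r \<odot>\<^bsub>M\<^esub> x)" by blast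
    then show ?thesis by (simp add: quot_module_def)
  qed
  show "module R ?Q"
  proof (rule moduleI)
    show "abelian_group ?Q"
    proof (rule abelian_groupI)
      fix X assume "X \<in> carrier ?Q"
      then obtain x where x: "x \<in> carrier M" "X = ?c x" unfolding c by auto
      then show "\<exists>Y\<in>carrier ?Q. Y \<oplus>\<^bsub>?Q\<^esub> X = \<zero>\<^bsub>?Q\<^esub>"
        using a[of "\<ominus>\<^bsub>M\<^esub> x" x] z unfolding c by (intro bexI[of _ "?c (\<ominus>\<^bsub>M\<^esub> x)"]) (auto simp: M.l_neg)
    qed (auto simp: c z a M.a_ac)
  qed (use is_cring in \<open>auto simp: c z a s smult_l_distr smult_r_distr smult_assoc1\<close>)
qed

section \<open>Cohomology of cochain complexes of modules\<close>

definition bd :: "(nat \<Rightarrow> ('r, 'a) module) \<Rightarrow> (nat \<Rightarrow> 'a \<Rightarrow> 'a) \<Rightarrow> nat \<Rightarrow> 'a set" where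
  "bd M d n = (case n of 0 \<Rightarrow> {\<zero>\<^bsub>M 0\<^esub>} | Suc k \<Rightarrow> d k ` carrier (M k))"

definition coho :: "(nat \<Rightarrow> ('r, 'a) module) \<Rightarrow> (nat \<Rightarrow> 'a \<Rightarrow> 'a) \<Rightarrow> nat \<Rightarrow> ('r, 'a set) module" where
  "coho M d n = quot_module ((M n)\<lparr>carrier := a_kernel (M n) (M (Suc n)) (d n)\<rparr>) (bd M d n)"

definition cls :: "(nat \<Rightarrow> ('r, 'a) module) \<Rightarrow> (nat \<Rightarrow> 'a \<Rightarrow> 'a) \<Rightarrow> nat \<Rightarrow> 'a \<Rightarrow> 'a set" where
  "cls M d n x = a_r_coset (M n) (bd M d n) x"

definition coho_map :: "(nat \<Rightarrow> ('r, 'b) module) \<Rightarrow> (nat \<Rightarrow> 'b \<Rightarrow> 'b) \<Rightarrow> nat \<Rightarrow> ('a \<Rightarrow> 'b) \<Rightarrow> 'a set \<Rightarrow> 'b set" where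
  "coho_map N e n h X = (\<Union>x\<in>X. cls N e n (h x))"

locale cochain =
  fixes R :: "'r ring" and M :: "nat \<Rightarrow> ('r, 'a) module" and d :: "nat \<Rightarrow> 'a \<Rightarrow> 'a"
  assumes mod: "\<And>n. module R (M n)"
    and d_hom: "\<And>n. d n \<in> mod_hom R (M n) (M (Suc n))"
    and dd: "\<And>n x. x \<in> carrier (M n) \<Longrightarrow> d (Suc n) (d n x) = \<zero>\<^bsub>M (Suc (Suc n))\<^esub>"
begin

sublocale X: module R "M n" for n by (rule mod)

lemma d_closed [simp, intro]: "x \<in> carrier (M n) \<Longrightarrow> d n x \<in> carrier (M (Suc n))"
  and d_add: "x \<in> carrier (M n) \<Longrightarrow> y \<in> carrier (M n) \<Longrightarrow> d n (x \<oplus>\<^bsub>M n\<^esub> y) = d n x \<oplus>\<^bsub>M (Suc n)\<^esub> d n y"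
  and d_smult: "a \<in> carrier R \<Longrightarrow> x \<in> carrier (M n) \<Longrightarrow> d n (a \<odot>\<^bsub>M n\<^esub> x) = a \<odot>\<^bsub>M (Suc n)\<^esub> d n x"
  using d_hom[of n] by (auto simp: mod_hom_def)

lemma d_zero [simp]: "d n \<zero>\<^bsub>M n\<^esub> = \<zero>\<^bsub>M (Suc n)\<^esub>"
  using mod_hom_zero[OF mod mod d_hom] .

lemma d_minus: "x \<in> carrier (M n) \<Longrightarrow> y \<in> carrier (M n) \<Longrightarrow> d n (x \<ominus>\<^bsub>M n\<^esub> y) = d n x \<ominus>\<^bsub>M (Suc n)\<^esub> d n y"
  using mod_hom_minus[OF mod mod d_hom] .

lemma submodule_bd: "submodule (bd M d n) R (M n)"
proof (cases n)
  case 0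
  then show ?thesis
    by (intro X.submoduleI) (auto simp: bd_def)
next
  case (Suc k)
  show ?thesis unfolding Suc
  proof (intro X.submoduleI)
    fix x y assume "x \<in> bd M d (Suc k)" "y \<in> bd M d (Suc k)"
    then obtain u v where u: "u \<in> carrier (M k)" "x = d k u" "v \<in> carrier (M k)" "y = d k v"
      by (auto simp: bd_def)
    then show "x \<oplus>\<^bsub>M (Suc k)\<^esub> y \<in> bd M d (Suc k)"
      by (auto simp: bd_def d_add intro!: image_eqI[of _ _ "u \<oplus>\<^bsub>M k\<^esub> v"])
    show "\<ominus>\<^bsub>M (Suc k)\<^esub> x \<in> bd M d (Suc k)"
      using u mod_hom_neg[OF mod mod d_hom u(1)] by (auto simp: bd_def intro!: image_eqI[of _ _ "\<ominus>\<^bsub>M k\<^esub> u"])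
  next
    fix a x assume "a \<in> carrier R" "x \<in> bd M d (Suc k)"
    then obtain u where u: "u \<in> carrier (M k)" "x = d k u" by (auto simp: bd_def)
    then show "a \<odot>\<^bsub>M (Suc k)\<^esub> x \<in> bd M d (Suc k)"
      using \<open>a \<in> carrier R\<close> by (auto simp: bd_def d_smult intro!: image_eqI[of _ _ "a \<odot>\<^bsub>M k\<^esub> u"])
  qed (auto simp: bd_def intro!: image_eqI[of _ _ "\<zero>\<^bsub>M k\<^esub>"])
qed

lemmas bdD = X.submoduleD[OF submodule_bd]

lemma d_bd: "b \<in> bd M d n \<Longrightarrow> d n b = \<zero>\<^bsub>M (Suc n)\<^esub>"
  by (cases n) (auto simp: bd_def dd)

lemma d_in_bd: "x \<in> carrier (M n) \<Longrightarrow> d n x \<in> bd M d (Suc n)"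
  by (auto simp: bd_def)

lemma submodule_ker: "submodule (a_kernel (M n) (M (Suc n)) (d n)) R (M n)"
  by (intro X.submoduleI)
    (auto simp: mem_a_kernel d_add d_smult mod_hom_neg[OF mod mod d_hom])

abbreviation "Z n \<equiv> a_kernel (M n) (M (Suc n)) (d n)"
abbreviation "Zm n \<equiv> (M n)\<lparr>carrier := Z n\<rparr>"

lemma module_Z: "module R (Zm n)"
  using submodule.submodule_is_module[OF submodule_ker mod] .

lemma submodule_bd_Z: "submodule (bd M d n) R (Zm n)"
proof -
  interpret Z: module R "Zm n" by (rule module_Z)
  have sub: "bd M d n \<subseteq> Z n" using bdD(1) d_bd by (auto simp: mem_a_kernel)
  have "module R ((Zm n)\<lparr>carrier := bd M d n\<rparr>)"
    using submodule.submodule_is_module[OF submodule_bd mod] by simp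
  then show ?thesis using sub by (intro Z.module_incl_imp_submodule) auto
qed

text \<open>A coset sees the addition and the subgroup but not the carrier. Classes can therefore be
  written over \<open>M n\<close>, although the quotient is formed from the module of
  cocycles.\<close>

lemma cls_Z: "a_r_coset (Zm n) (bd M d n) = cls M d n"
  by (auto simp: cls_def a_r_coset_def' fun_eq_iff)

lemma module_coho: "module R (coho M d n)"
  unfolding coho_def by (rule module_quot_module[OF module_Z submodule_bd_Z])

lemma carrier_coho: "carrier (coho M d n) = cls M d n ` Z n"
  unfolding coho_def carrier_quot_module[OF module_Z submodule_bd_Z] cls_Z by simp

lemma cohoE:
  assumes "X \<in> carrier (coho M d n)"
  obtains x where "x \<in> carrier (M n)" "d n x = \<zero>\<^bsub>M (Suc n)\<^esub>" "X = cls M d n x"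
  using assms by (auto simp: carrier_coho mem_a_kernel)

lemma cls_in_coho: "x \<in> carrier (M n) \<Longrightarrow> d n x = \<zero>\<^bsub>M (Suc n)\<^esub> \<Longrightarrow> cls M d n x \<in> carrier (coho M d n)"
  by (auto simp: carrier_coho mem_a_kernel)

lemma zero_coho: "\<zero>\<^bsub>coho M d n\<^esub> = cls M d n \<zero>\<^bsub>M n\<^esub>"
  unfolding coho_def zero_quot_module[OF module_Z submodule_bd_Z] cls_Z by simp

lemma add_coho: "x \<in> Z n \<Longrightarrow> y \<in> Z n \<Longrightarrow> cls M d n x \<oplus>\<^bsub>coho M d n\<^esub> cls M d n y = cls M d n (x \<oplus>\<^bsub>M n\<^esub> y)"
  using add_quot_module[OF module_Z submodule_bd_Z, of x n y] unfolding coho_def cls_Z by simp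

lemma smult_coho: "a \<in> carrier R \<Longrightarrow> x \<in> Z n \<Longrightarrow> a \<odot>\<^bsub>coho M d n\<^esub> cls M d n x = cls M d n (a \<odot>\<^bsub>M n\<^esub> x)"
  using smult_quot_module[OF module_Z submodule_bd_Z, of a x n] unfolding coho_def cls_Z by simp

lemma cls_eq_iff:
  "x \<in> carrier (M n) \<Longrightarrow> y \<in> carrier (M n) \<Longrightarrow> cls M d n x = cls M d n y \<longleftrightarrow> x \<ominus>\<^bsub>M n\<^esub> y \<in> bd M d n"
  unfolding cls_def by (rule coset_eq_iff[OF mod submodule_bd])

lemma cls_eq_zero_iff:
  "x \<in> carrier (M n) \<Longrightarrow> cls M d n x = \<zero>\<^bsub>coho M d n\<^esub> \<longleftrightarrow> x \<in> bd M d n"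
  using cls_eq_iff[of x n "\<zero>\<^bsub>M n\<^esub>"] by (simp add: zero_coho)

lemma mem_cls_iff: "x \<in> carrier (M n) \<Longrightarrow> y \<in> cls M d n x \<longleftrightarrow> y \<in> carrier (M n) \<and> y \<ominus>\<^bsub>M n\<^esub> x \<in> bd M d n"
  unfolding cls_def by (rule mem_a_r_coset_minus[OF mod submodule_bd])

text \<open>Linear maps out of cohomology are checked on cocycles, once their value on a class is
  known to be given by a formula in a representative.\<close>

lemma mod_hom_cohoI:
  assumes "\<And>x. x \<in> Z n \<Longrightarrow> \<Phi> (cls M d n x) = \<phi> x"
    and "\<And>x. x \<in> Z n \<Longrightarrow> \<phi> x \<in> carrier N"
    and "\<And>x y. x \<in> Z n \<Longrightarrow> y \<in> Z n \<Longrightarrow> \<phi> (x \<oplus>\<^bsub>M n\<^esub> y) = \<phi> x \<oplus>\<^bsub>N\<^esub> \<phi> y"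
    and "\<And>a x. a \<in> carrier R \<Longrightarrow> x \<in> Z n \<Longrightarrow> \<phi> (a \<odot>\<^bsub>M n\<^esub> x) = a \<odot>\<^bsub>N\<^esub> \<phi> x"
  shows "\<Phi> \<in> mod_hom R (coho M d n) N"
proof (rule mod_homI)
  note K = X.submoduleD[OF submodule_ker]
  show "\<Phi> X \<in> carrier N" if "X \<in> carrier (coho M d n)" for X
    using that assms(1,2) by (auto simp: carrier_coho)
  show "\<Phi> (X \<oplus>\<^bsub>coho M d n\<^esub> Y) = \<Phi> X \<oplus>\<^bsub>N\<^esub> \<Phi> Y"
    if "X \<in> carrier (coho M d n)" "Y \<in> carrier (coho M d n)" for X Y
    using that assms(1,3) K(4) by (auto simp: carrier_coho add_coho)
  show "\<Phi> (a \<odot>\<^bsub>coho M d n\<^esub> X) = a \<odot>\<^bsub>N\<^esub> \<Phi> X"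
    if "a \<in> carrier R" "X \<in> carrier (coho M d n)" for a X
    using that assms(1,4) K(6) by (auto simp: carrier_coho smult_coho)
qed

end

locale cochain_map = M: cochain R M d + N: cochain R N e
  for R :: "'r ring" and M :: "nat \<Rightarrow> ('r, 'a) module" and d
    and N :: "nat \<Rightarrow> ('r, 'b) module" and e +
  fixes h :: "nat \<Rightarrow> 'a \<Rightarrow> 'b"
  assumes h_hom: "\<And>n. h n \<in> mod_hom R (M n) (N n)"
    and h_d: "\<And>n x. x \<in> carrier (M n) \<Longrightarrow> h (Suc n) (d n x) = e n (h n x)"
begin

lemma h_closed [simp, intro]: "x \<in> carrier (M n) \<Longrightarrow> h n x \<in> carrier (N n)"
  and h_add: "x \<in> carrier (M n) \<Longrightarrow> y \<in> carrier (M n) \<Longrightarrow> h n (x \<oplus>\<^bsub>M n\<^esub> y) = h n x \<oplus>\<^bsub>N n\<^esub> h n y"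
  and h_smult: "a \<in> carrier R \<Longrightarrow> x \<in> carrier (M n) \<Longrightarrow> h n (a \<odot>\<^bsub>M n\<^esub> x) = a \<odot>\<^bsub>N n\<^esub> h n x"
  using h_hom[of n] by (auto simp: mod_hom_def)

lemma h_zero [simp]: "h n \<zero>\<^bsub>M n\<^esub> = \<zero>\<^bsub>N n\<^esub>"
  using mod_hom_zero[OF M.mod N.mod h_hom] .

lemma h_minus: "x \<in> carrier (M n) \<Longrightarrow> y \<in> carrier (M n) \<Longrightarrow> h n (x \<ominus>\<^bsub>M n\<^esub> y) = h n x \<ominus>\<^bsub>N n\<^esub> h n y"
  using mod_hom_minus[OF M.mod N.mod h_hom] .

lemma h_bd: "b \<in> bd M d n \<Longrightarrow> h n b \<in> bd N e n"
  by (cases n) (auto simp: bd_def h_d)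

lemma h_Z: "x \<in> M.Z n \<Longrightarrow> h n x \<in> N.Z n"
  by (auto simp: mem_a_kernel h_d[symmetric])

lemma coho_map_cls:
  assumes "x \<in> carrier (M n)"
  shows "coho_map N e n (h n) (cls M d n x) = cls N e n (h n x)"
proof -
  have "cls N e n (h n y) = cls N e n (h n x)" if "y \<in> cls M d n x" for y
  proof -
    have y: "y \<in> carrier (M n)" "y \<ominus>\<^bsub>M n\<^esub> x \<in> bd M d n" using M.mem_cls_iff assms that by auto
    then have "h n y \<ominus>\<^bsub>N n\<^esub> h n x \<in> bd N e n" using h_bd[OF y(2)] assms by (simp add: h_minus)
    then show ?thesis using N.cls_eq_iff y assms by simp
  qed
  moreover have "x \<in> cls M d n x" using assms M.mem_cls_iff[OF assms] M.bdD(2) by simp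
  ultimately show ?thesis unfolding coho_map_def by blast
qed

lemma coho_map_hom: "coho_map N e n (h n) \<in> mod_hom R (coho M d n) (coho N e n)"
proof (rule M.mod_hom_cohoI[where \<phi> = "\<lambda>x. cls N e n (h n x)"])
  fix x y a assume x: "x \<in> M.Z n"
  then have x': "x \<in> carrier (M n)" by (simp add: mem_a_kernel)
  show "coho_map N e n (h n) (cls M d n x) = cls N e n (h n x)" using coho_map_cls[OF x'] .
  show "cls N e n (h n x) \<in> carrier (coho N e n)" using h_Z[OF x] by (auto simp: N.carrier_coho)
  show "cls N e n (h n (x \<oplus>\<^bsub>M n\<^esub> y)) = cls N e n (h n x) \<oplus>\<^bsub>coho N e n\<^esub> cls N e n (h n y)" if "y \<in> M.Z n"
    using that x' by (simp add: N.add_coho[OF h_Z[OF x] h_Z[OF that]] h_add mem_a_kernel)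
  show "cls N e n (h n (a \<odot>\<^bsub>M n\<^esub> x)) = a \<odot>\<^bsub>coho N e n\<^esub> cls N e n (h n x)" if "a \<in> carrier R"
    using that x' by (simp add: N.smult_coho[OF that h_Z[OF x]] h_smult)
qed

text \<open>The two conditions are phrased for cocycles and coboundaries because exactness of a
  mapping cone delivers them in this form.\<close>

lemma coho_map_iso:
  assumes inj: "\<And>x. x \<in> carrier (M n) \<Longrightarrow> d n x = \<zero>\<^bsub>M (Suc n)\<^esub> \<Longrightarrow> h n x \<in> bd N e n \<Longrightarrow> x \<in> bd M d n"
    and surj: "\<And>y. y \<in> carrier (N n) \<Longrightarrow> e n y = \<zero>\<^bsub>N (Suc n)\<^esub> \<Longrightarrow>
      \<exists>x\<in>carrier (M n). d n x = \<zero>\<^bsub>M (Suc n)\<^esub> \<and> y \<ominus>\<^bsub>N n\<^esub> h n x \<in> bd N e n"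
  shows "coho_map N e n (h n) \<in> mod_iso R (coho M d n) (coho N e n)"
proof -
  have "inj_on (coho_map N e n (h n)) (carrier (coho M d n))"
  proof (rule inj_onI)
    fix X Y assume "X \<in> carrier (coho M d n)" "Y \<in> carrier (coho M d n)"
      and eq: "coho_map N e n (h n) X = coho_map N e n (h n) Y"
    then obtain x y where x: "x \<in> carrier (M n)" "d n x = \<zero>\<^bsub>M (Suc n)\<^esub>" "X = cls M d n x"
      and y: "y \<in> carrier (M n)" "d n y = \<zero>\<^bsub>M (Suc n)\<^esub>" "Y = cls M d n y"
      by (metis M.cohoE)
    then have "h n x \<ominus>\<^bsub>N n\<^esub> h n y \<in> bd N e n" using eq by (simp add: coho_map_cls N.cls_eq_iff)
    then have "x \<ominus>\<^bsub>M n\<^esub> y \<in> bd M d n"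
      using inj[of "x \<ominus>\<^bsub>M n\<^esub> y"] x y by (simp add: h_minus M.d_minus)
    then show "X = Y" using x y by (simp add: M.cls_eq_iff)
  qed
  moreover have "Y \<in> coho_map N e n (h n) ` carrier (coho M d n)" if "Y \<in> carrier (coho N e n)" for Y
  proof -
    obtain y where y: "y \<in> carrier (N n)" "e n y = \<zero>\<^bsub>N (Suc n)\<^esub>" "Y = cls N e n y"
      using \<open>Y \<in> carrier (coho N e n)\<close> N.cohoE by blast
    obtain x where x: "x \<in> carrier (M n)" "d n x = \<zero>\<^bsub>M (Suc n)\<^esub>" "y \<ominus>\<^bsub>N n\<^esub> h n x \<in> bd N e n"
      using surj y by blast
    then show ?thesis using y
      by (intro image_eqI[of _ _ "cls M d n x"]) (auto simp: coho_map_cls N.cls_eq_iff intro: M.cls_in_coho)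
  qed
  moreover have "coho_map N e n (h n) \<in> mod_hom R (coho M d n) (coho N e n)" by (rule coho_map_hom)
  ultimately show ?thesis using mod_hom_closed[of "coho_map N e n (h n)" R]
    by (auto simp: mod_iso_def bij_betw_def)
qed

end

section \<open>Subcomplexes and Mayer--Vietoris\<close>

context cochain
begin

text \<open>For a subcomplex \<open>A\<close>, this says that the \<open>n\<close>-th cohomology of \<open>M/A\<close> vanishes.\<close>

definition acyc :: "nat \<Rightarrow> (nat \<Rightarrow> 'a set) \<Rightarrow> bool" where
  "acyc n A \<longleftrightarrow> (\<forall>z\<in>carrier (M n). d n z \<in> A (Suc n) \<longrightarrow> (\<exists>b\<in>bd M d n. z \<ominus>\<^bsub>M n\<^esub> b \<in> A n))"

definition subcomplex :: "(nat \<Rightarrow> 'a set) \<Rightarrow> bool" where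
  "subcomplex A \<longleftrightarrow> (\<forall>n. submodule (A n) R (M n) \<and> (\<forall>x\<in>A n. d n x \<in> A (Suc n)))"

lemma
  assumes "subcomplex A"
  shows sub_carrier: "\<And>x n. x \<in> A n \<Longrightarrow> x \<in> carrier (M n)"
    and sub_zero: "\<And>n. \<zero>\<^bsub>M n\<^esub> \<in> A n"
    and sub_add: "\<And>x y n. x \<in> A n \<Longrightarrow> y \<in> A n \<Longrightarrow> x \<oplus>\<^bsub>M n\<^esub> y \<in> A n"
    and sub_minus: "\<And>x y n. x \<in> A n \<Longrightarrow> y \<in> A n \<Longrightarrow> x \<ominus>\<^bsub>M n\<^esub> y \<in> A n"
    and sub_d: "\<And>x n. x \<in> A n \<Longrightarrow> d n x \<in> A (Suc n)"
proof -
  have "submodule (A n) R (M n)" for n using assms by (simp add: subcomplex_def)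
  note N = X.submoduleD[OF this]
  show "\<And>x n. x \<in> A n \<Longrightarrow> x \<in> carrier (M n)" using N(1) .
  show "\<And>n. \<zero>\<^bsub>M n\<^esub> \<in> A n" using N(2) .
  show "\<And>x y n. x \<in> A n \<Longrightarrow> y \<in> A n \<Longrightarrow> x \<oplus>\<^bsub>M n\<^esub> y \<in> A n" using N(4) .
  show "\<And>x y n. x \<in> A n \<Longrightarrow> y \<in> A n \<Longrightarrow> x \<ominus>\<^bsub>M n\<^esub> y \<in> A n" using N(5) .
  show "\<And>x n. x \<in> A n \<Longrightarrow> d n x \<in> A (Suc n)" using assms by (simp add: subcomplex_def)
qed

lemma acycD:
  assumes "acyc n A" "z \<in> carrier (M n)" "d n z \<in> A (Suc n)"
  obtains b where "b \<in> bd M d n" "b \<in> carrier (M n)" "d n b = \<zero>\<^bsub>M (Suc n)\<^esub>" "z \<ominus>\<^bsub>M n\<^esub> b \<in> A n"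
  using assms bdD(1) d_bd unfolding acyc_def by blast

text \<open>The only coboundary in degree \<open>0\<close> is zero, so there are no two corrections
  that would have to be matched.\<close>

lemma acyc_0_inter: "acyc 0 A \<Longrightarrow> acyc 0 B \<Longrightarrow> acyc 0 (\<lambda>n. A n \<inter> B n)"
  unfolding acyc_def by (auto simp: bd_def)

text \<open>Mayer--Vietoris for the quotients by \<open>A\<close>, \<open>B\<close>, \<open>A \<inter> B\<close> and \<open>A + B\<close>. The cocycle \<open>f\<close> of \<open>M/B\<close> need not
  be a coboundary; this is used in degree \<open>0\<close>.\<close>

lemma acyc_Suc_inter':
  assumes A: "subcomplex A" and B: "subcomplex B"
    and acA: "acyc (Suc n) A" and acB: "acyc (Suc n) B"
    and sum: "\<And>y. y \<in> carrier (M n) \<Longrightarrow> \<exists>a\<in>A (Suc n). \<exists>b\<in>B (Suc n). d n y = a \<oplus>\<^bsub>M (Suc n)\<^esub> b \<Longrightarrow>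
      \<exists>f\<in>carrier (M n). d n f \<in> B (Suc n) \<and> (\<exists>a\<in>A n. \<exists>b\<in>B n. y \<ominus>\<^bsub>M n\<^esub> f = a \<oplus>\<^bsub>M n\<^esub> b)"
  shows "acyc (Suc n) (\<lambda>n. A n \<inter> B n)"
  unfolding acyc_def
proof (intro ballI impI)
  fix z assume z: "z \<in> carrier (M (Suc n))" and dz: "d (Suc n) z \<in> A (Suc (Suc n)) \<inter> B (Suc (Suc n))"
  obtain u where u: "u \<in> carrier (M n)" "z \<ominus>\<^bsub>M (Suc n)\<^esub> d n u \<in> A (Suc n)"
    using acycD[OF acA z] dz by (auto simp: bd_def)
  obtain v where v: "v \<in> carrier (M n)" "z \<ominus>\<^bsub>M (Suc n)\<^esub> d n v \<in> B (Suc n)"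
    using acycD[OF acB z] dz by (auto simp: bd_def)
  \<comment> \<open>The primitives \<open>u\<close> modulo \<open>A\<close> and \<open>v\<close>
    modulo \<open>B\<close> differ by a cocycle of the quotient by \<open>A + B\<close>, to which
    \<open>sum\<close> applies.\<close>
  have "d n (v \<ominus>\<^bsub>M n\<^esub> u) = (z \<ominus>\<^bsub>M (Suc n)\<^esub> d n u) \<oplus>\<^bsub>M (Suc n)\<^esub> (\<zero>\<^bsub>M (Suc n)\<^esub> \<ominus>\<^bsub>M (Suc n)\<^esub> (z \<ominus>\<^bsub>M (Suc n)\<^esub> d n v))"
    unfolding d_minus[OF v(1) u(1)] using u(1)[THEN d_closed] v(1)[THEN d_closed] z by algebra
  moreover have "\<zero>\<^bsub>M (Suc n)\<^esub> \<ominus>\<^bsub>M (Suc n)\<^esub> (z \<ominus>\<^bsub>M (Suc n)\<^esub> d n v) \<in> B (Suc n)"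
    using v(2) sub_zero[OF B] sub_minus[OF B] by blast
  ultimately obtain f a b where f: "f \<in> carrier (M n)" "d n f \<in> B (Suc n)" and a: "a \<in> A n" and b: "b \<in> B n"
    and eq: "(v \<ominus>\<^bsub>M n\<^esub> u) \<ominus>\<^bsub>M n\<^esub> f = a \<oplus>\<^bsub>M n\<^esub> b"
    using sum[of "v \<ominus>\<^bsub>M n\<^esub> u"] u v by auto
  have ab: "a \<in> carrier (M n)" "b \<in> carrier (M n)" using a b sub_carrier A B by auto
  \<comment> \<open>The common primitive. Seen from \<open>A\<close> it is \<open>u\<close> changed
    by an element of \<open>A\<close>; seen from \<open>B\<close> it is \<open>v\<close> changed by
    \<open>b\<close> and by \<open>f\<close>, whose differential lies in \<open>B\<close>.\<close>
  let ?w = "u \<oplus>\<^bsub>M n\<^esub> a"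
  have "?w = u \<oplus>\<^bsub>M n\<^esub> ((a \<oplus>\<^bsub>M n\<^esub> b) \<ominus>\<^bsub>M n\<^esub> b)" using ab u by algebra
  also have "\<dots> = v \<ominus>\<^bsub>M n\<^esub> (f \<oplus>\<^bsub>M n\<^esub> b)" unfolding eq[symmetric] using ab u v f(1) by algebra
  finally have w: "?w = v \<ominus>\<^bsub>M n\<^esub> (f \<oplus>\<^bsub>M n\<^esub> b)" .
  have "z \<ominus>\<^bsub>M (Suc n)\<^esub> d n ?w = (z \<ominus>\<^bsub>M (Suc n)\<^esub> d n u) \<ominus>\<^bsub>M (Suc n)\<^esub> d n a"
    unfolding d_add[OF u(1) ab(1)] using u(1)[THEN d_closed] ab(1)[THEN d_closed] z by algebra
  then have 1: "z \<ominus>\<^bsub>M (Suc n)\<^esub> d n ?w \<in> A (Suc n)"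
    using sub_minus[OF A u(2) sub_d[OF A a]] by simp
  have "z \<ominus>\<^bsub>M (Suc n)\<^esub> d n ?w = (z \<ominus>\<^bsub>M (Suc n)\<^esub> d n v) \<oplus>\<^bsub>M (Suc n)\<^esub> (d n f \<oplus>\<^bsub>M (Suc n)\<^esub> d n b)"
    unfolding w d_minus[OF v(1) X.M.a_closed[OF f(1) ab(2)]] d_add[OF f(1) ab(2)]
    using v(1)[THEN d_closed] f(1)[THEN d_closed] ab(2)[THEN d_closed] z by algebra
  then have 2: "z \<ominus>\<^bsub>M (Suc n)\<^esub> d n ?w \<in> B (Suc n)"
    using sub_add[OF B v(2) sub_add[OF B f(2) sub_d[OF B b]]] by simp
  show "\<exists>b\<in>bd M d (Suc n). z \<ominus>\<^bsub>M (Suc n)\<^esub> b \<in> A (Suc n) \<inter> B (Suc n)"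
    using 1 2 d_in_bd[of ?w n] u ab by blast
qed

text \<open>If the quotient by \<open>C = A + B\<close> is acyclic in degree \<open>n\<close>, the
  correcting cocycle can be chosen as a coboundary. Its differential is zero and so lies in
  \<open>B\<close> trivially.\<close>

lemma acyc_Suc_inter:
  assumes A: "subcomplex A" and B: "subcomplex B"
    and "acyc (Suc n) A" "acyc (Suc n) B" and C: "acyc n C"
    and sum: "\<And>n x. x \<in> C n \<longleftrightarrow> (\<exists>a\<in>A n. \<exists>b\<in>B n. x = a \<oplus>\<^bsub>M n\<^esub> b)"
  shows "acyc (Suc n) (\<lambda>n. A n \<inter> B n)"
proof (rule acyc_Suc_inter'[OF assms(1-4)])
  fix y assume y: "y \<in> carrier (M n)" "\<exists>a\<in>A (Suc n). \<exists>b\<in>B (Suc n). d n y = a \<oplus>\<^bsub>M (Suc n)\<^esub> b"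
  then have "d n y \<in> C (Suc n)" using sum by simp
  then obtain f where "f \<in> bd M d n" "f \<in> carrier (M n)" "d n f = \<zero>\<^bsub>M (Suc n)\<^esub>" "y \<ominus>\<^bsub>M n\<^esub> f \<in> C n"
    using acycD[OF C y(1)] by blast
  then show "\<exists>f\<in>carrier (M n). d n f \<in> B (Suc n) \<and> (\<exists>a\<in>A n. \<exists>b\<in>B n. y \<ominus>\<^bsub>M n\<^esub> f = a \<oplus>\<^bsub>M n\<^esub> b)"
    using sum[of "y \<ominus>\<^bsub>M n\<^esub> f" n] sub_zero[OF B] by (intro bexI[of _ f]) auto
qed

end

section \<open>Short exact sequences of complexes and the connecting homomorphism\<close>

locale cochain_ses = \<alpha>: cochain_map R L c M d \<alpha> + \<beta>: cochain_map R M d N e \<beta>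
  for R :: "'r ring" and L :: "nat \<Rightarrow> ('r, 'a) module" and c and M :: "nat \<Rightarrow> ('r, 'b) module" and d
    and N :: "nat \<Rightarrow> ('r, 'c) module" and e and \<alpha> and \<beta> +
  assumes inj: "\<And>n x. x \<in> carrier (L n) \<Longrightarrow> \<alpha> n x = \<zero>\<^bsub>M n\<^esub> \<Longrightarrow> x = \<zero>\<^bsub>L n\<^esub>"
    and \<beta>\<alpha>: "\<And>n x. x \<in> carrier (L n) \<Longrightarrow> \<beta> n (\<alpha> n x) = \<zero>\<^bsub>N n\<^esub>"
    and ker: "\<And>n y. y \<in> carrier (M n) \<Longrightarrow> \<beta> n y = \<zero>\<^bsub>N n\<^esub> \<Longrightarrow> \<exists>x\<in>carrier (L n). \<alpha> n x = y"
    and surj: "\<And>n z. z \<in> carrier (N n) \<Longrightarrow> \<exists>y\<in>carrier (M n). \<beta> n y = z"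
begin

abbreviation "Lc \<equiv> \<alpha>.M.Z"
abbreviation "Nc \<equiv> \<beta>.N.Z"

text \<open>Literally the set in \<open>connecting_hom\<close>, so that the two agree by
  unfolding.\<close>

definition conn :: "nat \<Rightarrow> 'c set \<Rightarrow> 'a set" where
  "conn n Z = {w \<in> carrier (L (Suc n)). \<exists>y\<in>carrier (M n). \<beta> n y \<in> Z \<and> \<alpha> (Suc n) w = d n y}"

lemma \<alpha>_inj:
  assumes "x \<in> carrier (L n)" "y \<in> carrier (L n)" "\<alpha> n x = \<alpha> n y"
  shows "x = y"
proof -
  have "x \<ominus>\<^bsub>L n\<^esub> y = \<zero>\<^bsub>L n\<^esub>" using assms inj[of "x \<ominus>\<^bsub>L n\<^esub> y"] by (simp add: \<alpha>.h_minus)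
  moreover have "x = (x \<ominus>\<^bsub>L n\<^esub> y) \<oplus>\<^bsub>L n\<^esub> y" using assms(1,2) by algebra
  ultimately show ?thesis using assms by simp
qed

text \<open>A coboundary lifts to a coboundary: lift a primitive along the surjection and apply the
  differential.\<close>

lemma bd_lift:
  assumes "b \<in> bd N e n"
  obtains b' where "b' \<in> bd M d n" "b' \<in> carrier (M n)" "\<beta> n b' = b"
proof (cases n)
  case 0
  then show ?thesis using assms that[of "\<zero>\<^bsub>M 0\<^esub>"] by (auto simp: bd_def)
next
  case (Suc k)
  then obtain v where v: "v \<in> carrier (N k)" "b = e k v" using assms by (auto simp: bd_def)
  obtain y where "y \<in> carrier (M k)" "\<beta> k y = v" using surj v by blast
  then show ?thesis using that[of "d k y"] v Suc by (auto simp: \<beta>.h_d bd_def)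
qed

lemma conn_lift:
  assumes "z \<in> carrier (N n)" "e n z = \<zero>\<^bsub>N (Suc n)\<^esub>"
  obtains y w where "y \<in> carrier (M n)" "\<beta> n y = z" "w \<in> carrier (L (Suc n))" "\<alpha> (Suc n) w = d n y"
proof -
  obtain y where y: "y \<in> carrier (M n)" "\<beta> n y = z" using surj assms by blast
  then obtain w where "w \<in> carrier (L (Suc n))" "\<alpha> (Suc n) w = d n y"
    using ker[of "d n y" "Suc n"] assms by (auto simp: \<beta>.h_d)
  then show thesis using that y by blast
qed

lemma conn_cocycle:
  assumes "y \<in> carrier (M n)" "w \<in> carrier (L (Suc n))" "\<alpha> (Suc n) w = d n y"
  shows "c (Suc n) w = \<zero>\<^bsub>L (Suc (Suc n))\<^esub>"
  using assms by (intro inj) (auto simp: \<alpha>.h_d \<alpha>.N.dd)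

text \<open>Two lifts of cohomologous elements differ by a coboundary and an element of
  \<open>L\<close>, which changes \<open>w\<close> by a coboundary. Conversely every change of
  \<open>w\<close> by \<open>c n u\<close> is realised by the lift \<open>y\<close> plus the image
  of \<open>u\<close>. Hence the set is a full class, and a single choice of \<open>y\<close> and
  \<open>w\<close> computes it.\<close>

lemma conn_cls:
  assumes z: "z \<in> carrier (N n)" and y: "y \<in> carrier (M n)" "\<beta> n y = z"
    and w: "w \<in> carrier (L (Suc n))" "\<alpha> (Suc n) w = d n y"
  shows "conn n (cls N e n z) = cls L c (Suc n) w"
proof -
  have "w' \<in> conn n (cls N e n z) \<longleftrightarrow> w' \<in> cls L c (Suc n) w" for w'
  proof
    assume "w' \<in> cls L c (Suc n) w"
    then obtain u where w': "w' \<in> carrier (L (Suc n))" and u: "u \<in> carrier (L n)" "w' \<ominus>\<^bsub>L (Suc n)\<^esub> w = c n u"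
      by (auto simp: \<alpha>.M.mem_cls_iff[OF w(1)] bd_def)
    have "w' = w \<oplus>\<^bsub>L (Suc n)\<^esub> (w' \<ominus>\<^bsub>L (Suc n)\<^esub> w)" using w' w(1) by algebra
    then have "\<alpha> (Suc n) w' = d n (y \<oplus>\<^bsub>M n\<^esub> \<alpha> n u)"
      using u w y by (simp add: \<alpha>.h_add \<alpha>.h_d \<alpha>.N.d_add)
    moreover have "\<beta> n (y \<oplus>\<^bsub>M n\<^esub> \<alpha> n u) = z" using y u z by (simp add: \<beta>.h_add \<beta>\<alpha>)
    moreover have "z \<in> cls N e n z" using \<beta>.N.mem_cls_iff[OF z] z \<beta>.N.bdD(2) by simp
    ultimately show "w' \<in> conn n (cls N e n z)" using w' y u
      unfolding conn_def by (auto intro!: bexI[of _ "y \<oplus>\<^bsub>M n\<^esub> \<alpha> n u"])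
  next
    assume "w' \<in> conn n (cls N e n z)"
    then obtain y' where w': "w' \<in> carrier (L (Suc n))" and y': "y' \<in> carrier (M n)" "\<beta> n y' \<ominus>\<^bsub>N n\<^esub> z \<in> bd N e n"
      "\<alpha> (Suc n) w' = d n y'"
      by (auto simp: conn_def \<beta>.N.mem_cls_iff[OF z])
    obtain b where b: "b \<in> bd M d n" "b \<in> carrier (M n)" "\<beta> n b = \<beta> n y' \<ominus>\<^bsub>N n\<^esub> z"
      using bd_lift[OF y'(2)] by blast
    have "\<beta> n ((y' \<ominus>\<^bsub>M n\<^esub> y) \<ominus>\<^bsub>M n\<^esub> b) = \<zero>\<^bsub>N n\<^esub>"
      using y y' b z by (simp add: \<beta>.h_minus)
    then obtain u where u: "u \<in> carrier (L n)" "\<alpha> n u = (y' \<ominus>\<^bsub>M n\<^esub> y) \<ominus>\<^bsub>M n\<^esub> b"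
      using ker y y' b by (metis \<alpha>.N.X.M.minus_closed)
    have "\<alpha> (Suc n) (c n u) = \<alpha> (Suc n) (w' \<ominus>\<^bsub>L (Suc n)\<^esub> w)"
      using u y y' b w w' by (simp add: \<alpha>.h_d \<alpha>.N.d_minus \<alpha>.h_minus \<alpha>.N.d_bd)
    then have "w' \<ominus>\<^bsub>L (Suc n)\<^esub> w = c n u" using \<alpha>_inj w w' u by (metis \<alpha>.M.X.M.minus_closed \<alpha>.M.d_closed)
    then show "w' \<in> cls L c (Suc n) w"
      using u w' by (simp add: \<alpha>.M.mem_cls_iff[OF w(1)] \<alpha>.M.d_in_bd)
  qed
  then show ?thesis by blast
qed

lemma conn_hom: "conn n \<in> mod_hom R (coho N e n) (coho L c (Suc n))"
proof (rule mod_homI)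
  fix X Y a assume X: "X \<in> carrier (coho N e n)"
  obtain z where z: "z \<in> carrier (N n)" "e n z = \<zero>\<^bsub>N (Suc n)\<^esub>" "X = cls N e n z"
    using X by (rule \<beta>.N.cohoE)
  obtain y w where y: "y \<in> carrier (M n)" "\<beta> n y = z" and w: "w \<in> carrier (L (Suc n))" "\<alpha> (Suc n) w = d n y"
    using conn_lift[OF z(1,2)] .
  have cX: "conn n X = cls L c (Suc n) w" using conn_cls[OF z(1) y w] z by simp
  have wZ: "w \<in> Lc (Suc n)" using conn_cocycle[OF y(1) w] w by (simp add: mem_a_kernel)
  have zZ: "z \<in> Nc n" using z by (simp add: mem_a_kernel)
  show "conn n X \<in> carrier (coho L c (Suc n))"
    using cX \<alpha>.M.cls_in_coho[OF w(1) conn_cocycle[OF y(1) w]] by simp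
  show "conn n (a \<odot>\<^bsub>coho N e n\<^esub> X) = a \<odot>\<^bsub>coho L c (Suc n)\<^esub> conn n X" if a: "a \<in> carrier R"
    unfolding cX unfolding z(3) \<beta>.N.smult_coho[OF a zZ] \<alpha>.M.smult_coho[OF a wZ]
    by (rule conn_cls[where y = "a \<odot>\<^bsub>M n\<^esub> y"]) (use a y w z in \<open>auto simp: \<beta>.h_smult \<alpha>.h_smult \<alpha>.N.d_smult\<close>)
  show "conn n (X \<oplus>\<^bsub>coho N e n\<^esub> Y) = conn n X \<oplus>\<^bsub>coho L c (Suc n)\<^esub> conn n Y" if Y: "Y \<in> carrier (coho N e n)"
  proof -
    obtain z' where z': "z' \<in> carrier (N n)" "e n z' = \<zero>\<^bsub>N (Suc n)\<^esub>" "Y = cls N e n z'"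
      using Y by (rule \<beta>.N.cohoE)
    obtain y' w' where y': "y' \<in> carrier (M n)" "\<beta> n y' = z'" and w': "w' \<in> carrier (L (Suc n))" "\<alpha> (Suc n) w' = d n y'"
      using conn_lift[OF z'(1,2)] .
    have cY: "conn n Y = cls L c (Suc n) w'" using conn_cls[OF z'(1) y' w'] z' by simp
    have wZ': "w' \<in> Lc (Suc n)" using conn_cocycle[OF y'(1) w'] w' by (simp add: mem_a_kernel)
    have zZ': "z' \<in> Nc n" using z' by (simp add: mem_a_kernel)
    show ?thesis
      unfolding cX cY unfolding z(3) z'(3) \<beta>.N.add_coho[OF zZ zZ'] \<alpha>.M.add_coho[OF wZ wZ']
      by (rule conn_cls[where y = "y \<oplus>\<^bsub>M n\<^esub> y'"])
        (use y y' w w' z z' in \<open>auto simp: \<beta>.h_add \<alpha>.h_add \<alpha>.N.d_add\<close>)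
  qed
qed

text \<open>The part of the long exact sequence around the connecting map. \<open>L0\<close> says
  that the cohomology of \<open>L\<close> vanishes in degree \<open>n\<close> and makes the first
  map injective; \<open>N0\<close> says the same of \<open>N\<close> in degree \<open>Suc n\<close>
  and makes the last map surjective.\<close>

lemma exact_four_coho:
  assumes L0: "\<And>x. x \<in> carrier (L n) \<Longrightarrow> c n x = \<zero>\<^bsub>L (Suc n)\<^esub> \<Longrightarrow> x \<in> bd L c n"
    and N0: "\<And>z. z \<in> carrier (N (Suc n)) \<Longrightarrow> e (Suc n) z = \<zero>\<^bsub>N (Suc (Suc n))\<^esub> \<Longrightarrow> z \<in> bd N e (Suc n)"
  shows "exact_four R (coho M d n) (coho_map N e n (\<beta> n)) (coho N e n) (conn n) (coho L c (Suc n))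
    (coho_map M d (Suc n) (\<alpha> (Suc n))) (coho M d (Suc n))"
proof -
  let ?b = "coho_map N e n (\<beta> n)" and ?a = "coho_map M d (Suc n) (\<alpha> (Suc n))"
  note homs = \<beta>.coho_map_hom[of n] conn_hom[of n] \<alpha>.coho_map_hom[of "Suc n"]
  have "inj_on ?b (carrier (coho M d n))"
  proof (rule inj_onI)
    fix X Y assume XY: "X \<in> carrier (coho M d n)" "Y \<in> carrier (coho M d n)" and eq: "?b X = ?b Y"
    obtain x where x: "x \<in> carrier (M n)" "d n x = \<zero>\<^bsub>M (Suc n)\<^esub>" "X = cls M d n x"
      using XY(1) by (rule \<alpha>.N.cohoE)
    obtain y where y: "y \<in> carrier (M n)" "d n y = \<zero>\<^bsub>M (Suc n)\<^esub>" "Y = cls M d n y"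
      using XY(2) by (rule \<alpha>.N.cohoE)
    let ?x = "x \<ominus>\<^bsub>M n\<^esub> y"
    have "\<beta> n ?x \<in> bd N e n" using eq x y by (simp add: \<beta>.coho_map_cls \<beta>.N.cls_eq_iff \<beta>.h_minus)
    then obtain b where b: "b \<in> bd M d n" "b \<in> carrier (M n)" "\<beta> n b = \<beta> n ?x" using bd_lift by metis
    have "\<beta> n (?x \<ominus>\<^bsub>M n\<^esub> b) = \<zero>\<^bsub>N n\<^esub>" using b x y by (simp add: \<beta>.h_minus)
    then obtain u where u: "u \<in> carrier (L n)" "\<alpha> n u = ?x \<ominus>\<^bsub>M n\<^esub> b"
      using ker x y b by (metis \<alpha>.N.X.M.minus_closed)
    have "\<alpha> (Suc n) (c n u) = \<zero>\<^bsub>M (Suc n)\<^esub>" using u b x y by (simp add: \<alpha>.h_d \<alpha>.N.d_minus \<alpha>.N.d_bd)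
    then have "u \<in> bd L c n" using L0 u inj by blast
    then have "?x \<ominus>\<^bsub>M n\<^esub> b \<in> bd M d n" using \<alpha>.h_bd u by metis
    moreover have "?x = (?x \<ominus>\<^bsub>M n\<^esub> b) \<oplus>\<^bsub>M n\<^esub> b" using x(1) y(1) b(2) by algebra
    ultimately have "?x \<in> bd M d n" using \<alpha>.N.bdD(4)[OF _ b(1)] by metis
    then show "X = Y" using x y by (simp add: \<alpha>.N.cls_eq_iff)
  qed
  moreover have "?b ` carrier (coho M d n) = a_kernel (coho N e n) (coho L c (Suc n)) (conn n)"
  proof (intro equalityI subsetI)
    fix Z assume "Z \<in> ?b ` carrier (coho M d n)"
    then obtain X where X: "X \<in> carrier (coho M d n)" "Z = ?b X" by blast
    obtain x where x: "x \<in> carrier (M n)" "d n x = \<zero>\<^bsub>M (Suc n)\<^esub>" "X = cls M d n x"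
      using X(1) by (rule \<alpha>.N.cohoE)
    then have x: "x \<in> carrier (M n)" "d n x = \<zero>\<^bsub>M (Suc n)\<^esub>" "Z = cls N e n (\<beta> n x)"
      using X by (simp_all add: \<beta>.coho_map_cls)
    have "conn n Z = cls L c (Suc n) \<zero>\<^bsub>L (Suc n)\<^esub>"
      unfolding x(3) by (rule conn_cls[where y = x]) (use x in auto)
    then show "Z \<in> a_kernel (coho N e n) (coho L c (Suc n)) (conn n)"
      using x by (auto simp: mem_a_kernel \<alpha>.M.zero_coho \<beta>.h_d[symmetric] intro!: \<beta>.N.cls_in_coho)
  next
    fix Z assume "Z \<in> a_kernel (coho N e n) (coho L c (Suc n)) (conn n)"
    then have Z: "Z \<in> carrier (coho N e n)" "conn n Z = \<zero>\<^bsub>coho L c (Suc n)\<^esub>" by (auto simp: mem_a_kernel)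
    obtain z where z: "z \<in> carrier (N n)" "e n z = \<zero>\<^bsub>N (Suc n)\<^esub>" "Z = cls N e n z"
      using Z(1) by (rule \<beta>.N.cohoE)
    obtain y w where y: "y \<in> carrier (M n)" "\<beta> n y = z" and w: "w \<in> carrier (L (Suc n))" "\<alpha> (Suc n) w = d n y"
      using conn_lift[OF z(1,2)] .
    have "w \<in> bd L c (Suc n)"
      using Z(2) conn_cls[OF z(1) y w] z w by (simp add: \<alpha>.M.cls_eq_zero_iff)
    then obtain u where u: "u \<in> carrier (L n)" "w = c n u" by (auto simp: bd_def)
    let ?x = "y \<ominus>\<^bsub>M n\<^esub> \<alpha> n u"
    have "d n ?x = \<zero>\<^bsub>M (Suc n)\<^esub>" using u w y by (simp add: \<alpha>.N.d_minus \<alpha>.h_d[symmetric])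
    moreover have "\<beta> n ?x = z" using y u z by (simp add: \<beta>.h_minus \<beta>\<alpha>)
    ultimately show "Z \<in> ?b ` carrier (coho M d n)"
      using y u z by (intro image_eqI[of _ _ "cls M d n ?x"]) (auto simp: \<beta>.coho_map_cls intro: \<alpha>.N.cls_in_coho)
  qed
  moreover have "conn n ` carrier (coho N e n) = a_kernel (coho L c (Suc n)) (coho M d (Suc n)) ?a"
  proof (intro equalityI subsetI)
    fix W assume "W \<in> conn n ` carrier (coho N e n)"
    then obtain Z where Z: "Z \<in> carrier (coho N e n)" "W = conn n Z" by blast
    obtain z where z: "z \<in> carrier (N n)" "e n z = \<zero>\<^bsub>N (Suc n)\<^esub>" "Z = cls N e n z"
      using Z(1) by (rule \<beta>.N.cohoE)
    obtain y w where y: "y \<in> carrier (M n)" "\<beta> n y = z" and w: "w \<in> carrier (L (Suc n))" "\<alpha> (Suc n) w = d n y"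
      using conn_lift[OF z(1,2)] .
    have W: "W = cls L c (Suc n) w" using conn_cls[OF z(1) y w] z Z by simp
    then have "?a W = \<zero>\<^bsub>coho M d (Suc n)\<^esub>"
      using w y by (simp add: \<alpha>.coho_map_cls \<alpha>.N.cls_eq_zero_iff \<alpha>.N.d_in_bd)
    then show "W \<in> a_kernel (coho L c (Suc n)) (coho M d (Suc n)) ?a"
      using W w conn_cocycle[OF y(1) w] by (auto simp: mem_a_kernel intro: \<alpha>.M.cls_in_coho)
  next
    fix W assume "W \<in> a_kernel (coho L c (Suc n)) (coho M d (Suc n)) ?a"
    then have W: "W \<in> carrier (coho L c (Suc n))" "?a W = \<zero>\<^bsub>coho M d (Suc n)\<^esub>" by (auto simp: mem_a_kernel)
    obtain w where w: "w \<in> carrier (L (Suc n))" "c (Suc n) w = \<zero>\<^bsub>L (Suc (Suc n))\<^esub>" "W = cls L c (Suc n) w"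
      using W(1) by (rule \<alpha>.M.cohoE)
    have "\<alpha> (Suc n) w \<in> bd M d (Suc n)" using W w by (simp add: \<alpha>.coho_map_cls \<alpha>.N.cls_eq_zero_iff)
    then obtain y where y: "y \<in> carrier (M n)" "\<alpha> (Suc n) w = d n y" by (auto simp: bd_def)
    have "e n (\<beta> n y) = \<zero>\<^bsub>N (Suc n)\<^esub>" using y w by (simp add: \<beta>.h_d[symmetric] \<beta>\<alpha> flip: y(2))
    then show "W \<in> conn n ` carrier (coho N e n)"
      using y w conn_cls[of "\<beta> n y" n y w]
      by (intro image_eqI[of _ _ "cls N e n (\<beta> n y)"]) (auto intro: \<beta>.N.cls_in_coho)
  qed
  moreover have "X \<in> ?a ` carrier (coho L c (Suc n))" if X: "X \<in> carrier (coho M d (Suc n))" for X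
  proof -
    obtain x where x: "x \<in> carrier (M (Suc n))" "d (Suc n) x = \<zero>\<^bsub>M (Suc (Suc n))\<^esub>" "X = cls M d (Suc n) x"
      using X by (rule \<alpha>.N.cohoE)
    have "\<beta> (Suc n) x \<in> bd N e (Suc n)" using N0[of "\<beta> (Suc n) x"] x by (simp add: \<beta>.h_d[symmetric])
    then obtain b where b: "b \<in> bd M d (Suc n)" "b \<in> carrier (M (Suc n))" "\<beta> (Suc n) b = \<beta> (Suc n) x"
      using bd_lift by metis
    have "\<beta> (Suc n) (x \<ominus>\<^bsub>M (Suc n)\<^esub> b) = \<zero>\<^bsub>N (Suc n)\<^esub>" using b x by (simp add: \<beta>.h_minus)
    then obtain w where w: "w \<in> carrier (L (Suc n))" "\<alpha> (Suc n) w = x \<ominus>\<^bsub>M (Suc n)\<^esub> b"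
      using ker x b by (metis \<alpha>.N.X.M.minus_closed)
    have "\<alpha> (Suc (Suc n)) (c (Suc n) w) = \<zero>\<^bsub>M (Suc (Suc n))\<^esub>"
      using w b x by (simp add: \<alpha>.h_d \<alpha>.N.d_minus \<alpha>.N.d_bd)
    then have "c (Suc n) w = \<zero>\<^bsub>L (Suc (Suc n))\<^esub>" using inj w by blast
    moreover have "x \<ominus>\<^bsub>M (Suc n)\<^esub> (x \<ominus>\<^bsub>M (Suc n)\<^esub> b) = b" using x(1) b(2) by algebra
    then have "cls M d (Suc n) x = cls M d (Suc n) (\<alpha> (Suc n) w)" using w x b by (simp add: \<alpha>.N.cls_eq_iff)
    ultimately show ?thesis using x w
      by (intro image_eqI[of _ _ "cls L c (Suc n) w"]) (auto simp: \<alpha>.coho_map_cls intro: \<alpha>.M.cls_in_coho)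
  qed
  moreover have "?a ` carrier (coho L c (Suc n)) \<subseteq> carrier (coho M d (Suc n))"
    using mod_hom_closed[OF homs(3)] by blast
  ultimately show ?thesis
    unfolding exact_four_def using homs by auto
qed

end

section \<open>Rules for functors and natural transformations\<close>

lemma
  assumes "presheaf_on R Q X"
  shows presheaf_module: "\<And>p. p \<in> Q \<Longrightarrow> module R (ob X p)"
    and presheaf_ar: "\<And>p q. p \<in> Q \<Longrightarrow> q \<in> Q \<Longrightarrow> q \<le> p \<Longrightarrow> ar X p q \<in> mod_hom R (ob X p) (ob X q)"
    and presheaf_id: "\<And>p x. p \<in> Q \<Longrightarrow> x \<in> carrier (ob X p) \<Longrightarrow> ar X p p x = x"
    and presheaf_comp: "\<And>p q r x. p \<in> Q \<Longrightarrow> q \<in> Q \<Longrightarrow> r \<in> Q \<Longrightarrow> r \<le> q \<Longrightarrow> q \<le> p \<Longrightarrow>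
      x \<in> carrier (ob X p) \<Longrightarrow> ar X q r (ar X p q x) = ar X p r x"
  using assms by (auto simp: presheaf_on_def module_def)

lemmas presheaf_ar_closed = mod_hom_closed[OF presheaf_ar]

lemma presheaf_ar_zero:
  assumes "presheaf_on R Q X" "p \<in> Q" "q \<in> Q" "q \<le> p"
  shows "ar X p q \<zero>\<^bsub>ob X p\<^esub> = \<zero>\<^bsub>ob X q\<^esub>"
  using mod_hom_zero[OF _ _ presheaf_ar[OF assms]] presheaf_module[OF assms(1)] assms(2,3) by blast

lemma presheaf_on_subset: "presheaf_on R Q X \<Longrightarrow> U \<subseteq> Q \<Longrightarrow> presheaf_on R U X"
  unfolding presheaf_on_def by (meson subsetD)

lemma nat_trans_subset: "nat_trans R Q X Y t \<Longrightarrow> U \<subseteq> Q \<Longrightarrow> nat_trans R U X Y t"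
  unfolding nat_trans_def by (meson subsetD)

lemma
  assumes "nat_trans R Q X Y t"
  shows nat_trans_hom: "\<And>p. p \<in> Q \<Longrightarrow> t p \<in> mod_hom R (ob X p) (ob Y p)"
    and nat_trans_ar: "\<And>p q x. p \<in> Q \<Longrightarrow> q \<in> Q \<Longrightarrow> q \<le> p \<Longrightarrow> x \<in> carrier (ob X p) \<Longrightarrow>
      t q (ar X p q x) = ar Y p q (t p x)"
  using assms by (auto simp: nat_trans_def)

lemmas nat_trans_closed = mod_hom_closed[OF nat_trans_hom]

lemma nat_trans_comp:
  assumes "presheaf_on R Q X" "nat_trans R Q X Y s" "nat_trans R Q Y W t"
  shows "nat_trans R Q X W (\<lambda>p x. t p (s p x))"
  unfolding nat_trans_def
  using mod_hom_comp[OF nat_trans_hom[OF assms(2)] nat_trans_hom[OF assms(3)]]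
  by (auto simp: nat_trans_ar[OF assms(2)] nat_trans_ar[OF assms(3)] nat_trans_closed[OF assms(2)])

subsection \<open>Sections\<close>

lemma mem_lim:
  "s \<in> carrier (lim_module Q X) \<longleftrightarrow> s \<in> extensional Q \<and> (\<forall>q\<in>Q. s q \<in> carrier (ob X q)) \<and>
     (\<forall>p\<in>Q. \<forall>q\<in>Q. q \<le> p \<longrightarrow> ar X p q (s p) = s q)"
  by (auto simp: lim_module_def PiE_iff)

lemma
  shows lim_closed: "s \<in> carrier (lim_module Q X) \<Longrightarrow> q \<in> Q \<Longrightarrow> s q \<in> carrier (ob X q)"
    and lim_ar: "s \<in> carrier (lim_module Q X) \<Longrightarrow> p \<in> Q \<Longrightarrow> q \<in> Q \<Longrightarrow> q \<le> p \<Longrightarrow> ar X p q (s p) = s q"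
  by (auto simp: mem_lim)

lemma lim_eqI:
  "s \<in> carrier (lim_module Q X) \<Longrightarrow> t \<in> carrier (lim_module Q X) \<Longrightarrow> (\<And>q. q \<in> Q \<Longrightarrow> s q = t q) \<Longrightarrow> s = t"
  by (auto simp: mem_lim intro: extensionalityI)

lemma
  assumes "q \<in> Q"
  shows lim_add: "(s \<oplus>\<^bsub>lim_module Q X\<^esub> t) q = s q \<oplus>\<^bsub>ob X q\<^esub> t q"
    and lim_zero: "\<zero>\<^bsub>lim_module Q X\<^esub> q = \<zero>\<^bsub>ob X q\<^esub>"
    and lim_smult: "(a \<odot>\<^bsub>lim_module Q X\<^esub> s) q = a \<odot>\<^bsub>ob X q\<^esub> s q"
  using assms by (auto simp: lim_module_def)

lemma
  shows lim_add_extensional: "s \<oplus>\<^bsub>lim_module Q X\<^esub> t \<in> extensional Q"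
    and lim_zero_extensional: "\<zero>\<^bsub>lim_module Q X\<^esub> \<in> extensional Q"
    and lim_smult_extensional: "a \<odot>\<^bsub>lim_module Q X\<^esub> s \<in> extensional Q"
  by (auto simp: lim_module_def)

lemma module_lim:
  assumes "cring R" and X: "presheaf_on R Q X"
  shows "module R (lim_module Q X)"
proof -
  note mo = presheaf_module[OF X] and ar = presheaf_ar[OF X]
  have ag: "abelian_group (ob X q)" if "q \<in> Q" for q using mo[OF that] by (simp add: module_def)
  have add: "s \<oplus>\<^bsub>lim_module Q X\<^esub> t \<in> carrier (lim_module Q X)"
    if "s \<in> carrier (lim_module Q X)" "t \<in> carrier (lim_module Q X)" for s t
    using that mod_hom_add[OF ar] abelian_groupE(1)[OF ag] by (auto simp: mem_lim lim_add lim_add_extensional)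
  have smult: "a \<odot>\<^bsub>lim_module Q X\<^esub> t \<in> carrier (lim_module Q X)"
    if "a \<in> carrier R" "t \<in> carrier (lim_module Q X)" for a t
    using that mod_hom_smult[OF ar] module.smult_closed[OF mo] by (auto simp: mem_lim lim_smult lim_smult_extensional)
  have zero: "\<zero>\<^bsub>lim_module Q X\<^esub> \<in> carrier (lim_module Q X)"
    using presheaf_ar_zero[OF X] abelian_groupE(2)[OF ag] by (auto simp: mem_lim lim_zero lim_zero_extensional)
  show ?thesis
  proof (rule moduleI)
    show "abelian_group (lim_module Q X)"
    proof (rule abelian_groupI)
      fix s assume s: "s \<in> carrier (lim_module Q X)"
      let ?t = "\<lambda>q\<in>Q. \<ominus>\<^bsub>ob X q\<^esub> s q"
      have t: "?t \<in> carrier (lim_module Q X)"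
        using s mod_hom_neg[OF mo mo ar] abelian_group.a_inv_closed[OF ag] by (auto simp: mem_lim)
      moreover have "?t \<oplus>\<^bsub>lim_module Q X\<^esub> s = \<zero>\<^bsub>lim_module Q X\<^esub>"
        by (rule lim_eqI[OF add[OF t s] zero])
          (use s in \<open>simp add: lim_add lim_zero lim_closed abelian_group.l_neg[OF ag]\<close>)
      ultimately show "\<exists>t\<in>carrier (lim_module Q X). t \<oplus>\<^bsub>lim_module Q X\<^esub> s = \<zero>\<^bsub>lim_module Q X\<^esub>" by blast
      show "\<zero>\<^bsub>lim_module Q X\<^esub> \<oplus>\<^bsub>lim_module Q X\<^esub> s = s"
        by (rule lim_eqI[OF add[OF zero s] s]) (use s in \<open>simp add: lim_add lim_zero lim_closed abelian_groupE(5)[OF ag]\<close>)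
      fix t assume t: "t \<in> carrier (lim_module Q X)"
      show "s \<oplus>\<^bsub>lim_module Q X\<^esub> t = t \<oplus>\<^bsub>lim_module Q X\<^esub> s"
        by (rule lim_eqI[OF add[OF s t] add[OF t s]]) (use s t in \<open>simp add: lim_add lim_closed abelian_groupE(4)[OF ag]\<close>)
      fix u assume u: "u \<in> carrier (lim_module Q X)"
      show "s \<oplus>\<^bsub>lim_module Q X\<^esub> t \<oplus>\<^bsub>lim_module Q X\<^esub> u = s \<oplus>\<^bsub>lim_module Q X\<^esub> (t \<oplus>\<^bsub>lim_module Q X\<^esub> u)"
        by (rule lim_eqI[OF add[OF add[OF s t] u] add[OF s add[OF t u]]])
          (use s t u in \<open>simp add: lim_add lim_closed abelian_groupE(3)[OF ag]\<close>)
    qed (use add zero in auto)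
    fix a b s t
    assume a: "a \<in> carrier R" and s: "s \<in> carrier (lim_module Q X)"
    show "a \<odot>\<^bsub>lim_module Q X\<^esub> (s \<oplus>\<^bsub>lim_module Q X\<^esub> t) = a \<odot>\<^bsub>lim_module Q X\<^esub> s \<oplus>\<^bsub>lim_module Q X\<^esub> a \<odot>\<^bsub>lim_module Q X\<^esub> t"
      if t: "t \<in> carrier (lim_module Q X)"
      by (rule lim_eqI[OF smult[OF a add[OF s t]] add[OF smult[OF a s] smult[OF a t]]])
        (use a s t in \<open>simp add: lim_add lim_smult lim_closed module.smult_r_distr[OF mo]\<close>)
    assume b: "b \<in> carrier R"
    have ab: "a \<oplus>\<^bsub>R\<^esub> b \<in> carrier R" "a \<otimes>\<^bsub>R\<^esub> b \<in> carrier R"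
      using a b \<open>cring R\<close> by (auto simp: cring_def intro: ring.ring_simprules)
    show "(a \<oplus>\<^bsub>R\<^esub> b) \<odot>\<^bsub>lim_module Q X\<^esub> s = a \<odot>\<^bsub>lim_module Q X\<^esub> s \<oplus>\<^bsub>lim_module Q X\<^esub> b \<odot>\<^bsub>lim_module Q X\<^esub> s"
      by (rule lim_eqI[OF smult[OF ab(1) s] add[OF smult[OF a s] smult[OF b s]]])
        (use a b s in \<open>simp add: lim_add lim_smult lim_closed module.smult_l_distr[OF mo]\<close>)
    show "(a \<otimes>\<^bsub>R\<^esub> b) \<odot>\<^bsub>lim_module Q X\<^esub> s = a \<odot>\<^bsub>lim_module Q X\<^esub> (b \<odot>\<^bsub>lim_module Q X\<^esub> s)"
      by (rule lim_eqI[OF smult[OF ab(2) s] smult[OF a smult[OF b s]]])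
        (use a b s in \<open>simp add: lim_smult lim_closed module.smult_assoc1[OF mo]\<close>)
  next
    fix s assume s: "s \<in> carrier (lim_module Q X)"
    have one: "\<one>\<^bsub>R\<^esub> \<in> carrier R"
      using \<open>cring R\<close> by (auto simp: cring_def intro: ring.ring_simprules)
    show "\<one>\<^bsub>R\<^esub> \<odot>\<^bsub>lim_module Q X\<^esub> s = s"
      by (rule lim_eqI[OF smult[OF one s] s]) (use s in \<open>simp add: lim_smult lim_closed module.smult_one[OF mo]\<close>)
  qed (use assms(1) smult in auto)
qed

lemma lim_minus:
  assumes "cring R" "presheaf_on R Q X" "s \<in> carrier (lim_module Q X)" "t \<in> carrier (lim_module Q X)" "q \<in> Q"
  shows "(s \<ominus>\<^bsub>lim_module Q X\<^esub> t) q = s q \<ominus>\<^bsub>ob X q\<^esub> t q"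
proof (rule mod_hom_minus[where R = R and h = "\<lambda>s. s q"])
  show "(\<lambda>s. s q) \<in> mod_hom R (lim_module Q X) (ob X q)"
    using assms(5) by (intro mod_homI) (auto simp: lim_add lim_smult lim_closed)
qed (use assms module_lim presheaf_module in blast)+

text \<open>\<open>lim_map U\<close> reads a section at points of \<open>U\<close> only. It
  therefore performs restriction from \<open>Q\<close> to \<open>U\<close> and the application of
  \<open>t\<close> in one go, as \<open>derived_map\<close> requires.\<close>

lemma lim_map_hom:
  assumes X: "presheaf_on R Q X" and t: "nat_trans R U X Y t" and "U \<subseteq> Q"
  shows "lim_map U t \<in> mod_hom R (lim_module Q X) (lim_module U Y)"
proof (rule mod_homI)
  have UQ: "u \<in> Q" if "u \<in> U" for u using that assms(3) by blast
  show "lim_map U t s \<in> carrier (lim_module U Y)" if "s \<in> carrier (lim_module Q X)" for s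
    using that UQ nat_trans_closed[OF t] nat_trans_ar[OF t, symmetric] by (auto simp: lim_map_def mem_lim)
  show "lim_map U t (s \<oplus>\<^bsub>lim_module Q X\<^esub> s') = lim_map U t s \<oplus>\<^bsub>lim_module U Y\<^esub> lim_map U t s'"
    if "s \<in> carrier (lim_module Q X)" "s' \<in> carrier (lim_module Q X)" for s s'
    using that UQ mod_hom_add[OF nat_trans_hom[OF t]]
    by (auto simp: lim_map_def lim_add lim_closed lim_module_def[of U] intro!: restrict_ext)
  show "lim_map U t (a \<odot>\<^bsub>lim_module Q X\<^esub> s) = a \<odot>\<^bsub>lim_module U Y\<^esub> lim_map U t s"
    if "a \<in> carrier R" "s \<in> carrier (lim_module Q X)" for s a
    using that UQ mod_hom_smult[OF nat_trans_hom[OF t]]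
    by (auto simp: lim_map_def lim_smult lim_closed lim_module_def[of U] intro!: restrict_ext)
qed

subsection \<open>Consequences of injectivity\<close>

text \<open>The test functors for injectivity take values in \<open>'r + 'i\<close>. A module with
  another carrier type is moved there along an injection \<open>i\<close> with left inverse
  \<open>j\<close>.\<close>

definition transport_module :: "('a \<Rightarrow> 'b) \<Rightarrow> ('b \<Rightarrow> 'a) \<Rightarrow> ('r, 'a) module \<Rightarrow> ('r, 'b) module" where
  "transport_module i j M =
     \<lparr>carrier = i ` carrier M, mult = undefined, one = undefined, zero = i \<zero>\<^bsub>M\<^esub>,
      add = (\<lambda>x y. i (j x \<oplus>\<^bsub>M\<^esub> j y)), smult = (\<lambda>a x. i (a \<odot>\<^bsub>M\<^esub> j x))\<rparr>"

lemma module_transport: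
  assumes "module R M" and ji: "\<And>x. j (i x) = x"
  shows "module R (transport_module i j M)"
proof -
  interpret module R M by fact
  show ?thesis
  proof (rule moduleI)
    show "abelian_group (transport_module i j M)"
    proof (rule abelian_groupI)
      fix x assume "x \<in> carrier (transport_module i j M)"
      then show "\<exists>y\<in>carrier (transport_module i j M).
          y \<oplus>\<^bsub>transport_module i j M\<^esub> x = \<zero>\<^bsub>transport_module i j M\<^esub>"
        by (auto simp: transport_module_def ji M.l_neg intro!: exI[of _ "\<ominus>\<^bsub>M\<^esub> j x"] bexI[of _ "\<ominus>\<^bsub>M\<^esub> j x"])
    qed (auto simp: transport_module_def ji M.a_ac)
  qed (use is_cring in \<open>auto simp: transport_module_def ji smult_l_distr smult_r_distr smult_assoc1\<close>)
qed

definition transport_presheaf :: "('a \<Rightarrow> 'b) \<Rightarrow> ('b \<Rightarrow> 'a) \<Rightarrow> ('p, 'r, 'a) presheaf \<Rightarrow> ('p, 'r, 'b) presheaf" where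
  "transport_presheaf i j X =
     \<lparr>ob = (\<lambda>p. transport_module i j (ob X p)), ar = (\<lambda>p q x. i (ar X p q (j x)))\<rparr>"

lemma presheaf_transport:
  assumes X: "presheaf_on R Q X" and ji: "\<And>x. j (i x) = x"
  shows "presheaf_on R Q (transport_presheaf i j X)"
  unfolding presheaf_on_def
proof (intro conjI ballI impI)
  fix p q assume "p \<in> Q" "q \<in> Q" "q \<le> p"
  then have h: "ar X p q \<in> mod_hom R (ob X p) (ob X q)" by (rule presheaf_ar[OF X])
  show "ar (transport_presheaf i j X) p q \<in> mod_hom R (ob (transport_presheaf i j X) p) (ob (transport_presheaf i j X) q)"
    by (rule mod_homI)
      (auto simp: transport_presheaf_def transport_module_def ji mod_hom_closed[OF h] mod_hom_add[OF h] mod_hom_smult[OF h])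
next
  show "module R (ob (transport_presheaf i j X) p)" if "p \<in> Q" for p
    using module_transport[of R "ob X p" j i] presheaf_module[OF X that] ji by (simp add: transport_presheaf_def)
qed (auto simp: transport_presheaf_def transport_module_def ji presheaf_id[OF X] presheaf_comp[OF X])

definition restr_presheaf :: "('p, 'r, 'a) presheaf \<Rightarrow> ('p \<Rightarrow> 'a set) \<Rightarrow> ('p, 'r, 'a) presheaf" where
  "restr_presheaf X N = \<lparr>ob = (\<lambda>p. (ob X p)\<lparr>carrier := N p\<rparr>), ar = ar X\<rparr>"

lemma presheaf_restr:
  assumes X: "presheaf_on R Q X" and N: "\<And>p. p \<in> Q \<Longrightarrow> submodule (N p) R (ob X p)"
    and cl: "\<And>p q x. p \<in> Q \<Longrightarrow> q \<in> Q \<Longrightarrow> q \<le> p \<Longrightarrow> x \<in> N p \<Longrightarrow> ar X p q x \<in> N q"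
  shows "presheaf_on R Q (restr_presheaf X N)"
proof -
  have sub: "x \<in> carrier (ob X p)" if "p \<in> Q" "x \<in> N p" for p x
    using module.submoduleD(1)[OF presheaf_module[OF X] N] that by blast
  show ?thesis
    unfolding presheaf_on_def
  proof (intro conjI ballI impI)
    show "module R (ob (restr_presheaf X N) p)" if "p \<in> Q" for p
      using submodule.submodule_is_module[OF N[OF that] presheaf_module[OF X that]] by (simp add: restr_presheaf_def)
    fix p q assume pq: "p \<in> Q" "q \<in> Q" "q \<le> p"
    then have h: "ar X p q \<in> mod_hom R (ob X p) (ob X q)" by (rule presheaf_ar[OF X])
    show "ar (restr_presheaf X N) p q \<in> mod_hom R (ob (restr_presheaf X N) p) (ob (restr_presheaf X N) q)"
      by (rule mod_homI) (use pq sub cl in \<open>auto simp: restr_presheaf_def mod_hom_add[OF h] mod_hom_smult[OF h]\<close>)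
  qed (use sub in \<open>auto simp: restr_presheaf_def presheaf_id[OF X] presheaf_comp[OF X]\<close>)
qed

text \<open>The lifting property for the inclusion of the subfunctor \<open>N\<close> of
  \<open>Y\<close>: both are moved to the test type along \<open>i\<close>, extended there, and the
  extension is pulled back along \<open>i\<close>.\<close>

lemma injective_extend_restr:
  fixes J :: "('p::order, 'r, 'i) presheaf" and Y :: "('p, 'r, 'y) presheaf" and i :: "'y \<Rightarrow> 'r + 'i"
  assumes J: "injective_presheaf R Q J" and Y: "presheaf_on R Q Y" and YN: "presheaf_on R Q (restr_presheaf Y N)"
    and N: "\<And>p. p \<in> Q \<Longrightarrow> N p \<subseteq> carrier (ob Y p)"
    and f: "nat_trans R Q (restr_presheaf Y N) J f" and ji: "\<And>x. j (i x) = x"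
  shows "\<exists>g. nat_trans R Q Y J g \<and> (\<forall>p\<in>Q. \<forall>x\<in>N p. g p x = f p x)"
proof -
  let ?X = "transport_presheaf i j (restr_presheaf Y N)" and ?Y = "transport_presheaf i j Y"
  have NY: "x \<in> carrier (ob Y p)" if "p \<in> Q" "x \<in> N p" for p x using N that by blast
  have m: "nat_trans R Q ?X ?Y (\<lambda>p x. x)"
    unfolding nat_trans_def
    by (auto simp: transport_presheaf_def transport_module_def restr_presheaf_def ji NY intro!: mod_homI)
  have f': "nat_trans R Q ?X J (\<lambda>p x. f p (j x))"
    unfolding nat_trans_def
  proof (intro conjI ballI impI)
    fix p assume "p \<in> Q"
    then have h: "f p \<in> mod_hom R (ob (restr_presheaf Y N) p) (ob J p)" by (rule nat_trans_hom[OF f])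
    show "(\<lambda>x. f p (j x)) \<in> mod_hom R (ob ?X p) (ob J p)"
      using mod_hom_closed[OF h] mod_hom_add[OF h] mod_hom_smult[OF h]
      by (intro mod_homI) (auto simp: transport_presheaf_def transport_module_def restr_presheaf_def ji)
  qed (use nat_trans_ar[OF f] in \<open>auto simp: transport_presheaf_def transport_module_def restr_presheaf_def ji\<close>)
  have X': "presheaf_on R Q ?X" and Y': "presheaf_on R Q ?Y"
    using presheaf_transport[where i = i and j = j] Y YN ji by blast+
  have "\<exists>g. nat_trans R Q ?Y J g \<and> (\<forall>p\<in>Q. \<forall>x\<in>carrier (ob ?X p). g p x = f p (j x))"
    by (rule conjunct2[OF J[unfolded injective_presheaf_def], rule_format, of ?X ?Y "\<lambda>p x. x" "\<lambda>p x. f p (j x)"])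
      (use m f' X' Y' in \<open>auto simp: inj_on_def\<close>)
  then obtain g where g: "nat_trans R Q ?Y J g" "\<forall>p\<in>Q. \<forall>x\<in>carrier (ob ?X p). g p x = f p (j x)"
    by blast
  have "nat_trans R Q Y J (\<lambda>p x. g p (i x))"
    unfolding nat_trans_def
  proof (intro conjI ballI impI)
    fix p assume "p \<in> Q"
    then have h: "g p \<in> mod_hom R (ob ?Y p) (ob J p)" by (rule nat_trans_hom[OF g(1)])
    show "(\<lambda>x. g p (i x)) \<in> mod_hom R (ob Y p) (ob J p)"
    proof (rule mod_homI)
      fix x y a assume x: "x \<in> carrier (ob Y p)"
      show "g p (i x) \<in> carrier (ob J p)"
        using mod_hom_closed[OF h, of "i x"] x by (simp add: transport_presheaf_def transport_module_def)
      show "g p (i (x \<oplus>\<^bsub>ob Y p\<^esub> y)) = g p (i x) \<oplus>\<^bsub>ob J p\<^esub> g p (i y)" if "y \<in> carrier (ob Y p)"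
        using mod_hom_add[OF h, of "i x" "i y"] x that by (simp add: transport_presheaf_def transport_module_def ji)
      show "g p (i (a \<odot>\<^bsub>ob Y p\<^esub> x)) = a \<odot>\<^bsub>ob J p\<^esub> g p (i x)" if "a \<in> carrier R"
        using mod_hom_smult[OF h, of a "i x"] x that by (simp add: transport_presheaf_def transport_module_def ji)
    qed
  next
    fix p q x assume "p \<in> Q" "q \<in> Q" "q \<le> p" "x \<in> carrier (ob Y p)"
    then show "g q (i (ar Y p q x)) = ar J p q (g p (i x))"
      using nat_trans_ar[OF g(1), of p q "i x"] by (simp add: transport_presheaf_def transport_module_def ji)
  qed
  moreover have "g p (i x) = f p x" if "p \<in> Q" "x \<in> N p" for p x
    using g(2) that by (simp add: transport_presheaf_def transport_module_def restr_presheaf_def ji)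
  ultimately show ?thesis by blast
qed

lemma submodule_image:
  assumes "module R M" "module R N" and h: "h \<in> mod_hom R M N"
  shows "submodule (h ` carrier M) R N"
proof -
  interpret M: module R M by fact
  interpret N: module R N by fact
  show ?thesis
  proof (rule N.submoduleI)
    have "h \<zero>\<^bsub>M\<^esub> \<in> h ` carrier M" by blast
    then show "\<zero>\<^bsub>N\<^esub> \<in> h ` carrier M" by (simp add: mod_hom_zero[OF assms])
  next
    fix a assume "a \<in> h ` carrier M"
    then obtain x where x: "x \<in> carrier M" "a = h x" by blast
    have "h (\<ominus>\<^bsub>M\<^esub> x) \<in> h ` carrier M" using x by blast
    then show "\<ominus>\<^bsub>N\<^esub> a \<in> h ` carrier M" using x by (simp add: mod_hom_neg[OF assms])
    have "h (x \<oplus>\<^bsub>M\<^esub> y) \<in> h ` carrier M" if "y \<in> carrier M" for y using x that by blast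
    then show "a \<oplus>\<^bsub>N\<^esub> b \<in> h ` carrier M" if "b \<in> h ` carrier M" for b
      using x that by (auto simp: mod_hom_add[OF h])
    have "h (r \<odot>\<^bsub>M\<^esub> x) \<in> h ` carrier M" if "r \<in> carrier R" for r using x that by blast
    then show "r \<odot>\<^bsub>N\<^esub> a \<in> h ` carrier M" if "r \<in> carrier R" for r
      using x that by (simp add: mod_hom_smult[OF h])
  qed (use mod_hom_closed[OF h] in auto)
qed

lemma mod_hom_inj_iff:
  assumes "module R M" "module R N" "h \<in> mod_hom R M N"
  shows "inj_on h (carrier M) \<longleftrightarrow> (\<forall>x\<in>carrier M. h x = \<zero>\<^bsub>N\<^esub> \<longrightarrow> x = \<zero>\<^bsub>M\<^esub>)"
proof -
  interpret M: module R M by fact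
  interpret N: module R N by fact
  show ?thesis
  proof
    assume "inj_on h (carrier M)"
    then show "\<forall>x\<in>carrier M. h x = \<zero>\<^bsub>N\<^esub> \<longrightarrow> x = \<zero>\<^bsub>M\<^esub>"
      using mod_hom_zero[OF assms] by (metis M.M.zero_closed inj_onD)
  next
    assume k: "\<forall>x\<in>carrier M. h x = \<zero>\<^bsub>N\<^esub> \<longrightarrow> x = \<zero>\<^bsub>M\<^esub>"
    show "inj_on h (carrier M)"
    proof (rule inj_onI)
      fix x y assume xy: "x \<in> carrier M" "y \<in> carrier M" "h x = h y"
      then have "x \<ominus>\<^bsub>M\<^esub> y = \<zero>\<^bsub>M\<^esub>"
        using k mod_hom_minus[OF assms xy(1,2)] mod_hom_closed[OF assms(3)] by simp
      moreover have "x = (x \<ominus>\<^bsub>M\<^esub> y) \<oplus>\<^bsub>M\<^esub> y" using xy(1,2) by algebra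
      ultimately show "x = y" using xy by simp
    qed
  qed
qed

text \<open>Values of \<open>Y\<close> and \<open>J\<close> lie in the same type, so that the image of \<open>W\<close> in \<open>Y\<close> is a legitimate
  test object for the injectivity of \<open>J\<close>, while \<open>W\<close> itself need not be one.\<close>

lemma injective_extend:
  fixes J Y :: "('p::order, 'r, 'i) presheaf" and W :: "('p, 'r, 'w) presheaf"
  assumes J: "injective_presheaf R Q J" and Y: "presheaf_on R Q Y" and W: "presheaf_on R Q W"
    and w: "nat_trans R Q W Y w" and f: "nat_trans R Q W J f"
    and ker: "\<And>p x. p \<in> Q \<Longrightarrow> x \<in> carrier (ob W p) \<Longrightarrow> w p x = \<zero>\<^bsub>ob Y p\<^esub> \<Longrightarrow> f p x = \<zero>\<^bsub>ob J p\<^esub>"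
  shows "\<exists>g. nat_trans R Q Y J g \<and> (\<forall>p\<in>Q. \<forall>x\<in>carrier (ob W p). g p (w p x) = f p x)"
proof -
  have J': "presheaf_on R Q J" using J by (simp add: injective_presheaf_def)
  note mW = presheaf_module[OF W] and mY = presheaf_module[OF Y] and mJ = presheaf_module[OF J']
  let ?N = "\<lambda>p. w p ` carrier (ob W p)"
  \<comment> \<open>Chosen preimages under \<open>w\<close>. As \<open>f\<close> kills the kernel of
    \<open>w\<close>, its value at a preimage does not depend on the choice, and \<open>f\<close>
    descends to the image of \<open>w\<close>, a subfunctor of \<open>Y\<close>.\<close>
  let ?c = "\<lambda>p y. SOME x. x \<in> carrier (ob W p) \<and> w p x = y"
  have c: "f p (?c p (w p x)) = f p x" if p: "p \<in> Q" and x: "x \<in> carrier (ob W p)" for p x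
  proof -
    let ?y = "?c p (w p x)"
    have y: "?y \<in> carrier (ob W p) \<and> w p ?y = w p x" by (rule someI[of _ x]) (use x in simp)
    interpret W: module R "ob W p" using mW p .
    interpret Y: module R "ob Y p" using mY p .
    interpret J: module R "ob J p" using mJ p .
    have "w p (?y \<ominus>\<^bsub>ob W p\<^esub> x) = \<zero>\<^bsub>ob Y p\<^esub>"
      using mod_hom_minus[OF mW mY nat_trans_hom[OF w]] p x y nat_trans_closed[OF w p x] by simp
    then have "f p (?y \<ominus>\<^bsub>ob W p\<^esub> x) = \<zero>\<^bsub>ob J p\<^esub>" using ker p x y by simp
    then have "f p ?y \<ominus>\<^bsub>ob J p\<^esub> f p x = \<zero>\<^bsub>ob J p\<^esub>"
      using mod_hom_minus[OF mW mJ nat_trans_hom[OF f]] p x y by simp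
    then show ?thesis using nat_trans_closed[OF f p x] nat_trans_closed[OF f p, of ?y] y
      by (simp add: J.M.minus_eq_zero_iff)
  qed
  have sub: "submodule (?N p) R (ob Y p)" if "p \<in> Q" for p
    using submodule_image[OF mW mY nat_trans_hom[OF w]] that by simp
  have N: "?N p \<subseteq> carrier (ob Y p)" if "p \<in> Q" for p using nat_trans_closed[OF w that] by blast
  have YN: "presheaf_on R Q (restr_presheaf Y ?N)"
    by (rule presheaf_restr[OF Y sub])
      (use nat_trans_ar[OF w, symmetric] presheaf_ar_closed[OF W] in auto)
  have "nat_trans R Q (restr_presheaf Y ?N) J (\<lambda>p y. f p (?c p y))"
    unfolding nat_trans_def
  proof (intro conjI ballI impI)
    fix p assume p: "p \<in> Q"
    note hw = nat_trans_hom[OF w p] and hf = nat_trans_hom[OF f p]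
    interpret W: module R "ob W p" using mW p .
    show "(\<lambda>y. f p (?c p y)) \<in> mod_hom R (ob (restr_presheaf Y ?N) p) (ob J p)"
    proof (rule mod_homI)
      fix x y a assume x: "x \<in> carrier (ob (restr_presheaf Y ?N) p)"
      then obtain x' where x': "x' \<in> carrier (ob W p)" "x = w p x'" by (auto simp: restr_presheaf_def)
      show "f p (?c p x) \<in> carrier (ob J p)" using x' c p mod_hom_closed[OF hf] by simp
      show "f p (?c p (a \<odot>\<^bsub>ob (restr_presheaf Y ?N) p\<^esub> x)) = a \<odot>\<^bsub>ob J p\<^esub> f p (?c p x)" if "a \<in> carrier R"
        using x' c p that mod_hom_smult[OF hf] by (simp add: restr_presheaf_def mod_hom_smult[OF hw, symmetric])
      show "f p (?c p (x \<oplus>\<^bsub>ob (restr_presheaf Y ?N) p\<^esub> y)) = f p (?c p x) \<oplus>\<^bsub>ob J p\<^esub> f p (?c p y)"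
        if y: "y \<in> carrier (ob (restr_presheaf Y ?N) p)"
      proof -
        obtain y' where y': "y' \<in> carrier (ob W p)" "y = w p y'" using y by (auto simp: restr_presheaf_def)
        show ?thesis
          using x' y' c p mod_hom_add[OF hf] by (simp add: restr_presheaf_def mod_hom_add[OF hw, symmetric])
      qed
    qed
  next
    fix p q y assume pq: "p \<in> Q" "q \<in> Q" "q \<le> p" and "y \<in> carrier (ob (restr_presheaf Y ?N) p)"
    then obtain x where x: "x \<in> carrier (ob W p)" "y = w p x" by (auto simp: restr_presheaf_def)
    then show "f q (?c q (ar (restr_presheaf Y ?N) p q y)) = ar J p q (f p (?c p y))"
      using pq c presheaf_ar_closed[OF W pq] nat_trans_ar[OF f pq]
      by (simp add: restr_presheaf_def nat_trans_ar[OF w pq, symmetric])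
  qed
  from injective_extend_restr[OF J Y YN N this, of projr Inr] c show ?thesis by fastforce
qed

definition down_in :: "'p::order set \<Rightarrow> 'p set \<Rightarrow> bool" where
  "down_in Q D \<longleftrightarrow> D \<subseteq> Q \<and> (\<forall>p\<in>D. \<forall>q\<in>Q. q \<le> p \<longrightarrow> q \<in> D)"

definition flasque :: "'p::order set \<Rightarrow> ('p, 'r, 'a) presheaf \<Rightarrow> bool" where
  "flasque Q X \<longleftrightarrow> (\<forall>D s. down_in Q D \<and> s \<in> carrier (lim_module D X) \<longrightarrow>
     (\<exists>s'\<in>carrier (lim_module Q X). \<forall>p\<in>D. s' p = s p))"

text \<open>A section over \<open>D\<close> is a morphism from the functor that is \<open>R\<close> on \<open>D\<close> and \<open>0\<close> elsewhere, and a
  section over \<open>Q\<close> is a morphism from the constant functor \<open>R\<close>.\<close>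

lemma injective_flasque:
  fixes J :: "('p::order, 'r, 'i) presheaf"
  assumes R: "cring R" and J: "injective_presheaf R Q J"
  shows "flasque Q J"
  unfolding flasque_def
proof (intro allI impI, elim conjE)
  fix D s assume D: "down_in Q D" and s: "s \<in> carrier (lim_module D J)"
  interpret R: cring R by fact
  have J': "presheaf_on R Q J" using J by (simp add: injective_presheaf_def)
  note mJ = presheaf_module[OF J']
  define Rm :: "('r, 'r) module" where "Rm = \<lparr>carrier = carrier R, mult = undefined, one = undefined, zero = \<zero>\<^bsub>R\<^esub>,
    add = add R, smult = mult R\<rparr>"
  have Rmod: "module R Rm"
  proof (rule moduleI)
    show "abelian_group Rm"
    proof (rule abelian_groupI)
      fix x assume "x \<in> carrier Rm"
      then show "\<exists>y\<in>carrier Rm. y \<oplus>\<^bsub>Rm\<^esub> x = \<zero>\<^bsub>Rm\<^esub>"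
        by (auto simp: Rm_def R.l_neg intro!: bexI[of _ "\<ominus>\<^bsub>R\<^esub> x"])
    qed (auto simp: Rm_def R.a_ac)
  qed (auto simp: Rm_def R.l_distr R.r_distr R.m_assoc R.is_cring)
  interpret Rm: module R Rm by fact
  define Y :: "('p, 'r, 'r) presheaf" where "Y = \<lparr>ob = (\<lambda>p. Rm), ar = (\<lambda>p q x. x)\<rparr>"
  let ?N = "\<lambda>p. if p \<in> D then carrier R else {\<zero>\<^bsub>R\<^esub>}"
  have Y: "presheaf_on R Q Y"
    by (auto simp: presheaf_on_def Y_def Rmod intro!: mod_homI)
  have N: "submodule (?N p) R (ob Y p)" for p
    using Rm.carrier_is_submodule Rm.submoduleI[of "{\<zero>\<^bsub>Rm\<^esub>}"] Rm.M.a_inv_zero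
      Rm.smult_r_null
    by (auto simp: Y_def Rm_def[THEN arg_cong[of _ _ carrier]] Rm_def[THEN arg_cong[of _ _ zero]])
  have YN: "presheaf_on R Q (restr_presheaf Y ?N)"
    by (rule presheaf_restr[OF Y N]) (use D in \<open>auto simp: Y_def down_in_def split: if_splits\<close>)
  let ?f = "\<lambda>p r. if p \<in> D then r \<odot>\<^bsub>ob J p\<^esub> s p else \<zero>\<^bsub>ob J p\<^esub>"
  have DQ: "p \<in> Q" if "p \<in> D" for p using D that by (auto simp: down_in_def)
  have f: "nat_trans R Q (restr_presheaf Y ?N) J ?f"
    unfolding nat_trans_def
  proof (intro conjI ballI impI)
    fix p assume p: "p \<in> Q"
    interpret J: module R "ob J p" using mJ p .
    show "?f p \<in> mod_hom R (ob (restr_presheaf Y ?N) p) (ob J p)"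
      using lim_closed[OF s, of p]
      by (intro mod_homI) (auto simp: restr_presheaf_def Y_def Rm_def J.smult_l_distr J.smult_assoc1)
  next
    fix p q r assume pq: "p \<in> Q" "q \<in> Q" "q \<le> p" and r: "r \<in> carrier (ob (restr_presheaf Y ?N) p)"
    interpret J: module R "ob J p" using mJ pq(1) .
    interpret Jq: module R "ob J q" using mJ pq(2) .
    have "q \<in> D" if "p \<in> D" using D pq that by (auto simp: down_in_def)
    then show "?f q (ar (restr_presheaf Y ?N) p q r) = ar J p q (?f p r)"
      using r lim_closed[OF s, of p] lim_closed[OF s, of q] lim_ar[OF s, of p q] pq
        mod_hom_smult[OF presheaf_ar[OF J' pq], of r "s p"] presheaf_ar_zero[OF J' pq]
      by (auto simp: restr_presheaf_def Y_def)
  qed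
  have NY: "?N p \<subseteq> carrier (ob Y p)" for p by (auto simp: Y_def Rm_def)
  \<comment> \<open>The constant functor has its values in \<open>'r\<close>, which enters the test
    type through \<open>Inl\<close>.\<close>
  have "\<exists>g. nat_trans R Q Y J g \<and> (\<forall>p\<in>Q. \<forall>x\<in>?N p. g p x = ?f p x)"
    by (rule injective_extend_restr[where i = Inl and j = projl, OF J Y YN NY f]) (rule sum.sel)
  then obtain g where g: "nat_trans R Q Y J g" "\<forall>p\<in>Q. \<forall>x\<in>?N p. g p x = ?f p x"
    by (elim exE conjE) (rule that)
  \<comment> \<open>A morphism from the constant functor is recovered from the images of
    \<open>1\<close>, and naturality makes these a section.\<close>
  let ?s = "\<lambda>p\<in>Q. g p \<one>\<^bsub>R\<^esub>"
  have "?s \<in> carrier (lim_module Q J)"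
    unfolding mem_lim
  proof (intro conjI ballI impI)
    fix p q assume "p \<in> Q" "q \<in> Q" "q \<le> p"
    then show "ar J p q (?s p) = ?s q"
      using nat_trans_ar[OF g(1), of p q "\<one>\<^bsub>R\<^esub>", symmetric] by (simp add: Y_def Rm_def)
  qed (use nat_trans_closed[OF g(1), of _ "\<one>\<^bsub>R\<^esub>"] in \<open>auto simp: Y_def Rm_def\<close>)
  moreover have "?s p = s p" if "p \<in> D" for p
    using that g(2) DQ[OF that] lim_closed[OF s that] module.smult_one[OF mJ] by simp
  ultimately show "\<exists>s'\<in>carrier (lim_module Q J). \<forall>p\<in>D. s' p = s p" by blast
qed

subsection \<open>Coresolutions and their sections\<close>

text \<open>The conditions on a resolution that are tested at single points or pairs of points, and
  hence pass to any subset of \<open>Q\<close>. Injectivity is kept apart because it is tested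
  against functors on all of \<open>Q\<close>.\<close>

definition coresolves :: "'r ring \<Rightarrow> 'p::order set \<Rightarrow> ('p, 'r, 'm) presheaf \<Rightarrow> ('p, 'r, 'm, 'i) coresolution \<Rightarrow> bool" where
  "coresolves R Q F I \<longleftrightarrow> presheaf_on R Q F \<and> (\<forall>n. presheaf_on R Q (cx I n)) \<and>
     nat_trans R Q F (cx I 0) (aug I) \<and> (\<forall>n. nat_trans R Q (cx I n) (cx I (Suc n)) (dif I n)) \<and>
     (\<forall>q\<in>Q. inj_on (aug I q) (carrier (ob F q)) \<and>
        aug I q ` carrier (ob F q) = a_kernel (ob (cx I 0) q) (ob (cx I 1) q) (dif I 0 q) \<and>
        (\<forall>n. dif I n q ` carrier (ob (cx I n) q) =
             a_kernel (ob (cx I (Suc n)) q) (ob (cx I (Suc (Suc n))) q) (dif I (Suc n) q)))"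

lemma injective_presheaf_on: "injective_presheaf R Q J \<Longrightarrow> presheaf_on R Q J"
  by (simp add: injective_presheaf_def)

lemma injective_resolution_iff:
  "presheaf_on R Q F \<Longrightarrow>
     injective_resolution R Q F I \<longleftrightarrow> coresolves R Q F I \<and> (\<forall>n. injective_presheaf R Q (cx I n))"
  unfolding injective_resolution_def coresolves_def
  by (intro iffI conjI; elim conjE) (simp_all add: injective_presheaf_on)

lemma coresolves_subset: "coresolves R Q F I \<Longrightarrow> U \<subseteq> Q \<Longrightarrow> coresolves R U F I"
  unfolding coresolves_def by (meson presheaf_on_subset nat_trans_subset subsetD)

lemma
  assumes "coresolves R Q F I"
  shows cores_F: "presheaf_on R Q F"
    and cores_cx: "presheaf_on R Q (cx I n)"
    and cores_aug: "nat_trans R Q F (cx I 0) (aug I)"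
    and cores_dif: "nat_trans R Q (cx I n) (cx I (Suc n)) (dif I n)"
    and cores_aug_inj: "q \<in> Q \<Longrightarrow> inj_on (aug I q) (carrier (ob F q))"
    and cores_dif_aug: "q \<in> Q \<Longrightarrow> x \<in> carrier (ob F q) \<Longrightarrow> dif I 0 q (aug I q x) = \<zero>\<^bsub>ob (cx I 1) q\<^esub>"
    and cores_dif_dif: "q \<in> Q \<Longrightarrow> y \<in> carrier (ob (cx I n) q) \<Longrightarrow>
      dif I (Suc n) q (dif I n q y) = \<zero>\<^bsub>ob (cx I (Suc (Suc n))) q\<^esub>"
    and cores_exact_0: "q \<in> Q \<Longrightarrow> z \<in> carrier (ob (cx I 0) q) \<Longrightarrow> dif I 0 q z = \<zero>\<^bsub>ob (cx I 1) q\<^esub> \<Longrightarrow>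
      \<exists>x\<in>carrier (ob F q). z = aug I q x"
    and cores_exact_Suc: "q \<in> Q \<Longrightarrow> w \<in> carrier (ob (cx I (Suc n)) q) \<Longrightarrow>
      dif I (Suc n) q w = \<zero>\<^bsub>ob (cx I (Suc (Suc n))) q\<^esub> \<Longrightarrow> \<exists>x\<in>carrier (ob (cx I n) q). w = dif I n q x"
  using assms unfolding coresolves_def set_eq_iff mem_a_kernel image_iff by blast+

text \<open>The usual degreewise extension: exactness is used of the source and the target,
  injectivity of the target.\<close>

lemma comparison_exists:
  fixes I :: "('p::order, 'r, 'm, 'i) coresolution" and J :: "('p, 'r, 'n, 'i) coresolution"
  assumes I: "coresolves R U F I" and J: "coresolves R U F' J" and inj: "\<And>n. injective_presheaf R U (cx J n)"
    and e: "nat_trans R U F F' e"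
  shows "\<exists>t. resolution_map R U F e I J t"
proof -
  \<comment> \<open>The middle condition, that \<open>t\<close> maps cocycles to cocycles, is
    carried through the recursion. It says that \<open>dif J n\<close> after \<open>t\<close> kills
    the kernel of \<open>dif I n\<close>, which is what the next extension asks for.\<close>
  let ?P = "\<lambda>n t. nat_trans R U (cx I n) (cx J n) t \<and>
    (\<forall>q\<in>U. \<forall>x\<in>carrier (ob (cx I n) q). dif I n q x = \<zero>\<^bsub>ob (cx I (Suc n)) q\<^esub> \<longrightarrow>
      dif J n q (t q x) = \<zero>\<^bsub>ob (cx J (Suc n)) q\<^esub>) \<and>
    (n = 0 \<longrightarrow> (\<forall>q\<in>U. \<forall>x\<in>carrier (ob F q). t q (aug I q x) = aug J q (e q x)))"
  let ?Q = "\<lambda>n t t'. \<forall>q\<in>U. \<forall>x\<in>carrier (ob (cx I n) q). t' q (dif I n q x) = dif J n q (t q x)"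
  have "\<exists>t. ?P 0 t"
  proof -
    note F = cores_F[OF I] and ea = nat_trans_comp[OF cores_F[OF I] e cores_aug[OF J]]
    have "\<exists>g. nat_trans R U (cx I 0) (cx J 0) g \<and>
      (\<forall>p\<in>U. \<forall>x\<in>carrier (ob F p). g p (aug I p x) = aug J p (e p x))"
    proof (rule injective_extend[OF inj cores_cx[OF I] F cores_aug[OF I] ea])
      fix p x assume p: "p \<in> U" and x: "x \<in> carrier (ob F p)" and 0: "aug I p x = \<zero>\<^bsub>ob (cx I 0) p\<^esub>"
      note mF = presheaf_module[OF F p] and mF' = presheaf_module[OF cores_F[OF J] p]
        and mI = presheaf_module[OF cores_cx[OF I] p] and mJ = presheaf_module[OF cores_cx[OF J] p]
      have "x = \<zero>\<^bsub>ob F p\<^esub>"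
        using mod_hom_inj_iff[OF mF mI nat_trans_hom[OF cores_aug[OF I] p]] cores_aug_inj[OF I p] x 0 by blast
      then show "aug J p (e p x) = \<zero>\<^bsub>ob (cx J 0) p\<^esub>"
        using mod_hom_zero[OF mF mJ nat_trans_hom[OF ea p]] by simp
    qed
    then obtain t where t: "nat_trans R U (cx I 0) (cx J 0) t"
      "\<forall>p\<in>U. \<forall>x\<in>carrier (ob F p). t p (aug I p x) = aug J p (e p x)" by blast
    have "dif J 0 q (t q x) = \<zero>\<^bsub>ob (cx J (Suc 0)) q\<^esub>"
      if qx: "q \<in> U" "x \<in> carrier (ob (cx I 0) q)" "dif I 0 q x = \<zero>\<^bsub>ob (cx I (Suc 0)) q\<^esub>" for q x
    proof -
      obtain y where "y \<in> carrier (ob F q)" "x = aug I q y" using cores_exact_0[OF I] qx by auto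
      then show ?thesis
        using t(2) that(1) cores_dif_aug[OF J that(1)] nat_trans_closed[OF e that(1)] by simp
    qed
    then show ?thesis using t by blast
  qed
  moreover have "\<exists>t'. ?P (Suc n) t' \<and> ?Q n t t'" if t: "?P n t" for n t
  proof -
    note nt = t[THEN conjunct1]
    note td = nat_trans_comp[OF cores_cx[OF I] nt cores_dif[OF J]]
    have "\<exists>g. nat_trans R U (cx I (Suc n)) (cx J (Suc n)) g \<and>
      (\<forall>p\<in>U. \<forall>x\<in>carrier (ob (cx I n) p). g p (dif I n p x) = dif J n p (t p x))"
      by (rule injective_extend[OF inj cores_cx[OF I] cores_cx[OF I] cores_dif[OF I] td]) (use t in blast)
    then obtain g where g: "nat_trans R U (cx I (Suc n)) (cx J (Suc n)) g"
      "\<forall>p\<in>U. \<forall>x\<in>carrier (ob (cx I n) p). g p (dif I n p x) = dif J n p (t p x)" by blast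
    have "dif J (Suc n) q (g q x) = \<zero>\<^bsub>ob (cx J (Suc (Suc n))) q\<^esub>"
      if qx: "q \<in> U" "x \<in> carrier (ob (cx I (Suc n)) q)" "dif I (Suc n) q x = \<zero>\<^bsub>ob (cx I (Suc (Suc n))) q\<^esub>" for q x
    proof -
      obtain y where "y \<in> carrier (ob (cx I n) q)" "x = dif I n q y" using cores_exact_Suc[OF I] qx by blast
      then show ?thesis
        using g(2) that(1) cores_dif_dif[OF J that(1)] nat_trans_closed[OF nt that(1)] by simp
    qed
    then show ?thesis using g by blast
  qed
  ultimately have "\<exists>t. \<forall>n. ?P n (t n) \<and> ?Q n (t n) (t (Suc n))"
    by (rule dependent_nat_choice)
  then obtain t where t: "\<And>n. ?P n (t n) \<and> ?Q n (t n) (t (Suc n))" by blast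
  show ?thesis unfolding resolution_map_def
  proof (intro exI[of _ t] conjI allI ballI)
    show "nat_trans R U (cx I n) (cx J n) (t n)" for n using t[of n] by blast
    show "t 0 q (aug I q x) = aug J q (e q x)" if "q \<in> U" "x \<in> carrier (ob F q)" for q x using t[of 0] that by blast
    show "t (Suc n) q (dif I n q x) = dif J n q (t n q x)" if "q \<in> U" "x \<in> carrier (ob (cx I n) q)" for n q x
      using t[of n] that by blast
  qed
qed

text \<open>\<open>coho\<close> copies the shape of \<open>derived_lim\<close>, so the abstract
  results on complexes apply after unfolding.\<close>

lemma derived_lim_eq_coho:
  "derived_lim Q I = coho (\<lambda>n. lim_module Q (cx I n)) (\<lambda>n. lim_map Q (dif I n))"
  by (auto simp: fun_eq_iff derived_lim_def coho_def lim_cocycles_def bd_def lim_coboundaries_def)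

lemma derived_map_eq_coho_map:
  "derived_map U J n t = coho_map (\<lambda>n. lim_module U (cx J n)) (\<lambda>n. lim_map U (dif J n)) n (lim_map U (t n))"
  by (auto simp: fun_eq_iff derived_map_def coho_map_def cls_def bd_def lim_coboundaries_def)

lemma cochain_lim:
  assumes "cring R" and I: "coresolves R Q F I"
  shows "cochain R (\<lambda>n. lim_module Q (cx I n)) (\<lambda>n. lim_map Q (dif I n))"
proof (rule cochain.intro)
  show m: "module R (lim_module Q (cx I n))" for n using module_lim[OF assms(1) cores_cx[OF I]] .
  show h: "lim_map Q (dif I n) \<in> mod_hom R (lim_module Q (cx I n)) (lim_module Q (cx I (Suc n)))" for n
    by (rule lim_map_hom[OF cores_cx[OF I] cores_dif[OF I] order_refl])
  show "lim_map Q (dif I (Suc n)) (lim_map Q (dif I n) x) = \<zero>\<^bsub>lim_module Q (cx I (Suc (Suc n)))\<^esub>"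
    if "x \<in> carrier (lim_module Q (cx I n))" for n x
  proof (rule lim_eqI)
    show "lim_map Q (dif I (Suc n)) (lim_map Q (dif I n) x) \<in> carrier (lim_module Q (cx I (Suc (Suc n))))"
      using mod_hom_closed[OF h] that by blast
    show "\<zero>\<^bsub>lim_module Q (cx I (Suc (Suc n)))\<^esub> \<in> carrier (lim_module Q (cx I (Suc (Suc n))))"
      using abelian_groupE(2) m module.axioms(2) by blast
  qed (use that cores_dif_dif[OF I] in \<open>simp add: lim_map_def lim_zero lim_closed\<close>)
qed

lemma cochain_map_lim:
  assumes R: "cring R" and I: "coresolves R Q F I" and J: "coresolves R U F' J" and "U \<subseteq> Q"
    and t: "resolution_map R U F e I J t"
  shows "cochain_map R (\<lambda>n. lim_module Q (cx I n)) (\<lambda>n. lim_map Q (dif I n))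
    (\<lambda>n. lim_module U (cx J n)) (\<lambda>n. lim_map U (dif J n)) (\<lambda>n. lim_map U (t n))"
proof -
  interpret I: cochain R "\<lambda>n. lim_module Q (cx I n)" "\<lambda>n. lim_map Q (dif I n)" by (rule cochain_lim[OF R I])
  interpret J: cochain R "\<lambda>n. lim_module U (cx J n)" "\<lambda>n. lim_map U (dif J n)" by (rule cochain_lim[OF R J])
  show ?thesis
  proof (intro cochain_map.intro cochain_map_axioms.intro I.cochain_axioms J.cochain_axioms)
    show "lim_map U (t n) \<in> mod_hom R (lim_module Q (cx I n)) (lim_module U (cx J n))" for n
      using t by (intro lim_map_hom[OF cores_cx[OF I] _ \<open>U \<subseteq> Q\<close>]) (simp add: resolution_map_def)
    show "lim_map U (t (Suc n)) (lim_map Q (dif I n) x) = lim_map U (dif J n) (lim_map U (t n) x)"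
      if "x \<in> carrier (lim_module Q (cx I n))" for n x
      using that \<open>U \<subseteq> Q\<close> t unfolding lim_map_def resolution_map_def
      by (auto intro!: restrict_ext simp: subset_iff lim_closed)
  qed
qed

text \<open>What the cohomology computations take from an injective resolution: exactness at every
  point and extension of sections from down-sets.\<close>

locale sections =
  fixes R :: "'r ring" and Q :: "'p::order set" and F :: "('p, 'r, 'm) presheaf"
    and I :: "('p, 'r, 'm, 'i) coresolution"
  assumes cring: "cring R" and res: "coresolves R Q F I" and fl: "\<And>n. flasque Q (cx I n)"
begin

abbreviation Sec :: "nat \<Rightarrow> ('r, 'p \<Rightarrow> 'i) module" where "Sec n \<equiv> lim_module Q (cx I n)"
abbreviation \<delta> :: "nat \<Rightarrow> ('p \<Rightarrow> 'i) \<Rightarrow> 'p \<Rightarrow> 'i" where "\<delta> n \<equiv> lim_map Q (dif I n)"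

sublocale cochain R Sec \<delta> by (rule cochain_lim[OF cring res])

lemmas presheaf_cx = cores_cx[OF res]
lemmas module_at = presheaf_module[OF presheaf_cx]

lemma \<delta>_at: "q \<in> Q \<Longrightarrow> \<delta> n s q = dif I n q (s q)"
  by (simp add: lim_map_def)

lemma minus_at:
  "s \<in> carrier (Sec n) \<Longrightarrow> t \<in> carrier (Sec n) \<Longrightarrow> q \<in> Q \<Longrightarrow> (s \<ominus>\<^bsub>Sec n\<^esub> t) q = s q \<ominus>\<^bsub>ob (cx I n) q\<^esub> t q"
  using lim_minus[OF cring presheaf_cx] .

lemma minus_at_zero_iff:
  assumes "s \<in> carrier (Sec n)" "t \<in> carrier (Sec n)" "q \<in> Q"
  shows "(s \<ominus>\<^bsub>Sec n\<^esub> t) q = \<zero>\<^bsub>ob (cx I n) q\<^esub> \<longleftrightarrow> s q = t q"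
proof -
  interpret q: module R "ob (cx I n) q" using module_at assms(3) .
  show ?thesis using assms by (simp add: minus_at q.M.minus_eq_zero_iff lim_closed)
qed

lemma zero_below:
  assumes "s \<in> carrier (Sec n)" "p \<in> Q" "q \<in> Q" "q \<le> p" "s p = \<zero>\<^bsub>ob (cx I n) p\<^esub>"
  shows "s q = \<zero>\<^bsub>ob (cx I n) q\<^esub>"
  using lim_ar[OF assms(1-4)] presheaf_ar_zero[OF presheaf_cx assms(2-4)] assms(5) by simp

lemma dif_zero: "q \<in> Q \<Longrightarrow> dif I n q \<zero>\<^bsub>ob (cx I n) q\<^esub> = \<zero>\<^bsub>ob (cx I (Suc n)) q\<^esub>"
  using mod_hom_zero[OF module_at module_at nat_trans_hom[OF cores_dif[OF res]]] by blast

text \<open>By flasqueness a section over a down-set \<open>D\<close> is the same as a global section modulo \<open>van D\<close>, so that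
  the cohomology over \<open>D\<close> is that of the quotient complex of global sections by \<open>van D\<close>.\<close>

definition van :: "'p set \<Rightarrow> nat \<Rightarrow> ('p \<Rightarrow> 'i) set" where
  "van D n = {s \<in> carrier (Sec n). \<forall>p\<in>D. s p = \<zero>\<^bsub>ob (cx I n) p\<^esub>}"

abbreviation below :: "'p \<Rightarrow> 'p set" where "below h \<equiv> {p\<in>Q. p \<le> h}"

lemma van_carrier: "s \<in> van D n \<Longrightarrow> s \<in> carrier (Sec n)"
  by (simp add: van_def)

lemma van_mono: "D \<subseteq> D' \<Longrightarrow> van D' n \<subseteq> van D n"
  by (auto simp: van_def)

lemma van_Un: "van (D \<union> D') n = van D n \<inter> van D' n"
  by (auto simp: van_def)

text \<open>Over the whole of \<open>Q\<close> the quotient by \<open>van Q\<close> is the complex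
  of sections itself, so acyclicity relative to \<open>van Q\<close> is vanishing of the derived
  limit.\<close>

lemma van_top: "van Q n = {\<zero>\<^bsub>Sec n\<^esub>}"
  by (auto simp: van_def lim_zero intro: lim_eqI)

lemma van_below: "h \<in> Q \<Longrightarrow> s \<in> van (below h) n \<longleftrightarrow> s \<in> carrier (Sec n) \<and> s h = \<zero>\<^bsub>ob (cx I n) h\<^esub>"
  using zero_below unfolding van_def by blast

lemma subcomplex_van:
  assumes "D \<subseteq> Q"
  shows "subcomplex (van D)"
  unfolding subcomplex_def
proof (intro allI conjI ballI)
  fix n
  have z: "\<zero>\<^bsub>ob (cx I n) q\<^esub> \<oplus>\<^bsub>ob (cx I n) q\<^esub> \<zero>\<^bsub>ob (cx I n) q\<^esub> = \<zero>\<^bsub>ob (cx I n) q\<^esub>"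
    "\<zero>\<^bsub>ob (cx I n) q\<^esub> \<ominus>\<^bsub>ob (cx I n) q\<^esub> \<zero>\<^bsub>ob (cx I n) q\<^esub> = \<zero>\<^bsub>ob (cx I n) q\<^esub>"
    "a \<in> carrier R \<Longrightarrow> a \<odot>\<^bsub>ob (cx I n) q\<^esub> \<zero>\<^bsub>ob (cx I n) q\<^esub> = \<zero>\<^bsub>ob (cx I n) q\<^esub>"
    if "q \<in> Q" for q a
  proof -
    interpret q: module R "ob (cx I n) q" using module_at that .
    show "\<zero>\<^bsub>ob (cx I n) q\<^esub> \<oplus>\<^bsub>ob (cx I n) q\<^esub> \<zero>\<^bsub>ob (cx I n) q\<^esub> = \<zero>\<^bsub>ob (cx I n) q\<^esub>"
      "\<zero>\<^bsub>ob (cx I n) q\<^esub> \<ominus>\<^bsub>ob (cx I n) q\<^esub> \<zero>\<^bsub>ob (cx I n) q\<^esub> = \<zero>\<^bsub>ob (cx I n) q\<^esub>"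
      "a \<in> carrier R \<Longrightarrow> a \<odot>\<^bsub>ob (cx I n) q\<^esub> \<zero>\<^bsub>ob (cx I n) q\<^esub> = \<zero>\<^bsub>ob (cx I n) q\<^esub>"
      by simp_all
  qed
  have DQ: "q \<in> Q" if "q \<in> D" for q using that assms by blast
  show "submodule (van D n) R (Sec n)"
  proof (rule X.submoduleI)
    fix a assume "a \<in> van D n"
    then have a: "a \<in> carrier (Sec n)" "\<forall>q\<in>D. a q = \<zero>\<^bsub>ob (cx I n) q\<^esub>" by (auto simp: van_def)
    have "\<ominus>\<^bsub>Sec n\<^esub> a = \<zero>\<^bsub>Sec n\<^esub> \<ominus>\<^bsub>Sec n\<^esub> a" using a by (simp add: a_minus_def)
    moreover have "(\<zero>\<^bsub>Sec n\<^esub> \<ominus>\<^bsub>Sec n\<^esub> a) q = \<zero>\<^bsub>ob (cx I n) q\<^esub>" if "q \<in> D" for q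
      using a that DQ[OF that] z(2)[of q] by (simp add: minus_at lim_zero)
    ultimately show "\<ominus>\<^bsub>Sec n\<^esub> a \<in> van D n" using a by (auto simp: van_def)
  qed (auto simp: van_def lim_zero lim_add lim_smult z DQ)
  show "\<delta> n x \<in> van D (Suc n)" if "x \<in> van D n" for x
    using that DQ by (auto simp: van_def \<delta>_at dif_zero)
qed

lemmas van_zero = sub_zero[OF subcomplex_van]
lemmas van_add = sub_add[OF subcomplex_van]
lemmas van_minus = sub_minus[OF subcomplex_van]
lemmas van_\<delta> = sub_d[OF subcomplex_van]

lemma extend:
  assumes "down_in Q D" "s \<in> extensional D" "\<And>p. p \<in> D \<Longrightarrow> s p \<in> carrier (ob (cx I n) p)"
    and "\<And>p q. p \<in> D \<Longrightarrow> q \<in> D \<Longrightarrow> q \<le> p \<Longrightarrow> ar (cx I n) p q (s p) = s q"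
  obtains s' where "s' \<in> carrier (Sec n)" "\<And>p. p \<in> D \<Longrightarrow> s' p = s p"
proof -
  have "s \<in> carrier (lim_module D (cx I n))" using assms by (simp add: mem_lim)
  then show thesis using fl[of n] assms(1) that unfolding flasque_def by metis
qed

text \<open>An element at \<open>h\<close> spreads to a section over the principal down-set by the
  structure maps, and from there to \<open>Q\<close> by flasqueness.\<close>

lemma extend_at:
  assumes h: "h \<in> Q" and v: "v \<in> carrier (ob (cx I n) h)"
  obtains s where "s \<in> carrier (Sec n)" "s h = v"
proof (rule extend[of "below h" "\<lambda>q\<in>below h. ar (cx I n) h q v" n])
  show "down_in Q (below h)" by (auto simp: down_in_def)
  show "ar (cx I n) p q ((\<lambda>q\<in>below h. ar (cx I n) h q v) p) = (\<lambda>q\<in>below h. ar (cx I n) h q v) q"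
    if "p \<in> below h" "q \<in> below h" "q \<le> p" for p q
    using that presheaf_comp[OF presheaf_cx h, of p q v n] v by simp
  show "\<And>s. s \<in> carrier (Sec n) \<Longrightarrow> (\<And>p. p \<in> below h \<Longrightarrow> s p = (\<lambda>q\<in>below h. ar (cx I n) h q v) p) \<Longrightarrow> thesis"
    using that presheaf_id[OF presheaf_cx h v] h by simp
qed (use presheaf_ar_closed[OF presheaf_cx h] v in auto)

text \<open>The step of Mayer--Vietoris that needs flasqueness. The family that is zero on
  \<open>D\<close> and equals \<open>x\<close> on \<open>D'\<close> is compatible because
  \<open>x\<close> vanishes on the overlap; an extension of it lies in \<open>van D\<close> and
  differs from \<open>x\<close> by an element of \<open>van D'\<close>.\<close>

lemma van_Int:
  assumes D: "down_in Q D" and D': "down_in Q D'"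
  shows "x \<in> van (D \<inter> D') n \<longleftrightarrow> (\<exists>a\<in>van D n. \<exists>b\<in>van D' n. x = a \<oplus>\<^bsub>Sec n\<^esub> b)"
proof
  have sub: "D \<subseteq> Q" "D' \<subseteq> Q" "D \<inter> D' \<subseteq> Q" using D D' by (auto simp: down_in_def)
  show "x \<in> van (D \<inter> D') n" if "\<exists>a\<in>van D n. \<exists>b\<in>van D' n. x = a \<oplus>\<^bsub>Sec n\<^esub> b"
    using that van_add[OF sub(3) subsetD[OF van_mono[OF Int_lower1]] subsetD[OF van_mono[OF Int_lower2]]] by blast
  assume x: "x \<in> van (D \<inter> D') n"
  then have xc: "x \<in> carrier (Sec n)" by (rule van_carrier)
  let ?s = "\<lambda>q\<in>D \<union> D'. if q \<in> D then \<zero>\<^bsub>ob (cx I n) q\<^esub> else x q"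
  have zc: "\<zero>\<^bsub>ob (cx I n) q\<^esub> \<in> carrier (ob (cx I n) q)" if "q \<in> Q" for q
    using module_at[OF that] abelian_groupE(2) module.axioms(2) by blast
  have "down_in Q (D \<union> D')" using D D' by (auto simp: down_in_def)
  moreover have "ar (cx I n) p q (?s p) = ?s q" if pq: "p \<in> D \<union> D'" "q \<in> D \<union> D'" "q \<le> p" for p q
  proof -
    have pqQ: "p \<in> Q" "q \<in> Q" using pq sub by auto
    show ?thesis
    proof (cases "p \<in> D")
      case True
      then have "q \<in> D" using D pq pqQ by (auto simp: down_in_def)
      then show ?thesis using True presheaf_ar_zero[OF presheaf_cx pqQ pq(3)] by simp
    next
      case False
      then have pD': "p \<in> D'" using pq by blast
      then have qD': "q \<in> D'" using D' pq pqQ by (auto simp: down_in_def)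
      show ?thesis using False pD' qD' lim_ar[OF xc pqQ pq(3)] x by (auto simp: van_def)
    qed
  qed
  ultimately obtain s where s: "s \<in> carrier (Sec n)" "\<And>p. p \<in> D \<union> D' \<Longrightarrow> s p = ?s p"
    using sub xc zc by (rule_tac extend[of "D \<union> D'" ?s n]) (auto simp: lim_closed subset_iff)
  have "s \<in> van D n" using s by (auto simp: van_def)
  moreover have "x \<ominus>\<^bsub>Sec n\<^esub> s \<in> van D' n"
    using s xc x sub minus_at_zero_iff[OF xc s(1)] by (auto simp: van_def subset_iff)
  moreover have "x = s \<oplus>\<^bsub>Sec n\<^esub> (x \<ominus>\<^bsub>Sec n\<^esub> s)" using s(1) xc by algebra
  ultimately show "\<exists>a\<in>van D n. \<exists>b\<in>van D' n. x = a \<oplus>\<^bsub>Sec n\<^esub> b" by blast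
qed

text \<open>No member of \<open>T\<close> lies below another element of \<open>B\<close>, and each
  \<open>\<kappa> h\<close> vanishes strictly below \<open>h\<close>. So arbitrary values at the
  members of \<open>T\<close> are compatible with zero at the other elements of \<open>B\<close>,
  and the family extends.\<close>

lemma glue:
  assumes B: "down_in Q B" and T: "T \<subseteq> B" "\<And>h p. h \<in> T \<Longrightarrow> p \<in> B \<Longrightarrow> \<not> h < p"
    and \<kappa>: "\<And>h. h \<in> T \<Longrightarrow> \<kappa> h \<in> carrier (Sec n)"
    and \<kappa>0: "\<And>h q. h \<in> T \<Longrightarrow> q \<in> Q \<Longrightarrow> q < h \<Longrightarrow> \<kappa> h q = \<zero>\<^bsub>ob (cx I n) q\<^esub>"
  obtains w where "w \<in> carrier (Sec n)" "\<And>h. h \<in> T \<Longrightarrow> w h = \<kappa> h h"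
    "\<And>p. p \<in> B \<Longrightarrow> p \<notin> T \<Longrightarrow> w p = \<zero>\<^bsub>ob (cx I n) p\<^esub>"
proof -
  let ?s = "\<lambda>q\<in>B. if q \<in> T then \<kappa> q q else \<zero>\<^bsub>ob (cx I n) q\<^esub>"
  have BQ: "B \<subseteq> Q" using B by (auto simp: down_in_def)
  have zc: "\<zero>\<^bsub>ob (cx I n) q\<^esub> \<in> carrier (ob (cx I n) q)" if "q \<in> Q" for q
    using module_at[OF that] abelian_groupE(2) module.axioms(2) by blast
  have compat: "ar (cx I n) p q (?s p) = ?s q" if pq: "p \<in> B" "q \<in> B" "q \<le> p" for p q
  proof -
    have pqQ: "p \<in> Q" "q \<in> Q" using pq BQ by auto
    have "q \<notin> T" if "q < p" using T(2)[of q p] that pq by blast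
    then show ?thesis
      using pq lim_ar[OF \<kappa> pqQ pq(3), of p] \<kappa>0[of p q] pqQ presheaf_ar_zero[OF presheaf_cx pqQ pq(3)]
      by (cases "q = p") auto
  qed
  obtain w where w: "w \<in> carrier (Sec n)" "\<And>p. p \<in> B \<Longrightarrow> w p = ?s p"
  proof (rule extend[OF B _ _ compat])
    show "?s p \<in> carrier (ob (cx I n) p)" if "p \<in> B" for p
      using BQ that lim_closed[OF \<kappa>, of p p] zc[of p] by auto
    show "?s \<in> extensional B" by (rule restrict_extensional)
  qed (assumption+, rule that)
  have "w h = \<kappa> h h" if "h \<in> T" for h using w(2)[of h] that T(1) by auto
  moreover have "w p = \<zero>\<^bsub>ob (cx I n) p\<^esub>" if "p \<in> B" "p \<notin> T" for p using w(2)[of p] that by auto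
  ultimately show thesis using that w(1) by blast
qed

lemma sec_exact_0:
  assumes "h \<in> Q" "z \<in> carrier (Sec 0)" "\<delta> 0 z \<in> van (below h) (Suc 0)"
  shows "\<exists>x\<in>carrier (ob F h). z h = aug I h x"
  using cores_exact_0[OF res assms(1) lim_closed[OF assms(2,1)]] assms by (simp add: van_below \<delta>_at)

text \<open>Exactness at the point \<open>h\<close> gives a primitive there, which
  \<open>extend_at\<close> turns into a global section.\<close>

lemma sec_exact_Suc:
  assumes "h \<in> Q" "z \<in> carrier (Sec (Suc n))" "\<delta> (Suc n) z \<in> van (below h) (Suc (Suc n))"
  obtains v where "v \<in> carrier (Sec n)" "z \<ominus>\<^bsub>Sec (Suc n)\<^esub> \<delta> n v \<in> van (below h) (Suc n)"
proof -
  obtain x where x: "x \<in> carrier (ob (cx I n) h)" "z h = dif I n h x"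
    using cores_exact_Suc[OF res assms(1) lim_closed[OF assms(2,1)]] assms by (auto simp: van_below \<delta>_at)
  obtain v where v: "v \<in> carrier (Sec n)" "v h = x" using extend_at[OF assms(1) x(1)] .
  then show thesis using that x minus_at_zero_iff[OF assms(2) d_closed[OF v(1)] assms(1)] assms
    by (auto simp: van_below \<delta>_at)
qed

text \<open>Evaluation at \<open>h\<close> identifies the sections modulo
  \<open>van (below h)\<close> with the resolution of \<open>F h\<close>: it is onto by
  \<open>extend_at\<close>, and a section that vanishes at \<open>h\<close> vanishes below it. Only
  degree \<open>0\<close> can contribute, and it contributes \<open>F h\<close>.\<close>

lemma acyc_below:
  assumes h: "h \<in> Q" and n: "n > 0 \<or> carrier (ob F h) = {\<zero>\<^bsub>ob F h\<^esub>}"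
  shows "acyc n (van (below h))"
proof (cases n)
  case 0
  have "z \<in> van (below h) 0" if "z \<in> carrier (Sec 0)" "\<delta> 0 z \<in> van (below h) (Suc 0)" for z
  proof -
    have "aug I h \<zero>\<^bsub>ob F h\<^esub> = \<zero>\<^bsub>ob (cx I 0) h\<^esub>"
      using mod_hom_zero[OF presheaf_module[OF cores_F[OF res] h] module_at[OF h] nat_trans_hom[OF cores_aug[OF res] h]] .
    then show ?thesis using sec_exact_0[OF h that] n 0 that h by (auto simp: van_below)
  qed
  then show ?thesis unfolding acyc_def 0 by (auto simp: bd_def van_carrier)
next
  case (Suc k)
  have "\<exists>b\<in>bd Sec \<delta> (Suc k). z \<ominus>\<^bsub>Sec (Suc k)\<^esub> b \<in> van (below h) (Suc k)"
    if z: "z \<in> carrier (Sec (Suc k))" "\<delta> (Suc k) z \<in> van (below h) (Suc (Suc k))" for z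
  proof -
    obtain v where "v \<in> carrier (Sec k)" "z \<ominus>\<^bsub>Sec (Suc k)\<^esub> \<delta> k v \<in> van (below h) (Suc k)"
      using sec_exact_Suc[OF h z] .
    then show ?thesis using d_in_bd by blast
  qed
  then show ?thesis unfolding acyc_def Suc by blast
qed

end

lemma sectionsI:
  assumes "cring R" "presheaf_on R Q F" "injective_resolution R Q F I"
  shows "sections R Q F I"
  using assms injective_resolution_iff[OF assms(2), of I] injective_flasque[OF assms(1), of Q]
  by (auto intro!: sections.intro)

subsection \<open>Invariance under comparison maps\<close>

definition prod_module :: "('r, 'a) module \<Rightarrow> ('r, 'b) module \<Rightarrow> ('r, 'a \<times> 'b) module" where
  "prod_module M N =
     \<lparr>carrier = carrier M \<times> carrier N, mult = undefined, one = undefined, zero = (\<zero>\<^bsub>M\<^esub>, \<zero>\<^bsub>N\<^esub>),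
      add = (\<lambda>(x, y) (x', y'). (x \<oplus>\<^bsub>M\<^esub> x', y \<oplus>\<^bsub>N\<^esub> y')), smult = (\<lambda>a (x, y). (a \<odot>\<^bsub>M\<^esub> x, a \<odot>\<^bsub>N\<^esub> y))\<rparr>"

lemma prod_module_simps [simp]:
  "carrier (prod_module M N) = carrier M \<times> carrier N"
  "\<zero>\<^bsub>prod_module M N\<^esub> = (\<zero>\<^bsub>M\<^esub>, \<zero>\<^bsub>N\<^esub>)"
  "(x, y) \<oplus>\<^bsub>prod_module M N\<^esub> (x', y') = (x \<oplus>\<^bsub>M\<^esub> x', y \<oplus>\<^bsub>N\<^esub> y')"
  "a \<odot>\<^bsub>prod_module M N\<^esub> (x, y) = (a \<odot>\<^bsub>M\<^esub> x, a \<odot>\<^bsub>N\<^esub> y)"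
  by (simp_all add: prod_module_def)

lemma module_prod:
  assumes "module R M" "module R N"
  shows "module R (prod_module M N)"
proof -
  interpret M: module R M by fact
  interpret N: module R N by fact
  show ?thesis
  proof (rule moduleI)
    show "abelian_group (prod_module M N)"
    proof (rule abelian_groupI)
      fix z assume "z \<in> carrier (prod_module M N)"
      then obtain x y where z: "z = (x, y)" "x \<in> carrier M" "y \<in> carrier N" by auto
      then have "(\<ominus>\<^bsub>M\<^esub> x, \<ominus>\<^bsub>N\<^esub> y) \<oplus>\<^bsub>prod_module M N\<^esub> z = \<zero>\<^bsub>prod_module M N\<^esub>"
        by (simp add: M.M.l_neg N.M.l_neg)
      moreover have "(\<ominus>\<^bsub>M\<^esub> x, \<ominus>\<^bsub>N\<^esub> y) \<in> carrier (prod_module M N)" using z by simp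
      ultimately show "\<exists>w\<in>carrier (prod_module M N). w \<oplus>\<^bsub>prod_module M N\<^esub> z = \<zero>\<^bsub>prod_module M N\<^esub>" by blast
    qed (auto simp: M.M.a_ac N.M.a_ac)
  qed (use M.is_cring in \<open>auto simp: M.smult_l_distr M.smult_r_distr M.smult_assoc1
    N.smult_l_distr N.smult_r_distr N.smult_assoc1\<close>)
qed

lemma prod_module_minus:
  fixes R :: "'r ring"
  assumes "module R M" "module R N" "x \<in> carrier M" "x' \<in> carrier M" "y \<in> carrier N" "y' \<in> carrier N"
  shows "(x, y) \<ominus>\<^bsub>prod_module M N\<^esub> (x', y') = (x \<ominus>\<^bsub>M\<^esub> x', y \<ominus>\<^bsub>N\<^esub> y')"
proof -
  have P: "module R (prod_module M N)" using module_prod assms(1,2) .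
  have "fst \<in> mod_hom R (prod_module M N) M" "snd \<in> mod_hom R (prod_module M N) N"
    by (auto intro!: mod_homI)
  then have "fst ((x, y) \<ominus>\<^bsub>prod_module M N\<^esub> (x', y')) = x \<ominus>\<^bsub>M\<^esub> x'" "snd ((x, y) \<ominus>\<^bsub>prod_module M N\<^esub> (x', y')) = y \<ominus>\<^bsub>N\<^esub> y'"
    using mod_hom_minus[OF P assms(1), of fst "(x, y)" "(x', y')"]
      mod_hom_minus[OF P assms(2), of snd "(x, y)" "(x', y')"] assms by auto
  then show ?thesis by (simp add: prod_eq_iff)
qed

lemma submodule_prod:
  fixes R :: "'r ring"
  assumes "module R M" "module R N" "submodule A R M" "submodule B R N"
  shows "submodule (A \<times> B) R (prod_module M N)"
proof -
  interpret M: module R M by fact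
  interpret N: module R N by fact
  interpret P: module R "prod_module M N" using module_prod assms(1,2) .
  note A = M.submoduleD[OF assms(3)] and B = N.submoduleD[OF assms(4)]
  show ?thesis
  proof (rule P.submoduleI)
    fix z assume "z \<in> A \<times> B"
    then obtain x y where z: "z = (x, y)" "x \<in> A" "y \<in> B" by auto
    have "\<ominus>\<^bsub>prod_module M N\<^esub> z = \<zero>\<^bsub>prod_module M N\<^esub> \<ominus>\<^bsub>prod_module M N\<^esub> z"
      using z A B P.M.a_zero_minus[of z] by simp
    then show "\<ominus>\<^bsub>prod_module M N\<^esub> z \<in> A \<times> B"
      using z A B prod_module_minus[OF assms(1,2), of "\<zero>\<^bsub>M\<^esub>" x "\<zero>\<^bsub>N\<^esub>" y] by simp
  qed (use A B in auto)
qed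

text \<open>Here \<open>N\<close> is already indexed with its shift, so \<open>h\<close> raises the
  index by one. With the minus sign the two mixed terms of the squared differential cancel.\<close>

lemma cone_cochain:
  assumes "cochain R M d" "cochain R N e"
    and h: "\<And>n. h n \<in> mod_hom R (M n) (N (Suc n))"
    and hd: "\<And>n x. x \<in> carrier (M n) \<Longrightarrow> h (Suc n) (d n x) = e (Suc n) (h n x)"
  shows "cochain R (\<lambda>n. prod_module (M n) (N n)) (\<lambda>n (x, y). (d n x, h n x \<ominus>\<^bsub>N (Suc n)\<^esub> e n y))"
proof -
  interpret M: cochain R M d by fact
  interpret N: cochain R N e by fact
  note hc = mod_hom_closed[OF h] and ha = mod_hom_add[OF h] and hs = mod_hom_smult[OF h]
  show ?thesis
  proof (rule cochain.intro)
    show "module R (prod_module (M n) (N n))" for n using module_prod M.mod N.mod .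
    show "(\<lambda>(x, y). (d n x, h n x \<ominus>\<^bsub>N (Suc n)\<^esub> e n y))
      \<in> mod_hom R (prod_module (M n) (N n)) (prod_module (M (Suc n)) (N (Suc n)))" for n
    proof (rule mod_homI)
      fix z w a assume "z \<in> carrier (prod_module (M n) (N n))"
      then obtain x y where z: "z = (x, y)" "x \<in> carrier (M n)" "y \<in> carrier (N n)" by auto
      let ?D = "\<lambda>(x, y). (d n x, h n x \<ominus>\<^bsub>N (Suc n)\<^esub> e n y)"
      show "?D z \<in> carrier (prod_module (M (Suc n)) (N (Suc n)))" using z hc by simp
      have sm: "a \<odot>\<^bsub>N (Suc n)\<^esub> (u \<ominus>\<^bsub>N (Suc n)\<^esub> v) = a \<odot>\<^bsub>N (Suc n)\<^esub> u \<ominus>\<^bsub>N (Suc n)\<^esub> a \<odot>\<^bsub>N (Suc n)\<^esub> v"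
        if "a \<in> carrier R" "u \<in> carrier (N (Suc n))" "v \<in> carrier (N (Suc n))" for u v
        using that by (simp add: a_minus_def N.X.smult_r_distr N.X.smult_r_minus)
      show "?D (a \<odot>\<^bsub>prod_module (M n) (N n)\<^esub> z) = a \<odot>\<^bsub>prod_module (M (Suc n)) (N (Suc n))\<^esub> ?D z"
        if "a \<in> carrier R" using that z by (simp add: M.d_smult N.d_smult hs sm hc)
      assume "w \<in> carrier (prod_module (M n) (N n))"
      then obtain x' y' where w: "w = (x', y')" "x' \<in> carrier (M n)" "y' \<in> carrier (N n)" by auto
      have "(h n x \<oplus>\<^bsub>N (Suc n)\<^esub> h n x') \<ominus>\<^bsub>N (Suc n)\<^esub> (e n y \<oplus>\<^bsub>N (Suc n)\<^esub> e n y') =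
        (h n x \<ominus>\<^bsub>N (Suc n)\<^esub> e n y) \<oplus>\<^bsub>N (Suc n)\<^esub> (h n x' \<ominus>\<^bsub>N (Suc n)\<^esub> e n y')"
        using hc[OF z(2)] hc[OF w(2)] N.d_closed[OF z(3)] N.d_closed[OF w(3)] by algebra
      then show "?D (z \<oplus>\<^bsub>prod_module (M n) (N n)\<^esub> w) = ?D z \<oplus>\<^bsub>prod_module (M (Suc n)) (N (Suc n))\<^esub> ?D w"
        using z w by (simp add: M.d_add N.d_add ha)
    qed
  next
    fix n z assume "z \<in> carrier (prod_module (M n) (N n))"
    then obtain x y where z: "z = (x, y)" "x \<in> carrier (M n)" "y \<in> carrier (N n)" by auto
    then show "(\<lambda>(x, y). (d (Suc n) x, h (Suc n) x \<ominus>\<^bsub>N (Suc (Suc n))\<^esub> e (Suc n) y))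
        ((\<lambda>(x, y). (d n x, h n x \<ominus>\<^bsub>N (Suc n)\<^esub> e n y)) z) = \<zero>\<^bsub>prod_module (M (Suc (Suc n))) (N (Suc (Suc n)))\<^esub>"
      using hc by (simp add: M.dd N.dd N.d_minus hd)
  qed
qed

text \<open>A zero module fills degree \<open>0\<close> after the shift, so that the cone can be
  indexed by natural numbers without a degree \<open>-1\<close>.\<close>

lemma (in cochain) shift_cochain:
  shows "cochain R (case_nat ((M 0)\<lparr>carrier := {\<zero>\<^bsub>M 0\<^esub>}\<rparr>) M) (case_nat (\<lambda>_. \<zero>\<^bsub>M 0\<^esub>) d)"
proof (rule cochain.intro)
  have "submodule {\<zero>\<^bsub>M 0\<^esub>} R (M 0)" by (rule X.submoduleI) (auto simp: X.M.a_inv_zero)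
  then have "module R ((M 0)\<lparr>carrier := {\<zero>\<^bsub>M 0\<^esub>}\<rparr>)" using submodule.submodule_is_module mod by blast
  then show "module R (case_nat ((M 0)\<lparr>carrier := {\<zero>\<^bsub>M 0\<^esub>}\<rparr>) M n)" for n
    by (cases n) (auto simp: mod)
  show "case_nat (\<lambda>_. \<zero>\<^bsub>M 0\<^esub>) d n \<in> mod_hom R (case_nat ((M 0)\<lparr>carrier := {\<zero>\<^bsub>M 0\<^esub>}\<rparr>) M n)
      (case_nat ((M 0)\<lparr>carrier := {\<zero>\<^bsub>M 0\<^esub>}\<rparr>) M (Suc n))" for n
    by (cases n) (auto simp: d_hom intro!: mod_homI)
  show "case_nat (\<lambda>_. \<zero>\<^bsub>M 0\<^esub>) d (Suc n) (case_nat (\<lambda>_. \<zero>\<^bsub>M 0\<^esub>) d n x) =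
      \<zero>\<^bsub>case_nat ((M 0)\<lparr>carrier := {\<zero>\<^bsub>M 0\<^esub>}\<rparr>) M (Suc (Suc n))\<^esub>"
    if "x \<in> carrier (case_nat ((M 0)\<lparr>carrier := {\<zero>\<^bsub>M 0\<^esub>}\<rparr>) M n)" for n x
    using that by (cases n) (auto simp: dd)
qed

text \<open>Used twice: for the restriction of \<open>G\<close> to the up-set \<open>U\<close>
  outside of which it vanishes, and with \<open>U = Q\<close> and the identity for two resolutions
  of the same functor.\<close>

locale comparison = I: sections R Q G I + J: sections R U F J
  for R :: "'r ring" and Q :: "'p::order set" and G :: "('p, 'r, 'n) presheaf" and I :: "('p, 'r, 'n, 'i) coresolution"
    and U and F :: "('p, 'r, 'm) presheaf" and J :: "('p, 'r, 'm, 'j) coresolution" +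
  fixes e :: "'p \<Rightarrow> 'n \<Rightarrow> 'm" and t :: "nat \<Rightarrow> 'p \<Rightarrow> 'i \<Rightarrow> 'j"
  assumes fin: "finite Q" and UQ: "U \<subseteq> Q" and up: "\<And>p q. p \<in> U \<Longrightarrow> q \<in> Q \<Longrightarrow> p \<le> q \<Longrightarrow> q \<in> U"
    and map: "resolution_map R U G e I J t"
    and e: "nat_trans R U G F e" "\<And>p. p \<in> U \<Longrightarrow> bij_betw (e p) (carrier (ob G p)) (carrier (ob F p))"
    and outside: "\<And>p. p \<in> Q \<Longrightarrow> p \<notin> U \<Longrightarrow> carrier (ob G p) = {\<zero>\<^bsub>ob G p\<^esub>}"
begin

abbreviation "T n \<equiv> lim_map U (t n)"

sublocale T: cochain_map R I.Sec I.\<delta> J.Sec J.\<delta> T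
  by (rule cochain_map_lim[OF I.cring I.res J.res UQ map])

definition "N \<equiv> case_nat ((J.Sec 0)\<lparr>carrier := {\<zero>\<^bsub>J.Sec 0\<^esub>}\<rparr>) J.Sec"
definition "dN \<equiv> case_nat (\<lambda>_. \<zero>\<^bsub>J.Sec 0\<^esub>) J.\<delta>"

lemma N_simps [simp]: "carrier (N 0) = {\<zero>\<^bsub>J.Sec 0\<^esub>}" "zero (N 0) = \<zero>\<^bsub>J.Sec 0\<^esub>" "N (Suc n) = J.Sec n"
    "dN 0 y = \<zero>\<^bsub>J.Sec 0\<^esub>" "dN (Suc n) = J.\<delta> n"
  by (simp_all add: N_def dN_def)

sublocale N: cochain R N dN
  unfolding N_def dN_def by (rule J.shift_cochain)

text \<open>The mapping cone of \<open>T\<close>; its second component \<open>N\<close> is the complex of sections of \<open>J\<close> shifted by one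
  degree, with a zero module in degree \<open>0\<close>.\<close>

abbreviation "Cone \<equiv> \<lambda>n. prod_module (I.Sec n) (N n)"
definition "dC \<equiv> \<lambda>n (x, y). (I.\<delta> n x, T n x \<ominus>\<^bsub>N (Suc n)\<^esub> dN n y)"

sublocale C: cochain R Cone dC
  unfolding dC_def by (rule cone_cochain[OF I.cochain_axioms N.cochain_axioms]) (simp_all add: T.h_hom T.h_d)

text \<open>The counterpart of \<open>van D\<close> for the cone. The second component only knows
  the points of \<open>U\<close>, hence the intersection; in degree \<open>0\<close> that component
  is the filled-in zero module.\<close>

definition K where "K D n = I.van D n \<times> (case n of 0 \<Rightarrow> {\<zero>\<^bsub>J.Sec 0\<^esub>} | Suc k \<Rightarrow> J.van (D \<inter> U) k)"

lemma T_at: "p \<in> U \<Longrightarrow> T n x p = t n p (x p)"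
  by (simp add: lim_map_def)

lemma t_nat: "nat_trans R U (cx I n) (cx J n) (t n)"
  using map by (simp add: resolution_map_def)

lemma t_zero: "p \<in> U \<Longrightarrow> t n p \<zero>\<^bsub>ob (cx I n) p\<^esub> = \<zero>\<^bsub>ob (cx J n) p\<^esub>"
  using mod_hom_zero[OF I.module_at J.module_at nat_trans_hom[OF t_nat]] UQ by blast

lemma T_van: "x \<in> I.van D n \<Longrightarrow> T n x \<in> J.van (D \<inter> U) n"
  by (auto simp: I.van_def J.van_def T_at t_zero)

lemma subcomplex_K:
  assumes D: "D \<subseteq> Q"
  shows "C.subcomplex (K D)"
proof -
  have DU: "D \<inter> U \<subseteq> U" by blast
  note sI = I.subcomplex_van[OF D] and sJ = J.subcomplex_van[OF DU]
  show ?thesis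
    unfolding C.subcomplex_def
  proof (intro allI conjI ballI)
    show "submodule (K D n) R (Cone n)" for n
      unfolding K_def
    proof (rule submodule_prod[OF I.mod N.mod])
      show "submodule (I.van D n) R (I.Sec n)" using sI by (simp add: I.subcomplex_def)
      show "submodule (case n of 0 \<Rightarrow> {\<zero>\<^bsub>J.Sec 0\<^esub>} | Suc k \<Rightarrow> J.van (D \<inter> U) k) R (N n)"
        using sJ N.X.carrier_is_submodule[of 0] by (cases n) (auto simp: J.subcomplex_def)
    qed
    fix n z assume "z \<in> K D n"
    then obtain x y where z: "z = (x, y)" "x \<in> I.van D n" and y: "y \<in> (case n of 0 \<Rightarrow> {\<zero>\<^bsub>J.Sec 0\<^esub>} | Suc k \<Rightarrow> J.van (D \<inter> U) k)"
      by (auto simp: K_def)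
    have "dN n y \<in> J.van (D \<inter> U) n"
      using y J.sub_d[OF sJ] J.sub_zero[OF sJ] by (cases n) auto
    then show "dC n z \<in> K D (Suc n)"
      using z T_van[OF z(2)] J.sub_minus[OF sJ] I.sub_d[OF sI] by (auto simp: K_def dC_def)
  qed
qed

lemma K_Un: "K (D \<union> D') n = K D n \<inter> K D' n"
proof -
  have "(D \<union> D') \<inter> U = (D \<inter> U) \<union> (D' \<inter> U)" by blast
  then show ?thesis by (cases n) (auto simp: K_def I.van_Un J.van_Un)
qed

lemma K_Int:
  assumes D: "down_in Q D" and D': "down_in Q D'"
  shows "z \<in> K (D \<inter> D') n \<longleftrightarrow> (\<exists>a\<in>K D n. \<exists>b\<in>K D' n. z = a \<oplus>\<^bsub>Cone n\<^esub> b)"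
proof -
  have du: "down_in U (D \<inter> U)" "down_in U (D' \<inter> U)" using D D' UQ by (auto simp: down_in_def)
  have eq: "D \<inter> D' \<inter> U = (D \<inter> U) \<inter> (D' \<inter> U)" by blast
  obtain x y where z: "z = (x, y)" by (cases z)
  have 1: "x \<in> I.van (D \<inter> D') n \<longleftrightarrow> (\<exists>a\<in>I.van D n. \<exists>b\<in>I.van D' n. x = a \<oplus>\<^bsub>I.Sec n\<^esub> b)"
    by (rule I.van_Int[OF D D'])
  have 2: "y \<in> (case n of 0 \<Rightarrow> {\<zero>\<^bsub>J.Sec 0\<^esub>} | Suc k \<Rightarrow> J.van (D \<inter> D' \<inter> U) k) \<longleftrightarrow>
    (\<exists>a\<in>(case n of 0 \<Rightarrow> {\<zero>\<^bsub>J.Sec 0\<^esub>} | Suc k \<Rightarrow> J.van (D \<inter> U) k).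
     \<exists>b\<in>(case n of 0 \<Rightarrow> {\<zero>\<^bsub>J.Sec 0\<^esub>} | Suc k \<Rightarrow> J.van (D' \<inter> U) k). y = a \<oplus>\<^bsub>N n\<^esub> b)"
  proof (cases n)
    case 0
    have "\<zero>\<^bsub>N 0\<^esub> \<oplus>\<^bsub>N 0\<^esub> \<zero>\<^bsub>N 0\<^esub> = \<zero>\<^bsub>N 0\<^esub>" by (rule N.X.M.l_zero) (rule N.X.M.zero_closed)
    then have z: "\<zero>\<^bsub>J.Sec 0\<^esub> \<oplus>\<^bsub>N 0\<^esub> \<zero>\<^bsub>J.Sec 0\<^esub> = \<zero>\<^bsub>J.Sec 0\<^esub>" unfolding N_simps .
    show ?thesis unfolding 0 nat.case by (simp only: bex_simps singleton_iff z simp_thms)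
  next
    case (Suc k)
    then show ?thesis using J.van_Int[OF du] unfolding eq by simp
  qed
  show ?thesis
    unfolding z K_def mem_Times_iff fst_conv snd_conv 1 2 by auto
qed

lemma Cone_minus:
  "x \<in> carrier (I.Sec n) \<Longrightarrow> x' \<in> carrier (I.Sec n) \<Longrightarrow> y \<in> carrier (N n) \<Longrightarrow> y' \<in> carrier (N n) \<Longrightarrow>
    (x, y) \<ominus>\<^bsub>Cone n\<^esub> (x', y') = (x \<ominus>\<^bsub>I.Sec n\<^esub> x', y \<ominus>\<^bsub>N n\<^esub> y')"
  using prod_module_minus[OF I.mod N.mod] .

text \<open>At \<open>h\<close> in \<open>U\<close> the cone compares resolutions of
  \<open>G h\<close> and \<open>F h\<close> over the isomorphism \<open>e h\<close>. At
  \<open>h\<close> outside \<open>U\<close> the second component disappears and the first resolves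
  the zero module. Both cones are exact, and \<open>extend_at\<close> lifts the primitives to
  sections.\<close>

lemma acyc_K_below:
  assumes h: "h \<in> Q"
  shows "C.acyc n (K (I.below h))"
proof -
  have U_below: "I.below h \<inter> U = J.below h" using UQ by auto
  have below_U: "J.below h = {}" if "h \<notin> U" using up that h by auto
  have bdC: "dC k (x', y') \<in> bd Cone dC (Suc k)" if "x' \<in> carrier (I.Sec k)" "y' \<in> carrier (N k)" for k x' y'
    using that by (intro C.d_in_bd) simp
  have main: "\<exists>b\<in>bd Cone dC n. (x, y) \<ominus>\<^bsub>Cone n\<^esub> b \<in> K (I.below h) n"
    if x: "x \<in> carrier (I.Sec n)" and y: "y \<in> carrier (N n)" and dx: "I.\<delta> n x \<in> I.van (I.below h) (Suc n)"
      and dy: "T n x \<ominus>\<^bsub>J.Sec n\<^esub> dN n y \<in> J.van (J.below h) n" for x y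
  proof (cases n)
    case 0
    obtain g where g: "g \<in> carrier (ob G h)" "x h = aug I h g" using I.sec_exact_0[OF h] x dx 0 by auto
    note mG = presheaf_module[OF cores_F[OF I.res] h]
    have augI: "aug I h \<zero>\<^bsub>ob G h\<^esub> = \<zero>\<^bsub>ob (cx I 0) h\<^esub>"
      using mod_hom_zero[OF mG I.module_at[OF h] nat_trans_hom[OF cores_aug[OF I.res] h]] .
    \<comment> \<open>In \<open>U\<close> the second component forces \<open>e h g\<close> to be
      zero and \<open>e h\<close> is injective; elsewhere \<open>G h\<close> is zero.\<close>
    have "g = \<zero>\<^bsub>ob G h\<^esub>"
    proof (cases "h \<in> U")
      case True
      note mF = presheaf_module[OF cores_F[OF J.res] True]
      have "T 0 x \<in> J.van (J.below h) 0" using dy y x 0 by simp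
      then have "t 0 h (x h) = \<zero>\<^bsub>ob (cx J 0) h\<^esub>" using True by (simp add: J.van_below T_at)
      then have "aug J h (e h g) = \<zero>\<^bsub>ob (cx J 0) h\<^esub>" using map g True by (simp add: resolution_map_def)
      then have "e h g = \<zero>\<^bsub>ob F h\<^esub>"
        using mod_hom_inj_iff[OF mF J.module_at[OF True] nat_trans_hom[OF cores_aug[OF J.res] True]]
          cores_aug_inj[OF J.res True] nat_trans_closed[OF e(1) True g(1)] by blast
      then show ?thesis
        using mod_hom_inj_iff[OF mG mF nat_trans_hom[OF e(1) True]] e(2)[OF True] g(1) by (auto simp: bij_betw_def)
    qed (use g outside[OF h] in auto)
    then have "x \<in> I.van (I.below h) 0" using g augI x 0 by (simp add: I.van_below[OF h])
    moreover have "(x, y) \<ominus>\<^bsub>Cone 0\<^esub> \<zero>\<^bsub>Cone 0\<^esub> = (x, y)" using x y 0 C.X.M.a_minus_zero[of "(x, y)" 0] by simp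
    ultimately show ?thesis using y 0 C.bdD(2)[of 0] by (intro bexI[of _ "\<zero>\<^bsub>Cone n\<^esub>"]) (auto simp: K_def)
  next
    case (Suc k)
    obtain x1 where x1: "x1 \<in> carrier (I.Sec k)" "x \<ominus>\<^bsub>I.Sec (Suc k)\<^esub> I.\<delta> k x1 \<in> I.van (I.below h) (Suc k)"
      using I.sec_exact_Suc[OF h x[unfolded Suc] dx[unfolded Suc]] .
    have y': "y \<in> carrier (J.Sec k)" using y Suc by simp
    \<comment> \<open>What remains after the first component has been made exact by
      \<open>x1\<close>. At a point of \<open>U\<close> it is a cocycle of the second resolution
      (\<open>dy1\<close> below).\<close>
    let ?y1 = "T k x1 \<ominus>\<^bsub>J.Sec k\<^esub> y"
    have "\<exists>x'\<in>carrier (I.Sec k). \<exists>y'\<in>carrier (N k). x \<ominus>\<^bsub>I.Sec (Suc k)\<^esub> I.\<delta> k x' \<in> I.van (I.below h) (Suc k) \<and>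
      y \<ominus>\<^bsub>J.Sec k\<^esub> (T k x' \<ominus>\<^bsub>J.Sec k\<^esub> dN k y') \<in> J.van (J.below h) k"
    proof (cases "h \<in> U")
      case False
      have "y \<ominus>\<^bsub>J.Sec k\<^esub> (T k x1 \<ominus>\<^bsub>J.Sec k\<^esub> dN k \<zero>\<^bsub>N k\<^esub>) \<in> J.van (J.below h) k"
        unfolding below_U[OF False] J.van_def using N.d_zero[of k] y' x1 by auto
      then show ?thesis using x1 N.X.M.zero_closed by blast
    next
      case True
      have xh: "x h = I.\<delta> k x1 h" using x1 I.minus_at_zero_iff x h Suc by (auto simp: I.van_below[OF h])
      have "T (Suc k) x h = J.\<delta> k y h"
        using dy Suc J.minus_at_zero_iff[of "T (Suc k) x" "Suc k" "J.\<delta> k y" h] True x y' by (simp add: J.van_below)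
      moreover have "T (Suc k) x h = T (Suc k) (I.\<delta> k x1) h" using True xh by (simp only: T_at)
      then have "T (Suc k) x h = J.\<delta> k (T k x1) h" unfolding T.h_d[OF x1(1)] .
      ultimately have dy1: "J.\<delta> k ?y1 \<in> J.van (J.below h) (Suc k)"
        using True x1 y' J.minus_at_zero_iff[of "J.\<delta> k (T k x1)" "Suc k" "J.\<delta> k y" h]
        by (simp add: J.van_below J.d_minus)
      have y1: "?y1 \<in> carrier (J.Sec k)" using x1 y' by simp
      show ?thesis
      proof (cases k)
        case 0
        \<comment> \<open>In degree \<open>0\<close> the remaining cocycle is an element of
          \<open>F h\<close>, hence comes from \<open>G h\<close>. It is removed by changing
          \<open>x1\<close> by a section \<open>s\<close> with that value, which is a cocycle at
          \<open>h\<close> and leaves the first component intact.\<close>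
        obtain f where f: "f \<in> carrier (ob F h)" "?y1 h = aug J h f"
          using J.sec_exact_0[OF True] y1 dy1 0 by blast
        obtain g where g: "g \<in> carrier (ob G h)" "f = e h g" using e(2)[OF True] f by (auto simp: bij_betw_def)
        obtain s where s: "s \<in> carrier (I.Sec 0)" "s h = aug I h g"
          using I.extend_at[OF h nat_trans_closed[OF cores_aug[OF I.res] h g(1)]] .
        have "I.\<delta> 0 s \<in> I.van (I.below h) (Suc 0)"
          using s h cores_dif_aug[OF I.res h g(1)] by (simp add: I.van_below I.\<delta>_at)
        moreover have "x \<ominus>\<^bsub>I.Sec (Suc 0)\<^esub> I.\<delta> 0 (x1 \<ominus>\<^bsub>I.Sec 0\<^esub> s) = (x \<ominus>\<^bsub>I.Sec (Suc 0)\<^esub> I.\<delta> 0 x1) \<oplus>\<^bsub>I.Sec (Suc 0)\<^esub> I.\<delta> 0 s"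
          unfolding I.d_minus[OF x1(1)[unfolded 0] s(1)]
          using x[unfolded Suc 0] I.d_closed[OF x1(1)[unfolded 0]] I.d_closed[OF s(1)] by algebra
        ultimately have 1: "x \<ominus>\<^bsub>I.Sec (Suc 0)\<^esub> I.\<delta> 0 (x1 \<ominus>\<^bsub>I.Sec 0\<^esub> s) \<in> I.van (I.below h) (Suc 0)"
          using x1(2)[unfolded 0] I.van_add[of "I.below h"] by auto
        have "T 0 s h = aug J h f" using map s g True by (simp add: T_at resolution_map_def)
        then have "?y1 h = T 0 s h" using f by simp
        moreover have "y \<ominus>\<^bsub>J.Sec 0\<^esub> (T 0 (x1 \<ominus>\<^bsub>I.Sec 0\<^esub> s) \<ominus>\<^bsub>J.Sec 0\<^esub> dN 0 \<zero>\<^bsub>N 0\<^esub>) = T 0 s \<ominus>\<^bsub>J.Sec 0\<^esub> ?y1"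
        proof -
          have *: "y \<ominus>\<^bsub>J.Sec 0\<^esub> (a \<ominus>\<^bsub>J.Sec 0\<^esub> b) = b \<ominus>\<^bsub>J.Sec 0\<^esub> (a \<ominus>\<^bsub>J.Sec 0\<^esub> y)"
            if "a \<in> carrier (J.Sec 0)" "b \<in> carrier (J.Sec 0)" for a b
            using that y'[unfolded 0] by algebra
          show ?thesis using x1 s y' 0 by (simp add: T.h_minus *)
        qed
        ultimately have 2: "y \<ominus>\<^bsub>J.Sec 0\<^esub> (T 0 (x1 \<ominus>\<^bsub>I.Sec 0\<^esub> s) \<ominus>\<^bsub>J.Sec 0\<^esub> dN 0 \<zero>\<^bsub>N 0\<^esub>) \<in> J.van (J.below h) 0"
          using True s y1 0 J.minus_at_zero_iff[of "T 0 s" 0 ?y1 h] by (simp add: J.van_below)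
        show ?thesis unfolding 0
          using 1 2 x1(1)[unfolded 0] s(1) by (intro bexI[of _ "x1 \<ominus>\<^bsub>I.Sec 0\<^esub> s"] bexI[of _ "\<zero>\<^bsub>N 0\<^esub>"]) auto
      next
        case (Suc l)
        \<comment> \<open>In positive degree the remaining cocycle has a primitive, which is
          absorbed by the second coordinate.\<close>
        obtain v where v: "v \<in> carrier (J.Sec l)" "?y1 \<ominus>\<^bsub>J.Sec k\<^esub> J.\<delta> l v \<in> J.van (J.below h) k"
          using J.sec_exact_Suc[OF True y1[unfolded Suc] dy1[unfolded Suc]] unfolding Suc .
        have *: "y \<ominus>\<^bsub>J.Sec k\<^esub> (a \<ominus>\<^bsub>J.Sec k\<^esub> b) = \<zero>\<^bsub>J.Sec k\<^esub> \<ominus>\<^bsub>J.Sec k\<^esub> ((a \<ominus>\<^bsub>J.Sec k\<^esub> y) \<ominus>\<^bsub>J.Sec k\<^esub> b)"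
          if "a \<in> carrier (J.Sec k)" "b \<in> carrier (J.Sec k)" for a b
          using that y' by algebra
        have "y \<ominus>\<^bsub>J.Sec k\<^esub> (T k x1 \<ominus>\<^bsub>J.Sec k\<^esub> J.\<delta> l v) = \<zero>\<^bsub>J.Sec k\<^esub> \<ominus>\<^bsub>J.Sec k\<^esub> (?y1 \<ominus>\<^bsub>J.Sec k\<^esub> J.\<delta> l v)"
          using x1 v Suc by (intro *) auto
        moreover have "\<zero>\<^bsub>J.Sec k\<^esub> \<ominus>\<^bsub>J.Sec k\<^esub> (?y1 \<ominus>\<^bsub>J.Sec k\<^esub> J.\<delta> l v) \<in> J.van (J.below h) k"
          by (intro J.van_minus J.van_zero v(2)) auto
        ultimately show ?thesis using x1 v Suc by (intro bexI[of _ x1] bexI[of _ v]) auto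
      qed
    qed
    then obtain x' y1 where w: "x' \<in> carrier (I.Sec k)" "y1 \<in> carrier (N k)"
      "x \<ominus>\<^bsub>I.Sec (Suc k)\<^esub> I.\<delta> k x' \<in> I.van (I.below h) (Suc k)"
      "y \<ominus>\<^bsub>J.Sec k\<^esub> (T k x' \<ominus>\<^bsub>J.Sec k\<^esub> dN k y1) \<in> J.van (J.below h) k" by blast
    have "dN k y1 \<in> carrier (J.Sec k)" using N.d_closed[OF w(2)] by simp
    then have "(x, y) \<ominus>\<^bsub>Cone n\<^esub> dC k (x', y1) \<in> K (I.below h) n"
      using w x y' Suc Cone_minus[of x "Suc k" "I.\<delta> k x'" y "T k x' \<ominus>\<^bsub>J.Sec k\<^esub> dN k y1"]
      by (simp add: dC_def K_def U_below)
    then show ?thesis using bdC[OF w(1,2)] Suc by blast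
  qed
  show ?thesis
    unfolding C.acyc_def
  proof (intro ballI impI)
    fix z assume "z \<in> carrier (Cone n)" "dC n z \<in> K (I.below h) (Suc n)"
    then show "\<exists>b\<in>bd Cone dC n. z \<ominus>\<^bsub>Cone n\<^esub> b \<in> K (I.below h) n"
      using main[of "fst z" "snd z"] by (cases z) (auto simp: dC_def K_def U_below)
  qed
qed

text \<open>Split off a maximal element \<open>p\<close>: \<open>D\<close> is the union of
  \<open>D - {p}\<close> and the principal down-set of \<open>p\<close>, and \<open>D - {p}\<close>
  and the intersection are smaller down-sets. Mayer--Vietoris thus spreads exactness from principal
  down-sets to all.\<close>

lemma acyc_K: "down_in Q D \<Longrightarrow> C.acyc n (K D)"
proof (induction "card D" arbitrary: D n rule: less_induct)
  case less
  have DQ: "D \<subseteq> Q" using less.prems by (auto simp: down_in_def)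
  then have fD: "finite D" using fin finite_subset by blast
  show ?case
  proof (cases "D = {}")
    case True
    have "z \<ominus>\<^bsub>Cone n\<^esub> \<zero>\<^bsub>Cone n\<^esub> \<in> K {} n" if "z \<in> carrier (Cone n)" for z
      using that C.X.M.a_minus_zero[OF that] by (cases n) (auto simp: K_def I.van_def J.van_def)
    then show ?thesis unfolding C.acyc_def True using C.bdD(2) by blast
  next
    case False
    then obtain p where p: "p \<in> D" "\<And>q. q \<in> D \<Longrightarrow> \<not> p < q"
      using finite_has_maximal[OF fD False] by (metis order_less_le)
    let ?A = "D - {p}" and ?B = "I.below p"
    have dA: "down_in Q ?A" using less.prems p by (auto simp: down_in_def order_less_le)
    have dB: "down_in Q ?B" by (auto simp: down_in_def)
    have BD: "?B \<subseteq> D" using less.prems p by (auto simp: down_in_def)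
    have eq: "D = ?A \<union> ?B" using BD p DQ by auto
    have cA: "card ?A < card D" using p fD by (meson card_Diff1_less)
    have cAB: "card (?A \<inter> ?B) < card D"
      using cA card_mono[of ?A "?A \<inter> ?B"] fD by auto
    have dAB: "down_in Q (?A \<inter> ?B)" using dA dB unfolding down_in_def by blast
    have AQ: "?A \<subseteq> Q" and BQ: "?B \<subseteq> Q" using DQ by blast+
    note sA = subcomplex_K[OF AQ] subcomplex_K[OF BQ]
    have pQ: "p \<in> Q" using p DQ by blast
    have "C.acyc n (\<lambda>n. K ?A n \<inter> K ?B n)"
    proof (cases n)
      case 0
      then show ?thesis using C.acyc_0_inter less.hyps[OF cA dA] acyc_K_below[OF pQ] by blast
    next
      case (Suc k)
      show ?thesis unfolding Suc
        by (rule C.acyc_Suc_inter[OF sA less.hyps[OF cA dA] acyc_K_below[OF pQ] less.hyps[OF cAB dAB] K_Int[OF dA dB]])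
    qed
    moreover have "K D = (\<lambda>n. K ?A n \<inter> K ?B n)"
      by (rule ext) (rule K_Un[of ?A ?B, folded eq])
    ultimately show ?thesis by simp
  qed
qed

text \<open>For \<open>D = Q\<close> the cone itself is exact. Exactness at \<open>(x, y)\<close>,
  where \<open>dN n y\<close> is the image of \<open>x\<close>, gives injectivity on cohomology;
  exactness at \<open>(0, y)\<close>, one degree higher, gives surjectivity.\<close>

theorem derived_map_iso: "derived_map U J n t \<in> mod_iso R (derived_lim Q I n) (derived_lim U J n)"
proof -
  have K: "K Q m = {\<zero>\<^bsub>Cone m\<^esub>}" for m
    using UQ by (cases m) (auto simp: K_def I.van_top Int_absorb1 J.van_top)
  have ac: "z \<in> bd Cone dC m" if z: "z \<in> carrier (Cone m)" "dC m z = \<zero>\<^bsub>Cone (Suc m)\<^esub>" for m z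
  proof -
    have aQ: "C.acyc m (K Q)" by (rule acyc_K) (auto simp: down_in_def)
    have dz: "dC m z \<in> K Q (Suc m)" unfolding K z(2) by blast
    obtain b where b: "b \<in> bd Cone dC m" "b \<in> carrier (Cone m)" "dC m b = \<zero>\<^bsub>Cone (Suc m)\<^esub>"
      "z \<ominus>\<^bsub>Cone m\<^esub> b \<in> K Q m"
      using C.acycD[OF aQ z(1) dz] .
    have "z \<ominus>\<^bsub>Cone m\<^esub> b = \<zero>\<^bsub>Cone m\<^esub>" using b(4) unfolding K by blast
    then show ?thesis using C.X.M.minus_eq_zero_iff[OF z(1) b(2)] b(1) by blast
  qed
  show ?thesis
    unfolding derived_map_eq_coho_map derived_lim_eq_coho
  proof (rule T.coho_map_iso)
    fix x assume x: "x \<in> carrier (I.Sec n)" "I.\<delta> n x = \<zero>\<^bsub>I.Sec (Suc n)\<^esub>" "T n x \<in> bd J.Sec J.\<delta> n"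
    then obtain y where y: "y \<in> carrier (N n)" "T n x = dN n y"
      by (cases n) (auto simp: bd_def)
    have "dN n y \<in> carrier (J.Sec n)" using N.d_closed[OF y(1)] by simp
    then have "dC n (x, y) = \<zero>\<^bsub>Cone (Suc n)\<^esub>" using x y by (simp add: dC_def)
    then have "(x, y) \<in> bd Cone dC n" using ac[of "(x, y)" n] x y by auto
    then show "x \<in> bd I.Sec I.\<delta> n" by (cases n) (auto simp: bd_def dC_def)
  next
    fix y assume y: "y \<in> carrier (J.Sec n)" "J.\<delta> n y = \<zero>\<^bsub>J.Sec (Suc n)\<^esub>"
    have "dC (Suc n) (\<zero>\<^bsub>I.Sec (Suc n)\<^esub>, y) = \<zero>\<^bsub>Cone (Suc (Suc n))\<^esub>" using y by (simp add: dC_def)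
    then obtain x' y' where w: "x' \<in> carrier (I.Sec n)" "y' \<in> carrier (N n)"
      "I.\<delta> n x' = \<zero>\<^bsub>I.Sec (Suc n)\<^esub>" "y = T n x' \<ominus>\<^bsub>J.Sec n\<^esub> dN n y'"
      using ac[of "(\<zero>\<^bsub>I.Sec (Suc n)\<^esub>, y)" "Suc n"] y by (auto simp: bd_def dC_def)
    have dN: "dN n y' \<in> carrier (J.Sec n)" using N.d_closed[OF w(2)] by simp
    have b: "dN n y' \<in> bd J.Sec J.\<delta> n" using w(2) by (cases n) (auto simp: bd_def)
    have "(T n x' \<ominus>\<^bsub>J.Sec n\<^esub> dN n y') \<ominus>\<^bsub>J.Sec n\<^esub> T n x' = \<zero>\<^bsub>J.Sec n\<^esub> \<ominus>\<^bsub>J.Sec n\<^esub> dN n y'"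
      using dN T.h_closed[OF w(1)] by algebra
    then have "y \<ominus>\<^bsub>J.Sec n\<^esub> T n x' \<in> bd J.Sec J.\<delta> n" using w(4) J.bdD(5)[OF J.bdD(2) b] by simp
    then show "\<exists>x\<in>carrier (I.Sec n). I.\<delta> n x = \<zero>\<^bsub>I.Sec (Suc n)\<^esub> \<and> y \<ominus>\<^bsub>J.Sec n\<^esub> T n x \<in> bd J.Sec J.\<delta> n"
      using w by blast
  qed
qed

end

subsection \<open>Pure dual CL-shellable posets\<close>

lemma linear_order_finite_max:
  assumes "finite T" "T \<noteq> {}" "linear_order_on S r" "T \<subseteq> S"
  shows "\<exists>h\<in>T. \<forall>x\<in>T. (x, h) \<in> r"
  using assms(1,2,4)
proof (induction T rule: finite_ne_induct)
  case (singleton x)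
  then show ?case using assms(3) by (auto simp: order_on_defs refl_on_def)
next
  case (insert x T)
  then obtain h where h: "h \<in> T" "\<forall>y\<in>T. (y, h) \<in> r" by auto
  have r: "trans r" "total_on S r" "refl_on S r" using assms(3) by (auto simp: order_on_defs)
  show ?case
  proof (cases "(x, h) \<in> r")
    case True
    then show ?thesis using h by auto
  next
    case False
    have "x \<noteq> h" using insert.hyps h by auto
    then have "(h, x) \<in> r" using r(2) False insert.prems h(1) by (auto simp: total_on_def)
    moreover have "(x, x) \<in> r" using r(3) insert.prems by (auto simp: refl_on_def)
    ultimately show ?thesis using h(2) transD[OF r(1), of _ h x] by (intro bexI[of _ x]) auto
  qed
qed

locale shellable =
  fixes P :: "'p::order set" and L :: "'p list \<Rightarrow> 'p rel"
  assumes CL: "dual_CL_shellable P L" and pure: "pure_poset P" and finP: "finite P"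
begin

abbreviation "bt \<equiv> bot_of P"
abbreviation "tp \<equiv> top_of P"
abbreviation "rk \<equiv> poset_rank P"

abbreviation "\<C> \<equiv> unref_chains_to P tp"

lemma bounded: "bounded_poset P"
  using CL by (simp add: dual_CL_shellable_def)

lemma bt: "bt \<in> P" "\<And>p. p \<in> P \<Longrightarrow> bt \<le> p"
proof -
  obtain b where "b \<in> P" "\<forall>p\<in>P. b \<le> p" using bounded by (auto simp: bounded_poset_def)
  then have "bt = b" unfolding bot_of_def by (intro Least_equality) auto
  then show "bt \<in> P" "\<And>p. p \<in> P \<Longrightarrow> bt \<le> p" using \<open>b \<in> P\<close> \<open>\<forall>p\<in>P. b \<le> p\<close> by auto
qed

lemma tp: "tp \<in> P" "\<And>p. p \<in> P \<Longrightarrow> p \<le> tp"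
proof -
  obtain b where "b \<in> P" "\<forall>p\<in>P. p \<le> b" using bounded by (auto simp: bounded_poset_def)
  then have "tp = b" unfolding top_of_def by (intro Greatest_equality) auto
  then show "tp \<in> P" "\<And>p. p \<in> P \<Longrightarrow> p \<le> tp" using \<open>b \<in> P\<close> \<open>\<forall>p\<in>P. p \<le> b\<close> by auto
qed

lemma coversD: "covers P p q \<Longrightarrow> p \<in> P \<and> q \<in> P \<and> p < q"
  by (simp add: covers_def)

lemma lower_covers_iff: "x \<in> lower_covers P q \<longleftrightarrow> covers P x q"
  by (simp add: lower_covers_def)

lemma cover_above:
  assumes "p \<in> P" "q \<in> P" "p < q"
  obtains x where "covers P x q" "p \<le> x"
proof -
  let ?S = "{x \<in> P. p \<le> x \<and> x < q}"
  have "finite ?S" "?S \<noteq> {}" using finP assms by auto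
  then obtain x where x: "x \<in> ?S" "\<forall>y\<in>?S. x \<le> y \<longrightarrow> x = y"
    using finite_has_maximal[of ?S] by blast
  have "\<not> (x < r \<and> r < q)" if r: "r \<in> P" for r
  proof
    assume "x < r \<and> r < q"
    then have "r \<in> ?S" "x \<le> r" "x \<noteq> r" using x(1) r by auto
    then show False using x(2) by blast
  qed
  then have "covers P x q" unfolding covers_def using x(1) assms(2) by blast
  then show thesis using that x by blast
qed

lemma unref_Cons:
  "c \<in> unref_chains_to P p \<Longrightarrow> covers P x (hd c) \<Longrightarrow> x # c \<in> unref_chains_to P p"
  by (cases c) (auto simp: unref_chains_to_def covers_def)

lemma unref_ne: "c \<in> unref_chains_to P p \<Longrightarrow> c \<noteq> []"
  by (simp add: unref_chains_to_def)

lemma unref_hd: "c \<in> unref_chains_to P p \<Longrightarrow> hd c \<in> P"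
  by (cases c) (auto simp: unref_chains_to_def)

lemma chain_length_Cons: "c \<in> unref_chains_to P p \<Longrightarrow> chain_length (x # c) = Suc (chain_length c)"
  by (cases c) (auto simp: unref_chains_to_def chain_length_def)

lemma unref_tp: "[tp] \<in> \<C>"
  by (simp add: unref_chains_to_def tp)

lemma unref_extend:
  assumes "c \<in> unref_chains_to P p"
  obtains b where "b @ c \<in> unref_chains_to P p" "hd (b @ c) = bt"
proof -
  have "\<exists>b. b @ c \<in> unref_chains_to P p \<and> hd (b @ c) = bt"
    using assms
  proof (induction "card {q\<in>P. q < hd c}" arbitrary: c rule: less_induct)
    case less
    show ?case
    proof (cases "hd c = bt")
      case True
      then show ?thesis using less.prems by (intro exI[of _ "[]"]) simp
    next
      case False
      have "bt < hd c" using bt(2)[OF unref_hd[OF less.prems]] False by simp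
      then obtain x where x: "covers P x (hd c)" using cover_above bt(1) unref_hd[OF less.prems] by metis
      have "{q\<in>P. q < x} \<subset> {q\<in>P. q < hd c}" using coversD[OF x] by auto
      then have "card {q\<in>P. q < hd (x # c)} < card {q\<in>P. q < hd c}" using finP by (simp add: psubset_card_mono)
      then obtain b where "b @ (x # c) \<in> unref_chains_to P p" "hd (b @ (x # c)) = bt"
        using less.hyps unref_Cons[OF less.prems x] by blast
      then show ?thesis by (intro exI[of _ "b @ [x]"]) simp
    qed
  qed
  then show thesis using that by blast
qed

lemma unref_sorted: "c \<in> unref_chains_to P p \<Longrightarrow> sorted_wrt (<) c"
proof -
  assume c: "c \<in> unref_chains_to P p"
  then have "successively (<) c"
    by (auto simp: unref_chains_to_def covers_def elim!: successively_mono)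
  then show ?thesis by (subst (asm) successively_conv_sorted_wrt) (auto simp: transp_on_def)
qed

text \<open>An element comparable to the whole chain moves up past one member after another, since
  it cannot lie between a member and its cover, and finally passes the last one.\<close>

lemma unref_gap:
  "successively (covers P) c \<Longrightarrow> c \<noteq> [] \<Longrightarrow> z \<in> P \<Longrightarrow> (\<And>y. y \<in> set c \<Longrightarrow> y < z \<or> z < y) \<Longrightarrow>
    hd c < z \<Longrightarrow> z < last c \<Longrightarrow> False"
proof (induction c rule: induct_list012)
  case (3 x y c)
  have "\<not> z < y" using 3(3,7) 3(5) by (auto simp: covers_def)
  then have "y < z" using 3(6)[of y] by auto
  then show False using 3 by auto
qed auto

text \<open>Purity is a statement about maximal chains as sets; this makes it available for
  unrefinable lists from bottom to top.\<close>

lemma unref_maxchain: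
  assumes c: "c \<in> \<C>" and hd: "hd c = bt"
  shows "pred_on.maxchain P (<) (set c)"
  unfolding pred_on.maxchain_def pred_on.chain_def
proof (intro conjI notI)
  have suc: "successively (covers P) c" "c \<noteq> []" "set c \<subseteq> P" "last c = tp"
    using c by (auto simp: unref_chains_to_def)
  show "set c \<subseteq> P" by fact
  show "\<forall>x\<in>set c. \<forall>y\<in>set c. (<)\<^sup>=\<^sup>= x y \<or> (<)\<^sup>=\<^sup>= y x"
    using unref_sorted[OF c] by (auto simp: sorted_wrt_iff_nth_less in_set_conv_nth) (metis linorder_neqE_nat)
  assume "\<exists>S. (S \<subseteq> P \<and> (\<forall>x\<in>S. \<forall>y\<in>S. (<)\<^sup>=\<^sup>= x y \<or> (<)\<^sup>=\<^sup>= y x)) \<and> set c \<subset> S"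
  then obtain S z where S: "S \<subseteq> P" "\<forall>x\<in>S. \<forall>y\<in>S. (<)\<^sup>=\<^sup>= x y \<or> (<)\<^sup>=\<^sup>= y x" "set c \<subseteq> S" "z \<in> S" "z \<notin> set c"
    by blast
  have zP: "z \<in> P" using S by blast
  have cmp: "y < z \<or> z < y" if "y \<in> set c" for y
  proof -
    have "(<)\<^sup>=\<^sup>= y z \<or> (<)\<^sup>=\<^sup>= z y" using S(2,3,4) that by blast
    then show ?thesis using S(5) that by auto
  qed
  have "hd c \<in> set c" "last c \<in> set c" using suc(2) by auto
  then have "hd c \<noteq> z" "z \<noteq> last c" using S(5) by auto
  then have "hd c < z" "z < last c" using bt(2)[OF zP] tp(2)[OF zP] hd suc(4) by (simp_all add: order_less_le)
  then show False using unref_gap[OF suc(1,2) zP cmp] by blast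
qed

text \<open>Purity enters here. The common length of the chains from bottom to top is the rank
  because every chain ending at the top extends down to the bottom, and because the rank function is
  monotone.\<close>

lemma unref_full_length:
  assumes c: "c \<in> \<C>" and hd: "hd c = bt"
  shows "chain_length c = rk"
proof -
  have len: "length b = length c" if b: "b \<in> \<C>" "hd b = bt" for b
  proof -
    have "card (set b) = card (set c)"
      using pure unref_maxchain[OF b] unref_maxchain[OF c hd] unfolding pure_poset_def by blast
    moreover have "distinct x" if "x \<in> \<C>" for x
      using unref_sorted[OF that] by (induction x) auto
    ultimately show ?thesis using b c by (simp add: distinct_card)
  qed
  have le: "chain_length b \<le> chain_length c" if b: "b \<in> \<C>" for b
  proof -
    obtain b' where "b' @ b \<in> \<C>" "hd (b' @ b) = bt" using unref_extend[OF b] .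
    then show ?thesis using len[of "b' @ b"] by (simp add: chain_length_def)
  qed
  have filt: "filtered_poset P" using bounded by (simp add: bounded_poset_def)
  have rank_tp: "elem_rank P tp = chain_length c"
    unfolding elem_rank_def
    by (rule Max_eqI) (use filt tp c le in \<open>auto simp: filtered_poset_def\<close>)
  have "elem_rank P p \<le> elem_rank P tp" if "p \<in> P" for p
  proof (cases "p = tp")
    case False
    then have "p < tp" using tp(2)[OF that] by simp
    then have "elem_rank P p < elem_rank P tp"
      using filt tp(1) that unfolding filtered_poset_def strict_mono_on_def by blast
    then show ?thesis by simp
  qed simp
  then have "rk = elem_rank P tp"
    unfolding poset_rank_def using finP tp(1) by (intro Max_eqI) auto
  then show ?thesis using rank_tp by simp
qed

text \<open>Extended down to the bottom, \<open>x # c\<close> must reach length \<open>rk\<close>,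
  which leaves room for exactly one more element.\<close>

lemma coatom_of_rank_2:
  assumes c: "c \<in> \<C>" and len: "chain_length c + 2 = rk" and x: "covers P x (hd c)"
  shows "covers P bt x"
proof -
  have xc: "x # c \<in> \<C>" using unref_Cons[OF c x] .
  obtain b where b: "b @ (x # c) \<in> \<C>" "hd (b @ (x # c)) = bt" using unref_extend[OF xc] .
  have "chain_length (b @ (x # c)) = rk" using unref_full_length[OF b] .
  then have "length b = 1" using len unref_ne[OF c] by (cases c) (auto simp: chain_length_def)
  then obtain y where "b = [y]" by (auto simp: length_Suc_conv)
  then show ?thesis using b by (auto simp: unref_chains_to_def)
qed

lemma not_atom:
  assumes c: "c \<in> \<C>" and len: "chain_length c + 2 \<le> rk"
  shows "\<not> covers P bt (hd c)" "hd c \<noteq> bt"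
proof -
  show "hd c \<noteq> bt" using unref_full_length[OF c] len by auto
  show "\<not> covers P bt (hd c)"
  proof
    assume "covers P bt (hd c)"
    then have "bt # c \<in> \<C>" using unref_Cons[OF c] by blast
    then have "chain_length (bt # c) = rk" using unref_full_length by simp
    then show False using len unref_ne[OF c] by (cases c) (auto simp: chain_length_def)
  qed
qed

definition segment :: "'p list \<Rightarrow> 'p set \<Rightarrow> bool" where
  "segment c T \<longleftrightarrow> ofilter (L c) T"

lemma well_order_L: "c \<in> \<C> \<Longrightarrow> well_order_on (lower_covers P (hd c)) (L c)"
  using CL by (simp add: dual_CL_shellable_def coatom_ordering_def)

lemma finite_lower_covers: "finite (lower_covers P p)"
  by (rule finite_subset[OF _ finP]) (auto simp: lower_covers_def covers_def)

lemma Field_L: "c \<in> \<C> \<Longrightarrow> Field (L c) = lower_covers P (hd c)"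
  using well_order_L well_order_on_Field by metis

lemma segment_subset: "c \<in> \<C> \<Longrightarrow> segment c T \<Longrightarrow> T \<subseteq> lower_covers P (hd c)"
  by (simp add: segment_def ofilter_def Field_L)

lemma segment_all: "c \<in> \<C> \<Longrightarrow> segment c (lower_covers P (hd c))"
  unfolding segment_def Field_L[symmetric] ofilter_def under_def by (auto simp: Field_def)

lemma segment_C_set: "c \<in> \<C> \<Longrightarrow> segment c (C_set P L c)"
  using CL by (simp add: dual_CL_shellable_def segment_def)

text \<open>Induction along the shelling order. The equation for \<open>T\<close> says that all
  earlier coatoms have been attached when \<open>h\<close> is, which is the situation of
  (CL2).\<close>

lemma segment_induct [consumes 2, case_names empty insert]:
  assumes c: "c \<in> \<C>" and T: "segment c T"
    and "\<Phi> {}"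
    and step: "\<And>T h. segment c T \<Longrightarrow> segment c (insert h T) \<Longrightarrow> h \<notin> T \<Longrightarrow> h \<in> lower_covers P (hd c) \<Longrightarrow>
      T = {h'. strictly_precedes (L c) h' h} \<Longrightarrow> \<Phi> T \<Longrightarrow> \<Phi> (insert h T)"
  shows "\<Phi> T"
  using T
proof (induction "card T" arbitrary: T)
  case 0
  then have "T = {}" using segment_subset[OF c] finite_lower_covers finite_subset by (metis card_0_eq)
  then show ?case using assms(3) by simp
next
  case (Suc n)
  let ?S = "lower_covers P (hd c)"
  have TS: "T \<subseteq> ?S" using segment_subset[OF c Suc.prems] .
  have fT: "finite T" using TS finite_lower_covers finite_subset by blast
  have lin: "linear_order_on ?S (L c)" using well_order_L[OF c] by (simp add: well_order_on_def)
  have anti: "antisym (L c)" using lin by (auto simp: order_on_defs)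
  have "T \<noteq> {}" using Suc.hyps(2) by auto
  \<comment> \<open>The last element of \<open>T\<close>; removing it leaves the segment of its
    strict predecessors.\<close>
  then obtain h where h: "h \<in> T" "\<forall>x\<in>T. (x, h) \<in> L c" using linear_order_finite_max[OF fT _ lin TS] by blast
  have T: "y \<in> T" if "x \<in> T" "(y, x) \<in> L c" for x y
    using Suc.prems that unfolding segment_def ofilter_def under_def by blast
  have sg: "segment c (T - {h})"
    using Suc.prems T h anti unfolding segment_def ofilter_def under_def antisym_def by blast
  have eq: "T - {h} = {h'. strictly_precedes (L c) h' h}"
    using T[OF h(1)] h(2) unfolding strictly_precedes_def by blast
  have cd: "card (T - {h}) = n" using Suc.hyps(2) h(1) fT by simp
  have ins: "insert h (T - {h}) = T" using h(1) by blast
  have sg': "segment c (insert h (T - {h}))" unfolding ins by (rule Suc.prems)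
  have "\<Phi> (insert h (T - {h}))"
    by (rule step[OF sg sg' _ _ eq Suc.hyps(1)[OF cd[symmetric] sg]]) (use h TS in blast)+
  then show ?case unfolding ins .
qed

definition Dn :: "'p set \<Rightarrow> 'p set" where
  "Dn T = {p\<in>P. \<exists>h\<in>T. p \<le> h}"

lemma Dn_insert: "Dn (insert h T) = Dn T \<union> {p\<in>P. p \<le> h}"
  by (auto simp: Dn_def)

lemma Dn_empty: "Dn {} = {}"
  by (simp add: Dn_def)

lemma Dn_lower_covers: "c \<in> \<C> \<Longrightarrow> Dn (lower_covers P (hd c)) = {p\<in>P. p < hd c}"
proof (intro equalityI subsetI)
  fix p assume c: "c \<in> \<C>" and "p \<in> {p\<in>P. p < hd c}"
  then have "p \<in> P" "p < hd c" by auto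
  then show "p \<in> Dn (lower_covers P (hd c))"
    using cover_above[OF _ unref_hd[OF c]] unfolding Dn_def lower_covers_def by blast
qed (auto simp: Dn_def lower_covers_iff dest!: coversD)

lemma Cons_in_\<C>: "c \<in> \<C> \<Longrightarrow> h \<in> lower_covers P (hd c) \<Longrightarrow> h # c \<in> \<C>"
  by (simp add: unref_Cons lower_covers_iff)

text \<open>This is where (CL2) enters.\<close>

lemma Dn_Int_below:
  assumes c: "c \<in> \<C>" and h: "h \<in> lower_covers P (hd c)" and T: "T = {h'. strictly_precedes (L c) h' h}"
  shows "Dn T \<inter> {p\<in>P. p \<le> h} = Dn (C_set P L (h # c))"
proof -
  let ?S = "lower_covers P (hd c)"
  have C: "C_set P L (h # c) = {x \<in> lower_covers P h. \<exists>h'\<in>?S. strictly_precedes (L c) h' h \<and> x < h'}"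
    using unref_ne[OF c] by (simp add: C_set_def chain_length_def)
  have TS: "h' \<in> ?S" if "strictly_precedes (L c) h' h" for h'
    using that Field_L[OF c] unfolding strictly_precedes_def by (auto simp: Field_def)
  have CL2: "\<exists>h''\<in>?S. \<exists>q\<in>lower_covers P h. strictly_precedes (L c) h'' h \<and> p \<le> q \<and> q < h''"
    if "strictly_precedes (L c) h' h" "p < h" "p < h'" "p \<in> P" for h' p
    using CL c h TS[OF that(1)] that unfolding dual_CL_shellable_def by blast
  show ?thesis
  proof (intro equalityI subsetI)
    fix p assume "p \<in> Dn T \<inter> {p\<in>P. p \<le> h}"
    then obtain h' where h': "p \<in> P" "p \<le> h" "strictly_precedes (L c) h' h" "p \<le> h'" by (auto simp: Dn_def T)
    have cov: "covers P h (hd c)" "covers P h' (hd c)" using h TS[OF h'(3)] by (auto simp: lower_covers_iff)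
    have ne: "h' \<noteq> h" using h'(3) by (simp add: strictly_precedes_def)
    \<comment> \<open>Distinct coatoms of the same element are incomparable, so \<open>p\<close>
      lies strictly below both, as (CL2) demands.\<close>
    have "\<not> h < h'" "\<not> h' < h" using cov by (auto simp: covers_def)
    then have "p < h" "p < h'" using h' ne by (auto simp: order_less_le)
    then obtain h'' q where "h'' \<in> ?S" "q \<in> lower_covers P h" "strictly_precedes (L c) h'' h" "p \<le> q" "q < h''"
      using CL2 h' by blast
    then show "p \<in> Dn (C_set P L (h # c))" unfolding C Dn_def using h'(1) by blast
  next
    fix p assume "p \<in> Dn (C_set P L (h # c))"
    then obtain x h' where "p \<in> P" "p \<le> x" "covers P x h" "strictly_precedes (L c) h' h" "x < h'"
      unfolding C by (auto simp: Dn_def lower_covers_iff)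
    then show "p \<in> Dn T \<inter> {p\<in>P. p \<le> h}"
      unfolding Dn_def T by (auto dest!: coversD)
  qed
qed

subsection \<open>Falling chains and the Moebius function\<close>

text \<open>\<open>falling n c T a\<close> are the unrefinable chains that continue \<open>c\<close> from an element of \<open>T\<close> down to \<open>a\<close>
  (which itself is not listed), such that every element after the first one belongs to the set \<open>C\<close> of
  the chain above it. There are \<open>n\<close> elements strictly between \<open>a\<close> and \<open>hd c\<close>.\<close>

fun falling :: "nat \<Rightarrow> 'p list \<Rightarrow> 'p set \<Rightarrow> 'p \<Rightarrow> 'p list set" where
  "falling 0 c T a = (if a \<in> T then {[]} else {})"
| "falling (Suc n) c T a = (\<Union>h\<in>T. (#) h ` falling n (h # c) (C_set P L (h # c)) a)"

text \<open>A valuation on down-sets that vanishes on every principal one except that of \<open>a\<close>; along a segment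
  it therefore obeys, up to sign, the same recursion as the number of falling chains.\<close>

definition val :: "'p \<Rightarrow> 'p set \<Rightarrow> int" where
  "val a D = (\<Sum>p\<in>{p\<in>D. a \<le> p}. mobius P a p)"

text \<open>\<open>mobius\<close> recurs in its first argument, whereas \<open>val\<close> sums over
  the second one. The dual recursion follows by expanding each term, exchanging the sums and
  induction on the size of the interval.\<close>

lemma mobius_sum:
  assumes "a \<in> P" "q \<in> P" "a \<le> q"
  shows "(\<Sum>r\<in>{r\<in>P. a \<le> r \<and> r \<le> q}. mobius P a r) = (if a = q then 1 else 0)"
  using assms
proof (induction "card {r\<in>P. a < r \<and> r \<le> q}" arbitrary: a rule: less_induct)
  case less
  have self: "mobius P x x = 1" for x by (simp add: mobius.simps)
  show ?case
  proof (cases "a = q")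
    case True
    then have "{r\<in>P. a \<le> r \<and> r \<le> q} = {a}" using less.prems by auto
    then show ?thesis using True self by simp
  next
    case False
    let ?I = "{r\<in>P. a < r \<and> r \<le> q}"
    have fin: "finite ?I" using finP by simp
    have "{r\<in>P. a \<le> r \<and> r \<le> q} = insert a ?I" using less.prems by auto
    then have "(\<Sum>r\<in>{r\<in>P. a \<le> r \<and> r \<le> q}. mobius P a r) = 1 + (\<Sum>r\<in>?I. mobius P a r)"
      using fin self by simp
    also have "(\<Sum>r\<in>?I. mobius P a r) = - (\<Sum>r\<in>?I. \<Sum>s\<in>{s\<in>P. a < s \<and> s \<le> r}. mobius P s r)"
      unfolding sum_negf[symmetric] by (rule sum.cong) (use finP in \<open>auto simp: mobius.simps[of P a] sum_negf\<close>)
    also have "(\<Sum>r\<in>?I. \<Sum>s\<in>{s\<in>P. a < s \<and> s \<le> r}. mobius P s r) =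
      (\<Sum>r\<in>?I. \<Sum>s\<in>{s\<in>?I. s \<le> r}. mobius P s r)"
      by (rule sum.cong) (auto intro!: sum.cong)
    \<comment> \<open>Now the inner sum belongs to an interval that starts at some \<open>s\<close>
      above \<open>a\<close>, where the induction hypothesis applies; only \<open>s = q\<close>
      survives.\<close>
    also have "\<dots> = (\<Sum>s\<in>?I. \<Sum>r\<in>{r\<in>?I. s \<le> r}. mobius P s r)"
      by (rule sum.swap_restrict[OF fin fin])
    also have "\<dots> = (\<Sum>s\<in>?I. \<Sum>r\<in>{r\<in>P. s \<le> r \<and> r \<le> q}. mobius P s r)"
      by (rule sum.cong) (auto intro!: sum.cong)
    also have "\<dots> = (\<Sum>s\<in>?I. if s = q then 1 else 0)"
    proof (rule sum.cong)
      fix s assume s: "s \<in> ?I"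
      then have "{r\<in>P. s < r \<and> r \<le> q} \<subset> ?I" by auto
      then show "(\<Sum>r\<in>{r\<in>P. s \<le> r \<and> r \<le> q}. mobius P s r) = (if s = q then 1 else 0)"
        using less.hyps[of s] s less.prems fin by (simp add: psubset_card_mono)
    qed simp
    also have "\<dots> = 1" using fin less.prems False by simp
    finally show ?thesis using False by simp
  qed
qed

lemma val_Un_Int:
  assumes "D \<subseteq> P" "D' \<subseteq> P"
  shows "val a (D \<union> D') + val a (D \<inter> D') = val a D + val a D'"
proof -
  have eq: "{p\<in>D \<union> D'. a \<le> p} = {p\<in>D. a \<le> p} \<union> {p\<in>D'. a \<le> p}" "{p\<in>D \<inter> D'. a \<le> p} = {p\<in>D. a \<le> p} \<inter> {p\<in>D'. a \<le> p}"
    by auto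
  have fin: "finite {p\<in>D. a \<le> p}" "finite {p\<in>D'. a \<le> p}" using assms by (auto intro: finite_subset[OF _ finP])
  show ?thesis unfolding val_def eq by (rule sum.union_inter[OF fin])
qed

text \<open>The sum over the interval from \<open>a\<close> to \<open>h\<close> vanishes by
  \<open>mobius_sum\<close>, and it is empty if \<open>a\<close> is not below
  \<open>h\<close>.\<close>

lemma val_below:
  assumes "a \<in> P" "h \<in> P" "a \<noteq> h"
  shows "val a {p\<in>P. p \<le> h} = 0"
proof (cases "a \<le> h")
  case True
  have "{p \<in> {p\<in>P. p \<le> h}. a \<le> p} = {p\<in>P. a \<le> p \<and> p \<le> h}" by auto
  then show ?thesis using mobius_sum[OF assms(1,2) True] assms(3) by (simp add: val_def)
next
  case False
  then have "{p \<in> {p\<in>P. p \<le> h}. a \<le> p} = {}" by (auto dest: order_trans)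
  then show ?thesis by (simp only: val_def sum.empty)
qed

lemma finite_falling: "c \<in> \<C> \<Longrightarrow> segment c T \<Longrightarrow> finite (falling n c T a)"
proof (induction n arbitrary: c T)
  case (Suc n)
  have TS: "T \<subseteq> lower_covers P (hd c)" using segment_subset Suc.prems by blast
  have fT: "finite T" using TS finite_lower_covers finite_subset by blast
  have "finite (falling n (h # c) (C_set P L (h # c)) a)" if "h \<in> T" for h
  proof -
    have "h # c \<in> \<C>" using Cons_in_\<C> Suc.prems(1) TS that by blast
    then show ?thesis using Suc.IH segment_C_set by blast
  qed
  then show ?case using fT by simp
qed simp

text \<open>Attaching \<open>h\<close> adds the falling chains through \<open>h\<close> to the
  count. To the valuation it adds that of a principal down-set, which is zero, minus that of the
  attaching set, which is counted one level below; this is where the sign changes.\<close>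

lemma card_falling:
  assumes "c \<in> \<C>" "segment c T" "chain_length c + n + 2 = rk" "covers P bt a"
  shows "int (card (falling n c T a)) = (-1) ^ n * val a (Dn T)"
  using assms(1-3)
proof (induction n arbitrary: c T)
  case 0
  have aP: "a \<in> P" "bt < a" using coversD[OF assms(4)] by auto
  \<comment> \<open>At this level \<open>T\<close> consists of atoms, so nothing but
    \<open>a\<close> itself can lie above \<open>a\<close>.\<close>
  have "{p \<in> Dn T. a \<le> p} = (if a \<in> T then {a} else {})"
  proof -
    have cov: "covers P bt h" if "h \<in> T" for h
      using coatom_of_rank_2[OF 0(1)] segment_subset[OF 0(1,2)] 0(3) that by (auto simp: lower_covers_iff)
    have eq: "p = a \<and> h = a" if "p \<in> P" "a \<le> p" "p \<le> h" "h \<in> T" for p h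
    proof -
      have "a \<le> h" "\<not> a < h" using that cov[OF that(4)] aP by (auto simp: covers_def)
      then show ?thesis using that by auto
    qed
    show ?thesis using eq aP(1) unfolding Dn_def by auto
  qed
  then show ?case by (simp add: val_def mobius.simps)
next
  case (Suc n)
  note c = Suc.prems(1)
  have aP: "a \<in> P" "bt < a" using coversD[OF assms(4)] by auto
  show ?case
    using c Suc.prems(2)
  proof (induction rule: segment_induct)
    case empty
    then show ?case by (simp add: Dn_empty val_def)
  next
    case (insert T h)
    let ?C = "C_set P L (h # c)" and ?B = "{p\<in>P. p \<le> h}"
    have hc: "h # c \<in> \<C>" using Cons_in_\<C>[OF c insert(4)] .
    have len: "chain_length (h # c) + n + 2 = rk" using Suc.prems(3) chain_length_Cons[OF c] by simp
    have hP: "h \<in> P" using coversD insert(4) by (auto simp: lower_covers_iff)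
    \<comment> \<open>The new coatom is not an atom, so \<open>a\<close> differs from it.\<close>
    have "\<not> covers P bt h" using not_atom(1)[OF hc] len by simp
    then have ah: "a \<noteq> h" using assms(4) by auto
    have fin: "finite (falling (Suc n) c T a)" "finite (falling n (h # c) ?C a)"
      using finite_falling[OF c insert(1)] finite_falling[OF hc segment_C_set[OF hc]] by blast+
    have "falling (Suc n) c (insert h T) a = (#) h ` falling n (h # c) ?C a \<union> falling (Suc n) c T a"
      by simp
    moreover have "(#) h ` falling n (h # c) ?C a \<inter> falling (Suc n) c T a = {}" using insert(3) by auto
    ultimately have ce: "card (falling (Suc n) c (insert h T) a) = card (falling n (h # c) ?C a) + card (falling (Suc n) c T a)"
      using fin by (simp add: card_Un_disjoint card_image del: falling.simps)
    have "val a (Dn T \<union> ?B) + val a (Dn ?C) = val a (Dn T) + val a ?B"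
      using val_Un_Int[of "Dn T" ?B a] unfolding Dn_Int_below[OF c insert(4,5)] by (auto simp: Dn_def)
    then have v: "val a (Dn (insert h T)) = val a (Dn T) - val a (Dn ?C)"
      using val_below[OF aP(1) hP ah] by (simp add: Dn_insert)
    show ?case
      using insert.IH Suc.IH[OF hc segment_C_set[OF hc] len]
      unfolding ce v by (simp add: algebra_simps del: falling.simps)
  qed
qed

text \<open>The sum of \<open>mobius P a r\<close> over all \<open>r\<close> from \<open>a\<close>
  to the top is zero, so the valuation of everything below the top is
  \<open>- mobius P a tp\<close>; the absolute value removes the remaining sign.\<close>

lemma card_falling_mobius:
  assumes "n + 2 = rk" "covers P bt a"
  shows "card (falling n [tp] (lower_covers P tp) a) = nat \<bar>mobius P a tp\<bar>"
proof -
  let ?T = "lower_covers P tp"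
  have a: "a \<in> P" using coversD[OF assms(2)] by blast
  have at: "a \<noteq> tp" using not_atom(1)[OF unref_tp] assms by (auto simp: chain_length_def)
  have D: "Dn ?T = {p\<in>P. p < tp}" using Dn_lower_covers[OF unref_tp] by simp
  have "{r\<in>P. a \<le> r \<and> r \<le> tp} = insert tp {r\<in>P. a \<le> r \<and> r < tp}" using a tp by (auto simp: order_less_le)
  then have "mobius P a tp + (\<Sum>r\<in>{r\<in>P. a \<le> r \<and> r < tp}. mobius P a r) = 0"
    using mobius_sum[OF a tp(1) tp(2)[OF a]] at finP by simp
  moreover have "{p \<in> {p\<in>P. p < tp}. a \<le> p} = {r\<in>P. a \<le> r \<and> r < tp}" by auto
  ultimately have "val a (Dn ?T) = - mobius P a tp" unfolding D val_def by simp
  moreover have "int (card (falling n [tp] ?T a)) = (-1) ^ n * val a (Dn ?T)"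
    using card_falling[OF unref_tp, of ?T n a] segment_all[OF unref_tp] assms by (simp add: chain_length_def)
  ultimately have "\<bar>int (card (falling n [tp] ?T a))\<bar> = \<bar>mobius P a tp\<bar>" by (simp add: abs_mult power_abs)
  then show ?thesis by linarith
qed

end

subsection \<open>Cohomology of shellable posets\<close>

context sections
begin

text \<open>Expresses by global sections that \<open>s\<close> restricts to a coboundary over
  \<open>D\<close>.\<close>

definition cob :: "'p set \<Rightarrow> nat \<Rightarrow> ('p \<Rightarrow> 'i) \<Rightarrow> bool" where
  "cob D n s \<longleftrightarrow> s \<in> carrier (Sec n) \<and> (\<exists>b\<in>bd Sec \<delta> n. s \<ominus>\<^bsub>Sec n\<^esub> b \<in> van D n)"

lemma cob_van: "s \<in> van D n \<Longrightarrow> cob D n s"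
  unfolding cob_def using van_carrier[of s D n] bdD(2)[of n]
  by (auto intro!: bexI[of _ "\<zero>\<^bsub>Sec n\<^esub>"])

lemma cob_mono: "D \<subseteq> D' \<Longrightarrow> cob D' n s \<Longrightarrow> cob D n s"
  unfolding cob_def using van_mono[of D D' n] by blast

lemma cob_minus:
  assumes "D \<subseteq> Q" "cob D n s" "cob D n t"
  shows "cob D n (s \<ominus>\<^bsub>Sec n\<^esub> t)"
proof -
  obtain b b' where b: "b \<in> bd Sec \<delta> n" "s \<ominus>\<^bsub>Sec n\<^esub> b \<in> van D n" and b': "b' \<in> bd Sec \<delta> n" "t \<ominus>\<^bsub>Sec n\<^esub> b' \<in> van D n"
    and st: "s \<in> carrier (Sec n)" "t \<in> carrier (Sec n)"
    using assms unfolding cob_def by blast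
  have "(s \<ominus>\<^bsub>Sec n\<^esub> t) \<ominus>\<^bsub>Sec n\<^esub> (b \<ominus>\<^bsub>Sec n\<^esub> b') = (s \<ominus>\<^bsub>Sec n\<^esub> b) \<ominus>\<^bsub>Sec n\<^esub> (t \<ominus>\<^bsub>Sec n\<^esub> b')"
    using st bdD(1)[OF b(1)] bdD(1)[OF b'(1)] by algebra
  then have "(s \<ominus>\<^bsub>Sec n\<^esub> t) \<ominus>\<^bsub>Sec n\<^esub> (b \<ominus>\<^bsub>Sec n\<^esub> b') \<in> van D n" using van_minus[OF assms(1) b(2) b'(2)] by simp
  then show ?thesis unfolding cob_def using st bdD(5)[OF b(1) b'(1)] by blast
qed

lemma cob_top: "cob Q n s \<longleftrightarrow> s \<in> bd Sec \<delta> n"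
proof
  assume "cob Q n s"
  then obtain b where b: "b \<in> bd Sec \<delta> n" "s \<ominus>\<^bsub>Sec n\<^esub> b = \<zero>\<^bsub>Sec n\<^esub>" "s \<in> carrier (Sec n)"
    unfolding cob_def van_top by blast
  then show "s \<in> bd Sec \<delta> n" using X.M.minus_eq_zero_iff[OF b(3) bdD(1)[OF b(1)]] by simp
next
  assume "s \<in> bd Sec \<delta> n"
  moreover have "s \<ominus>\<^bsub>Sec n\<^esub> s \<in> van Q n" using bdD(1)[OF calculation] by (simp add: van_top)
  ultimately show "cob Q n s" unfolding cob_def using bdD(1) by blast
qed

lemma acyc_empty: "acyc n (van {})"
  unfolding acyc_def van_def using bdD(2)[of n] by (auto intro!: bexI[of _ "\<zero>\<^bsub>Sec n\<^esub>"])

lemma acyc_cob: "acyc n (van D) \<Longrightarrow> s \<in> carrier (Sec n) \<Longrightarrow> \<delta> n s \<in> van D (Suc n) \<Longrightarrow> cob D n s"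
  unfolding acyc_def cob_def by blast

end

locale shell_sections = shellable P L + sections R Q F I
  for P :: "'p::order set" and L and R :: "'r ring" and Q and F :: "('p, 'r, 'm) presheaf"
    and I :: "('p, 'r, 'm, 'i) coresolution" +
  assumes Q_def: "Q = P - {top_of P}"
begin

lemma QP: "p \<in> Q \<longleftrightarrow> p \<in> P \<and> p < tp"
  using tp(2) by (auto simp: Q_def order_less_le)

lemma below_Q: "h \<in> Q \<Longrightarrow> {p\<in>P. p \<le> h} = below h"
  using QP by (auto intro: order.strict_trans1)

lemma hd_le_tp: "c \<in> \<C> \<Longrightarrow> hd c \<le> tp"
  using unref_hd tp by blast

lemma lower_covers_Q: "c \<in> \<C> \<Longrightarrow> h \<in> lower_covers P (hd c) \<Longrightarrow> h \<in> Q \<and> h < hd c"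
  using hd_le_tp coversD[of h "hd c"] unfolding QP lower_covers_iff by (auto intro: order.strict_trans2)

lemma Dn_Q:
  assumes "c \<in> \<C>" "T \<subseteq> lower_covers P (hd c)"
  shows "Dn T \<subseteq> Q" "down_in Q (Dn T)"
proof -
  show "Dn T \<subseteq> Q"
  proof
    fix p assume "p \<in> Dn T"
    then obtain h where h: "p \<in> P" "h \<in> T" "p \<le> h" by (auto simp: Dn_def)
    then have "h < tp" using lower_covers_Q[OF assms(1)] assms(2) QP by blast
    then show "p \<in> Q" using h unfolding QP by (auto intro: order.strict_trans1)
  qed
  then show "down_in Q (Dn T)"
    unfolding down_in_def Dn_def by (auto simp: QP intro: order_trans)
qed

abbreviation "open_below c \<equiv> Dn (lower_covers P (hd c))"

lemma open_below: "c \<in> \<C> \<Longrightarrow> p \<in> open_below c \<longleftrightarrow> p \<in> P \<and> p < hd c"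
  by (simp add: Dn_lower_covers)

lemma down_below: "down_in Q (below h)"
  by (auto simp: down_in_def)

text \<open>\<open>Dn_Int_below\<close> in terms of sections: attaching \<open>h\<close> intersects
  the two vanishing subcomplexes, and their sum belongs to the down-set of the smaller
  segment.\<close>

lemma van_step:
  assumes "c \<in> \<C>" "h \<in> lower_covers P (hd c)" "T = {h'. strictly_precedes (L c) h' h}" "segment c T"
  shows "van (Dn (insert h T)) n = van (Dn T) n \<inter> van (below h) n"
    and "x \<in> van (Dn (C_set P L (h # c))) n \<longleftrightarrow> (\<exists>a\<in>van (Dn T) n. \<exists>b\<in>van (below h) n. x = a \<oplus>\<^bsub>Sec n\<^esub> b)"
proof -
  have h: "h \<in> Q" using lower_covers_Q assms by blast
  show "van (Dn (insert h T)) n = van (Dn T) n \<inter> van (below h) n"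
    unfolding Dn_insert below_Q[OF h] van_Un ..
  have TS: "T \<subseteq> lower_covers P (hd c)" using segment_subset assms by blast
  show "x \<in> van (Dn (C_set P L (h # c))) n \<longleftrightarrow> (\<exists>a\<in>van (Dn T) n. \<exists>b\<in>van (below h) n. x = a \<oplus>\<^bsub>Sec n\<^esub> b)"
    unfolding Dn_Int_below[OF assms(1-3), symmetric] below_Q[OF h]
    by (rule van_Int[OF Dn_Q(2)[OF assms(1) TS] down_below])
qed

text \<open>Mayer--Vietoris along the shelling order. \<open>H\<close> says that every class of
  degree \<open>n\<close> on the attaching set of \<open>h\<close> comes from the principal down-set
  of \<open>h\<close>, which covers both a vanishing class and, in degree \<open>0\<close>, an
  element of \<open>F h\<close>.\<close>

lemma acyc_Suc_segment:
  assumes c: "c \<in> \<C>" and T: "segment c T"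
    and H: "\<And>h y. h \<in> lower_covers P (hd c) \<Longrightarrow> y \<in> carrier (Sec n) \<Longrightarrow>
      \<delta> n y \<in> van (Dn (C_set P L (h # c))) (Suc n) \<Longrightarrow>
      \<exists>f\<in>carrier (Sec n). \<delta> n f \<in> van (below h) (Suc n) \<and> y \<ominus>\<^bsub>Sec n\<^esub> f \<in> van (Dn (C_set P L (h # c))) n"
  shows "acyc (Suc n) (van (Dn T))"
  using c T
proof (induction rule: segment_induct)
  case empty
  show ?case unfolding Dn_empty by (rule acyc_empty)
next
  case (insert T h)
  have TS: "T \<subseteq> lower_covers P (hd c)" using segment_subset[OF c insert(1)] .
  have h: "h \<in> Q" using lower_covers_Q c insert(4) by blast
  note st = van_step[OF c insert(4,5,1)]
  have "acyc (Suc n) (\<lambda>n. van (Dn T) n \<inter> van (below h) n)"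
  proof (rule acyc_Suc_inter')
    show "subcomplex (van (Dn T))" by (rule subcomplex_van[OF Dn_Q(1)[OF c TS]])
    show "subcomplex (van (below h))" by (rule subcomplex_van) blast
    show "acyc (Suc n) (van (below h))" by (rule acyc_below[OF h]) simp
    fix y assume y: "y \<in> carrier (Sec n)"
      "\<exists>a\<in>van (Dn T) (Suc n). \<exists>b\<in>van (below h) (Suc n). \<delta> n y = a \<oplus>\<^bsub>Sec (Suc n)\<^esub> b"
    then show "\<exists>f\<in>carrier (Sec n). \<delta> n f \<in> van (below h) (Suc n) \<and>
        (\<exists>a\<in>van (Dn T) n. \<exists>b\<in>van (below h) n. y \<ominus>\<^bsub>Sec n\<^esub> f = a \<oplus>\<^bsub>Sec n\<^esub> b)"
      using H[OF insert(4) y(1)] unfolding st(2) by blast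
  qed (rule insert.IH)
  moreover have "van (Dn (insert h T)) = (\<lambda>n. van (Dn T) n \<inter> van (below h) n)"
    by (rule ext) (rule st(1))
  ultimately show ?case by simp
qed

lemma acyc_0_segment:
  assumes c: "c \<in> \<C>" and T: "segment c T"
    and H: "\<And>h. h \<in> lower_covers P (hd c) \<Longrightarrow> carrier (ob F h) = {\<zero>\<^bsub>ob F h\<^esub>}"
  shows "acyc 0 (van (Dn T))"
  using c T
proof (induction rule: segment_induct)
  case empty
  show ?case unfolding Dn_empty by (rule acyc_empty)
next
  case (insert T h)
  have h: "h \<in> Q" using lower_covers_Q c insert(4) by blast
  have "acyc 0 (\<lambda>n. van (Dn T) n \<inter> van (below h) n)"
    by (rule acyc_0_inter[OF insert.IH acyc_below[OF h]]) (use H[OF insert(4)] in simp)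
  moreover have "van (Dn (insert h T)) = (\<lambda>n. van (Dn T) n \<inter> van (below h) n)"
    by (rule ext) (rule van_step(1)[OF c insert(4,5,1)])
  ultimately show ?case by simp
qed

text \<open>A class that vanishes on the attaching set is corrected by a coboundary, which is a
  cocycle everywhere and in particular below \<open>h\<close>.\<close>

lemma acyc_correction:
  assumes "acyc n (van D)" "y \<in> carrier (Sec n)" "\<delta> n y \<in> van D (Suc n)"
  shows "\<exists>f\<in>carrier (Sec n). \<delta> n f \<in> van (below h) (Suc n) \<and> y \<ominus>\<^bsub>Sec n\<^esub> f \<in> van D n"
proof -
  obtain b where b: "b \<in> carrier (Sec n)" "\<delta> n b = \<zero>\<^bsub>Sec (Suc n)\<^esub>" "y \<ominus>\<^bsub>Sec n\<^esub> b \<in> van D n"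
    using acycD[OF assms] .
  have "\<zero>\<^bsub>Sec (Suc n)\<^esub> \<in> van (below h) (Suc n)" by (rule van_zero) blast
  then show ?thesis using b by (intro bexI[of _ b]) simp_all
qed

text \<open>The interval below \<open>hd c\<close> has rank \<open>n + 3\<close>, and
  \<open>Suc n\<close> is the top degree of its open part. The induction descends to rank
  \<open>3\<close>, where the attaching sets consist of atoms and degree \<open>0\<close> is handled
  by \<open>epi\<close>.\<close>

theorem top_vanishing:
  assumes epi: "\<And>c x. c \<in> \<C> \<Longrightarrow> chain_length c + 2 = rk \<Longrightarrow>
      (\<And>a. a \<in> C_set P L c \<Longrightarrow> x a \<in> carrier (ob F a)) \<Longrightarrow>
      \<exists>g\<in>carrier (ob F (hd c)). \<forall>a\<in>C_set P L c. ar F (hd c) a g = x a"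
    and "c \<in> \<C>" "chain_length c + n + 3 = rk" "segment c T"
  shows "acyc (Suc n) (van (Dn T))"
  using assms(2-4)
proof (induction n arbitrary: c T)
  case 0
  note c = 0(1)
  show ?case
  proof (rule acyc_Suc_segment[OF c 0(3)])
    fix h y assume h: "h \<in> lower_covers P (hd c)" and y: "y \<in> carrier (Sec 0)"
      and dy: "\<delta> 0 y \<in> van (Dn (C_set P L (h # c))) (Suc 0)"
    let ?C = "C_set P L (h # c)"
    have hc: "h # c \<in> \<C>" using Cons_in_\<C>[OF c h] .
    \<comment> \<open>One step further down the chain has the length for which \<open>epi\<close> is
      available.\<close>
    have len: "chain_length (h # c) + 2 = rk" using 0(2) chain_length_Cons[OF c] by simp
    have CS: "?C \<subseteq> lower_covers P h" using segment_subset[OF hc segment_C_set[OF hc]] by simp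
    have hQ: "h \<in> Q" using lower_covers_Q[OF c h] by blast
    have CQ: "a \<in> Q \<and> a < h \<and> a \<in> Dn ?C" if "a \<in> ?C" for a
      using lower_covers_Q[OF hc] CS that QP by (auto simp: Dn_def)
    \<comment> \<open>A cocycle of degree \<open>0\<close> on the attaching set is given at each
      member of \<open>?C\<close> by an element of \<open>F\<close>, and \<open>epi\<close> turns
      this family into one element \<open>g\<close> at \<open>h\<close>.\<close>
    have "\<exists>x\<in>carrier (ob F a). y a = aug I a x" if a: "a \<in> ?C" for a
    proof (rule sec_exact_0[OF _ y])
      show "a \<in> Q" using CQ[OF a] by blast
      then show "\<delta> 0 y \<in> van (below a) (Suc 0)" using dy CQ[OF a] y by (auto simp: van_below van_def[of "Dn _"])
    qed
    then obtain x where x: "\<And>a. a \<in> ?C \<Longrightarrow> x a \<in> carrier (ob F a) \<and> y a = aug I a (x a)" by metis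
    obtain g where g: "g \<in> carrier (ob F h)" "\<And>a. a \<in> ?C \<Longrightarrow> ar F h a g = x a"
      using epi[OF hc len, of x] x by auto
    \<comment> \<open>A section with value \<open>g\<close> at \<open>h\<close>; by naturality it
      agrees with \<open>y\<close> at the members of \<open>?C\<close>, hence below them.\<close>
    obtain f where f: "f \<in> carrier (Sec 0)" "f h = aug I h g"
      using extend_at[OF hQ nat_trans_closed[OF cores_aug[OF res] hQ g(1)]] .
    have "\<delta> 0 f \<in> van (below h) (Suc 0)"
      using f hQ cores_dif_aug[OF res hQ g(1)] by (simp add: van_below \<delta>_at)
    moreover have "y \<ominus>\<^bsub>Sec 0\<^esub> f \<in> van (Dn ?C) 0"
    proof -
      have yf: "y \<ominus>\<^bsub>Sec 0\<^esub> f \<in> carrier (Sec 0)" using y f by simp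
      have "(y \<ominus>\<^bsub>Sec 0\<^esub> f) p = \<zero>\<^bsub>ob (cx I 0) p\<^esub>" if p: "p \<in> Dn ?C" for p
      proof -
        obtain a where a: "a \<in> ?C" "p \<le> a" "p \<in> P" using p by (auto simp: Dn_def)
        have aQ: "a \<in> Q" "a < h" using CQ[OF a(1)] by auto
        have pQ: "p \<in> Q" using a aQ by (auto simp: QP intro: order.strict_trans1)
        have "f a = ar (cx I 0) h a (f h)" using lim_ar[OF f(1) hQ aQ(1)] aQ(2) by simp
        also have "\<dots> = aug I a (ar F h a g)"
          unfolding f(2) by (rule nat_trans_ar[OF cores_aug[OF res] hQ aQ(1) _ g(1), symmetric]) (use aQ in simp)
        finally have "f a = y a" using g(2) x a by simp
        then have "(y \<ominus>\<^bsub>Sec 0\<^esub> f) a = \<zero>\<^bsub>ob (cx I 0) a\<^esub>" using minus_at_zero_iff[OF y f(1) aQ(1)] by simp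
        then show ?thesis using zero_below[OF yf aQ(1) pQ a(2)] by simp
      qed
      then show ?thesis using yf by (simp add: van_def)
    qed
    ultimately show "\<exists>f\<in>carrier (Sec 0). \<delta> 0 f \<in> van (below h) (Suc 0) \<and> y \<ominus>\<^bsub>Sec 0\<^esub> f \<in> van (Dn ?C) 0"
      using f(1) by blast
  qed
next
  case (Suc n)
  note c = Suc.prems(1)
  show ?case
  proof (rule acyc_Suc_segment[OF c Suc.prems(3)])
    fix h y assume h: "h \<in> lower_covers P (hd c)" and y: "y \<in> carrier (Sec (Suc n))"
      and dy: "\<delta> (Suc n) y \<in> van (Dn (C_set P L (h # c))) (Suc (Suc n))"
    have hc: "h # c \<in> \<C>" using Cons_in_\<C>[OF c h] .
    have len: "chain_length (h # c) + n + 3 = rk" using Suc.prems(2) chain_length_Cons[OF c] by simp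
    show "\<exists>f\<in>carrier (Sec (Suc n)). \<delta> (Suc n) f \<in> van (below h) (Suc (Suc n)) \<and>
        y \<ominus>\<^bsub>Sec (Suc n)\<^esub> f \<in> van (Dn (C_set P L (h # c))) (Suc n)"
      by (rule acyc_correction[OF Suc.IH[OF hc len segment_C_set[OF hc]] y dy])
  qed
qed

end

section \<open>Functors concentrated on atoms: vanishing below the top degree\<close>

locale atomic_sections = shell_sections P L R Q F I
  for P :: "'p::order set" and L and R :: "'r ring" and Q and F :: "('p, 'r, 'm) presheaf"
    and I :: "('p, 'r, 'm, 'i) coresolution" +
  fixes A :: "'p set"
  assumes A_atoms: "A \<subseteq> atoms_of P"
    and A_conc: "\<And>p. p \<in> Q \<Longrightarrow> p \<notin> A \<Longrightarrow> carrier (ob F p) = {\<zero>\<^bsub>ob F p\<^esub>}"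
begin

lemma A_covers: "a \<in> A \<Longrightarrow> covers P bt a"
  using A_atoms by (auto simp: atoms_of_def)

text \<open>The interval below \<open>hd c\<close> has rank \<open>n + 2\<close>, so that
  \<open>n\<close> is the top degree of its open part; at stage \<open>0\<close> its coatoms are
  atoms.\<close>

definition stage :: "nat \<Rightarrow> 'p list \<Rightarrow> 'p set \<Rightarrow> bool" where
  "stage n c T \<longleftrightarrow> c \<in> \<C> \<and> segment c T \<and> chain_length c + n + 2 = rk"

lemma stage_\<C>: "stage n c T \<Longrightarrow> c \<in> \<C>"
  and stage_segment: "stage n c T \<Longrightarrow> segment c T"
  by (simp_all add: stage_def)

lemma stage_subset: "stage n c T \<Longrightarrow> T \<subseteq> lower_covers P (hd c)"
  using segment_subset by (simp add: stage_def)

lemma stage_step: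
  assumes "stage (Suc n) c T" "h \<in> lower_covers P (hd c)"
  shows "stage n (h # c) (C_set P L (h # c))" "h \<notin> A" "h \<in> Q" "h < hd c"
    "carrier (ob F h) = {\<zero>\<^bsub>ob F h\<^esub>}"
proof -
  have c: "c \<in> \<C>" using assms(1) by (simp add: stage_def)
  have hc: "h # c \<in> \<C>" using Cons_in_\<C>[OF c assms(2)] .
  show st: "stage n (h # c) (C_set P L (h # c))"
    using assms(1) hc segment_C_set[OF hc] chain_length_Cons[OF c] by (simp add: stage_def)
  have "\<not> covers P bt h" using not_atom(1)[OF hc] st by (simp add: stage_def)
  then show hA: "h \<notin> A" using A_covers by blast
  show hQ: "h \<in> Q" "h < hd c" using lower_covers_Q[OF c assms(2)] by auto
  show "carrier (ob F h) = {\<zero>\<^bsub>ob F h\<^esub>}" using A_conc[OF hQ(1) hA] .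
qed

text \<open>At a positive stage no coatom is an atom, so \<open>F\<close> is zero at all of them and
  degree \<open>0\<close> vanishes. In a higher degree the attaching sets are one stage and one
  degree lower.\<close>

lemma low_vanishing: "stage n c T \<Longrightarrow> j < n \<Longrightarrow> acyc j (van (Dn T))"
proof (induction n arbitrary: c T j)
  case (Suc n)
  note c = stage_\<C>[OF Suc.prems(1)] and T = stage_segment[OF Suc.prems(1)]
  show ?case
  proof (cases j)
    case 0
    show ?thesis unfolding 0 using acyc_0_segment[OF c T] stage_step(5)[OF Suc.prems(1)] by blast
  next
    case (Suc i)
    then have i: "i < n" using Suc.prems by simp
    show ?thesis unfolding Suc
    proof (rule acyc_Suc_segment[OF c T])
      fix h y assume h: "h \<in> lower_covers P (hd c)" and y: "y \<in> carrier (Sec i)"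
        and dy: "\<delta> i y \<in> van (Dn (C_set P L (h # c))) (Suc i)"
      show "\<exists>f\<in>carrier (Sec i). \<delta> i f \<in> van (below h) (Suc i) \<and> y \<ominus>\<^bsub>Sec i\<^esub> f \<in> van (Dn (C_set P L (h # c))) i"
        by (rule acyc_correction[OF Suc.IH[OF stage_step(1)[OF Suc.prems(1) h] i] y dy])
    qed
  qed
qed simp

end

section \<open>Representing top classes by families indexed by falling chains\<close>

context atomic_sections
begin

text \<open>\<open>rep n c T x s\<close>: the section \<open>s\<close> represents the class with coordinates \<open>x a b \<in> F a\<close> at the falling
  chains \<open>b\<close> from \<open>T\<close> to \<open>a\<close>. It vanishes over \<open>hd c\<close> away from \<open>T\<close>, and at \<open>h \<in> T\<close> it is the connecting
  homomorphism applied to the class over the elements below \<open>h\<close> with the induced coordinates. Using a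
  relation rather than a function avoids choosing representatives.\<close>

fun rep :: "nat \<Rightarrow> 'p list \<Rightarrow> 'p set \<Rightarrow> ('p \<Rightarrow> 'p list \<Rightarrow> 'm) \<Rightarrow> ('p \<Rightarrow> 'i) \<Rightarrow> bool" where
  "rep 0 c T x s \<longleftrightarrow> s \<in> carrier (Sec 0) \<and>
     (\<forall>p\<in>P. p < hd c \<and> p \<notin> T \<inter> A \<longrightarrow> s p = \<zero>\<^bsub>ob (cx I 0) p\<^esub>) \<and> (\<forall>a\<in>T \<inter> A. s a = aug I a (x a []))"
| "rep (Suc n) c T x s \<longleftrightarrow> s \<in> carrier (Sec (Suc n)) \<and>
     (\<forall>p\<in>P. p < hd c \<and> p \<notin> T \<longrightarrow> s p = \<zero>\<^bsub>ob (cx I (Suc n)) p\<^esub>) \<and>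
     (\<forall>h\<in>T. \<exists>y. rep n (h # c) (C_set P L (h # c)) (\<lambda>a b. x a (h # b)) y \<and> s h = \<delta> n y h)"

definition valid :: "('p \<Rightarrow> 'p list \<Rightarrow> 'm) \<Rightarrow> bool" where
  "valid x \<longleftrightarrow> (\<forall>a\<in>A. \<forall>b. x a b \<in> carrier (ob F a))"

lemma valid_shift: "valid x \<Longrightarrow> valid (\<lambda>a b. x a (h # b))"
  by (simp add: valid_def)

lemma rep_carrier: "rep n c T x s \<Longrightarrow> s \<in> carrier (Sec n)"
  by (cases n) auto

lemma rep_zero_off: "rep n c T x s \<Longrightarrow> p \<in> P \<Longrightarrow> p < hd c \<Longrightarrow> p \<notin> T \<Longrightarrow> s p = \<zero>\<^bsub>ob (cx I n) p\<^esub>"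
  by (cases n) auto

lemma stage_0_coatom: "stage 0 c T \<Longrightarrow> h \<in> lower_covers P (hd c) \<Longrightarrow> covers P bt h"
  using coatom_of_rank_2[of c h] by (simp add: stage_def lower_covers_iff)

lemma open_below_Q: "c \<in> \<C> \<Longrightarrow> p \<in> P \<Longrightarrow> p < hd c \<Longrightarrow> p \<in> Q"
  using hd_le_tp QP by (auto intro: order.strict_trans2)

lemma coatom_maximal: "h \<in> lower_covers P (hd c) \<Longrightarrow> p \<in> P \<Longrightarrow> p < hd c \<Longrightarrow> \<not> h < p"
  by (auto simp: lower_covers_iff covers_def)

lemma van_open_belowI:
  assumes c: "c \<in> \<C>" and s: "s \<in> carrier (Sec n)"
    and z: "\<And>h. h \<in> lower_covers P (hd c) \<Longrightarrow> s h = \<zero>\<^bsub>ob (cx I n) h\<^esub>"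
  shows "s \<in> van (open_below c) n"
  unfolding van_def
proof (intro CollectI conjI ballI s)
  fix p assume "p \<in> open_below c"
  then obtain h where h: "p \<in> P" "h \<in> lower_covers P (hd c)" "p \<le> h" by (auto simp: Dn_def)
  have "h \<in> Q" "p \<in> Q" using lower_covers_Q[OF c h(2)] h QP by (auto intro: order.strict_trans1)
  then show "s p = \<zero>\<^bsub>ob (cx I n) p\<^esub>" using zero_below[OF s] z h by blast
qed

lemma glue_coatoms:
  assumes c: "c \<in> \<C>" and T: "T \<subseteq> lower_covers P (hd c)"
    and \<kappa>: "\<And>h. h \<in> T \<Longrightarrow> \<kappa> h \<in> carrier (Sec n)"
    and \<kappa>0: "\<And>h q. h \<in> T \<Longrightarrow> q \<in> P \<Longrightarrow> q < h \<Longrightarrow> \<kappa> h q = \<zero>\<^bsub>ob (cx I n) q\<^esub>"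
  obtains w where "w \<in> carrier (Sec n)" "\<And>h. h \<in> T \<Longrightarrow> w h = \<kappa> h h"
    "\<And>p. p \<in> P \<Longrightarrow> p < hd c \<Longrightarrow> p \<notin> T \<Longrightarrow> w p = \<zero>\<^bsub>ob (cx I n) p\<^esub>"
proof -
  have TB: "T \<subseteq> open_below c"
    using T coversD by (auto simp: open_below[OF c] lower_covers_iff)
  have mx: "\<not> h < p" if "h \<in> T" "p \<in> open_below c" for h p
    using coatom_maximal[of h c p] T that by (auto simp: open_below[OF c])
  have z: "\<kappa> h q = \<zero>\<^bsub>ob (cx I n) q\<^esub>" if "h \<in> T" "q \<in> Q" "q < h" for h q
    using \<kappa>0 that QP by blast
  obtain w where w: "w \<in> carrier (Sec n)" "\<And>h. h \<in> T \<Longrightarrow> w h = \<kappa> h h"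
    "\<And>p. p \<in> open_below c \<Longrightarrow> p \<notin> T \<Longrightarrow> w p = \<zero>\<^bsub>ob (cx I n) p\<^esub>"
    by (rule glue[OF Dn_Q(2)[OF c order_refl] TB, of \<kappa> n]) ((rule mx \<kappa> z that; assumption)+)
  then show thesis using that open_below[OF c] by blast
qed

text \<open>It suffices to look at coatoms. There \<open>s\<close> is zero, an image of the
  augmentation, or a value of the previous differential, each of which the next differential
  kills.\<close>

lemma rep_cocycle:
  assumes st: "stage n c T" and x: "valid x" and r: "rep n c T x s"
  shows "\<delta> n s \<in> van (open_below c) (Suc n)"
proof (rule van_open_belowI[OF stage_\<C>[OF st]])
  have s: "s \<in> carrier (Sec n)" using rep_carrier[OF r] .
  then show "\<delta> n s \<in> carrier (Sec (Suc n))" by simp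
  fix h assume h: "h \<in> lower_covers P (hd c)"
  have hQ: "h \<in> Q" "h < hd c" "h \<in> P" using lower_covers_Q[OF stage_\<C>[OF st] h] QP by auto
  have triv: "\<delta> n s h = \<zero>\<^bsub>ob (cx I (Suc n)) h\<^esub>" if "s h = \<zero>\<^bsub>ob (cx I n) h\<^esub>"
    using that hQ dif_zero by (simp add: \<delta>_at)
  show "\<delta> n s h = \<zero>\<^bsub>ob (cx I (Suc n)) h\<^esub>"
  proof (cases n)
    case 0
    show ?thesis
    proof (cases "h \<in> T \<inter> A")
      case True
      then show ?thesis
        using r x 0 hQ(1) cores_dif_aug[OF res hQ(1), of "x h []"] by (simp add: \<delta>_at valid_def)
    next
      case False
      then show ?thesis using r 0 hQ triv by simp
    qed
  next
    case (Suc m)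
    show ?thesis
    proof (cases "h \<in> T")
      case True
      then obtain y where y: "rep m (h # c) (C_set P L (h # c)) (\<lambda>a b. x a (h # b)) y" "s h = \<delta> m y h"
        using r Suc by auto
      have "y h \<in> carrier (ob (cx I m) h)" using lim_closed[OF rep_carrier[OF y(1)] hQ(1)] .
      then show ?thesis using y(2) Suc hQ(1) cores_dif_dif[OF res hQ(1)] by (simp add: \<delta>_at)
    next
      case False
      then show ?thesis using rep_zero_off[OF r] hQ triv by blast
    qed
  qed
qed

text \<open>By \<open>rep_cocycle\<close> the differentials of the representatives one stage below
  vanish strictly below their coatoms, so \<open>glue_coatoms\<close> can prescribe them at the
  members of \<open>T\<close> independently.\<close>

lemma rep_exists: "stage n c T \<Longrightarrow> valid x \<Longrightarrow> \<exists>s. rep n c T x s"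
proof (induction n arbitrary: c T x)
  case 0
  note c = stage_\<C>[OF 0(1)]
  have TS: "T \<subseteq> lower_covers P (hd c)" using stage_subset[OF 0(1)] .
  then have TAS: "T \<inter> A \<subseteq> lower_covers P (hd c)" by blast
  have "\<exists>k. k \<in> carrier (Sec 0) \<and> k a = aug I a (x a [])" if a: "a \<in> T \<inter> A" for a
  proof -
    have aQ: "a \<in> Q" using lower_covers_Q[OF c] a TS by blast
    have "x a [] \<in> carrier (ob F a)" using 0(2) a by (simp add: valid_def)
    then show ?thesis using extend_at[OF aQ nat_trans_closed[OF cores_aug[OF res] aQ]] by metis
  qed
  then obtain \<kappa> where \<kappa>: "\<And>a. a \<in> T \<inter> A \<Longrightarrow> \<kappa> a \<in> carrier (Sec 0) \<and> \<kappa> a a = aug I a (x a [])" by metis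
  have low: "\<kappa> a q = \<zero>\<^bsub>ob (cx I 0) q\<^esub>" if a: "a \<in> T \<inter> A" and q: "q \<in> P" "q < a" for a q
  proof -
    have aQ: "a \<in> Q" using lower_covers_Q[OF c] a TS by blast
    then have qQ: "q \<in> Q" using q QP by (auto intro: order.strict_trans)
    \<comment> \<open>Only the bottom lies below an atom; it does not belong to \<open>A\<close>, so
      \<open>F\<close> is zero there.\<close>
    have "q = bt" using A_covers[of a] a q bt(2)[OF q(1)] by (auto simp: covers_def order_less_le)
    then have "q \<notin> A" using A_covers by (auto simp: covers_def)
    then have Fq: "carrier (ob F q) = {\<zero>\<^bsub>ob F q\<^esub>}" using A_conc qQ by blast
    have xa: "x a [] \<in> carrier (ob F a)" using 0(2) a by (simp add: valid_def)
    have qa: "q \<le> a" using q by simp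
    have "\<kappa> a q = aug I q (ar F a q (x a []))"
      using lim_ar[of "\<kappa> a" Q "cx I 0" a q] \<kappa>[OF a] aQ qQ qa nat_trans_ar[OF cores_aug[OF res] aQ qQ qa xa] by simp
    also have "ar F a q (x a []) = \<zero>\<^bsub>ob F q\<^esub>" using presheaf_ar_closed[OF cores_F[OF res] aQ qQ qa xa] Fq by simp
    finally show ?thesis
      using mod_hom_zero[OF presheaf_module[OF cores_F[OF res] qQ] module_at[OF qQ] nat_trans_hom[OF cores_aug[OF res] qQ]]
      by simp
  qed
  obtain w where "w \<in> carrier (Sec 0)" "\<And>h. h \<in> T \<inter> A \<Longrightarrow> w h = \<kappa> h h"
    "\<And>p. p \<in> P \<Longrightarrow> p < hd c \<Longrightarrow> p \<notin> T \<inter> A \<Longrightarrow> w p = \<zero>\<^bsub>ob (cx I 0) p\<^esub>"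
    using glue_coatoms[OF c TAS, of \<kappa> 0] \<kappa> low by blast
  then show ?case using \<kappa> by (intro exI[of _ w]) auto
next
  case (Suc n)
  note c = stage_\<C>[OF Suc.prems(1)]
  have TS: "T \<subseteq> lower_covers P (hd c)" using stage_subset[OF Suc.prems(1)] .
  let ?r = "\<lambda>h. rep n (h # c) (C_set P L (h # c)) (\<lambda>a b. x a (h # b))"
  have "\<forall>h\<in>T. \<exists>y. ?r h y"
    using Suc.IH[OF stage_step(1)[OF Suc.prems(1)] valid_shift[OF Suc.prems(2)]] TS by blast
  then obtain y where y: "\<And>h. h \<in> T \<Longrightarrow> ?r h (y h)" by metis
  have low: "\<delta> n (y h) q = \<zero>\<^bsub>ob (cx I (Suc n)) q\<^esub>" if h: "h \<in> T" and q: "q \<in> P" "q < h" for h q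
  proof -
    have hS: "h \<in> lower_covers P (hd c)" using h TS by blast
    have "\<delta> n (y h) \<in> van (open_below (h # c)) (Suc n)"
      by (rule rep_cocycle[OF stage_step(1)[OF Suc.prems(1) hS] valid_shift[OF Suc.prems(2)] y[OF h]])
    moreover have "q \<in> open_below (h # c)" using open_below[OF Cons_in_\<C>[OF c hS]] q by simp
    ultimately show ?thesis by (simp add: van_def)
  qed
  have cl: "\<delta> n (y h) \<in> carrier (Sec (Suc n))" if "h \<in> T" for h using rep_carrier[OF y[OF that]] by simp
  obtain w where "w \<in> carrier (Sec (Suc n))" "\<And>h. h \<in> T \<Longrightarrow> w h = \<delta> n (y h) h"
    "\<And>p. p \<in> P \<Longrightarrow> p < hd c \<Longrightarrow> p \<notin> T \<Longrightarrow> w p = \<zero>\<^bsub>ob (cx I (Suc n)) p\<^esub>"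
    using glue_coatoms[OF c TS, of "\<lambda>h. \<delta> n (y h)" "Suc n"] cl low by blast
  then show ?case using y by (intro exI[of _ w]) auto
qed

text \<open>One combination serves for sums, scalar multiples and, with \<open>r\<close> the
  negative of \<open>1\<close>, differences; this is how linearity is expressed for a
  relation.\<close>

lemma rep_linear:
  "stage n c T \<Longrightarrow> valid x \<Longrightarrow> valid x' \<Longrightarrow> r \<in> carrier R \<Longrightarrow> rep n c T x s \<Longrightarrow> rep n c T x' s' \<Longrightarrow>
    rep n c T (\<lambda>a b. x a b \<oplus>\<^bsub>ob F a\<^esub> r \<odot>\<^bsub>ob F a\<^esub> x' a b) (s \<oplus>\<^bsub>Sec n\<^esub> r \<odot>\<^bsub>Sec n\<^esub> s')"
proof (induction n arbitrary: c T x x' s s')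
  case 0
  note c = stage_\<C>[OF 0(1)]
  have s: "s \<in> carrier (Sec 0)" "s' \<in> carrier (Sec 0)" using 0 by auto
  have at: "(s \<oplus>\<^bsub>Sec 0\<^esub> r \<odot>\<^bsub>Sec 0\<^esub> s') p = s p \<oplus>\<^bsub>ob (cx I 0) p\<^esub> r \<odot>\<^bsub>ob (cx I 0) p\<^esub> s' p" if "p \<in> Q" for p
    using that by (simp add: lim_add lim_smult)
  show ?case
    unfolding rep.simps
  proof (intro conjI ballI impI)
    show "s \<oplus>\<^bsub>Sec 0\<^esub> r \<odot>\<^bsub>Sec 0\<^esub> s' \<in> carrier (Sec 0)" using s 0(4) by simp
    fix p assume p: "p \<in> P" "p < hd c \<and> p \<notin> T \<inter> A"
    then have pQ: "p \<in> Q" using open_below_Q[OF c] by blast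
    interpret p: module R "ob (cx I 0) p" using module_at[OF pQ] .
    show "(s \<oplus>\<^bsub>Sec 0\<^esub> r \<odot>\<^bsub>Sec 0\<^esub> s') p = \<zero>\<^bsub>ob (cx I 0) p\<^esub>"
      using 0 p at[OF pQ] by simp
  next
    fix a assume a: "a \<in> T \<inter> A"
    then have aQ: "a \<in> Q" using lower_covers_Q[OF c] stage_subset[OF 0(1)] by blast
    interpret F: module R "ob F a" using presheaf_module[OF cores_F[OF res] aQ] .
    note h = nat_trans_hom[OF cores_aug[OF res] aQ]
    have "x a [] \<in> carrier (ob F a)" "x' a [] \<in> carrier (ob F a)" using 0(2,3) a by (auto simp: valid_def)
    then show "(s \<oplus>\<^bsub>Sec 0\<^esub> r \<odot>\<^bsub>Sec 0\<^esub> s') a = aug I a (x a [] \<oplus>\<^bsub>ob F a\<^esub> r \<odot>\<^bsub>ob F a\<^esub> x' a [])"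
      using 0(4-6) a at[OF aQ] by (simp add: mod_hom_add[OF h] mod_hom_smult[OF h])
  qed
next
  case (Suc n)
  note c = stage_\<C>[OF Suc.prems(1)] and rR = Suc.prems(4)
  have s: "s \<in> carrier (Sec (Suc n))" "s' \<in> carrier (Sec (Suc n))" using Suc.prems rep_carrier by blast+
  have at: "(s \<oplus>\<^bsub>Sec (Suc n)\<^esub> r \<odot>\<^bsub>Sec (Suc n)\<^esub> s') p = s p \<oplus>\<^bsub>ob (cx I (Suc n)) p\<^esub> r \<odot>\<^bsub>ob (cx I (Suc n)) p\<^esub> s' p"
    if "p \<in> Q" for p
    using that by (simp add: lim_add lim_smult)
  show ?case
    unfolding rep.simps
  proof (intro conjI ballI impI)
    show "s \<oplus>\<^bsub>Sec (Suc n)\<^esub> r \<odot>\<^bsub>Sec (Suc n)\<^esub> s' \<in> carrier (Sec (Suc n))" using s rR by simp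
    fix p assume p: "p \<in> P" "p < hd c \<and> p \<notin> T"
    then have pQ: "p \<in> Q" using open_below_Q[OF c] by blast
    interpret p: module R "ob (cx I (Suc n)) p" using module_at[OF pQ] .
    show "(s \<oplus>\<^bsub>Sec (Suc n)\<^esub> r \<odot>\<^bsub>Sec (Suc n)\<^esub> s') p = \<zero>\<^bsub>ob (cx I (Suc n)) p\<^esub>"
      using rep_zero_off[OF Suc.prems(5) p(1)] rep_zero_off[OF Suc.prems(6) p(1)] p(2) rR at[OF pQ] by simp
  next
    fix h assume h: "h \<in> T"
    then have hS: "h \<in> lower_covers P (hd c)" using stage_subset[OF Suc.prems(1)] by blast
    have hQ: "h \<in> Q" using lower_covers_Q[OF c hS] by blast
    let ?r = "rep n (h # c) (C_set P L (h # c))"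
    obtain y where y: "?r (\<lambda>a b. x a (h # b)) y" "s h = \<delta> n y h" using Suc.prems(5) h by auto
    obtain y' where y': "?r (\<lambda>a b. x' a (h # b)) y'" "s' h = \<delta> n y' h" using Suc.prems(6) h by auto
    have yc: "y \<in> carrier (Sec n)" "y' \<in> carrier (Sec n)" using rep_carrier y(1) y'(1) by blast+
    have "?r (\<lambda>a b. x a (h # b) \<oplus>\<^bsub>ob F a\<^esub> r \<odot>\<^bsub>ob F a\<^esub> x' a (h # b)) (y \<oplus>\<^bsub>Sec n\<^esub> r \<odot>\<^bsub>Sec n\<^esub> y')"
      by (rule Suc.IH[OF stage_step(1)[OF Suc.prems(1) hS] valid_shift[OF Suc.prems(2)] valid_shift[OF Suc.prems(3)] rR y(1) y'(1)])
    moreover have "(s \<oplus>\<^bsub>Sec (Suc n)\<^esub> r \<odot>\<^bsub>Sec (Suc n)\<^esub> s') h = \<delta> n (y \<oplus>\<^bsub>Sec n\<^esub> r \<odot>\<^bsub>Sec n\<^esub> y') h"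
    proof -
      have "\<delta> n (y \<oplus>\<^bsub>Sec n\<^esub> r \<odot>\<^bsub>Sec n\<^esub> y') = \<delta> n y \<oplus>\<^bsub>Sec (Suc n)\<^esub> r \<odot>\<^bsub>Sec (Suc n)\<^esub> \<delta> n y'"
        using yc rR by (simp only: d_add d_smult X.smult_closed)
      then show ?thesis using at[OF hQ] y(2) y'(2) hQ by (simp only: lim_add lim_smult)
    qed
    ultimately show "\<exists>y. ?r (\<lambda>a b. x a (h # b) \<oplus>\<^bsub>ob F a\<^esub> r \<odot>\<^bsub>ob F a\<^esub> x' a (h # b)) y \<and>
        (s \<oplus>\<^bsub>Sec (Suc n)\<^esub> r \<odot>\<^bsub>Sec (Suc n)\<^esub> s') h = \<delta> n y h" by blast
  qed
qed

text \<open>The conclusion reaches over the whole open interval, beyond \<open>Dn T\<close>. In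
  \<open>rep_inj\<close> a representative for \<open>T\<close> must be a coboundary also over the
  next principal down-set.\<close>

lemma rep_zero:
  "stage n c T \<Longrightarrow> rep n c T x s \<Longrightarrow> (\<And>a b. a \<in> A \<Longrightarrow> b \<in> falling n c T a \<Longrightarrow> x a b = \<zero>\<^bsub>ob F a\<^esub>) \<Longrightarrow>
    cob (open_below c) n s"
proof (induction n arbitrary: c T x s)
  case 0
  note c = stage_\<C>[OF 0(1)]
  have "s h = \<zero>\<^bsub>ob (cx I 0) h\<^esub>" if h: "h \<in> lower_covers P (hd c)" for h
  proof (cases "h \<in> T \<inter> A")
    case True
    have hQ: "h \<in> Q" using lower_covers_Q[OF c h] by blast
    show ?thesis using 0(2,3) True
        mod_hom_zero[OF presheaf_module[OF cores_F[OF res] hQ] module_at[OF hQ] nat_trans_hom[OF cores_aug[OF res] hQ]]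
      by simp
  next
    case False
    then show ?thesis using 0(2) lower_covers_Q[OF c h] QP by simp
  qed
  then show ?case by (intro cob_van van_open_belowI[OF c rep_carrier[OF 0(2)]])
next
  case (Suc n)
  note c = stage_\<C>[OF Suc.prems(1)]
  have s: "s \<in> carrier (Sec (Suc n))" using rep_carrier[OF Suc.prems(2)] .
  have TS: "T \<subseteq> lower_covers P (hd c)" using stage_subset[OF Suc.prems(1)] .
  have "\<exists>\<kappa>. \<kappa> \<in> van (open_below (h # c)) n \<and> s h = \<delta> n \<kappa> h" if h: "h \<in> T" for h
  proof -
    have hS: "h \<in> lower_covers P (hd c)" using h TS by blast
    have hQ: "h \<in> Q" using lower_covers_Q[OF c hS] by blast
    obtain y where y: "rep n (h # c) (C_set P L (h # c)) (\<lambda>a b. x a (h # b)) y" "s h = \<delta> n y h"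
      using Suc.prems(2) h by auto
    have yc: "y \<in> carrier (Sec n)" using rep_carrier[OF y(1)] .
    have "cob (open_below (h # c)) n y"
      by (rule Suc.IH[OF stage_step(1)[OF Suc.prems(1) hS] y(1)]) (use Suc.prems(3) h in auto)
    then obtain b where b: "b \<in> bd Sec \<delta> n" "y \<ominus>\<^bsub>Sec n\<^esub> b \<in> van (open_below (h # c)) n" unfolding cob_def by blast
    \<comment> \<open>Subtracting the coboundary \<open>b\<close> makes \<open>y\<close> vanish
      below \<open>h\<close> without changing its differential.\<close>
    have "\<delta> n (y \<ominus>\<^bsub>Sec n\<^esub> b) = \<delta> n y" using yc bdD(1)[OF b(1)] d_bd[OF b(1)] by (simp only: d_minus X.M.a_minus_zero d_closed)
    then show ?thesis using b(2) y(2) by metis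
  qed
  then obtain \<kappa> where \<kappa>: "\<And>h. h \<in> T \<Longrightarrow> \<kappa> h \<in> van (open_below (h # c)) n \<and> s h = \<delta> n (\<kappa> h) h" by metis
  have low: "\<kappa> h q = \<zero>\<^bsub>ob (cx I n) q\<^esub>" if "h \<in> T" "q \<in> P" "q < h" for h q
  proof -
    have "q \<in> open_below (h # c)" using open_below[OF Cons_in_\<C>[OF c]] TS that by auto
    then show ?thesis using \<kappa>[OF that(1)] by (simp add: van_def)
  qed
  have cl: "\<kappa> h \<in> carrier (Sec n)" if "h \<in> T" for h using \<kappa>[OF that] van_carrier by blast
  \<comment> \<open>The modified \<open>y\<close> for the various coatoms fit together to one
    section, whose differential agrees with \<open>s\<close> at every coatom.\<close>
  obtain w where w: "w \<in> carrier (Sec n)" "\<And>h. h \<in> T \<Longrightarrow> w h = \<kappa> h h"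
    "\<And>p. p \<in> P \<Longrightarrow> p < hd c \<Longrightarrow> p \<notin> T \<Longrightarrow> w p = \<zero>\<^bsub>ob (cx I n) p\<^esub>"
    using glue_coatoms[OF c TS, of \<kappa> n] cl low by blast
  have "s \<ominus>\<^bsub>Sec (Suc n)\<^esub> \<delta> n w \<in> van (open_below c) (Suc n)"
  proof (rule van_open_belowI[OF c])
    show "s \<ominus>\<^bsub>Sec (Suc n)\<^esub> \<delta> n w \<in> carrier (Sec (Suc n))" using s w(1) by simp
    fix h assume h: "h \<in> lower_covers P (hd c)"
    have hQ: "h \<in> Q" "h \<in> P" "h < hd c" using lower_covers_Q[OF c h] QP by auto
    have "s h = \<delta> n w h"
    proof (cases "h \<in> T")
      case True
      then show ?thesis using w(2) \<kappa> hQ(1) by (simp add: \<delta>_at)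
    next
      case False
      then show ?thesis using w(3)[OF hQ(2,3) False] rep_zero_off[OF Suc.prems(2) hQ(2,3) False] hQ(1) dif_zero
        by (simp add: \<delta>_at)
    qed
    then show "(s \<ominus>\<^bsub>Sec (Suc n)\<^esub> \<delta> n w) h = \<zero>\<^bsub>ob (cx I (Suc n)) h\<^esub>"
      using minus_at_zero_iff[OF s d_closed[OF w(1)] hQ(1)] by blast
  qed
  then show ?case unfolding cob_def using s d_in_bd[OF w(1)] by blast
qed

text \<open>Dropping the last coatom means replacing the value at \<open>h\<close> by zero. This is
  compatible because \<open>s\<close> vanishes strictly below the members of \<open>T\<close> and no
  coatom lies below another.\<close>

lemma rep_restrict:
  assumes st: "stage n c (insert h T)" and h: "h \<notin> T" and r: "rep n c (insert h T) x s"
  obtains s' where "rep n c T x s'" "\<And>p. p \<in> P \<Longrightarrow> p < hd c \<Longrightarrow> p \<noteq> h \<Longrightarrow> s' p = s p"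
proof -
  note c = stage_\<C>[OF st]
  have TS: "insert h T \<subseteq> lower_covers P (hd c)" using stage_subset[OF st] .
  have s: "s \<in> carrier (Sec n)" using rep_carrier[OF r] .
  have low: "s q = \<zero>\<^bsub>ob (cx I n) q\<^esub>" if "g \<in> T" "q \<in> P" "q < g" for g q
  proof (rule rep_zero_off[OF r that(2)])
    have g: "g \<in> P" "g < hd c" using TS that(1) coversD by (auto simp: lower_covers_iff)
    then show "q < hd c" using that(3) by simp
    show "q \<notin> insert h T" using coatom_maximal[of q c g] TS g that(3) by blast
  qed
  obtain w where w: "w \<in> carrier (Sec n)" "\<And>g. g \<in> T \<Longrightarrow> w g = s g"
    "\<And>p. p \<in> P \<Longrightarrow> p < hd c \<Longrightarrow> p \<notin> T \<Longrightarrow> w p = \<zero>\<^bsub>ob (cx I n) p\<^esub>"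
    using glue_coatoms[OF c, of T "\<lambda>_. s" n] s low TS by blast
  have eq: "w p = s p" if "p \<in> P" "p < hd c" "p \<noteq> h" for p
    using w(2,3) rep_zero_off[OF r] that by (cases "p \<in> T") auto
  have hP: "h \<in> P" "h < hd c" using TS coversD by (auto simp: lower_covers_iff)
  have wh: "w h = \<zero>\<^bsub>ob (cx I n) h\<^esub>" using w(3)[OF hP h] .
  have "rep n c T x w"
  proof (cases n)
    case 0
    have "w p = \<zero>\<^bsub>ob (cx I 0) p\<^esub>" if "p \<in> P" "p < hd c" "p \<notin> T \<inter> A" for p
      using wh eq[OF that(1,2)] r that 0 by (cases "p = h") auto
    then show ?thesis using r w(1,2) 0 by simp
  next
    case (Suc m)
    then show ?thesis using r w by simp
  qed
  then show thesis using that eq by blast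
qed

end

section \<open>Coordinates determine a top class, and every top class has coordinates\<close>

context atomic_sections
begin

lemma cob_SucE:
  assumes "cob D (Suc n) s"
  obtains u where "u \<in> carrier (Sec n)" "s \<ominus>\<^bsub>Sec (Suc n)\<^esub> \<delta> n u \<in> van D (Suc n)"
  using assms unfolding cob_def by (auto simp: bd_def)

lemma A_Q:
  assumes "stage n c T" "a \<in> A"
  shows "a \<in> Q"
proof -
  have "a \<in> P" "covers P bt a" using A_covers[OF assms(2)] coversD by auto
  moreover have "\<not> covers P bt tp"
    using not_atom(1)[OF unref_tp] assms(1) by (auto simp: stage_def chain_length_def)
  ultimately show ?thesis unfolding Q_def by auto
qed

text \<open>Induction on the stage and, inside, along the shelling order. The coordinates on chains
  from the earlier coatoms vanish by the inner induction; the rest of \<open>s\<close> is the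
  connecting image of a class on the attaching set of \<open>h\<close>. The connecting map is
  injective because the cohomology below the top degree vanishes.\<close>

lemma rep_inj:
  "stage n c T \<Longrightarrow> valid x \<Longrightarrow> rep n c T x s \<Longrightarrow> cob (Dn T) n s \<Longrightarrow>
    \<forall>a\<in>A. \<forall>b\<in>falling n c T a. x a b = \<zero>\<^bsub>ob F a\<^esub>"
proof (induction n arbitrary: c T x s)
  case 0
  note c = stage_\<C>[OF 0(1)]
  have "s \<in> van (Dn T) 0" using 0(4) X.M.a_minus_zero by (auto simp: cob_def bd_def)
  have "x a [] = \<zero>\<^bsub>ob F a\<^esub>" if a: "a \<in> A" "a \<in> T" for a
  proof -
    have aQ: "a \<in> Q" using lower_covers_Q[OF c] stage_subset[OF 0(1)] a by blast
    have "a \<in> Dn T" using a aQ QP by (auto simp: Dn_def)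
    then have "s a = \<zero>\<^bsub>ob (cx I 0) a\<^esub>" using \<open>s \<in> van (Dn T) 0\<close> by (simp add: van_def)
    then have "aug I a (x a []) = \<zero>\<^bsub>ob (cx I 0) a\<^esub>" using 0(3) a by simp
    moreover have "x a [] \<in> carrier (ob F a)" using 0(2) a by (simp add: valid_def)
    ultimately show ?thesis
      using mod_hom_inj_iff[OF presheaf_module[OF cores_F[OF res] aQ] module_at[OF aQ] nat_trans_hom[OF cores_aug[OF res] aQ]]
        cores_aug_inj[OF res aQ] by blast
  qed
  then show ?case by (auto split: if_splits)
next
  case (Suc n)
  note c = stage_\<C>[OF Suc.prems(1)]
  have len: "chain_length c + Suc n + 2 = rk" using Suc.prems(1) by (simp add: stage_def)
  have "\<forall>s. rep (Suc n) c T x s \<longrightarrow> cob (Dn T) (Suc n) s \<longrightarrow>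
      (\<forall>a\<in>A. \<forall>b\<in>falling (Suc n) c T a. x a b = \<zero>\<^bsub>ob F a\<^esub>)"
    using c stage_segment[OF Suc.prems(1)]
  proof (induction rule: segment_induct)
    case empty
    show ?case by simp
  next
    case (insert T h)
    note hS = insert(4)
    have st: "stage (Suc n) c T" and sti: "stage (Suc n) c (insert h T)"
      using c len insert(1,2) by (auto simp: stage_def)
    have TS: "T \<subseteq> lower_covers P (hd c)" using stage_subset[OF st] .
    have hQ: "h \<in> Q" "h < hd c" "h \<in> P" using lower_covers_Q[OF c hS] QP by auto
    note DT = Dn_Q[OF c TS]
    let ?C = "C_set P L (h # c)"
    show ?case
    proof (intro allI impI)
      fix s assume r: "rep (Suc n) c (insert h T) x s" and cb: "cob (Dn (insert h T)) (Suc n) s"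
      have s: "s \<in> carrier (Sec (Suc n))" using rep_carrier[OF r] .
      obtain s' where s': "rep (Suc n) c T x s'" and eq: "\<And>p. p \<in> P \<Longrightarrow> p < hd c \<Longrightarrow> p \<noteq> h \<Longrightarrow> s' p = s p"
        using rep_restrict[OF sti insert(3) r] by blast
      have s'c: "s' \<in> carrier (Sec (Suc n))" using rep_carrier[OF s'] .
      \<comment> \<open>The contribution of the chains through \<open>h\<close>: among the elements
        below \<open>hd c\<close> it can be nonzero only at \<open>h\<close>.\<close>
      let ?\<tau> = "s \<ominus>\<^bsub>Sec (Suc n)\<^esub> s'"
      have \<tau>c: "?\<tau> \<in> carrier (Sec (Suc n))" using s s'c by simp
      have \<tau>T: "?\<tau> \<in> van (Dn T) (Suc n)"
        unfolding van_def
      proof (intro CollectI conjI ballI \<tau>c)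
        fix p assume "p \<in> Dn T"
        then obtain g where g: "p \<in> P" "g \<in> T" "p \<le> g" by (auto simp: Dn_def)
        have gc: "g \<in> P" "g < hd c" "g \<noteq> h" using lower_covers_Q[OF c] TS g(2) QP insert(3) by auto
        have "\<not> h < g" using coatom_maximal[OF hS gc(1,2)] .
        then have "p \<noteq> h" using g(3) gc(3) by auto
        moreover have "p < hd c" using g(3) gc(2) by simp
        ultimately show "?\<tau> p = \<zero>\<^bsub>ob (cx I (Suc n)) p\<^esub>"
          using eq g(1) open_below_Q[OF c] minus_at_zero_iff[OF s s'c] by simp
      qed
      have "cob (Dn T) (Suc n) s" by (rule cob_mono[OF _ cb]) (auto simp: Dn_def)
      then have "cob (Dn T) (Suc n) (s \<ominus>\<^bsub>Sec (Suc n)\<^esub> ?\<tau>)" using cob_minus[OF DT(1) _ cob_van[OF \<tau>T]] by blast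
      moreover have "s \<ominus>\<^bsub>Sec (Suc n)\<^esub> ?\<tau> = s'" using s s'c by algebra
      ultimately have xT: "\<forall>a\<in>A. \<forall>b\<in>falling (Suc n) c T a. x a b = \<zero>\<^bsub>ob F a\<^esub>"
        using insert.IH s' by simp
      have iT: "insert h T \<subseteq> lower_covers P (hd c)" using TS hS by blast
      have "cob (open_below c) (Suc n) s'" by (rule rep_zero[OF st s']) (use xT in blast)
      then have "cob (Dn (insert h T)) (Suc n) s'" by (rule cob_mono[rotated]) (use iT in \<open>auto simp: Dn_def\<close>)
      then have "cob (Dn (insert h T)) (Suc n) ?\<tau>" using cob_minus[OF Dn_Q(1)[OF c iT] cb] by blast
      then obtain u where u: "u \<in> carrier (Sec n)" "?\<tau> \<ominus>\<^bsub>Sec (Suc n)\<^esub> \<delta> n u \<in> van (Dn (insert h T)) (Suc n)"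
        by (rule cob_SucE)
      then have u2: "?\<tau> \<ominus>\<^bsub>Sec (Suc n)\<^esub> \<delta> n u \<in> van (Dn T) (Suc n)" "?\<tau> \<ominus>\<^bsub>Sec (Suc n)\<^esub> \<delta> n u \<in> van (below h) (Suc n)"
        using van_step(1)[OF c hS insert(5,1)] by auto
      have "\<delta> n u = ?\<tau> \<ominus>\<^bsub>Sec (Suc n)\<^esub> (?\<tau> \<ominus>\<^bsub>Sec (Suc n)\<^esub> \<delta> n u)" using \<tau>c d_closed[OF u(1)] by algebra
      then have "\<delta> n u \<in> van (Dn T) (Suc n)" using van_minus[OF DT(1) \<tau>T u2(1)] by simp
      \<comment> \<open>Over \<open>Dn T\<close> the primitive \<open>u\<close> is a cocycle below
        the top degree, hence a coboundary, and can be made to vanish there.\<close>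
      then obtain b where b: "b \<in> bd Sec \<delta> n" "b \<in> carrier (Sec n)" "\<delta> n b = \<zero>\<^bsub>Sec (Suc n)\<^esub>" "u \<ominus>\<^bsub>Sec n\<^esub> b \<in> van (Dn T) n"
        using acycD[OF low_vanishing[OF st lessI] u(1)] by blast
      let ?u = "u \<ominus>\<^bsub>Sec n\<^esub> b"
      have du: "\<delta> n ?u = \<delta> n u" using u(1) b(2,3) by (simp only: d_minus X.M.a_minus_zero d_closed)
      have uc: "?u \<in> carrier (Sec n)" using u(1) b(2) by simp
      obtain y where y: "rep n (h # c) ?C (\<lambda>a b. x a (h # b)) y" "s h = \<delta> n y h" using r by auto
      have yc: "y \<in> carrier (Sec n)" using rep_carrier[OF y(1)] .
      have s'h: "s' h = \<zero>\<^bsub>ob (cx I (Suc n)) h\<^esub>" using rep_zero_off[OF s' hQ(3,2) insert(3)] .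
      interpret h: module R "ob (cx I (Suc n)) h" using module_at[OF hQ(1)] .
      have \<tau>h: "?\<tau> h = \<delta> n y h"
        using y(2) s'h minus_at[OF s s'c hQ(1)] lim_closed[OF s hQ(1)] by simp
      have "\<delta> n u h = ?\<tau> h"
        using u2(2) minus_at_zero_iff[OF \<tau>c d_closed[OF u(1)] hQ(1)] by (simp add: van_below[OF hQ(1)])
      \<comment> \<open>At \<open>h\<close> both \<open>y\<close> and \<open>?u\<close> are
        primitives of \<open>?\<tau>\<close>. Their difference is a cocycle on the principal
        down-set, which is acyclic in every degree because \<open>F h\<close> is zero.\<close>
      then have "\<delta> n (y \<ominus>\<^bsub>Sec n\<^esub> ?u) h = \<zero>\<^bsub>ob (cx I (Suc n)) h\<^esub>"
        unfolding d_minus[OF yc uc] du minus_at_zero_iff[OF d_closed[OF yc] d_closed[OF u(1)] hQ(1)] using \<tau>h by simp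
      moreover have yuc: "y \<ominus>\<^bsub>Sec n\<^esub> ?u \<in> carrier (Sec n)" using yc uc by simp
      ultimately have "\<delta> n (y \<ominus>\<^bsub>Sec n\<^esub> ?u) \<in> van (below h) (Suc n)" using van_below[OF hQ(1)] d_closed by blast
      then obtain b' where b': "b' \<in> bd Sec \<delta> n" "b' \<in> carrier (Sec n)" "y \<ominus>\<^bsub>Sec n\<^esub> ?u \<ominus>\<^bsub>Sec n\<^esub> b' \<in> van (below h) n"
        using acycD[OF acyc_below[OF hQ(1)] yuc] stage_step(5)[OF sti hS] by blast
      \<comment> \<open>Writes \<open>y\<close> up to a coboundary as a part vanishing on
        \<open>Dn T\<close> plus a part vanishing below \<open>h\<close>. So \<open>y\<close> is a
        coboundary on the attaching set, and the outer induction applies to its coordinates.\<close>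
      have alg: "y \<ominus>\<^bsub>Sec n\<^esub> b' = w \<oplus>\<^bsub>Sec n\<^esub> (y \<ominus>\<^bsub>Sec n\<^esub> w \<ominus>\<^bsub>Sec n\<^esub> b')" if "w \<in> carrier (Sec n)" for w
        using yc that b'(2) by algebra
      have "y \<ominus>\<^bsub>Sec n\<^esub> b' \<in> van (Dn ?C) n"
        using van_step(2)[OF c hS insert(5,1)] b(4) b'(3) alg[OF uc] by blast
      then have "cob (Dn ?C) n y" unfolding cob_def using yc b'(1) by blast
      then have xh: "\<forall>a\<in>A. \<forall>b\<in>falling n (h # c) ?C a. x a (h # b) = \<zero>\<^bsub>ob F a\<^esub>"
        using Suc.IH[OF stage_step(1)[OF sti hS] valid_shift[OF Suc.prems(2)] y(1)] by blast
      show "\<forall>a\<in>A. \<forall>b\<in>falling (Suc n) c (insert h T) a. x a b = \<zero>\<^bsub>ob F a\<^esub>"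
      proof (intro ballI)
        fix a b assume a: "a \<in> A" and "b \<in> falling (Suc n) c (insert h T) a"
        then consider "b \<in> falling (Suc n) c T a" | b' where "b = h # b'" "b' \<in> falling n (h # c) ?C a" by auto
        then show "x a b = \<zero>\<^bsub>ob F a\<^esub>" using xT xh a by cases auto
      qed
    qed
  qed
  then show ?case using Suc.prems by blast
qed

text \<open>The earlier coatoms account for \<open>z\<close> over \<open>Dn T\<close> by the inner
  induction. The remainder is the connecting image of a class on the attaching set of
  \<open>h\<close>, which has coordinates by the outer induction.\<close>

lemma rep_surj:
  "stage n c T \<Longrightarrow> z \<in> carrier (Sec n) \<Longrightarrow> \<delta> n z \<in> van (Dn T) (Suc n) \<Longrightarrow>
    \<exists>x s. valid x \<and> rep n c T x s \<and> cob (Dn T) n (z \<ominus>\<^bsub>Sec n\<^esub> s)"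
proof (induction n arbitrary: c T z)
  case 0
  note c = stage_\<C>[OF 0(1)]
  have TS: "T \<subseteq> lower_covers P (hd c)" using stage_subset[OF 0(1)] .
  note DT = Dn_Q[OF c TS]
  have augz: "aug I p \<zero>\<^bsub>ob F p\<^esub> = \<zero>\<^bsub>ob (cx I 0) p\<^esub>" if "p \<in> Q" for p
    using mod_hom_zero[OF presheaf_module[OF cores_F[OF res] that] module_at[OF that] nat_trans_hom[OF cores_aug[OF res] that]] .
  have "\<exists>g\<in>carrier (ob F p). z p = aug I p g" if p: "p \<in> Dn T" for p
  proof (rule sec_exact_0[OF _ 0(2)])
    show pQ: "p \<in> Q" using p DT(1) by blast
    show "\<delta> 0 z \<in> van (below p) (Suc 0)" unfolding van_below[OF pQ]
      using 0(2,3) p by (simp add: van_def)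
  qed
  then obtain g where g: "\<And>p. p \<in> Dn T \<Longrightarrow> g p \<in> carrier (ob F p) \<and> z p = aug I p (g p)" by metis
  define x :: "'p \<Rightarrow> 'p list \<Rightarrow> 'm" where "x = (\<lambda>a b. if a \<in> Dn T then g a else \<zero>\<^bsub>ob F a\<^esub>)"
  have AQ: "a \<in> Q" if "a \<in> A" for a using A_Q[OF 0(1) that] .
  have x: "valid x"
    unfolding valid_def x_def
  proof (intro ballI allI)
    fix a assume a: "a \<in> A"
    interpret a: module R "ob F a" using presheaf_module[OF cores_F[OF res] AQ[OF a]] .
    show "(if a \<in> Dn T then g a else \<zero>\<^bsub>ob F a\<^esub>) \<in> carrier (ob F a)" using g by simp
  qed
  obtain s where s: "rep 0 c T x s" using rep_exists[OF 0(1) x] by blast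
  have sc: "s \<in> carrier (Sec 0)" using rep_carrier[OF s] .
  have zs: "z \<ominus>\<^bsub>Sec 0\<^esub> s \<in> van (Dn T) 0"
    unfolding van_def
  proof (intro CollectI conjI ballI)
    show "z \<ominus>\<^bsub>Sec 0\<^esub> s \<in> carrier (Sec 0)" using 0(2) sc by simp
    fix p assume p: "p \<in> Dn T"
    then have pQ: "p \<in> Q" using DT(1) by blast
    obtain h where h: "h \<in> T" "p \<le> h" "p \<in> P" using p by (auto simp: Dn_def)
    have hc: "h < hd c" "covers P bt h" using lower_covers_Q[OF c] stage_0_coatom[OF 0(1)] h TS by auto
    have "z p = s p"
    proof (cases "p \<in> T \<inter> A")
      case True
      then show ?thesis using s g[OF p] p by (simp add: x_def)
    next
      case False
      have "p \<notin> A"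
      proof
        assume pA: "p \<in> A"
        then have "bt < p" using A_covers by (auto simp: covers_def)
        then have "p = h" using hc(2) h by (auto simp: covers_def order_less_le)
        then show False using False pA h by blast
      qed
      then have "g p = \<zero>\<^bsub>ob F p\<^esub>" using A_conc[OF pQ] g[OF p] by auto
      then have "z p = \<zero>\<^bsub>ob (cx I 0) p\<^esub>" using g[OF p] augz[OF pQ] by simp
      moreover have "p < hd c" using h hc by simp
      ultimately show ?thesis using s False h(3) by simp
    qed
    then show "(z \<ominus>\<^bsub>Sec 0\<^esub> s) p = \<zero>\<^bsub>ob (cx I 0) p\<^esub>" using minus_at_zero_iff[OF 0(2) sc pQ] by blast
  qed
  then show ?case using x s cob_van by blast
next
  case (Suc n)
  note c = stage_\<C>[OF Suc.prems(1)]
  have len: "chain_length c + Suc n + 2 = rk" using Suc.prems(1) by (simp add: stage_def)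
  have "\<forall>z\<in>carrier (Sec (Suc n)). \<delta> (Suc n) z \<in> van (Dn T) (Suc (Suc n)) \<longrightarrow>
      (\<exists>x s. valid x \<and> rep (Suc n) c T x s \<and> cob (Dn T) (Suc n) (z \<ominus>\<^bsub>Sec (Suc n)\<^esub> s))"
    using c stage_segment[OF Suc.prems(1)]
  proof (induction rule: segment_induct)
    case empty
    show ?case
    proof (intro ballI impI)
      fix z assume z: "z \<in> carrier (Sec (Suc n))"
      have seg: "segment c {}" by (simp add: segment_def ofilter_def)
      have st: "stage (Suc n) c {}" using c len seg by (simp add: stage_def)
      let ?x = "\<lambda>a b. \<zero>\<^bsub>ob F a\<^esub>"
      have x: "valid ?x"
        unfolding valid_def
      proof (intro ballI allI)
        fix a assume "a \<in> A"
        then have "a \<in> Q" using A_Q[OF st] by blast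
        then interpret a: module R "ob F a" using presheaf_module[OF cores_F[OF res]] by blast
        show "\<zero>\<^bsub>ob F a\<^esub> \<in> carrier (ob F a)" by simp
      qed
      obtain s where s: "rep (Suc n) c {} ?x s" using rep_exists[OF st x] by blast
      have "z \<ominus>\<^bsub>Sec (Suc n)\<^esub> s \<in> van (Dn {}) (Suc n)" using z rep_carrier[OF s] by (simp add: van_def Dn_empty)
      then show "\<exists>x s. valid x \<and> rep (Suc n) c {} x s \<and> cob (Dn {}) (Suc n) (z \<ominus>\<^bsub>Sec (Suc n)\<^esub> s)"
        using x s cob_van by blast
    qed
  next
    case (insert T h)
    note hS = insert(4)
    have st: "stage (Suc n) c T" and sti: "stage (Suc n) c (insert h T)"
      using c len insert(1,2) by (auto simp: stage_def)
    have TS: "T \<subseteq> lower_covers P (hd c)" using stage_subset[OF st] .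
    have hQ: "h \<in> Q" "h < hd c" "h \<in> P" using lower_covers_Q[OF c hS] QP by auto
    note DT = Dn_Q[OF c TS]
    have BQ: "below h \<subseteq> Q" by blast
    let ?C = "C_set P L (h # c)"
    note v1 = van_step(1)[OF c hS insert(5,1)] and v2 = van_step(2)[OF c hS insert(5,1)]
    show ?case
    proof (intro ballI impI)
      fix z assume z: "z \<in> carrier (Sec (Suc n))" and dz: "\<delta> (Suc n) z \<in> van (Dn (insert h T)) (Suc (Suc n))"
      have dzT: "\<delta> (Suc n) z \<in> van (Dn T) (Suc (Suc n))" and dzh: "\<delta> (Suc n) z \<in> van (below h) (Suc (Suc n))"
        using dz v1 by auto
      obtain x' s' where x': "valid x'" and s': "rep (Suc n) c T x' s'" and cb: "cob (Dn T) (Suc n) (z \<ominus>\<^bsub>Sec (Suc n)\<^esub> s')"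
        using insert.IH z dzT by blast
      have s'c: "s' \<in> carrier (Sec (Suc n))" using rep_carrier[OF s'] .
      obtain u where u: "u \<in> carrier (Sec n)" "z \<ominus>\<^bsub>Sec (Suc n)\<^esub> s' \<ominus>\<^bsub>Sec (Suc n)\<^esub> \<delta> n u \<in> van (Dn T) (Suc n)"
        using cb by (rule cob_SucE)
      \<comment> \<open>The remainder: it vanishes over \<open>Dn T\<close> and is a cocycle below
        \<open>h\<close>, where it has a primitive \<open>v\<close>.\<close>
      let ?k = "z \<ominus>\<^bsub>Sec (Suc n)\<^esub> s' \<ominus>\<^bsub>Sec (Suc n)\<^esub> \<delta> n u"
      have duc: "\<delta> n u \<in> carrier (Sec (Suc n))" using u(1) by simp
      have kc: "?k \<in> carrier (Sec (Suc n))" using z s'c duc by simp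
      have "\<delta> (Suc n) ?k = \<delta> (Suc n) z \<ominus>\<^bsub>Sec (Suc (Suc n))\<^esub> \<delta> (Suc n) s'"
        using z s'c duc by (simp only: d_minus dd[OF u(1)] X.M.minus_closed d_closed X.M.a_minus_zero)
      moreover have "\<delta> (Suc n) s' \<in> van (below h) (Suc (Suc n))"
      proof -
        have "below h \<subseteq> open_below c" using open_below[OF c] hQ(2) QP by (auto intro: order.strict_trans1)
        then show ?thesis using rep_cocycle[OF st x' s'] van_mono by blast
      qed
      ultimately have dk: "\<delta> (Suc n) ?k \<in> van (below h) (Suc (Suc n))" using van_minus[OF BQ dzh] by simp
      obtain v where v: "v \<in> carrier (Sec n)" "?k \<ominus>\<^bsub>Sec (Suc n)\<^esub> \<delta> n v \<in> van (below h) (Suc n)"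
        using sec_exact_Suc[OF hQ(1) kc dk] .
      have dvc: "\<delta> n v \<in> carrier (Sec (Suc n))" using v(1) by simp
      let ?m = "\<zero>\<^bsub>Sec (Suc n)\<^esub> \<ominus>\<^bsub>Sec (Suc n)\<^esub> (?k \<ominus>\<^bsub>Sec (Suc n)\<^esub> \<delta> n v)"
      have "\<delta> n v = ?k \<oplus>\<^bsub>Sec (Suc n)\<^esub> ?m" using z s'c duc dvc by algebra
      moreover have "?m \<in> van (below h) (Suc n)" by (rule van_minus[OF BQ van_zero[OF BQ] v(2)])
      \<comment> \<open>On the overlap the remainder vanishes, so \<open>v\<close> is a cocycle
        there; its class is the one whose connecting image is the remainder.\<close>
      ultimately have dv: "\<delta> n v \<in> van (Dn ?C) (Suc n)" using v2 u(2) by blast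
      obtain xh y where xh: "valid xh" and y: "rep n (h # c) ?C xh y" and cby: "cob (Dn ?C) n (v \<ominus>\<^bsub>Sec n\<^esub> y)"
        using Suc.IH[OF stage_step(1)[OF sti hS] v(1) dv] by blast
      have yc: "y \<in> carrier (Sec n)" using rep_carrier[OF y] .
      obtain b where b: "b \<in> bd Sec \<delta> n" "v \<ominus>\<^bsub>Sec n\<^esub> y \<ominus>\<^bsub>Sec n\<^esub> b \<in> van (Dn ?C) n" using cby unfolding cob_def by blast
      obtain \<rho>1 \<rho>2 where \<rho>: "\<rho>1 \<in> van (Dn T) n" "\<rho>2 \<in> van (below h) n" "v \<ominus>\<^bsub>Sec n\<^esub> y \<ominus>\<^bsub>Sec n\<^esub> b = \<rho>1 \<oplus>\<^bsub>Sec n\<^esub> \<rho>2"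
        using b(2) v2 by blast
      have bc: "b \<in> carrier (Sec n)" using bdD(1)[OF b(1)] .
      have \<rho>c: "\<rho>1 \<in> carrier (Sec n)" "\<rho>2 \<in> carrier (Sec n)" using \<rho> van_carrier by blast+
      have d\<rho>: "\<delta> n v \<ominus>\<^bsub>Sec (Suc n)\<^esub> \<delta> n y = \<delta> n \<rho>1 \<oplus>\<^bsub>Sec (Suc n)\<^esub> \<delta> n \<rho>2"
        using arg_cong[OF \<rho>(3), of "\<delta> n"] v(1) yc bc \<rho>c
        by (simp only: d_minus d_add d_bd[OF b(1)] X.M.minus_closed d_closed X.M.a_minus_zero)
      \<comment> \<open>Chains through \<open>h\<close> take their coordinates from
        \<open>xh\<close>, all others from \<open>x'\<close>. The value at the empty list has no
        effect at a positive stage.\<close>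
      define x where "x = (\<lambda>a b. case b of [] \<Rightarrow> x' a [] | k # b' \<Rightarrow> if k = h then xh a b' else x' a (k # b'))"
      have x: "valid x" using x' xh by (auto simp: valid_def x_def split: list.split)
      have xsh: "(\<lambda>a b. x a (h # b)) = xh" and xsg: "\<And>g. g \<noteq> h \<Longrightarrow> (\<lambda>a b. x a (g # b)) = (\<lambda>a b. x' a (g # b))"
        by (auto simp: x_def)
      have dyc: "\<delta> n y \<in> carrier (Sec (Suc n))" using yc by simp
      have low: "\<delta> n y q = \<zero>\<^bsub>ob (cx I (Suc n)) q\<^esub>" if "g \<in> {h}" "q \<in> P" "q < g" for g q
      proof -
        have "\<delta> n y \<in> van (open_below (h # c)) (Suc n)" by (rule rep_cocycle[OF stage_step(1)[OF sti hS] xh y])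
        then show ?thesis using that open_below[OF Cons_in_\<C>[OF c hS]] by (simp add: van_def)
      qed
      \<comment> \<open>The connecting image of \<open>y\<close> as a section that lives at
        \<open>h\<close> alone; adding it to \<open>s'\<close> yields the representative for
        \<open>insert h T\<close>.\<close>
      obtain t where t: "t \<in> carrier (Sec (Suc n))" "t h = \<delta> n y h"
        "\<And>p. p \<in> P \<Longrightarrow> p < hd c \<Longrightarrow> p \<noteq> h \<Longrightarrow> t p = \<zero>\<^bsub>ob (cx I (Suc n)) p\<^esub>"
      proof -
        have hS': "{h} \<subseteq> lower_covers P (hd c)" using hS by blast
        obtain w where "w \<in> carrier (Sec (Suc n))" "\<And>g. g \<in> {h} \<Longrightarrow> w g = \<delta> n y g"
          "\<And>p. p \<in> P \<Longrightarrow> p < hd c \<Longrightarrow> p \<notin> {h} \<Longrightarrow> w p = \<zero>\<^bsub>ob (cx I (Suc n)) p\<^esub>"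
          using glue_coatoms[OF c hS', of "\<lambda>_. \<delta> n y" "Suc n"] dyc low by blast
        then show thesis using that by blast
      qed
      let ?s = "s' \<oplus>\<^bsub>Sec (Suc n)\<^esub> t"
      have sc: "?s \<in> carrier (Sec (Suc n))" using s'c t(1) by simp
      have at: "?s p = s' p \<oplus>\<^bsub>ob (cx I (Suc n)) p\<^esub> t p" if "p \<in> Q" for p using that by (simp add: lim_add)
      have rs: "rep (Suc n) c (insert h T) x ?s"
        unfolding rep.simps
      proof (intro conjI ballI impI sc)
        fix p assume p: "p \<in> P" "p < hd c \<and> p \<notin> insert h T"
        have pQ: "p \<in> Q" using open_below_Q[OF c] p by blast
        interpret p: module R "ob (cx I (Suc n)) p" using module_at[OF pQ] .
        show "?s p = \<zero>\<^bsub>ob (cx I (Suc n)) p\<^esub>" using rep_zero_off[OF s' p(1)] t(3)[OF p(1)] p(2) at[OF pQ] by simp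
      next
        fix g assume g: "g \<in> insert h T"
        then have gS: "g \<in> lower_covers P (hd c)" using TS hS by blast
        have gQ: "g \<in> Q" "g < hd c" "g \<in> P" using lower_covers_Q[OF c gS] QP by auto
        interpret g: module R "ob (cx I (Suc n)) g" using module_at[OF gQ(1)] .
        interpret h: module R "ob (cx I (Suc n)) h" using module_at[OF hQ(1)] .
        show "\<exists>y. rep n (g # c) (C_set P L (g # c)) (\<lambda>a b. x a (g # b)) y \<and> ?s g = \<delta> n y g"
        proof (cases "g = h")
          case True
          have "?s h = \<delta> n y h"
            using rep_zero_off[OF s' hQ(3,2) insert(3)] at[OF hQ(1)] t(2) lim_closed[OF dyc hQ(1)] True by simp
          then show ?thesis using y True xsh by auto
        next
          case False
          then have gT: "g \<in> T" using g by blast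
          obtain y' where y': "rep n (g # c) (C_set P L (g # c)) (\<lambda>a b. x' a (g # b)) y'" "s' g = \<delta> n y' g"
            using s' gT by auto
          have "?s g = \<delta> n y' g" using at[OF gQ(1)] t(3)[OF gQ(3,2) False] y'(2) lim_closed[OF s'c gQ(1)] by simp
          then show ?thesis using y'(1) xsg[OF False] by auto
        qed
      qed
      have tT: "t \<in> van (Dn T) (Suc n)"
        unfolding van_def
      proof (intro CollectI conjI ballI t(1))
        fix p assume "p \<in> Dn T"
        then obtain g where g: "p \<in> P" "g \<in> T" "p \<le> g" by (auto simp: Dn_def)
        have gc: "g \<in> P" "g < hd c" "g \<noteq> h" using lower_covers_Q[OF c] TS g(2) QP insert(3) by auto
        have "\<not> h < g" using coatom_maximal[OF hS gc(1,2)] .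
        then have "p \<noteq> h" using g(3) gc(3) by auto
        moreover have "p < hd c" using g(3) gc(2) by simp
        ultimately show "t p = \<zero>\<^bsub>ob (cx I (Suc n)) p\<^esub>" using t(3) g(1) by blast
      qed
      have th: "\<delta> n y \<ominus>\<^bsub>Sec (Suc n)\<^esub> t \<in> van (below h) (Suc n)"
        using minus_at_zero_iff[OF dyc t(1) hQ(1)] t(1,2) dyc by (simp add: van_below[OF hQ(1)])
      \<comment> \<open>The error between \<open>v\<close> and \<open>y\<close> on the overlap was
        split into \<open>\<rho>1\<close> and \<open>\<rho>2\<close>. Adding \<open>\<rho>1\<close>
        to \<open>u\<close> changes nothing over \<open>Dn T\<close> and repairs the comparison
        below \<open>h\<close>, so that one primitive serves both parts.\<close>
      let ?W = "(z \<ominus>\<^bsub>Sec (Suc n)\<^esub> ?s) \<ominus>\<^bsub>Sec (Suc n)\<^esub> \<delta> n (u \<oplus>\<^bsub>Sec n\<^esub> \<rho>1)"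
      have d1c: "\<delta> n \<rho>1 \<in> carrier (Sec (Suc n))" "\<delta> n \<rho>2 \<in> carrier (Sec (Suc n))" using \<rho>c by simp_all
      have W1: "?W = ?k \<ominus>\<^bsub>Sec (Suc n)\<^esub> t \<ominus>\<^bsub>Sec (Suc n)\<^esub> \<delta> n \<rho>1"
        unfolding d_add[OF u(1) \<rho>c(1)] using z s'c t(1) duc d1c by algebra
      have WT: "?W \<in> van (Dn T) (Suc n)"
        unfolding W1 using van_minus[OF DT(1) van_minus[OF DT(1) u(2) tT] van_\<delta>[OF DT(1) \<rho>(1)]] .
      have "\<delta> n \<rho>1 = (\<delta> n \<rho>1 \<oplus>\<^bsub>Sec (Suc n)\<^esub> \<delta> n \<rho>2) \<ominus>\<^bsub>Sec (Suc n)\<^esub> \<delta> n \<rho>2" using d1c by algebra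
      also have "\<dots> = \<delta> n v \<ominus>\<^bsub>Sec (Suc n)\<^esub> \<delta> n y \<ominus>\<^bsub>Sec (Suc n)\<^esub> \<delta> n \<rho>2" unfolding d\<rho>[symmetric] ..
      finally have d1: "\<delta> n \<rho>1 = \<delta> n v \<ominus>\<^bsub>Sec (Suc n)\<^esub> \<delta> n y \<ominus>\<^bsub>Sec (Suc n)\<^esub> \<delta> n \<rho>2" .
      have alg: "k \<ominus>\<^bsub>Sec (Suc n)\<^esub> t \<ominus>\<^bsub>Sec (Suc n)\<^esub> (\<delta> n v \<ominus>\<^bsub>Sec (Suc n)\<^esub> \<delta> n y \<ominus>\<^bsub>Sec (Suc n)\<^esub> \<delta> n \<rho>2) =
          (k \<ominus>\<^bsub>Sec (Suc n)\<^esub> \<delta> n v) \<oplus>\<^bsub>Sec (Suc n)\<^esub> \<delta> n \<rho>2 \<oplus>\<^bsub>Sec (Suc n)\<^esub> (\<delta> n y \<ominus>\<^bsub>Sec (Suc n)\<^esub> t)"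
        if "k \<in> carrier (Sec (Suc n))" for k
        using that t(1) dvc dyc d1c(2) by algebra
      have W2: "?W = (?k \<ominus>\<^bsub>Sec (Suc n)\<^esub> \<delta> n v) \<oplus>\<^bsub>Sec (Suc n)\<^esub> \<delta> n \<rho>2 \<oplus>\<^bsub>Sec (Suc n)\<^esub> (\<delta> n y \<ominus>\<^bsub>Sec (Suc n)\<^esub> t)"
        unfolding W1 d1 by (rule alg[OF kc])
      have Wh: "?W \<in> van (below h) (Suc n)"
        unfolding W2 using van_add[OF BQ van_add[OF BQ v(2) van_\<delta>[OF BQ \<rho>(2)]] th] .
      have "cob (Dn (insert h T)) (Suc n) (z \<ominus>\<^bsub>Sec (Suc n)\<^esub> ?s)"
        unfolding cob_def v1
        using WT Wh z sc d_in_bd[of "u \<oplus>\<^bsub>Sec n\<^esub> \<rho>1" n] u(1) \<rho>c(1) by blast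
      then show "\<exists>x s. valid x \<and> rep (Suc n) c (insert h T) x s \<and> cob (Dn (insert h T)) (Suc n) (z \<ominus>\<^bsub>Sec (Suc n)\<^esub> s)"
        using x rs by blast
    qed
  qed
  then show ?case using Suc.prems(2,3) by blast
qed

text \<open>The difference of the two sections represents a family that is zero on all falling
  chains, so \<open>rep_zero\<close> applies.\<close>

lemma rep_unique:
  assumes st: "stage n c T" and x: "valid x" "valid x'"
    and eq: "\<And>a b. a \<in> A \<Longrightarrow> b \<in> falling n c T a \<Longrightarrow> x a b = x' a b"
    and r: "rep n c T x s" "rep n c T x' s'"
  shows "cob (open_below c) n (s \<ominus>\<^bsub>Sec n\<^esub> s')"
proof -
  have sc: "s \<in> carrier (Sec n)" "s' \<in> carrier (Sec n)" using rep_carrier r by blast+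
  let ?m = "\<ominus>\<^bsub>R\<^esub> \<one>\<^bsub>R\<^esub>"
  have m: "?m \<in> carrier R" by simp
  have "rep n c T (\<lambda>a b. x a b \<oplus>\<^bsub>ob F a\<^esub> ?m \<odot>\<^bsub>ob F a\<^esub> x' a b) (s \<oplus>\<^bsub>Sec n\<^esub> ?m \<odot>\<^bsub>Sec n\<^esub> s')"
    by (rule rep_linear[OF st x m r])
  then have "cob (open_below c) n (s \<oplus>\<^bsub>Sec n\<^esub> ?m \<odot>\<^bsub>Sec n\<^esub> s')"
  proof (rule rep_zero[OF st])
    fix a b assume a: "a \<in> A" and b: "b \<in> falling n c T a"
    interpret a: module R "ob F a" using presheaf_module[OF cores_F[OF res] A_Q[OF st a]] .
    have "x' a b \<in> carrier (ob F a)" using x a by (simp add: valid_def)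
    then show "x a b \<oplus>\<^bsub>ob F a\<^esub> ?m \<odot>\<^bsub>ob F a\<^esub> x' a b = \<zero>\<^bsub>ob F a\<^esub>"
      using eq[OF a b] by (simp add: a.smult_l_minus a.M.r_neg)
  qed
  then show ?thesis using sc by (simp add: X.smult_l_minus a_minus_def)
qed

end

section \<open>Finite direct sums\<close>

lemma dsum_at:
  assumes "i \<in> I"
  shows "(x \<oplus>\<^bsub>dsum_module I M\<^esub> y) i = x i \<oplus>\<^bsub>M i\<^esub> y i" "(a \<odot>\<^bsub>dsum_module I M\<^esub> x) i = a \<odot>\<^bsub>M i\<^esub> x i"
    "\<zero>\<^bsub>dsum_module I M\<^esub> i = \<zero>\<^bsub>M i\<^esub>"
  using assms by (simp_all add: dsum_module_def)

lemma dsum_extensional: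
  "x \<oplus>\<^bsub>dsum_module I M\<^esub> y \<in> extensional I" "a \<odot>\<^bsub>dsum_module I M\<^esub> x \<in> extensional I"
  "\<zero>\<^bsub>dsum_module I M\<^esub> \<in> extensional I"
  by (simp_all add: dsum_module_def)

lemma mem_dsum_finite:
  "finite I \<Longrightarrow> x \<in> carrier (dsum_module I M) \<longleftrightarrow> x \<in> extensional I \<and> (\<forall>i\<in>I. x i \<in> carrier (M i))"
  by (auto simp: dsum_module_def PiE_iff)

lemma module_dsum_finite:
  assumes "cring R" "finite I" and mo: "\<And>i. i \<in> I \<Longrightarrow> module R (M i)"
  shows "module R (dsum_module I M)"
proof -
  let ?D = "dsum_module I M"
  have ag: "abelian_group (M i)" if "i \<in> I" for i using mo[OF that] by (simp add: module_def)
  note mem = mem_dsum_finite[OF assms(2), of _ M]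
  have add: "x \<oplus>\<^bsub>?D\<^esub> y \<in> carrier ?D" if "x \<in> carrier ?D" "y \<in> carrier ?D" for x y
    using that abelian_groupE(1)[OF ag] by (simp add: mem dsum_at dsum_extensional)
  have smult: "a \<odot>\<^bsub>?D\<^esub> x \<in> carrier ?D" if "a \<in> carrier R" "x \<in> carrier ?D" for a x
    using that module.smult_closed[OF mo] by (simp add: mem dsum_at dsum_extensional)
  have zero: "\<zero>\<^bsub>?D\<^esub> \<in> carrier ?D"
    using abelian_groupE(2)[OF ag] by (simp add: mem dsum_at dsum_extensional)
  have eqI: "x = y" if "x \<in> carrier ?D" "y \<in> carrier ?D" "\<And>i. i \<in> I \<Longrightarrow> x i = y i" for x y
    using that by (auto simp: mem intro: extensionalityI)
  have cl: "x i \<in> carrier (M i)" if "x \<in> carrier ?D" "i \<in> I" for x i using that by (simp add: mem)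
  interpret R: cring R by fact
  show ?thesis
  proof (rule moduleI)
    show "abelian_group ?D"
    proof (rule abelian_groupI)
      fix x assume x: "x \<in> carrier ?D"
      let ?y = "\<lambda>i\<in>I. \<ominus>\<^bsub>M i\<^esub> x i"
      have y: "?y \<in> carrier ?D" using cl[OF x] abelian_group.a_inv_closed[OF ag] by (simp add: mem)
      moreover have "?y \<oplus>\<^bsub>?D\<^esub> x = \<zero>\<^bsub>?D\<^esub>"
        by (rule eqI[OF add[OF y x] zero]) (use cl[OF x] in \<open>simp add: dsum_at abelian_group.l_neg[OF ag]\<close>)
      ultimately show "\<exists>y\<in>carrier ?D. y \<oplus>\<^bsub>?D\<^esub> x = \<zero>\<^bsub>?D\<^esub>" by blast
      show "\<zero>\<^bsub>?D\<^esub> \<oplus>\<^bsub>?D\<^esub> x = x"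
        by (rule eqI[OF add[OF zero x] x]) (use cl[OF x] in \<open>simp add: dsum_at abelian_groupE(5)[OF ag]\<close>)
      fix y assume y: "y \<in> carrier ?D"
      show "x \<oplus>\<^bsub>?D\<^esub> y = y \<oplus>\<^bsub>?D\<^esub> x"
        by (rule eqI[OF add[OF x y] add[OF y x]])
          (use cl[OF x] cl[OF y] in \<open>simp add: dsum_at abelian_groupE(4)[OF ag]\<close>)
      fix z assume z: "z \<in> carrier ?D"
      show "x \<oplus>\<^bsub>?D\<^esub> y \<oplus>\<^bsub>?D\<^esub> z = x \<oplus>\<^bsub>?D\<^esub> (y \<oplus>\<^bsub>?D\<^esub> z)"
        by (rule eqI[OF add[OF add[OF x y] z] add[OF x add[OF y z]]])
          (use cl[OF x] cl[OF y] cl[OF z] in \<open>simp add: dsum_at abelian_groupE(3)[OF ag]\<close>)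
    qed (use add zero in auto)
    fix a b x y assume a: "a \<in> carrier R" and x: "x \<in> carrier ?D"
    show "a \<odot>\<^bsub>?D\<^esub> (x \<oplus>\<^bsub>?D\<^esub> y) = a \<odot>\<^bsub>?D\<^esub> x \<oplus>\<^bsub>?D\<^esub> a \<odot>\<^bsub>?D\<^esub> y" if y: "y \<in> carrier ?D"
      by (rule eqI[OF smult[OF a add[OF x y]] add[OF smult[OF a x] smult[OF a y]]])
        (use a cl[OF x] cl[OF y] in \<open>simp add: dsum_at module.smult_r_distr[OF mo]\<close>)
    assume b: "b \<in> carrier R"
    show "(a \<oplus>\<^bsub>R\<^esub> b) \<odot>\<^bsub>?D\<^esub> x = a \<odot>\<^bsub>?D\<^esub> x \<oplus>\<^bsub>?D\<^esub> b \<odot>\<^bsub>?D\<^esub> x"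
      by (rule eqI[OF smult[OF R.a_closed[OF a b] x] add[OF smult[OF a x] smult[OF b x]]])
        (use a b cl[OF x] in \<open>simp add: dsum_at module.smult_l_distr[OF mo]\<close>)
    show "(a \<otimes>\<^bsub>R\<^esub> b) \<odot>\<^bsub>?D\<^esub> x = a \<odot>\<^bsub>?D\<^esub> (b \<odot>\<^bsub>?D\<^esub> x)"
      by (rule eqI[OF smult[OF R.m_closed[OF a b] x] smult[OF a smult[OF b x]]])
        (use a b cl[OF x] in \<open>simp add: dsum_at module.smult_assoc1[OF mo]\<close>)
  next
    fix x assume x: "x \<in> carrier ?D"
    show "\<one>\<^bsub>R\<^esub> \<odot>\<^bsub>?D\<^esub> x = x"
      by (rule eqI[OF smult[OF R.one_closed x] x]) (use cl[OF x] in \<open>simp add: dsum_at module.smult_one[OF mo]\<close>)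
  qed (use assms(1) smult in auto)
qed

section \<open>The top cohomology as a direct sum\<close>

context atomic_sections
begin

lemma stage_tp: "n + 2 = rk \<Longrightarrow> stage n [tp] (lower_covers P tp)"
  using segment_all[OF unref_tp] unref_tp by (simp add: stage_def chain_length_def)

lemma Dn_top: "Dn (lower_covers P tp) = Q"
  using open_below[OF unref_tp] QP by auto

text \<open>The falling chains to \<open>a\<close> are numbered through
  \<open>card_falling_mobius\<close>. The class of a chosen representative is independent of the
  choice by \<open>rep_unique\<close>, linear by \<open>rep_linear\<close>, and the resulting map is
  bijective by \<open>rep_inj\<close> and \<open>rep_surj\<close>.\<close>

theorem top_cohomology:
  assumes n: "n + 2 = rk"
  shows "\<exists>\<Theta>. \<Theta> \<in> mod_iso R (dsum_module A (\<lambda>a. dsum_module {..<nat \<bar>mobius P a tp\<bar>} (\<lambda>_. ob F a))) (coho Sec \<delta> n)"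
proof -
  let ?T = "lower_covers P tp" and ?N = "\<lambda>a. nat \<bar>mobius P a tp\<bar>"
  let ?B = "\<lambda>a. dsum_module {..<?N a} (\<lambda>_. ob F a)"
  let ?S = "dsum_module A ?B"
  let ?fal = "falling n [tp] ?T" and ?rep = "rep n [tp] ?T"
  note st = stage_tp[OF n]
  have AP: "A \<subseteq> P" using A_covers coversD by blast
  then have fA: "finite A" using finP finite_subset by blast
  have mF: "module R (ob F a)" if "a \<in> A" for a using presheaf_module[OF cores_F[OF res] A_Q[OF st that]] .
  have memS: "s \<in> carrier ?S \<longleftrightarrow> s \<in> extensional A \<and>
    (\<forall>a\<in>A. s a \<in> extensional {..<?N a} \<and> (\<forall>i<?N a. s a i \<in> carrier (ob F a)))" for s
    unfolding mem_dsum_finite[OF fA] by (simp add: mem_dsum_finite Ball_def)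
  have fin: "finite (?fal a)" for a using finite_falling[OF unref_tp] segment_all[OF unref_tp] by simp
  have "\<exists>\<beta>. bij_betw \<beta> (?fal a) {..<?N a}" if "a \<in> A" for a
    using card_falling_mobius[OF n A_covers[OF that]] fin by (intro finite_same_card_bij) auto
  then obtain \<beta> where \<beta>: "\<And>a. a \<in> A \<Longrightarrow> bij_betw (\<beta> a) (?fal a) {..<?N a}" by metis
  have \<beta>N: "\<beta> a b < ?N a" if "a \<in> A" "b \<in> ?fal a" for a b
    using bij_betwE[OF \<beta>[OF that(1)]] that(2) by blast
  \<comment> \<open>Coordinates off the falling chains are set to zero; they do not affect the
    class.\<close>
  define co where "co = (\<lambda>s a b. if b \<in> ?fal a then s a (\<beta> a b) else \<zero>\<^bsub>ob F a\<^esub>)"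
  have valid_co: "valid (co s)" if s: "s \<in> carrier ?S" for s
    unfolding valid_def
  proof (intro ballI allI)
    fix a b assume a: "a \<in> A"
    interpret a: module R "ob F a" using mF[OF a] .
    show "co s a b \<in> carrier (ob F a)" using s a \<beta>N[OF a] by (simp add: co_def memS)
  qed
  define \<sigma> where "\<sigma> = (\<lambda>s. SOME t. ?rep (co s) t)"
  have \<sigma>: "?rep (co s) (\<sigma> s)" if "s \<in> carrier ?S" for s
    unfolding \<sigma>_def by (rule someI_ex[OF rep_exists[OF st valid_co[OF that]]])
  have \<sigma>c: "\<sigma> s \<in> carrier (Sec n)" if "s \<in> carrier ?S" for s using rep_carrier[OF \<sigma>[OF that]] .
  have open_tp: "open_below [tp] = Q" using Dn_top by simp
  have d\<sigma>: "\<delta> n (\<sigma> s) = \<zero>\<^bsub>Sec (Suc n)\<^esub>" if "s \<in> carrier ?S" for s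
    using rep_cocycle[OF st valid_co[OF that] \<sigma>[OF that]] unfolding open_tp van_top by blast
  have \<sigma>Z: "\<sigma> s \<in> Z n" if "s \<in> carrier ?S" for s using \<sigma>c d\<sigma> that by (simp add: mem_a_kernel)
  have uniq: "cls Sec \<delta> n t = cls Sec \<delta> n (\<sigma> s)"
    if "s \<in> carrier ?S" "valid x" "?rep x t" "\<And>a b. a \<in> A \<Longrightarrow> b \<in> ?fal a \<Longrightarrow> x a b = co s a b" for s x t
  proof -
    have "cob (open_below [tp]) n (t \<ominus>\<^bsub>Sec n\<^esub> \<sigma> s)"
      by (rule rep_unique[OF st that(2) valid_co[OF that(1)] that(4,3) \<sigma>[OF that(1)]])
    then show ?thesis unfolding open_tp cob_top using cls_eq_iff[OF rep_carrier[OF that(3)] \<sigma>c[OF that(1)]] by simp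
  qed
  let ?\<Theta> = "\<lambda>s. cls Sec \<delta> n (\<sigma> s)"
  interpret S: module R ?S
    by (rule module_dsum_finite[OF cring fA]) (rule module_dsum_finite[OF cring], simp_all add: mF)
  have lin: "?\<Theta> (s \<oplus>\<^bsub>?S\<^esub> r \<odot>\<^bsub>?S\<^esub> s') = cls Sec \<delta> n (\<sigma> s \<oplus>\<^bsub>Sec n\<^esub> r \<odot>\<^bsub>Sec n\<^esub> \<sigma> s')"
    if s: "s \<in> carrier ?S" "s' \<in> carrier ?S" "r \<in> carrier R" for s s' r
  proof (rule uniq[symmetric])
    show "s \<oplus>\<^bsub>?S\<^esub> r \<odot>\<^bsub>?S\<^esub> s' \<in> carrier ?S" using s by simp
    show "valid (\<lambda>a b. co s a b \<oplus>\<^bsub>ob F a\<^esub> r \<odot>\<^bsub>ob F a\<^esub> co s' a b)"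
      unfolding valid_def
    proof (intro ballI allI)
      fix a b assume a: "a \<in> A"
      interpret a: module R "ob F a" using mF[OF a] .
      show "co s a b \<oplus>\<^bsub>ob F a\<^esub> r \<odot>\<^bsub>ob F a\<^esub> co s' a b \<in> carrier (ob F a)"
        using valid_co[OF s(1)] valid_co[OF s(2)] a s(3) by (simp add: valid_def)
    qed
    show "?rep (\<lambda>a b. co s a b \<oplus>\<^bsub>ob F a\<^esub> r \<odot>\<^bsub>ob F a\<^esub> co s' a b) (\<sigma> s \<oplus>\<^bsub>Sec n\<^esub> r \<odot>\<^bsub>Sec n\<^esub> \<sigma> s')"
      by (rule rep_linear[OF st valid_co[OF s(1)] valid_co[OF s(2)] s(3) \<sigma>[OF s(1)] \<sigma>[OF s(2)]])
    show "co s a b \<oplus>\<^bsub>ob F a\<^esub> r \<odot>\<^bsub>ob F a\<^esub> co s' a b = co (s \<oplus>\<^bsub>?S\<^esub> r \<odot>\<^bsub>?S\<^esub> s') a b"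
      if "a \<in> A" "b \<in> ?fal a" for a b
      using that \<beta>N[OF that] by (simp add: co_def dsum_at)
  qed
  have hom: "?\<Theta> \<in> mod_hom R ?S (coho Sec \<delta> n)"
  proof (rule mod_homI)
    fix s assume s: "s \<in> carrier ?S"
    show "?\<Theta> s \<in> carrier (coho Sec \<delta> n)" using cls_in_coho[OF \<sigma>c[OF s] d\<sigma>[OF s]] .
    fix s' assume s': "s' \<in> carrier ?S"
    show "?\<Theta> (s \<oplus>\<^bsub>?S\<^esub> s') = ?\<Theta> s \<oplus>\<^bsub>coho Sec \<delta> n\<^esub> ?\<Theta> s'"
      using lin[OF s s' X.R.one_closed] s s' \<sigma>c[OF s'] by (simp add: add_coho[OF \<sigma>Z[OF s] \<sigma>Z[OF s']])
  next
    fix r s assume r: "r \<in> carrier R" and s: "s \<in> carrier ?S"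
    have rr: "r \<ominus>\<^bsub>R\<^esub> \<one>\<^bsub>R\<^esub> \<in> carrier R" using r by simp
    \<comment> \<open>\<open>lin\<close> treats \<open>s\<close> plus a multiple of
      \<open>s'\<close>; writing \<open>r\<close> as \<open>1\<close> plus the rest turns a scalar
      multiple of \<open>s\<close> into this form.\<close>
    have eqr: "r = \<one>\<^bsub>R\<^esub> \<oplus>\<^bsub>R\<^esub> (r \<ominus>\<^bsub>R\<^esub> \<one>\<^bsub>R\<^esub>)" using r X.R.one_closed by algebra
    have 1: "s \<oplus>\<^bsub>?S\<^esub> (r \<ominus>\<^bsub>R\<^esub> \<one>\<^bsub>R\<^esub>) \<odot>\<^bsub>?S\<^esub> s = r \<odot>\<^bsub>?S\<^esub> s"
      using S.smult_l_distr[OF X.R.one_closed rr s] eqr s by simp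
    have 2: "\<sigma> s \<oplus>\<^bsub>Sec n\<^esub> (r \<ominus>\<^bsub>R\<^esub> \<one>\<^bsub>R\<^esub>) \<odot>\<^bsub>Sec n\<^esub> \<sigma> s = r \<odot>\<^bsub>Sec n\<^esub> \<sigma> s"
      using X.smult_l_distr[OF X.R.one_closed rr \<sigma>c[OF s]] eqr \<sigma>c[OF s] by simp
    show "?\<Theta> (r \<odot>\<^bsub>?S\<^esub> s) = r \<odot>\<^bsub>coho Sec \<delta> n\<^esub> ?\<Theta> s"
      using lin[OF s s rr] unfolding 1 2 smult_coho[OF r \<sigma>Z[OF s]] .
  qed
  have inj: "inj_on ?\<Theta> (carrier ?S)"
  proof (subst mod_hom_inj_iff[OF S.module_axioms module_coho hom], intro ballI impI)
    fix s assume s: "s \<in> carrier ?S" and "?\<Theta> s = \<zero>\<^bsub>coho Sec \<delta> n\<^esub>"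
    then have "\<sigma> s \<in> bd Sec \<delta> n" using cls_eq_zero_iff[OF \<sigma>c[OF s]] by simp
    then have "cob (Dn ?T) n (\<sigma> s)" unfolding Dn_top cob_top .
    then have z: "\<forall>a\<in>A. \<forall>b\<in>?fal a. co s a b = \<zero>\<^bsub>ob F a\<^esub>"
      using rep_inj[OF st valid_co[OF s] \<sigma>[OF s]] by blast
    have "s a i = \<zero>\<^bsub>ob F a\<^esub>" if "a \<in> A" "i < ?N a" for a i
    proof -
      obtain b where "b \<in> ?fal a" "\<beta> a b = i"
        using \<beta>[OF \<open>a \<in> A\<close>] \<open>i < ?N a\<close> by (metis (no_types, lifting) bij_betw_def imageE lessThan_iff)
      then show ?thesis using z that by (auto simp: co_def)
    qed
    then have "s a = \<zero>\<^bsub>?B a\<^esub>" if "a \<in> A" for a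
      using s that by (intro extensionalityI[of _ "{..<?N a}"]) (auto simp: memS dsum_at dsum_extensional)
    then show "s = \<zero>\<^bsub>?S\<^esub>"
      using s by (intro extensionalityI[of _ A]) (auto simp: memS dsum_at dsum_extensional)
  qed
  have surj: "X \<in> ?\<Theta> ` carrier ?S" if X: "X \<in> carrier (coho Sec \<delta> n)" for X
  proof -
    obtain z where z: "z \<in> carrier (Sec n)" "\<delta> n z = \<zero>\<^bsub>Sec (Suc n)\<^esub>" "X = cls Sec \<delta> n z"
      using X by (rule cohoE)
    have "\<delta> n z \<in> van (Dn ?T) (Suc n)" unfolding Dn_top van_top z(2) by blast
    then obtain x t where x: "valid x" "?rep x t" "cob (Dn ?T) n (z \<ominus>\<^bsub>Sec n\<^esub> t)"
      using rep_surj[OF st z(1)] by blast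
    let ?s = "\<lambda>a\<in>A. \<lambda>i\<in>{..<?N a}. x a (inv_into (?fal a) (\<beta> a) i)"
    have s: "?s \<in> carrier ?S" using x(1) by (auto simp: memS valid_def)
    have "cls Sec \<delta> n t = ?\<Theta> ?s"
    proof (rule uniq[OF s x(1,2)])
      fix a b assume a: "a \<in> A" and b: "b \<in> ?fal a"
      have "inv_into (?fal a) (\<beta> a) (\<beta> a b) = b" using \<beta>[OF a] b by (simp add: bij_betw_def)
      then show "x a b = co ?s a b" using a b \<beta>N[OF a b] by (simp add: co_def)
    qed
    moreover have "X = cls Sec \<delta> n t"
      using x(3) cls_eq_iff[OF z(1) rep_carrier[OF x(2)]] z(3) unfolding Dn_top cob_top by simp
    ultimately show ?thesis using s by blast
  qed
  have "?\<Theta> ` carrier ?S = carrier (coho Sec \<delta> n)"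
    using surj mod_hom_closed[OF hom] by blast
  then have "?\<Theta> \<in> mod_iso R ?S (coho Sec \<delta> n)"
    unfolding mod_iso_def using hom inj by (simp add: bij_betw_def)
  then show ?thesis by blast
qed

end

subsection \<open>The short exact sequence of functors\<close>

text \<open>Limits are left exact, so only surjectivity on the right needs an argument. As
  \<open>IE\<close> is injective in each degree, the sequence of functors splits there, and the
  splitting lifts sections.\<close>

lemma cochain_ses_lim:
  fixes IE :: "('p::order, 'r, 'a, 'i) coresolution" and IF :: "('p, 'r, 'b, 'i) coresolution"
    and IG :: "('p, 'r, 'c, 'i) coresolution"
  assumes R: "cring R" and pre: "presheaf_on R Q E" "presheaf_on R Q F" "presheaf_on R Q G"
    and ses: "short_exact_resolutions R Q E i F p G IE \<alpha> IF \<beta> IG"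
  shows "cochain_ses R (\<lambda>n. lim_module Q (cx IE n)) (\<lambda>n. lim_map Q (dif IE n))
    (\<lambda>n. lim_module Q (cx IF n)) (\<lambda>n. lim_map Q (dif IF n))
    (\<lambda>n. lim_module Q (cx IG n)) (\<lambda>n. lim_map Q (dif IG n)) (\<lambda>n. lim_map Q (\<alpha> n)) (\<lambda>n. lim_map Q (\<beta> n))"
proof -
  have rE: "coresolves R Q E IE" and iE: "\<And>n. injective_presheaf R Q (cx IE n)"
    and rF: "coresolves R Q F IF" and rG: "coresolves R Q G IG"
    and mA: "resolution_map R Q E i IE IF \<alpha>" and mB: "resolution_map R Q F p IF IG \<beta>"
    and ex: "\<And>n q. q \<in> Q \<Longrightarrow> short_exact R (ob (cx IE n) q) (\<alpha> n q) (ob (cx IF n) q) (\<beta> n q) (ob (cx IG n) q)"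
    using ses pre by (simp_all add: short_exact_resolutions_def injective_resolution_iff)
  have nA: "nat_trans R Q (cx IE n) (cx IF n) (\<alpha> n)" and nB: "nat_trans R Q (cx IF n) (cx IG n) (\<beta> n)" for n
    using mA mB by (auto simp: resolution_map_def)
  note pE = cores_cx[OF rE] and pF = cores_cx[OF rF] and pG = cores_cx[OF rG]
  note mE = presheaf_module[OF pE] and mF = presheaf_module[OF pF] and mG = presheaf_module[OF pG]
  have inj: "inj_on (\<alpha> n q) (carrier (ob (cx IE n) q))"
    and BA: "x \<in> carrier (ob (cx IE n) q) \<Longrightarrow> \<beta> n q (\<alpha> n q x) = \<zero>\<^bsub>ob (cx IG n) q\<^esub>"
    and kerB: "y \<in> carrier (ob (cx IF n) q) \<Longrightarrow> \<beta> n q y = \<zero>\<^bsub>ob (cx IG n) q\<^esub> \<Longrightarrow>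
      \<exists>x\<in>carrier (ob (cx IE n) q). \<alpha> n q x = y"
    and surB: "z \<in> carrier (ob (cx IG n) q) \<Longrightarrow> \<exists>y\<in>carrier (ob (cx IF n) q). \<beta> n q y = z"
    if "q \<in> Q" for n q x y z
  proof -
    note e = ex[OF that, of n, unfolded short_exact_def]
    show "inj_on (\<alpha> n q) (carrier (ob (cx IE n) q))" using e by blast
    have im: "\<alpha> n q ` carrier (ob (cx IE n) q) = a_kernel (ob (cx IF n) q) (ob (cx IG n) q) (\<beta> n q)"
      and su: "\<beta> n q ` carrier (ob (cx IF n) q) = carrier (ob (cx IG n) q)" using e by blast+
    show "\<beta> n q (\<alpha> n q x) = \<zero>\<^bsub>ob (cx IG n) q\<^esub>" if "x \<in> carrier (ob (cx IE n) q)"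
    proof -
      have "\<alpha> n q x \<in> a_kernel (ob (cx IF n) q) (ob (cx IG n) q) (\<beta> n q)" using im that by blast
      then show ?thesis by (simp add: mem_a_kernel)
    qed
    show "\<exists>x\<in>carrier (ob (cx IE n) q). \<alpha> n q x = y"
      if "y \<in> carrier (ob (cx IF n) q)" "\<beta> n q y = \<zero>\<^bsub>ob (cx IG n) q\<^esub>"
    proof -
      have "y \<in> \<alpha> n q ` carrier (ob (cx IE n) q)" unfolding im using that by (simp add: mem_a_kernel)
      then show ?thesis by blast
    qed
    show "\<exists>y\<in>carrier (ob (cx IF n) q). \<beta> n q y = z" if "z \<in> carrier (ob (cx IG n) q)"
    proof -
      have "z \<in> \<beta> n q ` carrier (ob (cx IF n) q)" unfolding su by (rule that)
      then show ?thesis by blast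
    qed
  qed
  have A0: "x = \<zero>\<^bsub>ob (cx IE n) q\<^esub>"
    if "q \<in> Q" "x \<in> carrier (ob (cx IE n) q)" "\<alpha> n q x = \<zero>\<^bsub>ob (cx IF n) q\<^esub>" for n q x
    using mod_hom_inj_iff[OF mE mF nat_trans_hom[OF nA]] inj that by blast
  have Aeq: "x = x'" if "q \<in> Q" "x \<in> carrier (ob (cx IE n) q)" "x' \<in> carrier (ob (cx IE n) q)" "\<alpha> n q x = \<alpha> n q x'" for n q x x'
    using inj[OF that(1)] that by (auto dest: inj_onD)
  show ?thesis
  proof (intro cochain_ses.intro cochain_ses_axioms.intro)
    show "cochain_map R (\<lambda>n. lim_module Q (cx IE n)) (\<lambda>n. lim_map Q (dif IE n))
      (\<lambda>n. lim_module Q (cx IF n)) (\<lambda>n. lim_map Q (dif IF n)) (\<lambda>n. lim_map Q (\<alpha> n))"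
      by (rule cochain_map_lim[OF R rE rF order_refl mA])
    show "cochain_map R (\<lambda>n. lim_module Q (cx IF n)) (\<lambda>n. lim_map Q (dif IF n))
      (\<lambda>n. lim_module Q (cx IG n)) (\<lambda>n. lim_map Q (dif IG n)) (\<lambda>n. lim_map Q (\<beta> n))"
      by (rule cochain_map_lim[OF R rF rG order_refl mB])
  next
    fix n x assume x: "x \<in> carrier (lim_module Q (cx IE n))"
    interpret LE: module R "lim_module Q (cx IE n)" using module_lim[OF R pE] .
    interpret LG: module R "lim_module Q (cx IG n)" using module_lim[OF R pG] .
    show "x = \<zero>\<^bsub>lim_module Q (cx IE n)\<^esub>" if "lim_map Q (\<alpha> n) x = \<zero>\<^bsub>lim_module Q (cx IF n)\<^esub>"
    proof (rule lim_eqI[OF x LE.M.zero_closed])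
      fix q assume q: "q \<in> Q"
      have "\<alpha> n q (x q) = \<zero>\<^bsub>ob (cx IF n) q\<^esub>" using fun_cong[OF that, of q] q by (simp add: lim_map_def lim_zero)
      then show "x q = \<zero>\<^bsub>lim_module Q (cx IE n)\<^esub> q" using A0[OF q lim_closed[OF x q]] q by (simp add: lim_zero)
    qed
    have hA: "lim_map Q (\<alpha> n) \<in> mod_hom R (lim_module Q (cx IE n)) (lim_module Q (cx IF n))"
      by (rule lim_map_hom[OF pE nA order_refl])
    have hB: "lim_map Q (\<beta> n) \<in> mod_hom R (lim_module Q (cx IF n)) (lim_module Q (cx IG n))"
      by (rule lim_map_hom[OF pF nB order_refl])
    show "lim_map Q (\<beta> n) (lim_map Q (\<alpha> n) x) = \<zero>\<^bsub>lim_module Q (cx IG n)\<^esub>"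
      by (rule lim_eqI[OF mod_hom_closed[OF hB mod_hom_closed[OF hA x]] LG.M.zero_closed])
        (use BA lim_closed[OF x] in \<open>simp add: lim_map_def lim_zero\<close>)
  next
    fix n y assume y: "y \<in> carrier (lim_module Q (cx IF n))" and "lim_map Q (\<beta> n) y = \<zero>\<^bsub>lim_module Q (cx IG n)\<^esub>"
    then have "lim_map Q (\<beta> n) y q = \<zero>\<^bsub>lim_module Q (cx IG n)\<^esub> q" for q by simp
    then have "\<beta> n q (y q) = \<zero>\<^bsub>ob (cx IG n) q\<^esub>" if "q \<in> Q" for q
      using that by (metis (no_types) lim_map_def lim_zero restrict_apply')
    then have "\<exists>x\<in>carrier (ob (cx IE n) q). \<alpha> n q x = y q" if "q \<in> Q" for q
      using kerB[OF that lim_closed[OF y that]] that by blast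
    then obtain x where x: "\<And>q. q \<in> Q \<Longrightarrow> x q \<in> carrier (ob (cx IE n) q) \<and> \<alpha> n q (x q) = y q" by metis
    let ?x = "\<lambda>q\<in>Q. x q"
    have "?x \<in> carrier (lim_module Q (cx IE n))"
      unfolding mem_lim
    proof (intro conjI ballI impI)
      fix p q assume pq: "p \<in> Q" "q \<in> Q" "q \<le> p"
      have "\<alpha> n q (ar (cx IE n) p q (x p)) = ar (cx IF n) p q (y p)"
        using nat_trans_ar[OF nA pq] x pq by simp
      also have "\<dots> = \<alpha> n q (x q)" using lim_ar[OF y pq] x pq by simp
      finally have "ar (cx IE n) p q (x p) = x q"
        using Aeq[OF pq(2) presheaf_ar_closed[OF pE pq]] x pq by blast
      then show "ar (cx IE n) p q (?x p) = ?x q" using pq by simp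
    qed (use x in auto)
    moreover have "lim_map Q (\<alpha> n) ?x = y"
      using x y by (auto simp: lim_map_def mem_lim fun_eq_iff extensional_def)
    ultimately show "\<exists>x\<in>carrier (lim_module Q (cx IE n)). lim_map Q (\<alpha> n) x = y" by blast
  next
    fix n z assume z: "z \<in> carrier (lim_module Q (cx IG n))"
    \<comment> \<open>A retraction of \<open>\<alpha> n\<close>, obtained by extending the identity
      of \<open>cx IE n\<close>.\<close>
    have "\<exists>g. nat_trans R Q (cx IF n) (cx IE n) g \<and> (\<forall>q\<in>Q. \<forall>x\<in>carrier (ob (cx IE n) q). g q (\<alpha> n q x) = x)"
    proof (rule injective_extend[OF iE pF pE nA])
      show "nat_trans R Q (cx IE n) (cx IE n) (\<lambda>q x. x)" by (auto simp: nat_trans_def mod_hom_def)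
    qed (rule A0)
    then obtain \<rho> where n\<rho>: "nat_trans R Q (cx IF n) (cx IE n) \<rho>"
      and \<rho>: "\<And>q x. q \<in> Q \<Longrightarrow> x \<in> carrier (ob (cx IE n) q) \<Longrightarrow> \<rho> q (\<alpha> n q x) = x" by blast
    \<comment> \<open>The projection along the image of \<open>\<alpha> n\<close>. It depends on
      \<open>x\<close> only through \<open>\<beta> n q x\<close>, so applying it to arbitrary
      pointwise lifts of \<open>z\<close> makes them compatible.\<close>
    let ?\<pi> = "\<lambda>q x. x \<ominus>\<^bsub>ob (cx IF n) q\<^esub> \<alpha> n q (\<rho> q x)"
    have \<pi>: "?\<pi> q x = ?\<pi> q x'"
      if q: "q \<in> Q" and x: "x \<in> carrier (ob (cx IF n) q)" "x' \<in> carrier (ob (cx IF n) q)" and e: "\<beta> n q x = \<beta> n q x'" for q x x'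
    proof -
      interpret E: module R "ob (cx IE n) q" using mE[OF q] .
      interpret F: module R "ob (cx IF n) q" using mF[OF q] .
      interpret G: module R "ob (cx IG n) q" using mG[OF q] .
      note hA = nat_trans_hom[OF nA q] and hB = nat_trans_hom[OF nB q] and hR = nat_trans_hom[OF n\<rho> q]
      have "\<beta> n q (x \<ominus>\<^bsub>ob (cx IF n) q\<^esub> x') = \<zero>\<^bsub>ob (cx IG n) q\<^esub>"
        using mod_hom_minus[OF mF[OF q] mG[OF q] hB x] e mod_hom_closed[OF hB x(2)] by simp
      then obtain w where w: "w \<in> carrier (ob (cx IE n) q)" "\<alpha> n q w = x \<ominus>\<^bsub>ob (cx IF n) q\<^esub> x'"
        using kerB[OF q] x by blast
      have "\<rho> q x \<ominus>\<^bsub>ob (cx IE n) q\<^esub> \<rho> q x' = w"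
        using \<rho>[OF q w(1)] w(2) mod_hom_minus[OF mF[OF q] mE[OF q] hR x] by simp
      then have "\<alpha> n q (\<rho> q x) \<ominus>\<^bsub>ob (cx IF n) q\<^esub> \<alpha> n q (\<rho> q x') = x \<ominus>\<^bsub>ob (cx IF n) q\<^esub> x'"
        using w(2) mod_hom_minus[OF mE[OF q] mF[OF q] hA mod_hom_closed[OF hR x(1)] mod_hom_closed[OF hR x(2)]] by simp
      moreover have "a \<ominus>\<^bsub>ob (cx IF n) q\<^esub> b = (a' \<ominus>\<^bsub>ob (cx IF n) q\<^esub> b') \<oplus>\<^bsub>ob (cx IF n) q\<^esub>
          ((a \<ominus>\<^bsub>ob (cx IF n) q\<^esub> a') \<ominus>\<^bsub>ob (cx IF n) q\<^esub> (b \<ominus>\<^bsub>ob (cx IF n) q\<^esub> b'))"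
        if "a \<in> carrier (ob (cx IF n) q)" "a' \<in> carrier (ob (cx IF n) q)" "b \<in> carrier (ob (cx IF n) q)"
          "b' \<in> carrier (ob (cx IF n) q)" for a a' b b'
        using that by algebra
      note this[OF x(1,2) mod_hom_closed[OF hA mod_hom_closed[OF hR x(1)]] mod_hom_closed[OF hA mod_hom_closed[OF hR x(2)]]]
      ultimately show ?thesis
        using x mod_hom_closed[OF hA mod_hom_closed[OF hR x(2)]] by simp
    qed
    have "\<forall>q\<in>Q. \<exists>y. y \<in> carrier (ob (cx IF n) q) \<and> \<beta> n q y = z q"
      using surB lim_closed[OF z] by blast
    then obtain x where x: "\<And>q. q \<in> Q \<Longrightarrow> x q \<in> carrier (ob (cx IF n) q) \<and> \<beta> n q (x q) = z q" by metis
    let ?y = "\<lambda>q\<in>Q. ?\<pi> q (x q)"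
    have cl: "\<alpha> n q (\<rho> q (x q)) \<in> carrier (ob (cx IF n) q)" if "q \<in> Q" for q
      using nat_trans_closed[OF nA that nat_trans_closed[OF n\<rho> that]] x that by blast
    have "?y \<in> carrier (lim_module Q (cx IF n))"
      unfolding mem_lim
    proof (intro conjI ballI impI)
      fix q assume q: "q \<in> Q"
      interpret F: module R "ob (cx IF n) q" using mF[OF q] .
      show "?y q \<in> carrier (ob (cx IF n) q)" using x[OF q] cl[OF q] q by simp
    next
      fix p q assume pq: "p \<in> Q" "q \<in> Q" "q \<le> p"
      have xp: "x p \<in> carrier (ob (cx IF n) p)" using x pq by blast
      have "ar (cx IF n) p q (?\<pi> p (x p)) = ?\<pi> q (ar (cx IF n) p q (x p))"
        unfolding mod_hom_minus[OF mF[OF pq(1)] mF[OF pq(2)] presheaf_ar[OF pF pq] xp cl[OF pq(1)]]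
        using nat_trans_ar[OF nA pq nat_trans_closed[OF n\<rho> pq(1) xp]] nat_trans_ar[OF n\<rho> pq xp] by simp
      also have "\<dots> = ?\<pi> q (x q)"
      proof (rule \<pi>[OF pq(2) presheaf_ar_closed[OF pF pq xp]])
        show "\<beta> n q (ar (cx IF n) p q (x p)) = \<beta> n q (x q)"
          using nat_trans_ar[OF nB pq xp] x pq lim_ar[OF z pq] by simp
      qed (use x pq in blast)
      finally show "ar (cx IF n) p q (?y p) = ?y q" using pq by simp
    qed simp
    moreover have "lim_map Q (\<beta> n) ?y = z"
    proof (rule extensionalityI[of _ Q])
      show "z \<in> extensional Q" using z by (simp add: mem_lim)
      fix q assume q: "q \<in> Q"
      interpret G: module R "ob (cx IG n) q" using mG[OF q] .
      have "\<beta> n q (?\<pi> q (x q)) = z q"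
        using mod_hom_minus[OF mF[OF q] mG[OF q] nat_trans_hom[OF nB q] _ cl[OF q]] x[OF q] BA[OF q nat_trans_closed[OF n\<rho> q]]
          lim_closed[OF z q] by simp
      then show "lim_map Q (\<beta> n) ?y q = z q" using q by (simp add: lim_map_def)
    qed (simp add: lim_map_def)
    ultimately show "\<exists>y\<in>carrier (lim_module Q (cx IF n)). lim_map Q (\<beta> n) y = z" by blast
  qed
qed

lemma presheaf_quot:
  assumes X: "presheaf_on R Q X" and N: "\<And>p. p \<in> Q \<Longrightarrow> submodule (carrier (ob Y p)) R (ob X p)"
    and cl: "\<And>p q x. p \<in> Q \<Longrightarrow> q \<in> Q \<Longrightarrow> q \<le> p \<Longrightarrow> x \<in> carrier (ob Y p) \<Longrightarrow> ar X p q x \<in> carrier (ob Y q)"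
  shows "presheaf_on R Q (quot_presheaf X Y)"
    and "\<And>p q x. p \<in> Q \<Longrightarrow> q \<in> Q \<Longrightarrow> q \<le> p \<Longrightarrow> x \<in> carrier (ob X p) \<Longrightarrow>
      ar (quot_presheaf X Y) p q (quot_proj X Y p x) = quot_proj X Y q (ar X p q x)"
    and "\<And>p. p \<in> Q \<Longrightarrow> carrier (ob (quot_presheaf X Y) p) = quot_proj X Y p ` carrier (ob X p)"
    and "\<And>p. p \<in> Q \<Longrightarrow> quot_proj X Y p \<in> mod_hom R (ob X p) (ob (quot_presheaf X Y) p)"
    and "\<And>p. p \<in> Q \<Longrightarrow> \<zero>\<^bsub>ob (quot_presheaf X Y) p\<^esub> = quot_proj X Y p \<zero>\<^bsub>ob X p\<^esub>"
proof -
  note mX = presheaf_module[OF X]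
  let ?G = "quot_presheaf X Y" and ?c = "quot_proj X Y"
  have ob: "ob ?G p = quot_module (ob X p) (carrier (ob Y p))" for p by (simp add: quot_presheaf_def)
  have c: "?c p x = a_r_coset (ob X p) (carrier (ob Y p)) x" for p x by (simp add: quot_proj_def)
  show car: "carrier (ob ?G p) = ?c p ` carrier (ob X p)" if "p \<in> Q" for p
    unfolding ob c by (rule carrier_quot_module[OF mX[OF that] N[OF that]])
  show "\<zero>\<^bsub>ob ?G p\<^esub> = ?c p \<zero>\<^bsub>ob X p\<^esub>" if "p \<in> Q" for p
    unfolding ob c by (rule zero_quot_module[OF mX[OF that] N[OF that]])
  have add: "?c p x \<oplus>\<^bsub>ob ?G p\<^esub> ?c p y = ?c p (x \<oplus>\<^bsub>ob X p\<^esub> y)"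
    if "p \<in> Q" "x \<in> carrier (ob X p)" "y \<in> carrier (ob X p)" for p x y
    unfolding ob c by (rule add_quot_module[OF mX[OF that(1)] N[OF that(1)] that(2,3)])
  have sm: "a \<odot>\<^bsub>ob ?G p\<^esub> ?c p x = ?c p (a \<odot>\<^bsub>ob X p\<^esub> x)"
    if "p \<in> Q" "a \<in> carrier R" "x \<in> carrier (ob X p)" for p x a
    unfolding ob c by (rule smult_quot_module[OF mX[OF that(1)] N[OF that(1)] that(2,3)])
  show "?c p \<in> mod_hom R (ob X p) (ob ?G p)" if "p \<in> Q" for p
    by (rule mod_homI) (use car add sm that in auto)
  show arc: "ar ?G p q (?c p x) = ?c q (ar X p q x)" if pq: "p \<in> Q" "q \<in> Q" "q \<le> p" and x: "x \<in> carrier (ob X p)" for p q x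
  proof -
    interpret p: module R "ob X p" using mX[OF pq(1)] .
    interpret q: module R "ob X q" using mX[OF pq(2)] .
    have "?c q (ar X p q y) = ?c q (ar X p q x)" if "y \<in> ?c p x" for y
    proof -
      have y: "y \<in> carrier (ob X p)" "y \<ominus>\<^bsub>ob X p\<^esub> x \<in> carrier (ob Y p)"
        using that mem_a_r_coset_minus[OF mX[OF pq(1)] N[OF pq(1)] x] unfolding c by auto
      have "ar X p q y \<ominus>\<^bsub>ob X q\<^esub> ar X p q x \<in> carrier (ob Y q)"
        using cl[OF pq y(2)] mod_hom_minus[OF mX[OF pq(1)] mX[OF pq(2)] presheaf_ar[OF X pq] y(1) x] by simp
      then show ?thesis
        unfolding c using coset_eq_iff[OF mX[OF pq(2)] N[OF pq(2)] presheaf_ar_closed[OF X pq y(1)] presheaf_ar_closed[OF X pq x]] by simp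
    qed
    moreover have "x \<in> ?c p x"
      unfolding c mem_a_r_coset_minus[OF mX[OF pq(1)] N[OF pq(1)] x] using x p.submoduleD(2)[OF N[OF pq(1)]] by simp
    ultimately have "(\<Union>y\<in>?c p x. ?c q (ar X p q y)) = ?c q (ar X p q x)" by blast
    then show ?thesis by (simp add: quot_presheaf_def)
  qed
  show "presheaf_on R Q ?G"
    unfolding presheaf_on_def
  proof (intro conjI ballI impI)
    show "module R (ob ?G p)" if "p \<in> Q" for p unfolding ob by (rule module_quot_module[OF mX[OF that] N[OF that]])
  next
    fix p q assume pq: "p \<in> Q" "q \<in> Q" "q \<le> p"
    note h = presheaf_ar[OF X pq]
    show "ar ?G p q \<in> mod_hom R (ob ?G p) (ob ?G q)"
    proof (rule mod_homI)
      fix Z W a assume "Z \<in> carrier (ob ?G p)"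
      then obtain x where x: "x \<in> carrier (ob X p)" "Z = ?c p x" using car[OF pq(1)] by auto
      note xq = mod_hom_closed[OF h x(1)]
      interpret p: module R "ob X p" using mX[OF pq(1)] .
      show "ar ?G p q Z \<in> carrier (ob ?G q)" using x arc[OF pq] car[OF pq(2)] xq by simp
      show "ar ?G p q (a \<odot>\<^bsub>ob ?G p\<^esub> Z) = a \<odot>\<^bsub>ob ?G q\<^esub> ar ?G p q Z" if "a \<in> carrier R"
        using x that arc[OF pq] sm[OF pq(1) that] sm[OF pq(2) that xq] mod_hom_smult[OF h that] by simp
      assume "W \<in> carrier (ob ?G p)"
      then obtain y where y: "y \<in> carrier (ob X p)" "W = ?c p y" using car[OF pq(1)] by auto
      note yq = mod_hom_closed[OF h y(1)]
      show "ar ?G p q (Z \<oplus>\<^bsub>ob ?G p\<^esub> W) = ar ?G p q Z \<oplus>\<^bsub>ob ?G q\<^esub> ar ?G p q W"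
        using x y arc[OF pq] add[OF pq(1)] add[OF pq(2) xq yq] mod_hom_add[OF h] by simp
    qed
  next
    fix p Z assume p: "p \<in> Q" and "Z \<in> carrier (ob ?G p)"
    then obtain x where x: "x \<in> carrier (ob X p)" "Z = ?c p x" using car[OF p] by auto
    then show "ar ?G p p Z = Z" using arc[OF p p order_refl] presheaf_id[OF X p] by simp
  next
    fix p q r Z assume pq: "p \<in> Q" "q \<in> Q" and r: "r \<in> Q" and le: "r \<le> q \<and> q \<le> p" and "Z \<in> carrier (ob ?G p)"
    then obtain x where x: "x \<in> carrier (ob X p)" "Z = ?c p x" using car[OF pq(1)] by auto
    have le': "r \<le> q" "q \<le> p" "r \<le> p" using le by auto
    show "ar ?G q r (ar ?G p q Z) = ar ?G p r Z"
      using x arc[OF pq le'(2)] arc[OF pq(2) r le'(1)] arc[OF pq(1) r le'(3)] presheaf_ar_closed[OF X pq le'(2)]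
        presheaf_comp[OF X pq r le'(1,2)] by simp
  qed
qed

lemma dsum_module_cong:
  assumes "\<And>i. i \<in> I \<Longrightarrow> M i = N i"
  shows "dsum_module I M = dsum_module I N"
proof -
  have "{i \<in> I. x i \<noteq> \<zero>\<^bsub>M i\<^esub>} = {i \<in> I. x i \<noteq> \<zero>\<^bsub>N i\<^esub>}" for x using assms by auto
  then show ?thesis
    unfolding dsum_module_def using assms by (auto simp: PiE_iff fun_eq_iff restrict_def)
qed

theorem theorem4p4:
  fixes R :: "'r ring"
    and P A Q U :: "'p::order set"
    and L :: "'p list \<Rightarrow> 'p rel"
    and F E :: "('p, 'r, 'm) presheaf"
    and G :: "('p, 'r, 'm set) presheaf"
    and K J IE IF :: "('p, 'r, 'm, 'i) coresolution"
    and IG :: "('p, 'r, 'm set, 'i) coresolution"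
    and S :: "('r, 'p \<Rightarrow> nat \<Rightarrow> 'm) module"
    and \<alpha> \<beta> :: "nat \<Rightarrow> 'p \<Rightarrow> 'i \<Rightarrow> 'i"
  assumes "cring R"
    and "dual_CL_shellable P L"
    and "pure_poset P"
    and "finite P"
    and "poset_rank P \<ge> 3"
    and "presheaf_on R P F"
    and "carrier (ob F (bot_of P)) = {\<zero>\<^bsub>ob F (bot_of P)\<^esub>}"
    and "A \<subseteq> atoms_of P"
    and "\<And>c. c \<in> unref_chains_to P (top_of P) \<Longrightarrow> chain_length c = poset_rank P - 2 \<Longrightarrow>
           (\<lambda>x. \<lambda>a\<in>C_set P L c - A. ar F (hd c) a x) ` carrier (ob F (hd c)) =
           carrier (dsum_module (C_set P L c - A) (ob F))"
    and "Q = P - {top_of P}"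
    and "U = proper_part P - A"
    and "E = sub_presheaf A F"
    and "G = quot_presheaf F E"
    and "S = dsum_module A (\<lambda>a. dsum_module {..<nat \<bar>mobius P a (top_of P)\<bar>} (\<lambda>_. ob F a))"
    and "injective_resolution R Q F K"
    and "injective_resolution R U F J"
    and "short_exact_resolutions R Q E (\<lambda>p x. x) F (quot_proj F E) G IE \<alpha> IF \<beta> IG"
  shows "\<exists>t \<psi> f \<delta> g.
     resolution_map R U G (\<lambda>p X. the_elem X) IG J t \<and>
     derived_map U J (poset_rank P - 3) t
       \<in> mod_iso R (derived_lim Q IG (poset_rank P - 3)) (derived_lim U J (poset_rank P - 3)) \<and>
     \<psi> \<in> mod_iso R (derived_lim Q IE (poset_rank P - 2)) S \<and>
     (\<forall>Z\<in>carrier (derived_lim Q IG (poset_rank P - 3)).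
        \<delta> (derived_map U J (poset_rank P - 3) t Z) =
        \<psi> (connecting_hom Q IE \<alpha> IF \<beta> (poset_rank P - 3) Z)) \<and>
     exact_four R
       (derived_lim Q K (poset_rank P - 3)) f
       (derived_lim U J (poset_rank P - 3)) \<delta>
       S g
       (derived_lim Q K (poset_rank P - 2))"
proof -
  note R = assms(1) and F = assms(6) and F0 = assms(7) and AA = assms(8) and epi = assms(9)
    and Qd = assms(10) and Ud = assms(11) and Ed = assms(12) and Gd = assms(13) and Sd = assms(14)
  interpret P: shellable P L using assms(2-4) by (rule shellable.intro)
  \<comment> \<open>The connecting map leads from degree \<open>n\<close> for \<open>G\<close> to
    degree \<open>Suc n\<close> for \<open>E\<close>, the top degree.\<close>
  obtain n where n: "P.rk = n + 3" using assms(5) le_Suc_ex by (metis add.commute)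
  have QP: "Q \<subseteq> P" using Qd by blast
  then have QPP: "q \<in> P" if "q \<in> Q" for q using that by blast
  have UQ: "U \<subseteq> Q" using Ud Qd by (auto simp: proper_part_def)
  have FQ: "presheaf_on R Q F" and FU: "presheaf_on R U F" using presheaf_on_subset[OF F] QP UQ by blast+
  note mF = presheaf_module[OF FQ]
  have Acov: "covers P P.bt a" if "a \<in> A" for a using AA that by (auto simp: atoms_of_def)
  have btA: "P.bt \<notin> A" using Acov by (auto simp: covers_def)
  have E_ob: "ob E p = (ob F p)\<lparr>carrier := (if p \<in> A then carrier (ob F p) else {\<zero>\<^bsub>ob F p\<^esub>})\<rparr>" for p
    by (simp add: Ed sub_presheaf_def)
  have E_car: "carrier (ob E p) = (if p \<in> A then carrier (ob F p) else {\<zero>\<^bsub>ob F p\<^esub>})" for p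
    by (simp add: E_ob)
  have Esub: "submodule (carrier (ob E p)) R (ob F p)" if p: "p \<in> Q" for p
  proof -
    interpret p: module R "ob F p" using mF[OF p] .
    show ?thesis unfolding E_car using p.carrier_is_submodule
      by (auto intro!: p.submoduleI simp: p.M.a_inv_zero)
  qed
  have Ear: "ar F p q x \<in> carrier (ob E q)"
    if pq: "p \<in> Q" "q \<in> Q" "q \<le> p" and x: "x \<in> carrier (ob E p)" for p q x
  proof (cases "p \<in> A")
    case True
    have xF: "x \<in> carrier (ob F p)" using x True by (simp add: E_car)
    have y: "ar F p q x \<in> carrier (ob F q)" using presheaf_ar_closed[OF FQ pq xF] .
    \<comment> \<open>Below an atom lies only the bottom, where \<open>F\<close> is zero; hence the
      values of \<open>E\<close> are stable under the structure maps.\<close>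
    have "q = p \<or> q = P.bt"
      using Acov[OF True] P.bt(2)[OF QPP[OF pq(2)]] pq QPP by (auto simp: covers_def order_less_le)
    then show ?thesis using y True F0 btA by (auto simp: E_car)
  next
    case False
    then show ?thesis using x presheaf_ar_zero[OF FQ pq] module.submoduleD(2)[OF mF[OF pq(2)] Esub[OF pq(2)]] by (simp add: E_car[of p])
  qed
  have E_pre: "E = restr_presheaf F (\<lambda>p. carrier (ob E p))"
    by (simp add: E_car) (simp add: Ed sub_presheaf_def restr_presheaf_def)
  have EQ: "presheaf_on R Q E"
    by (subst E_pre) (rule presheaf_restr[OF FQ Esub Ear])
  have GQ: "presheaf_on R Q G"
    unfolding Gd by (rule presheaf_quot(1)[OF FQ Esub Ear])
  have Gar: "ar G p q (quot_proj F E p x) = quot_proj F E q (ar F p q x)"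
    if "p \<in> Q" "q \<in> Q" "q \<le> p" "x \<in> carrier (ob F p)" for p q x
    unfolding Gd by (rule presheaf_quot(2)[OF FQ Esub Ear that])
  have Gcar: "carrier (ob G p) = quot_proj F E p ` carrier (ob F p)" if "p \<in> Q" for p
    unfolding Gd by (rule presheaf_quot(3)[OF FQ Esub Ear that])
  have Ghom: "quot_proj F E p \<in> mod_hom R (ob F p) (ob G p)" if "p \<in> Q" for p
    unfolding Gd by (rule presheaf_quot(4)[OF FQ Esub Ear that])
  have Gzero: "\<zero>\<^bsub>ob G p\<^esub> = quot_proj F E p \<zero>\<^bsub>ob F p\<^esub>" if "p \<in> Q" for p
    unfolding Gd by (rule presheaf_quot(5)[OF FQ Esub Ear that])
  have single: "quot_proj F E p x = {x}" if p: "p \<in> Q" "p \<notin> A" and x: "x \<in> carrier (ob F p)" for p x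
  proof -
    interpret p: module R "ob F p" using mF[OF p(1)] .
    show ?thesis using p(2) x by (auto simp: quot_proj_def E_car mem_a_r_coset)
  qed
  have G_A: "carrier (ob G p) = {\<zero>\<^bsub>ob G p\<^esub>}" if p: "p \<in> Q" "p \<in> A \<or> p = P.bt" for p
  proof -
    interpret p: module R "ob F p" using mF[OF p(1)] .
    have "quot_proj F E p x = quot_proj F E p \<zero>\<^bsub>ob F p\<^esub>" if x: "x \<in> carrier (ob F p)" for x
    proof (cases "p \<in> A")
      case True
      then show ?thesis unfolding quot_proj_def
        using coset_eq_iff[OF mF[OF p(1)] Esub[OF p(1)] x p.M.zero_closed] x by (simp add: E_car)
    next
      case False
      then show ?thesis using p(2) x F0 by simp
    qed
    then show ?thesis unfolding Gcar[OF p(1)] Gzero[OF p(1)] using p.M.zero_closed by blast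
  qed
  have U_iff: "p \<in> U \<longleftrightarrow> p \<in> Q \<and> p \<notin> A \<and> p \<noteq> P.bt" for p
    using Ud Qd by (auto simp: proper_part_def)
  \<comment> \<open>Nothing lies strictly between the bottom and an atom, so one cannot leave
    \<open>U\<close> upwards.\<close>
  have up: "q \<in> U" if "p \<in> U" "q \<in> Q" "p \<le> q" for p q
  proof -
    have p: "p \<in> Q" "p \<notin> A" "p \<noteq> P.bt" using that(1) U_iff by auto
    have btp: "P.bt < p" using P.bt(2)[OF QPP[OF p(1)]] p(3) by simp
    have "q \<notin> A"
    proof
      assume q: "q \<in> A"
      then have "p \<noteq> q" using p by auto
      then have "p < q" using that(3) by simp
      then show False using Acov[OF q] btp QPP[OF p(1)] by (auto simp: covers_def)
    qed
    moreover have "q \<noteq> P.bt" using btp that(3) by auto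
    ultimately show ?thesis using that(2) U_iff by blast
  qed
  have eU: "nat_trans R U G F (\<lambda>p X. the_elem X)"
    unfolding nat_trans_def
  proof (intro conjI ballI impI)
    fix p assume "p \<in> U"
    then have p: "p \<in> Q" "p \<notin> A" using U_iff by auto
    interpret p: module R "ob F p" using mF[OF p(1)] .
    note h = Ghom[OF p(1)] and sg = single[OF p]
    show "the_elem \<in> mod_hom R (ob G p) (ob F p)"
    proof (rule mod_homI)
      fix X Y a assume "X \<in> carrier (ob G p)"
      then obtain x where x: "x \<in> carrier (ob F p)" "X = quot_proj F E p x" using Gcar[OF p(1)] by auto
      show "the_elem X \<in> carrier (ob F p)" using x sg by simp
      show "the_elem (a \<odot>\<^bsub>ob G p\<^esub> X) = a \<odot>\<^bsub>ob F p\<^esub> the_elem X" if a: "a \<in> carrier R"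
      proof -
        have "a \<odot>\<^bsub>ob G p\<^esub> X = quot_proj F E p (a \<odot>\<^bsub>ob F p\<^esub> x)" unfolding x(2) mod_hom_smult[OF h a x(1)] ..
        then show ?thesis using a x sg by simp
      qed
      assume "Y \<in> carrier (ob G p)"
      then obtain y where y: "y \<in> carrier (ob F p)" "Y = quot_proj F E p y" using Gcar[OF p(1)] by auto
      have "X \<oplus>\<^bsub>ob G p\<^esub> Y = quot_proj F E p (x \<oplus>\<^bsub>ob F p\<^esub> y)" unfolding x(2) y(2) mod_hom_add[OF h x(1) y(1)] ..
      then show "the_elem (X \<oplus>\<^bsub>ob G p\<^esub> Y) = the_elem X \<oplus>\<^bsub>ob F p\<^esub> the_elem Y" using x y sg by simp
    qed
  next
    fix p q X assume "p \<in> U" "q \<in> U" and le: "q \<le> p" and X: "X \<in> carrier (ob G p)"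
    then have pq: "p \<in> Q" "q \<in> Q" "p \<notin> A" "q \<notin> A" using U_iff by auto
    obtain x where x: "x \<in> carrier (ob F p)" "X = quot_proj F E p x" using Gcar[OF pq(1)] X by auto
    show "the_elem (ar G p q X) = ar F p q (the_elem X)"
      using x Gar[OF pq(1,2) le x(1)] single[OF pq(1,3) x(1)]
        single[OF pq(2,4) presheaf_ar_closed[OF FQ pq(1,2) le x(1)]] by simp
  qed
  have bU: "bij_betw the_elem (carrier (ob G p)) (carrier (ob F p))" if "p \<in> U" for p
  proof -
    have p: "p \<in> Q" "p \<notin> A" using that U_iff by auto
    have "carrier (ob G p) = (\<lambda>x. {x}) ` carrier (ob F p)" unfolding Gcar[OF p(1)] using single[OF p] by auto
    then show ?thesis by (auto simp: bij_betw_def inj_on_def image_image)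
  qed
  have ses: "injective_resolution R Q E IE" "injective_resolution R Q F IF" "injective_resolution R Q G IG"
    using assms(17) unfolding short_exact_resolutions_def by blast+
  have rK: "coresolves R Q F K" using assms(15) injective_resolution_iff[OF FQ] by blast
  have rJ: "coresolves R U F J" and iJ: "\<And>n. injective_presheaf R U (cx J n)"
    using assms(16) injective_resolution_iff[OF FU] by blast+
  have rE: "coresolves R Q E IE" using ses(1) injective_resolution_iff[OF EQ] by blast
  have rF: "coresolves R Q F IF" and iF: "\<And>n. injective_presheaf R Q (cx IF n)"
    using ses(2) injective_resolution_iff[OF FQ] by blast+
  have rG: "coresolves R Q G IG" using ses(3) injective_resolution_iff[OF GQ] by blast
  note sK = sectionsI[OF R FQ assms(15)] and sJ = sectionsI[OF R FU assms(16)]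
    and sE = sectionsI[OF R EQ ses(1)] and sF = sectionsI[OF R FQ ses(2)] and sG = sectionsI[OF R GQ ses(3)]
  have finQ: "finite Q" using assms(4) QP finite_subset by blast
  \<comment> \<open>Restriction to \<open>U\<close> keeps \<open>IG\<close> exact, which suffices
    for the source of a comparison map; the target \<open>J\<close> is injective.\<close>
  obtain t where t: "resolution_map R U G (\<lambda>p X. the_elem X) IG J t"
    using comparison_exists[OF coresolves_subset[OF rG UQ] rJ iJ eU] by blast
  have cU: "comparison R Q G IG U F J (\<lambda>p X. the_elem X) t"
  proof (intro comparison.intro comparison_axioms.intro sG sJ finQ UQ t eU)
    show "q \<in> U" if "p \<in> U" "q \<in> Q" "p \<le> q" for p q using up that .
    show "bij_betw the_elem (carrier (ob G p)) (carrier (ob F p))" if "p \<in> U" for p using bU that .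
    show "carrier (ob G p) = {\<zero>\<^bsub>ob G p\<^esub>}" if "p \<in> Q" "p \<notin> U" for p using G_A[OF that(1)] that U_iff by blast
  qed
  have idF: "nat_trans R Q F F (\<lambda>p x. x)" by (auto simp: nat_trans_def mod_hom_def)
  obtain s where s: "resolution_map R Q F (\<lambda>p x. x) K IF s"
    using comparison_exists[OF rK rF iF idF] by blast
  have cK: "comparison R Q F K Q F IF (\<lambda>p x. x) s"
    by (intro comparison.intro comparison_axioms.intro sK sF finQ order_refl s idF) (simp_all add: bij_betw_def inj_on_def)
  note isoU = comparison.derived_map_iso[OF cU] and isoK = comparison.derived_map_iso[OF cK]
  interpret AE: atomic_sections P L R Q E IE A
    by (intro atomic_sections.intro shell_sections.intro P.shellable_axioms sE shell_sections_axioms.intro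
        atomic_sections_axioms.intro Qd AA) (simp add: E_car E_ob)
  interpret SG: shell_sections P L R Q G IG
    by (intro shell_sections.intro P.shellable_axioms sG shell_sections_axioms.intro Qd)
  interpret C: cochain_ses R AE.Sec AE.\<delta> "\<lambda>n. lim_module Q (cx IF n)" "\<lambda>n. lim_map Q (dif IF n)" SG.Sec SG.\<delta>
    "\<lambda>n. lim_map Q (\<alpha> n)" "\<lambda>n. lim_map Q (\<beta> n)"
    by (rule cochain_ses_lim[OF R EQ FQ GQ assms(17)])
  have rk1: "Suc n + 2 = P.rk" using n by simp
  \<comment> \<open>The poset below the top is at stage \<open>Suc n\<close>, so degree
    \<open>n\<close> is below the top degree of \<open>E\<close>.\<close>
  have L0: "x \<in> bd AE.Sec AE.\<delta> n" if "x \<in> carrier (AE.Sec n)" "AE.\<delta> n x = \<zero>\<^bsub>AE.Sec (Suc n)\<^esub>" for x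
  proof -
    have "AE.acyc n (AE.van Q)" using AE.low_vanishing[OF AE.stage_tp[OF rk1] lessI] unfolding AE.Dn_top .
    moreover have "AE.\<delta> n x \<in> AE.van Q (Suc n)" unfolding AE.van_top that(2) by blast
    ultimately show ?thesis using AE.acyc_cob[OF _ that(1)] AE.cob_top by blast
  qed
  \<comment> \<open>The hypothesis concerns \<open>F\<close> and the members of \<open>C\<close>
    outside \<open>A\<close>. It gives the same for \<open>G\<close> at all of \<open>C\<close>:
    outside \<open>A\<close> the two functors agree up to cosets, and on \<open>A\<close> the
    functor \<open>G\<close> is zero.\<close>
  have epi': "\<exists>g\<in>carrier (ob G (hd c)). \<forall>a\<in>C_set P L c. ar G (hd c) a g = x a"
    if c: "c \<in> P.\<C>" "chain_length c + 2 = P.rk" and x: "\<And>a. a \<in> C_set P L c \<Longrightarrow> x a \<in> carrier (ob G a)" for c x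
  proof -
    let ?C = "C_set P L c"
    \<comment> \<open>As \<open>rk\<close> is at least \<open>3\<close>, the chain has positive
      length, so its head is not the top and lies in \<open>Q\<close>.\<close>
    obtain h k c' where hc: "c = h # k # c'"
      using c n by (cases c; cases "tl c") (auto simp: chain_length_def)
    have "last (k # c') = P.tp" using c(1) hc by (simp add: unref_chains_to_def)
    moreover have "last (k # c') \<in> set (k # c')" by (rule last_in_set) simp
    moreover have "\<forall>x\<in>set (k # c'). h < x" using P.unref_sorted[OF c(1)] hc by simp
    ultimately have "hd c \<noteq> P.tp" using hc by auto
    then have hQ: "hd c \<in> Q" using P.unref_hd[OF c(1)] Qd by simp
    have CS: "?C \<subseteq> lower_covers P (hd c)" using P.segment_subset[OF c(1) P.segment_C_set[OF c(1)]] .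
    have CQ: "a \<in> Q" "a \<le> hd c" if "a \<in> ?C" for a
      using AE.lower_covers_Q[OF c(1)] CS that by (auto intro: order_less_imp_le)
    have fC: "finite (?C - A)" using finQ CQ by (intro finite_subset[of "?C - A" Q]) auto
    have "\<exists>y\<in>carrier (ob F a). x a = quot_proj F E a y" if "a \<in> ?C" for a
      using x[OF that] Gcar[OF CQ(1)[OF that]] by blast
    then obtain y where y: "\<And>a. a \<in> ?C \<Longrightarrow> y a \<in> carrier (ob F a) \<and> x a = quot_proj F E a (y a)" by metis
    have "(\<lambda>a\<in>?C - A. y a) \<in> carrier (dsum_module (?C - A) (ob F))"
      using y by (simp add: mem_dsum_finite[OF fC])
    also have "\<dots> = (\<lambda>x. \<lambda>a\<in>?C - A. ar F (hd c) a x) ` carrier (ob F (hd c))"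
      using epi[OF c(1)] c(2) by simp
    finally obtain v where v: "v \<in> carrier (ob F (hd c))" "(\<lambda>a\<in>?C - A. y a) = (\<lambda>a\<in>?C - A. ar F (hd c) a v)" by blast
    have vy: "ar F (hd c) a v = y a" if "a \<in> ?C" "a \<notin> A" for a
      using fun_cong[OF v(2), of a] that by simp
    have "ar G (hd c) a (quot_proj F E (hd c) v) = x a" if a: "a \<in> ?C" for a
    proof (cases "a \<in> A")
      case True
      have "ar G (hd c) a (quot_proj F E (hd c) v) \<in> carrier (ob G a)"
        unfolding Gar[OF hQ CQ[OF a] v(1)] Gcar[OF CQ(1)[OF a]]
        using presheaf_ar_closed[OF FQ hQ CQ[OF a] v(1)] by blast
      then show ?thesis using G_A[OF CQ(1)[OF a]] True x[OF a] by auto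
    next
      case False
      then show ?thesis unfolding Gar[OF hQ CQ[OF a] v(1)] using vy[OF a] y[OF a] by simp
    qed
    moreover have "quot_proj F E (hd c) v \<in> carrier (ob G (hd c))" unfolding Gcar[OF hQ] using v(1) by blast
    ultimately show ?thesis by blast
  qed
  have N0: "x \<in> bd SG.Sec SG.\<delta> (Suc n)"
    if x: "x \<in> carrier (SG.Sec (Suc n))" "SG.\<delta> (Suc n) x = \<zero>\<^bsub>SG.Sec (Suc (Suc n))\<^esub>" for x
  proof -
    have len: "chain_length [P.tp] + n + 3 = P.rk" using n by (simp add: chain_length_def)
    have seg: "P.segment [P.tp] (lower_covers P P.tp)" using P.segment_all[OF P.unref_tp] by simp
    have "SG.acyc (Suc n) (SG.van (P.Dn (lower_covers P P.tp)))"
      by (rule SG.top_vanishing[OF epi' P.unref_tp len seg])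
    then have "SG.acyc (Suc n) (SG.van Q)" unfolding AE.Dn_top .
    moreover have "SG.\<delta> (Suc n) x \<in> SG.van Q (Suc (Suc n))" unfolding SG.van_top x(2) by blast
    ultimately show ?thesis using SG.acyc_cob[OF _ x(1)] SG.cob_top by blast
  qed
  have les: "exact_four R (derived_lim Q IF n) (coho_map SG.Sec SG.\<delta> n (lim_map Q (\<beta> n)))
      (derived_lim Q IG n) (C.conn n) (derived_lim Q IE (Suc n))
      (coho_map (\<lambda>n. lim_module Q (cx IF n)) (\<lambda>n. lim_map Q (dif IF n)) (Suc n) (lim_map Q (\<alpha> (Suc n))))
      (derived_lim Q IF (Suc n))"
    unfolding derived_lim_eq_coho by (rule C.exact_four_coho[OF L0 N0])
  have conn: "C.conn n = connecting_hom Q IE \<alpha> IF \<beta> n"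
    by (simp add: fun_eq_iff C.conn_def connecting_hom_def)
  have fA: "finite A" using Acov assms(4) by (intro finite_subset[of A P]) (auto simp: covers_def)
  have AQ: "a \<in> Q" if "a \<in> A" for a using AE.A_Q[OF AE.stage_tp[OF rk1] that] .
  have modS: "module R S"
    unfolding Sd by (intro module_dsum_finite R fA finite_lessThan) (use mF AQ in blast)
  \<comment> \<open>On \<open>A\<close> the functors \<open>E\<close> and \<open>F\<close> have the
    same values.\<close>
  have "S = dsum_module A (\<lambda>a. dsum_module {..<nat \<bar>mobius P a P.tp\<bar>} (\<lambda>_. ob E a))"
    unfolding Sd by (rule dsum_module_cong) (simp add: E_ob)
  then obtain \<Theta> where \<Theta>: "\<Theta> \<in> mod_iso R S (derived_lim Q IE (Suc n))"
    using AE.top_cohomology[OF rk1] unfolding derived_lim_eq_coho by auto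
  have \<psi>: "inv_into (carrier S) \<Theta> \<in> mod_iso R (derived_lim Q IE (Suc n)) S" by (rule mod_iso_inv[OF modS \<Theta>])
  have modJ: "module R (derived_lim U J n)"
    unfolding derived_lim_eq_coho by (rule cochain.module_coho[OF cochain_lim[OF R rJ]])
  have mK: "module R (derived_lim Q K m)" for m
    unfolding derived_lim_eq_coho by (rule cochain.module_coho[OF cochain_lim[OF R rK]])
  have mIE: "module R (derived_lim Q IE m)" for m
    unfolding derived_lim_eq_coho by (rule cochain.module_coho[OF cochain_lim[OF R rE]])
  have mIF: "module R (derived_lim Q IF m)" for m
    unfolding derived_lim_eq_coho by (rule cochain.module_coho[OF cochain_lim[OF R rF]])
  have mIG: "module R (derived_lim Q IG m)" for m
    unfolding derived_lim_eq_coho by (rule cochain.module_coho[OF cochain_lim[OF R rG]])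
  note ex = exact_four_transport[OF les mIF mIG mIE mIF modS mK isoK isoU \<psi> mod_iso_inv[OF mK isoK]]
  have inj: "inj_on (derived_map U J n t) (carrier (derived_lim Q IG n))"
    using isoU[of n] by (simp add: mod_iso_def bij_betw_def)
  have rks: "P.rk - 3 = n" "P.rk - 2 = Suc n" using n by simp_all
  show ?thesis
    unfolding rks
    \<comment> \<open>Exactness is proved before the equation for the connecting map, because it
      instantiates the three maps that are still schematic.\<close>
    by ((rule exI)+, rule conjI, rule t, rule conjI, rule isoU, rule conjI, rule \<psi>, rule conjI[rotated], rule ex)
      (simp add: inv_into_f_f[OF inj] conn)
qed

end
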